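(* Work over $k=\mathbb{Z}$, and let $R$, $V=R^{(1)}$, $I$, $M_8=\operatorname{Proj}(R)\subset\mathbb{P}V=\operatorname{Proj}(\operatorname{Sym}(V))$ be the objects attached to eight points on the projective line, as defined in the context. Then there is a non-zero cubic polynomial $s'\in\operatorname{Sym}^3(V)$, which is a rational multiple of the (unique up to scaling) non-zero skew-invariant cubic $s\in\operatorname{Sym}^3(V\otimes\mathbb{Q})$, such that $M_8$ is the singular locus of $s'=0$. Moreover, the ideal $I$ is generated over $\mathbb{Z}$ by $s'$ and its $14$ partial derivatives (with respect to a $\mathbb{Z}$-basis of $V$). In particular, over $\mathbb{Z}[1/3]$ the ideal $I\otimes\mathbb{Z}[1/3]$ is generated by the $14$ partial derivatives of $s'$. Over $\mathbb{Z}$, the cubic $s'$ does not lie in the ideal generated by its $14$ partial derivatives.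
   Context: Let $k$ be a commutative ring and $L=\{1,\dots,8\}$. Consider the polynomial ring $k[x_1,y_1,\dots,x_8,y_8]$, on which the algebraic group (scheme) $\mathrm{SL}_2$ acts by acting simultaneously on all pairs $(x_i,y_i)$. For $d\ge 0$ let $R^{(d)}$ be the $k$-module of $\mathrm{SL}_2$-invariant polynomials that are homogeneous of degree $d$ in each pair $(x_i,y_i)$ separately, i.e. $R^{(d)}=((\operatorname{Sym}^d U^* )^{\otimes 8})^{\mathrm{SL}(U)}$ with $U$ free of rank two. It is known that $R^{(d)}$ is the $k$-span of the products $X_\Gamma=\prod_{(i,j)}(x_iy_j-x_jy_i)$ over directed edges $(i,j)$ of $\Gamma$, where $\Gamma$ runs over directed (multi)graphs on $L$ in which every vertex has valence $d$, and that the formation of $R$ commutes with base change from $\mathbb{Z}$. Put $R=\bigoplus_{d\ge0}R^{(d)}$, a graded ring. The symmetric group $S_8$ acts on $R$ by permuting the indices. The GIT quotient $(\mathbb{P}^1)^8/\!/\mathrm{GL}(2)$ is $M_8=\operatorname{Proj}(R)$. Put $V=R^{(1)}$. It is known that $V$ is free of rank $14$ and that $R$ is generated by $V$ as a $k$-algebra. Let $I=\ker(\operatorname{Sym}(V)\to R)$, so $M_8\subset\mathbb{P}V$ is cut out by $I$. An element $f\in\operatorname{Sym}^3(V\otimes\mathbb{Q})$ is skew-invariant if $\sigma f=\operatorname{sgn}(\sigma)f$ for all $\sigma\in S_8$; it is known that the skew-invariants form a one-dimensional space. Over $\mathbb{Z}$, the singular locus of $s'=0$ in $\mathbb{P}V$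 means the (relative) singular locus over $\operatorname{Spec}\mathbb{Z}$, i.e. the locus where $s'$ and all its partial derivatives vanish. *)

theory Defs
  imports
    "HOL-Library.Poly_Mapping"
    "HOL-Library.Numeral_Type"
    "HOL-Combinatorics.Permutations"
    "HOL-Algebra.Ideal"
    "HOL-Algebra.AbelCoset"
    "HOL-Algebra.Algebraic_Closure_Type"
begin

section \<open>Multivariate polynomials\<close>

type_synonym ('v, 'k) mpoly = "('v \<Rightarrow>\<^sub>0 nat) \<Rightarrow>\<^sub>0 'k"

definition mvar :: "'v \<Rightarrow> ('v, 'k::comm_ring_1) mpoly" where
  "mvar v = Poly_Mapping.single (Poly_Mapping.single v 1) 1"

definition mconst :: "'k::comm_ring_1 \<Rightarrow> ('v, 'k) mpoly" where
  "mconst c = Poly_Mapping.single 0 c"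

definition msubst ::
  "('k::comm_ring_1 \<Rightarrow> 'a::comm_ring_1) \<Rightarrow> ('v \<Rightarrow> 'a) \<Rightarrow> ('v, 'k) mpoly \<Rightarrow> 'a" where
  "msubst h \<phi> f = (\<Sum>m\<in>Poly_Mapping.keys f. h (Poly_Mapping.lookup f m) *
     (\<Prod>v\<in>Poly_Mapping.keys m. \<phi> v ^ Poly_Mapping.lookup m v))"

definition homog :: "nat \<Rightarrow> ('v, 'k::comm_ring_1) mpoly set" where
  "homog d = {f. \<forall>m\<in>Poly_Mapping.keys f.
     (\<Sum>v\<in>Poly_Mapping.keys m. Poly_Mapping.lookup m v) = d}"

definition mpderiv :: "'v \<Rightarrow> ('v, 'k::comm_ring_1) mpoly \<Rightarrow> ('v, 'k) mpoly" where
  "mpderiv v f = (\<Sum>m\<in>Poly_Mapping.keys f. Poly_Mapping.single (m - Poly_Mapping.single v 1)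
     (of_nat (Poly_Mapping.lookup m v) * Poly_Mapping.lookup f m))"

section \<open>Rings and Proj\<close>

definition ring_on :: "'a::comm_ring_1 set \<Rightarrow> 'a ring" where
  "ring_on S = ring_of_type_algebra\<lparr>carrier := S\<rparr>"

text \<open>For a ring \<open>A\<close> with homogeneous pieces \<open>G d\<close>: the homogeneous prime ideals that do not
  contain the irrelevant ideal.\<close>

definition Proj :: "('a, 'm) ring_scheme \<Rightarrow> (nat \<Rightarrow> 'a set) \<Rightarrow> 'a set set" where
  "Proj A G = {q. primeideal q A \<and> q = genideal A (q \<inter> (\<Union>d. G d)) \<and>
     \<not> (\<Union>d\<in>{0<..}. G d) \<subseteq> q}"

section \<open>The ring of invariants of eight points\<close>

text \<open>The coordinates \<open>x\<^sub>i, y\<^sub>i\<close> of the points; the label set is the eight-element type \<open>8\<close>.\<close>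

datatype pvar = PX 8 | PY 8

text \<open>The entries of the generic two-by-two matrix.\<close>

datatype gvar = A11 | A12 | A21 | A22

text \<open>
  Invariance under the group scheme is invariance under its generic point, the universal element
  over \<open>\<int>[SL\<^sub>2] = \<int>[a\<^sub>1\<^sub>1, a\<^sub>1\<^sub>2, a\<^sub>2\<^sub>1, a\<^sub>2\<^sub>2]/(det - 1)\<close>: the coaction
  sends \<open>f\<close> to \<open>f \<otimes> 1\<close>.  Both sides are computed with coefficients in
  \<open>\<int>[a\<^sub>1\<^sub>1, a\<^sub>1\<^sub>2, a\<^sub>2\<^sub>1, a\<^sub>2\<^sub>2]\<close> and compared modulo \<open>det - 1\<close>.
\<close>

definition generic_translate :: "(pvar, int) mpoly \<Rightarrow> (pvar, (gvar, int) mpoly) mpoly" where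
  "generic_translate = msubst of_int (\<lambda>v. case v of
       PX i \<Rightarrow> mconst (mvar A11) * mvar (PX i) + mconst (mvar A12) * mvar (PY i)
     | PY i \<Rightarrow> mconst (mvar A21) * mvar (PX i) + mconst (mvar A22) * mvar (PY i))"

definition sl2_invariant :: "(pvar, int) mpoly \<Rightarrow> bool" where
  "sl2_invariant f \<longleftrightarrow>
     mconst (mvar A11 * mvar A22 - mvar A12 * mvar A21 - 1)
       dvd generic_translate f - Poly_Mapping.map mconst f"

definition R_deg :: "nat \<Rightarrow> (pvar, int) mpoly set" where
  "R_deg d = {f. sl2_invariant f \<and> (\<forall>m\<in>Poly_Mapping.keys f. \<forall>i.
     Poly_Mapping.lookup m (PX i) + Poly_Mapping.lookup m (PY i) = d)}"

definition R_ring :: "(pvar, int) mpoly ring" where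
  "R_ring = ring_on {f. \<exists>n g. (\<forall>d. g d \<in> R_deg d) \<and> f = (\<Sum>d\<le>n. g d)}"

definition perm_act :: "(8 \<Rightarrow> 8) \<Rightarrow> (pvar, int) mpoly \<Rightarrow> (pvar, int) mpoly" where
  "perm_act \<sigma> = msubst of_int (\<lambda>v. case v of PX i \<Rightarrow> mvar (PX (\<sigma> i)) | PY i \<Rightarrow> mvar (PY (\<sigma> i)))"

section \<open>The symmetric algebra of \<open>V = R_deg 1\<close>\<close>

definition Z_basis :: "('n::finite \<Rightarrow> 'a::comm_ring_1) \<Rightarrow> 'a set \<Rightarrow> bool" where
  "Z_basis b W \<longleftrightarrow> (\<forall>i. b i \<in> W) \<and> (\<forall>w\<in>W. \<exists>!c::'n \<Rightarrow> int. w = (\<Sum>i\<in>UNIV. of_int (c i) * b i))"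

definition coords :: "('n::finite \<Rightarrow> 'a::comm_ring_1) \<Rightarrow> 'a \<Rightarrow> 'n \<Rightarrow> int" where
  "coords b w = (THE c. w = (\<Sum>i\<in>UNIV. of_int (c i) * b i))"

text \<open>
  A basis \<open>b\<close> of \<open>V\<close> identifies \<open>Sym(V)\<close> with the polynomial ring \<open>\<int>[t\<^sub>i]\<close>, where \<open>t\<^sub>i\<close> stands
  for \<open>b i\<close>.
\<close>

definition Sym_V :: "(14, int) mpoly ring" where
  "Sym_V = ring_on UNIV"

definition sym_to_R :: "(14 \<Rightarrow> (pvar, int) mpoly) \<Rightarrow> (14, int) mpoly \<Rightarrow> (pvar, int) mpoly" where
  "sym_to_R b = msubst of_int b"

definition rel_ideal :: "(14 \<Rightarrow> (pvar, int) mpoly) \<Rightarrow> (14, int) mpoly set" where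
  "rel_ideal b = a_kernel Sym_V R_ring (sym_to_R b)"

definition to_rat :: "('v, int) mpoly \<Rightarrow> ('v, rat) mpoly" where
  "to_rat = Poly_Mapping.map of_int"

definition perm_act_sym ::
  "(14 \<Rightarrow> (pvar, int) mpoly) \<Rightarrow> (8 \<Rightarrow> 8) \<Rightarrow> (14, rat) mpoly \<Rightarrow> (14, rat) mpoly" where
  "perm_act_sym b \<sigma> = msubst mconst
     (\<lambda>i. \<Sum>j\<in>UNIV. mconst (of_int (coords b (perm_act \<sigma> (b i)) j)) * mvar j)"

definition skew_invariant_cubics :: "(14 \<Rightarrow> (pvar, int) mpoly) \<Rightarrow> (14, rat) mpoly set" where
  "skew_invariant_cubics b = {f \<in> homog 3.
     \<forall>\<sigma>. \<sigma> permutes UNIV \<longrightarrow> perm_act_sym b \<sigma> f = of_int (sign \<sigma>) * f}"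

text \<open>\<open>\<int>[1/3][t\<^sub>i]\<close> inside \<open>\<rat>[t\<^sub>i]\<close>.\<close>

definition Sym_V_third :: "(14, rat) mpoly ring" where
  "Sym_V_third = ring_on {f. \<forall>m. \<exists>n. 3 ^ n * Poly_Mapping.lookup f m \<in> \<int>}"

section \<open>Closed subschemes of \<open>\<PP>V\<close>\<close>

text \<open>
  A closed subscheme of \<open>\<PP>V\<close> is recorded by its set of points and by its ideal sheaf on the
  standard charts \<open>D\<^sub>+(t\<^sub>i)\<close>.  A section \<open>g/t\<^sub>i\<^sup>n\<close> of the ideal sheaf over \<open>D\<^sub>+(t\<^sub>i)\<close>,
  with \<open>g\<close> homogeneous of degree \<open>n\<close>, is represented by the pair \<open>(n, g)\<close>.
\<close>

type_synonym subscheme = "(14, int) mpoly set set \<times> (14 \<Rightarrow> (nat \<times> (14, int) mpoly) set)"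

definition PV :: "(14, int) mpoly set set" where
  "PV = Proj Sym_V homog"

text \<open>The closed subscheme with ideal sheaf associated with the homogeneous ideal \<open>J\<close>; the
  condition on \<open>(n, g)\<close> says that \<open>g/t\<^sub>i\<^sup>n\<close> lies in the localization of \<open>J\<close> at \<open>t\<^sub>i\<close>.\<close>

definition closed_subscheme :: "(14, int) mpoly set \<Rightarrow> subscheme" where
  "closed_subscheme J =
     ({p \<in> PV. J \<subseteq> p}, \<lambda>i. {(n, g). g \<in> homog n \<and> (\<exists>m. mvar i ^ m * g \<in> J)})"

definition singular_locus :: "(14, int) mpoly \<Rightarrow> subscheme" where
  "singular_locus f = closed_subscheme (genideal Sym_V (insert f (range (\<lambda>i. mpderiv i f))))"

text \<open>
  \<open>Proj(R)\<close> as a closed subscheme of \<open>\<PP>V\<close> via \<open>Sym(V) \<rightarrow> R\<close>: its points are the preimages of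
  the points of \<open>Proj(R)\<close>, and over \<open>D\<^sub>+(t\<^sub>i)\<close> its ideal is the kernel of the induced map from
  the degree-zero part of \<open>Sym(V)[1/t\<^sub>i]\<close> to that of \<open>R[1/b\<^sub>i]\<close>.
\<close>

definition M8 :: "(14 \<Rightarrow> (pvar, int) mpoly) \<Rightarrow> subscheme" where
  "M8 b =
     ((\<lambda>q. {f. sym_to_R b f \<in> q}) ` Proj R_ring R_deg,
      \<lambda>i. {(n, g). g \<in> homog n \<and> (\<exists>m. b i ^ m * sym_to_R b g = 0)})"

end

theory Submission
  imports Defs "HOL-Computational_Algebra.Polynomial"
begin

text \<open>
  Write \<open>P\<close> for the points \<open>0, 1, 2, 3\<close> and \<open>N\<close> for the other four. The theorem rests on a presentation of the
  ring of invariants by bipartite graphs between \<open>P\<close> and \<open>N\<close>, which is available over the integers.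

  The invariants are the integral combinations of bracket products: an invariant that vanishes when two points
  collide is divisible by their bracket, which allows an induction on the multidegree
  (\<open>shear_inv_spanned_by_brackets\<close>, \<open>R_deg_eq_zspan\<close>). The straightening algorithm shows that all linear relations
  between bracket products follow from the Pluecker relation (\<open>relation_transfer\<close>). A product of a bracket inside
  \<open>P\<close> and a bracket inside \<open>N\<close> is a two-by-two minor of the matrix of brackets between \<open>P\<close> and \<open>N\<close>, so bipartite
  graphs suffice to span, and the Pluecker relations turn into the statement that this matrix has rank two: the
  relations between bipartite products are generated by the three-by-three minors (\<open>bip_relations\<close>). By the theorems
  of Hall and Koenig a regular bipartite graph is a union of perfect matchings (\<open>regular_factorization\<close>). Hence the
  relations between the generators, the matchings, are of two kinds: two decompositions of the same bipartite graph
  give the same product, and the minors vanish.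

  Each split of the eight points into two fours gives a quadratic relation \<open>quad\<close>. There is a cubic \<open>s3\<close> whose
  derivative in the direction of a split is the quadric of that split up to the sign of a permutation (\<open>D_s3\<close>). These
  derivatives span all derivatives, so the ideal \<open>J\<close> generated by \<open>s3\<close> and the quadrics is the ideal of the cubic
  and its partial derivatives (\<open>J_eq_derivatives\<close>). The formula for the derivatives also shows that \<open>s3\<close> is skew, and
  a skew cubic is determined by one of its third derivatives (\<open>skew_cubic_eq_0\<close>).

  Both kinds of relations lie in \<open>J\<close>. For two decompositions of a graph one moves from one to the other by exchanges
  that involve two or three matchings (\<open>connected_fibres\<close>); the exchanges of two matchings are the quadrics and
  those of three matchings are \<open>- s3\<close> plus a combination of quadrics (\<open>three_move_C_standard\<close>,
  \<open>three_move_D_standard\<close>). An expanded minor either contains the complementary edge, and then it is a product with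
  a linear relation, which is zero in \<open>V\<close>, or it contains a fixed graph with five edges, and then it is a product with
  a difference of two quadrics (\<open>alt_in_J\<close>). Thus \<open>J\<close> is the kernel (\<open>kernel_eq_J\<close>). The scheme-theoretic
  statement follows, because the homomorphism from \<open>Sym(V)\<close> is onto the invariants and compatible with the gradings.

  Euler's formula puts \<open>3 s3\<close> in the ideal of the derivatives. That \<open>s3\<close> itself is not there is detected by a
  functional on cubics that is a sum of \<open>28\<close> third derivatives (\<open>fano\<close>): its values on the degree-three part of that
  ideal are multiples of three, and its value on \<open>s3\<close> is \<open>28\<close>.
\<close>

section \<open>Substitution into polynomials\<close>

definition is_hom :: "('a::comm_ring_1 \<Rightarrow> 'b::comm_ring_1) \<Rightarrow> bool" where
  "is_hom h \<longleftrightarrow> (\<forall>x y. h (x + y) = h x + h y) \<and> (\<forall>x y. h (x * y) = h x * h y) \<and> h 1 = 1"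

lemma is_hom_add: "is_hom h \<Longrightarrow> h (x + y) = h x + h y"
  and is_hom_mult: "is_hom h \<Longrightarrow> h (x * y) = h x * h y"
  and is_hom_one: "is_hom h \<Longrightarrow> h 1 = 1"
  by (auto simp: is_hom_def)

lemma is_hom_zero: "is_hom h \<Longrightarrow> h 0 = 0"
  using is_hom_add[of h 0 0] by simp

lemma is_hom_uminus: "is_hom h \<Longrightarrow> h (- x) = - h x"
  using is_hom_add[of h x "-x"] by (simp add: is_hom_zero eq_neg_iff_add_eq_0 add.commute)

lemma is_hom_diff: "is_hom h \<Longrightarrow> h (x - y) = h x - h y"
  using is_hom_add[of h x "-y"] by (simp add: is_hom_uminus)

lemma is_hom_sum: "is_hom h \<Longrightarrow> h (sum f S) = (\<Sum>i\<in>S. h (f i))"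
  by (induction S rule: infinite_finite_induct) (auto simp: is_hom_zero is_hom_add)

lemma is_hom_prod: "is_hom h \<Longrightarrow> h (prod f S) = (\<Prod>i\<in>S. h (f i))"
  by (induction S rule: infinite_finite_induct) (auto simp: is_hom_one is_hom_mult)

lemma is_hom_power: "is_hom h \<Longrightarrow> h (x ^ n) = h x ^ n"
  by (induction n) (auto simp: is_hom_one is_hom_mult)

lemma is_hom_of_nat: "is_hom h \<Longrightarrow> h (of_nat n) = of_nat n"
  by (induction n) (auto simp: is_hom_one is_hom_zero is_hom_add)

lemma is_hom_of_int: "is_hom h \<Longrightarrow> h (of_int n) = of_int n"
  by (cases n) (auto simp: is_hom_of_nat is_hom_uminus is_hom_diff is_hom_one)

lemma is_hom_numeral: "is_hom h \<Longrightarrow> h (numeral n) = numeral n"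
  using is_hom_of_nat[of h "numeral n"] by simp

lemmas is_hom_simps = is_hom_add is_hom_mult is_hom_one is_hom_zero is_hom_uminus is_hom_diff
  is_hom_sum is_hom_prod is_hom_power is_hom_of_nat is_hom_of_int is_hom_numeral

lemma is_hom_comp: "is_hom h \<Longrightarrow> is_hom g \<Longrightarrow> is_hom (\<lambda>x. g (h x))"
  by (simp add: is_hom_def)

lemma is_hom_id: "is_hom (\<lambda>x. x)"
  by (simp add: is_hom_def)

lemma is_hom_of_int_map: "is_hom (of_int :: int \<Rightarrow> 'a::comm_ring_1)"
  by (simp add: is_hom_def)

lemma is_hom_mconst: "is_hom (mconst :: 'k::comm_ring_1 \<Rightarrow> ('v, 'k) mpoly)"
  by (simp add: is_hom_def mconst_def single_add mult_single)

lemma mconst_0 [simp]: "mconst 0 = 0" and mconst_1 [simp]: "mconst 1 = 1"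
  by (simp_all add: mconst_def)

lemma mconst_of_int [simp]: "mconst (of_int n) = of_int n"
  by (rule is_hom_of_int[OF is_hom_mconst])

definition mono_val :: "('v \<Rightarrow> 'a::comm_ring_1) \<Rightarrow> ('v \<Rightarrow>\<^sub>0 nat) \<Rightarrow> 'a" where
  "mono_val \<phi> m = (\<Prod>v\<in>Poly_Mapping.keys m. \<phi> v ^ Poly_Mapping.lookup m v)"

lemma mono_val_superset:
  assumes "finite K" "Poly_Mapping.keys m \<subseteq> K"
  shows "mono_val \<phi> m = (\<Prod>v\<in>K. \<phi> v ^ Poly_Mapping.lookup m v)"
  unfolding mono_val_def
  by (rule prod.mono_neutral_left) (use assms in \<open>auto simp: in_keys_iff\<close>)

lemma mono_val_add: "mono_val \<phi> (m + n) = mono_val \<phi> m * mono_val \<phi> n"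
proof -
  let ?K = "Poly_Mapping.keys m \<union> Poly_Mapping.keys n"
  have "Poly_Mapping.keys (m + n) \<subseteq> ?K" by (rule keys_add)
  then show ?thesis
    by (simp add: mono_val_superset[of ?K] lookup_add power_add prod.distrib)
qed

lemma mono_val_0 [simp]: "mono_val \<phi> 0 = 1"
  by (simp add: mono_val_def)

lemma mono_val_single: "mono_val \<phi> (Poly_Mapping.single v n) = \<phi> v ^ n"
  by (simp add: mono_val_def)

lemma msubst_alt: "msubst h \<phi> f =
    (\<Sum>m\<in>Poly_Mapping.keys f. h (Poly_Mapping.lookup f m) * mono_val \<phi> m)"
  by (simp add: msubst_def mono_val_def)

lemma msubst_superset:
  assumes "is_hom h" "finite K" "Poly_Mapping.keys f \<subseteq> K"
  shows "msubst h \<phi> f = (\<Sum>m\<in>K. h (Poly_Mapping.lookup f m) * mono_val \<phi> m)"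
  unfolding msubst_alt
  by (rule sum.mono_neutral_left) (use assms in \<open>auto simp: in_keys_iff is_hom_zero\<close>)

lemma msubst_add: "is_hom h \<Longrightarrow> msubst h \<phi> (f + g) = msubst h \<phi> f + msubst h \<phi> g"
proof -
  assume h: "is_hom h"
  let ?K = "Poly_Mapping.keys f \<union> Poly_Mapping.keys g"
  have "Poly_Mapping.keys (f + g) \<subseteq> ?K" by (rule keys_add)
  then show ?thesis
    by (simp add: h msubst_superset[of h ?K] lookup_add is_hom_add distrib_right sum.distrib)
qed

lemma msubst_single: "is_hom h \<Longrightarrow> msubst h \<phi> (Poly_Mapping.single m c) = h c * mono_val \<phi> m"
  by (subst msubst_superset[of h "{m}"]) (auto simp: is_hom_zero)

lemma poly_mapping_sum_singles:
  "(f :: 'a \<Rightarrow>\<^sub>0 'b::comm_monoid_add) = (\<Sum>m\<in>Poly_Mapping.keys f. Poly_Mapping.single m (Poly_Mapping.lookup f m))"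
  by (rule poly_mapping_eqI)
     (auto simp: lookup_sum lookup_single when_def in_keys_iff if_distrib sum.delta' cong: if_cong)

lemma poly_mapping_single_induct:
  assumes "\<And>m c. P (Poly_Mapping.single m c)" "\<And>f g. P f \<Longrightarrow> P g \<Longrightarrow> P (f + g)"
  shows "P (f :: 'a \<Rightarrow>\<^sub>0 'b::comm_monoid_add)"
proof -
  have "finite K \<Longrightarrow> P (\<Sum>m\<in>K. Poly_Mapping.single m (Poly_Mapping.lookup f m))" for K
    by (induction K rule: finite_induct) (use assms assms(1)[of undefined 0] in auto)
  then show ?thesis using poly_mapping_sum_singles[of f] by (metis finite_keys)
qed

lemma msubst_mult: "is_hom h \<Longrightarrow> msubst h \<phi> (f * g) = msubst h \<phi> f * msubst h \<phi> g"
proof -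
  assume h: "is_hom h"
  have 1: "msubst h \<phi> (Poly_Mapping.single m c * g) = msubst h \<phi> (Poly_Mapping.single m c) * msubst h \<phi> g" for m c
    by (induction g rule: poly_mapping_single_induct)
       (simp_all add: h mult_single msubst_single is_hom_mult mono_val_add msubst_add algebra_simps)
  show ?thesis
    by (induction f rule: poly_mapping_single_induct) (simp_all add: 1 h msubst_add distrib_right)
qed

lemma is_hom_msubst: "is_hom h \<Longrightarrow> is_hom (msubst h \<phi>)"
  by (auto simp: is_hom_def[of "msubst h \<phi>"] msubst_add msubst_mult)
     (simp flip: single_one add: msubst_single is_hom_one)

lemma msubst_mconst: "is_hom h \<Longrightarrow> msubst h \<phi> (mconst c) = h c"
  by (simp add: mconst_def msubst_single)

lemma msubst_mvar: "is_hom h \<Longrightarrow> msubst h \<phi> (mvar v) = \<phi> v"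
  by (simp add: mvar_def msubst_single mono_val_single is_hom_one)

lemma mconst_times_single: "mconst c * Poly_Mapping.single m d = Poly_Mapping.single m (c * d)"
  by (simp add: mconst_def mult_single)

lemma lookup_mconst_times: "Poly_Mapping.lookup (mconst c * f) m = c * Poly_Mapping.lookup f m"
  by (induction f rule: poly_mapping_single_induct)
     (simp_all add: mconst_times_single lookup_add lookup_single when_def algebra_simps)

lemma mono_val_mvar: "mono_val mvar m = Poly_Mapping.single m (1::'k::comm_ring_1)"
proof (induction m rule: poly_mapping_single_induct)
  case (1 v n)
  have "mvar v ^ n = Poly_Mapping.single (Poly_Mapping.single v n) (1::'k)"
    by (induction n) (auto simp: mvar_def mult_single simp flip: single_add)
  then show ?case by (simp add: mono_val_single)
next
  case (2 m n) then show ?case by (simp add: mono_val_add mult_single)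
qed

lemma mpoly_induct [case_names const var add mult]:
  assumes "\<And>c. P (mconst c)" "\<And>v. P (mvar v)"
    "\<And>f g. P f \<Longrightarrow> P g \<Longrightarrow> P (f + g)" "\<And>f g. P f \<Longrightarrow> P g \<Longrightarrow> P (f * g)"
  shows "P (f :: ('v, 'k::comm_ring_1) mpoly)"
proof (induction f rule: poly_mapping_single_induct)
  case (1 m c)
  have pw: "P (mvar v ^ n)" for v n
    by (induction n) (use assms(1)[of 1] assms in auto)
  have "finite K \<Longrightarrow> P (\<Prod>v\<in>K. mvar v ^ Poly_Mapping.lookup m v)" for K
    by (induction K rule: finite_induct) (use assms(1)[of 1] assms(4) pw in auto)
  then have "P (mono_val mvar m)" unfolding mono_val_def by simp
  then have "P (mconst c * mono_val mvar m)" using assms by blast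
  then show ?case by (simp add: mono_val_mvar mconst_times_single)
next
  case (2 f g) then show ?case using assms by blast
qed

text \<open>The universal property of the polynomial ring, uniqueness part.\<close>

lemma hom_eqI:
  assumes "is_hom g" "is_hom h" "\<And>c. g (mconst c) = h (mconst c)" "\<And>v. g (mvar v) = h (mvar v)"
  shows "g f = h (f :: ('v, 'k::comm_ring_1) mpoly)"
  by (induction f rule: mpoly_induct) (simp_all add: assms is_hom_simps)

lemma mconst_int: "mconst (c::int) = of_int c"
proof -
  have "mconst (of_int c :: int) = of_int c" by (rule mconst_of_int)
  then show ?thesis by simp
qed

lemma hom_int_eqI:
  assumes "is_hom g" "is_hom h" "\<And>v. g (mvar v) = h (mvar v)"
  shows "g f = h (f :: ('v, int) mpoly)"
  by (rule hom_eqI) (use assms in \<open>auto simp: mconst_int is_hom_of_int\<close>)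

text \<open>Coefficientwise maps along ring homomorphisms.\<close>

lemma lookup_map_hom: "is_hom h \<Longrightarrow> Poly_Mapping.lookup (Poly_Mapping.map h f) k = h (Poly_Mapping.lookup f k)"
  by (auto simp: Poly_Mapping.map.rep_eq when_def is_hom_zero)

lemma map_conv_msubst:
  assumes "is_hom h"
  shows "Poly_Mapping.map h f = msubst (\<lambda>c. mconst (h c)) mvar f"
proof (rule poly_mapping_eqI)
  fix k
  have h: "is_hom (\<lambda>c. mconst (h c))" by (rule is_hom_comp[OF assms is_hom_mconst])
  show "Poly_Mapping.lookup (Poly_Mapping.map h f) k =
      Poly_Mapping.lookup (msubst (\<lambda>c. mconst (h c)) mvar f) k"
    by (induction f rule: poly_mapping_single_induct)
       (auto simp: h msubst_single msubst_add mono_val_mvar mconst_times_single lookup_add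
         lookup_single when_def lookup_map_hom is_hom_simps assms)
qed

lemma is_hom_map: "is_hom h \<Longrightarrow> is_hom (Poly_Mapping.map h :: ('v,_) mpoly \<Rightarrow> _)"
proof -
  assume h: "is_hom h"
  have "Poly_Mapping.map h = msubst (\<lambda>c. mconst (h c)) (mvar :: 'v \<Rightarrow> _)"
    by (rule ext) (rule map_conv_msubst[OF h])
  then show ?thesis by (simp add: is_hom_msubst is_hom_comp[OF h is_hom_mconst])
qed

lemma map_mvar: "is_hom h \<Longrightarrow> Poly_Mapping.map h (mvar v) = mvar v"
  by (simp add: map_conv_msubst msubst_mvar is_hom_comp[OF _ is_hom_mconst])

lemma map_mconst: "is_hom h \<Longrightarrow> Poly_Mapping.map h (mconst c) = mconst (h c)"
  by (simp add: map_conv_msubst msubst_mconst is_hom_comp[OF _ is_hom_mconst])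

section \<open>Partial derivatives\<close>

lemma mpderiv_superset:
  assumes "finite K" "Poly_Mapping.keys f \<subseteq> K"
  shows "mpderiv v f = (\<Sum>m\<in>K. Poly_Mapping.single (m - Poly_Mapping.single v 1)
     (of_nat (Poly_Mapping.lookup m v) * Poly_Mapping.lookup f m))"
  unfolding mpderiv_def
  by (rule sum.mono_neutral_left) (use assms in \<open>auto simp: in_keys_iff\<close>)

lemma mpderiv_add: "mpderiv v (f + g) = mpderiv v f + mpderiv v g"
proof -
  let ?K = "Poly_Mapping.keys f \<union> Poly_Mapping.keys g"
  have "Poly_Mapping.keys (f + g) \<subseteq> ?K" by (rule keys_add)
  then show ?thesis
    by (simp add: mpderiv_superset[of ?K] lookup_add distrib_left sum.distrib single_add)
qed

lemma mpderiv_single: "mpderiv v (Poly_Mapping.single m c) =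
    Poly_Mapping.single (m - Poly_Mapping.single v 1) (of_nat (Poly_Mapping.lookup m v) * c)"
  by (subst mpderiv_superset[of "{m}"]) auto

lemma mpderiv_mconst [simp]: "mpderiv v (mconst c) = 0"
  by (simp add: mconst_def mpderiv_single)

lemma mpderiv_mvar: "mpderiv v (mvar w) = (if v = w then 1 else 0)"
  by (auto simp: mvar_def mpderiv_single lookup_single when_def)

lemma exp_minus_add:
  fixes m n :: "'v \<Rightarrow>\<^sub>0 nat"
  assumes "Poly_Mapping.lookup m v \<noteq> 0"
  shows "m + n - Poly_Mapping.single v 1 = m - Poly_Mapping.single v 1 + n"
  by (rule poly_mapping_eqI) (use assms in \<open>auto simp: lookup_add lookup_minus lookup_single when_def\<close>)

lemma mpderiv_mult: "mpderiv v (f * g) = mpderiv v f * g + f * mpderiv v g"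
proof -
  have s: "mpderiv v (Poly_Mapping.single m c * Poly_Mapping.single n d) =
      mpderiv v (Poly_Mapping.single m c) * Poly_Mapping.single n d +
      Poly_Mapping.single m c * mpderiv v (Poly_Mapping.single n d)"
    for m n :: "'a \<Rightarrow>\<^sub>0 nat" and c d :: 'b
  proof -
    let ?e = "Poly_Mapping.single v (Suc 0)"
    have 1: "Poly_Mapping.single (m + n - ?e) (of_nat (Poly_Mapping.lookup m v) * (c * d)) =
        Poly_Mapping.single (m - ?e + n) (of_nat (Poly_Mapping.lookup m v) * c * d)"
      by (cases "Poly_Mapping.lookup m v = 0") (simp_all add: exp_minus_add[simplified] mult.assoc)
    have 2: "Poly_Mapping.single (m + n - ?e) (of_nat (Poly_Mapping.lookup n v) * (c * d)) =
        Poly_Mapping.single (m + (n - ?e)) (c * (of_nat (Poly_Mapping.lookup n v) * d))"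
      using exp_minus_add[of n v m]
      by (cases "Poly_Mapping.lookup n v = 0") (simp_all add: ac_simps)
    show ?thesis
      by (simp add: mult_single mpderiv_single lookup_add distrib_right single_add 1 2)
  qed
  have 1: "mpderiv v (Poly_Mapping.single m c * g) = mpderiv v (Poly_Mapping.single m c) * g +
      Poly_Mapping.single m c * mpderiv v g" for m c
    by (induction g rule: poly_mapping_single_induct) (simp_all add: s mpderiv_add algebra_simps)
  show ?thesis
    by (induction f rule: poly_mapping_single_induct)
      (simp_all add: 1 mpderiv_add distrib_right distrib_left add_ac)
qed

section \<open>Integral spans\<close>

text \<open>Integral spans are generated by adding and subtracting generators, so that a property of a span is proved by one induction.\<close>

inductive_set zspan :: "'a::ab_group_add set \<Rightarrow> 'a set" for G where
  zspan_zero: "0 \<in> zspan G"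
| zspan_plus: "x \<in> zspan G \<Longrightarrow> g \<in> G \<Longrightarrow> x + g \<in> zspan G"
| zspan_minus: "x \<in> zspan G \<Longrightarrow> g \<in> G \<Longrightarrow> x - g \<in> zspan G"

lemma zspan_base: "g \<in> G \<Longrightarrow> g \<in> zspan G"
  using zspan_plus[OF zspan_zero, of g G] by simp

lemma zspan_add:
  assumes x: "x \<in> zspan G" and "y \<in> zspan G" shows "x + y \<in> zspan G"
  using assms(2)
  by induction (use x in \<open>auto simp: add.assoc[symmetric] add_diff_eq intro: zspan.intros\<close>)

lemma zspan_uminus:
  assumes "y \<in> zspan G" shows "- y \<in> zspan G"
  using assms by induction (auto simp: intro: zspan.intros dest: zspan_minus zspan_plus)

lemma zspan_diff: "x \<in> zspan G \<Longrightarrow> y \<in> zspan G \<Longrightarrow> x - y \<in> zspan G"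
  using zspan_add[of x G "-y"] zspan_uminus[of y G] by simp

lemma zspan_sum: "(\<And>i. i \<in> A \<Longrightarrow> f i \<in> zspan G) \<Longrightarrow> sum f A \<in> zspan G"
  by (induction A rule: infinite_finite_induct) (auto intro: zspan_zero zspan_add)

lemma zspan_of_int_mult:
  fixes y :: "'a::comm_ring_1"
  assumes "y \<in> zspan G" shows "of_int n * y \<in> zspan G"
proof -
  have nat: "of_nat k * y \<in> zspan G" for k
    by (induction k) (auto simp: distrib_right intro: zspan_zero zspan_add assms)
  show ?thesis using nat zspan_uminus[OF nat] by (cases n) (auto simp del: of_nat_Suc)
qed

lemma zspan_mono: "x \<in> zspan G \<Longrightarrow> G \<subseteq> zspan H \<Longrightarrow> x \<in> zspan H"
  by (induction rule: zspan.induct) (auto intro: zspan_zero zspan_add zspan_diff)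

lemma zspan_image:
  assumes "x \<in> zspan G" "\<And>x y. h (x + y) = h x + h y" "\<And>g. g \<in> G \<Longrightarrow> h g \<in> zspan H"
  shows "h x \<in> zspan H"
proof -
  have h0: "h 0 = 0" using assms(2)[of 0 0] by simp
  have hd: "h (x - y) = h x - h y" for x y using assms(2)[of "x - y" y] by simp
  from assms(1) show ?thesis
    by induction (auto simp: h0 assms(2) hd intro: zspan_zero zspan_add zspan_diff assms(3))
qed

lemma zspan_lift:
  assumes "x \<in> zspan G" "\<And>x y. h (x + y) = h x + h y" "\<And>g. g \<in> G \<Longrightarrow> \<exists>g'\<in>H. h g' = g"
  shows "\<exists>x'\<in>zspan H. h x' = x"
proof -
  have h0: "h 0 = 0" using assms(2)[of 0 0] by simp
  have hd: "h (x - y) = h x - h y" for x y using assms(2)[of "x - y" y] by simp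
  from assms(1) show ?thesis
  proof induction
    case zspan_zero then show ?case using h0 zspan.zspan_zero by blast
  next
    case (zspan_plus x g) then show ?case using assms(2,3) by (metis zspan.zspan_plus)
  next
    case (zspan_minus x g) then show ?case using hd assms(3) by (metis zspan.zspan_minus)
  qed
qed

section \<open>Brackets\<close>

instantiation pvar :: linorder
begin
definition less_eq_pvar :: "pvar \<Rightarrow> pvar \<Rightarrow> bool" where
  "less_eq_pvar a b = (case a of PX i \<Rightarrow> (case b of PX j \<Rightarrow> i \<le> j | PY j \<Rightarrow> True)
     | PY i \<Rightarrow> (case b of PX j \<Rightarrow> False | PY j \<Rightarrow> i \<le> j))"
definition less_pvar :: "pvar \<Rightarrow> pvar \<Rightarrow> bool" where
  "less_pvar a b = (a \<le> b \<and> \<not> b \<le> (a::pvar))"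
instance
  by standard (auto simp: less_eq_pvar_def less_pvar_def split: pvar.splits)
end

abbreviation xv :: "8 \<Rightarrow> (pvar, int) mpoly" where "xv i \<equiv> mvar (PX i)"
abbreviation yv :: "8 \<Rightarrow> (pvar, int) mpoly" where "yv i \<equiv> mvar (PY i)"

definition br :: "8 \<Rightarrow> 8 \<Rightarrow> (pvar, int) mpoly" where
  "br i j = xv i * yv j - xv j * yv i"

definition ev :: "(8 \<times> 8) list \<Rightarrow> (pvar, int) mpoly" where
  "ev L = (\<Prod>(i, j)\<leftarrow>L. br i j)"

definition ends :: "('v \<times> 'v) list \<Rightarrow> 'v multiset" where
  "ends L = mset (map fst L) + mset (map snd L)"

lemma ev_Nil [simp]: "ev [] = 1" and ev_Cons [simp]: "ev (e # L) = br (fst e) (snd e) * ev L"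
  by (simp_all add: ev_def case_prod_beta)

lemma ends_Nil [simp]: "ends [] = {#}"
  and ends_Cons [simp]: "ends (e # L) = add_mset (fst e) (add_mset (snd e) (ends L))"
  by (simp_all add: ends_def)

lemma br_self [simp]: "br i i = 0"
  by (simp add: br_def mult.commute)

lemma br_swap: "br j i = - br i j"
  by (simp add: br_def)

lemma br_pluecker: "br a b * br c d = br a c * br b d - br a d * br b c"
  unfolding br_def by (simp add: algebra_simps)

lemma mvar_neq_0 [simp]: "mvar v \<noteq> (0 :: ('v, 'k::comm_ring_1) mpoly)"
  by (metis lookup_single_eq lookup_zero mvar_def zero_neq_one)

lemma br_neq_0: "i \<noteq> j \<Longrightarrow> br i j \<noteq> 0"
proof
  assume ij: "i \<noteq> j" and "br i j = 0"
  then have "msubst of_int (\<lambda>v. if v = PX i \<or> v = PY j then 1 else 0) (br i j) = (0::int)"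
    by (simp add: is_hom_zero is_hom_msubst is_hom_of_int_map del: of_int_eq_id)
  then show False using ij
    by (simp add: br_def is_hom_simps is_hom_msubst[OF is_hom_of_int_map] msubst_mvar
        is_hom_of_int_map del: of_int_eq_id)
qed

section \<open>Multidegrees\<close>

definition mh :: "8 multiset \<Rightarrow> (pvar, 'k::comm_ring_1) mpoly \<Rightarrow> bool" where
  "mh \<delta> f \<longleftrightarrow> (\<forall>m\<in>Poly_Mapping.keys f. \<forall>i.
     Poly_Mapping.lookup m (PX i) + Poly_Mapping.lookup m (PY i) = count \<delta> i)"

lemma mh_0 [simp]: "mh \<delta> 0"
  by (simp add: mh_def)

lemma mh_add: "mh \<delta> f \<Longrightarrow> mh \<delta> g \<Longrightarrow> mh \<delta> (f + g)"
  unfolding mh_def using keys_add[of f g] by blast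

lemma keys_uminus': "Poly_Mapping.keys (- f) = Poly_Mapping.keys (f :: ('v, 'k::comm_ring_1) mpoly)"
  by (auto simp: in_keys_iff)

lemma mh_uminus: "mh \<delta> f \<Longrightarrow> mh \<delta> (- f)"
  unfolding mh_def keys_uminus' .

lemma mh_diff: "mh \<delta> f \<Longrightarrow> mh \<delta> g \<Longrightarrow> mh \<delta> (f - g)"
  using mh_add[of \<delta> f "-g"] mh_uminus[of \<delta> g] by simp

lemma mh_mult: "mh \<delta> f \<Longrightarrow> mh \<epsilon> g \<Longrightarrow> mh (\<delta> + \<epsilon>) (f * g)"
proof -
  assume a: "mh \<delta> f" "mh \<epsilon> g"
  show ?thesis unfolding mh_def
  proof (intro ballI allI)
    fix m i assume "m \<in> Poly_Mapping.keys (f * g)"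
    then obtain p q where "m = p + q" "p \<in> Poly_Mapping.keys f" "q \<in> Poly_Mapping.keys g"
      using keys_mult[of f g] by blast
    moreover have "Poly_Mapping.lookup p (PX i) + Poly_Mapping.lookup p (PY i) = count \<delta> i"
      "Poly_Mapping.lookup q (PX i) + Poly_Mapping.lookup q (PY i) = count \<epsilon> i"
      using a calculation(2,3) by (auto simp: mh_def)
    ultimately show "Poly_Mapping.lookup m (PX i) + Poly_Mapping.lookup m (PY i) = count (\<delta> + \<epsilon>) i"
      by (simp add: lookup_add)
  qed
qed

lemma mh_one: "mh {#} 1"
  by (simp add: mh_def)

lemma mh_mvar: "mh {#i#} (mvar (PX i))" "mh {#i#} (mvar (PY i))"
  by (auto simp: mh_def mvar_def lookup_single when_def)

lemma mh_br: "mh {#i, j#} (br i j)"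
proof -
  have "mh ({#i#} + {#j#}) (xv i * yv j)" "mh ({#j#} + {#i#}) (xv j * yv i)"
    by (intro mh_mult mh_mvar)+
  then show ?thesis unfolding br_def by (intro mh_diff) (auto simp: add_mset_commute)
qed

lemma mh_ev: "mh (ends L) (ev L)"
proof (induction L)
  case (Cons e L)
  then show ?case using mh_mult[OF mh_br[of "fst e" "snd e"] Cons] by (simp add: add_mset_commute)
qed (simp add: mh_one)

lemma mh_zspan: "f \<in> zspan {ev L | L. ends L = \<delta>} \<Longrightarrow> mh \<delta> f"
  by (induction rule: zspan.induct) (auto intro: mh_add mh_diff mh_ev)

definition restr :: "('m \<Rightarrow> bool) \<Rightarrow> ('m \<Rightarrow>\<^sub>0 'k::comm_ring_1) \<Rightarrow> ('m \<Rightarrow>\<^sub>0 'k)" where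
  "restr Q f = (\<Sum>m\<in>Poly_Mapping.keys f. Poly_Mapping.single m (Poly_Mapping.lookup f m when Q m))"

lemma lookup_restr: "Poly_Mapping.lookup (restr Q f) m = (Poly_Mapping.lookup f m when Q m)"
proof -
  have "Poly_Mapping.lookup (restr Q f) m =
      (\<Sum>x\<in>Poly_Mapping.keys f. if x = m then (Poly_Mapping.lookup f m when Q m) else 0)"
    unfolding restr_def lookup_sum by (rule sum.cong) (auto simp: lookup_single when_def)
  then show ?thesis by (simp add: in_keys_iff when_def)
qed

lemma restr_add: "restr Q (f + g) = restr Q f + restr Q g"
  by (rule poly_mapping_eqI) (simp add: lookup_restr lookup_add when_def)

lemma restr_single: "restr Q (Poly_Mapping.single m c) = (Poly_Mapping.single m c when Q m)"
  by (rule poly_mapping_eqI) (auto simp: lookup_restr lookup_single when_def)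

lemma restr_mult:
  assumes "\<And>m n. m \<in> Poly_Mapping.keys f \<Longrightarrow> Q (m + n) = Q' n"
  shows "restr Q (f * g) = f * restr Q' g"
proof -
  have s: "restr Q (Poly_Mapping.single m c * g) = Poly_Mapping.single m c * restr Q' g"
    if "m \<in> Poly_Mapping.keys f" for m c
    by (induction g rule: poly_mapping_single_induct)
       (auto simp: restr_add distrib_left mult_single restr_single when_def assms[OF that])
  have "A \<subseteq> Poly_Mapping.keys f \<Longrightarrow> finite A \<Longrightarrow> restr Q ((\<Sum>m\<in>A. Poly_Mapping.single m (Poly_Mapping.lookup f m)) * g)
      = (\<Sum>m\<in>A. Poly_Mapping.single m (Poly_Mapping.lookup f m)) * restr Q' g" for A
  proof (induction A rule: infinite_finite_induct)
    case empty
    show ?case by (simp add: restr_def)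
  qed (auto simp: distrib_right restr_add s)
  from this[OF order_refl finite_keys] show ?thesis
    by (simp flip: poly_mapping_sum_singles)
qed

lemma restr_id: "(\<And>m. m \<in> Poly_Mapping.keys f \<Longrightarrow> Q m) \<Longrightarrow> restr Q f = f"
  by (rule poly_mapping_eqI) (auto simp: lookup_restr when_def in_keys_iff)

lemma mh_cofactor:
  assumes "mh \<delta> f" "mh (\<delta> + \<epsilon>) (f * g)"
  shows "\<exists>g'. f * g' = f * g \<and> mh \<epsilon> g'"
proof (intro exI conjI)
  let ?Q = "\<lambda>\<delta> m. \<forall>i. Poly_Mapping.lookup m (PX i) + Poly_Mapping.lookup m (PY i) = count \<delta> i"
  have "restr (?Q (\<delta> + \<epsilon>)) (f * g) = f * restr (?Q \<epsilon>) g"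
  proof (rule restr_mult)
    fix m n assume m: "m \<in> Poly_Mapping.keys f"
    have e: "Poly_Mapping.lookup m (PX i) + Poly_Mapping.lookup m (PY i) = count \<delta> i" for i
      using assms(1) m by (auto simp: mh_def)
    have "(Poly_Mapping.lookup (m + n) (PX i) + Poly_Mapping.lookup (m + n) (PY i) = count (\<delta> + \<epsilon>) i)
      = (Poly_Mapping.lookup n (PX i) + Poly_Mapping.lookup n (PY i) = count \<epsilon> i)" for i
      using e[of i] by (simp add: lookup_add) linarith
    then show "?Q (\<delta> + \<epsilon>) (m + n) = ?Q \<epsilon> n" by simp
  qed
  moreover have "restr (?Q (\<delta> + \<epsilon>)) (f * g) = f * g"
    by (rule restr_id) (use assms(2) in \<open>simp add: mh_def\<close>)
  ultimately show "f * restr (?Q \<epsilon>) g = f * g" by simp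
  show "mh \<epsilon> (restr (?Q \<epsilon>) g)" by (auto simp: mh_def in_keys_iff lookup_restr when_def split: if_splits)
qed

section \<open>The first fundamental theorem\<close>

definition shearx :: "int \<Rightarrow> (pvar, int) mpoly \<Rightarrow> (pvar, int) mpoly" where
  "shearx u = msubst of_int (\<lambda>v. case v of PX i \<Rightarrow> xv i + of_int u * yv i | PY i \<Rightarrow> yv i)"

definition sheary :: "int \<Rightarrow> (pvar, int) mpoly \<Rightarrow> (pvar, int) mpoly" where
  "sheary u = msubst of_int (\<lambda>v. case v of PX i \<Rightarrow> xv i | PY i \<Rightarrow> yv i + of_int u * xv i)"

definition shear_inv :: "(pvar, int) mpoly \<Rightarrow> bool" where
  "shear_inv f \<longleftrightarrow> (\<forall>u. shearx u f = f \<and> sheary u f = f)"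

lemma is_hom_shear: "is_hom (shearx u)" "is_hom (sheary u)"
  by (simp_all add: shearx_def sheary_def is_hom_msubst is_hom_of_int_map)

lemma shear_mvar:
  "shearx u (xv i) = xv i + of_int u * yv i" "shearx u (yv i) = yv i"
  "sheary u (xv i) = xv i" "sheary u (yv i) = yv i + of_int u * xv i"
  by (simp_all add: shearx_def sheary_def msubst_mvar is_hom_of_int_map)

lemma shear_inv_br: "shear_inv (br i j)"
  by (simp add: shear_inv_def br_def is_hom_simps is_hom_shear shear_mvar algebra_simps)

lemma shear_inv_add: "shear_inv f \<Longrightarrow> shear_inv g \<Longrightarrow> shear_inv (f + g)"
  and shear_inv_diff: "shear_inv f \<Longrightarrow> shear_inv g \<Longrightarrow> shear_inv (f - g)"
  and shear_inv_mult: "shear_inv f \<Longrightarrow> shear_inv g \<Longrightarrow> shear_inv (f * g)"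
  and shear_inv_0: "shear_inv 0"
  and shear_inv_1: "shear_inv 1"
  by (simp_all add: shear_inv_def is_hom_simps is_hom_shear)

lemma shear_inv_ev: "shear_inv (ev L)"
  by (induction L) (auto intro: shear_inv_1 shear_inv_mult shear_inv_br)

lemma shear_inv_zspan: "f \<in> zspan {ev L | L. Q L} \<Longrightarrow> shear_inv f"
  by (induction rule: zspan.induct) (auto intro: shear_inv_0 shear_inv_add shear_inv_diff shear_inv_ev)

definition relabel :: "(8 \<Rightarrow> 8) \<Rightarrow> (pvar, int) mpoly \<Rightarrow> (pvar, int) mpoly" where
  "relabel \<rho> = msubst of_int (\<lambda>v. case v of PX i \<Rightarrow> xv (\<rho> i) | PY i \<Rightarrow> yv (\<rho> i))"

lemma relabel_perm_act: "relabel = perm_act"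
  by (rule ext)+ (simp add: relabel_def perm_act_def)

lemma is_hom_relabel: "is_hom (relabel \<rho>)"
  by (simp add: relabel_def is_hom_msubst is_hom_of_int_map)

lemma relabel_mvar [simp]: "relabel \<rho> (xv i) = xv (\<rho> i)" "relabel \<rho> (yv i) = yv (\<rho> i)"
  by (simp_all add: relabel_def msubst_mvar is_hom_of_int_map)

lemma relabel_br [simp]: "relabel \<rho> (br i j) = br (\<rho> i) (\<rho> j)"
  by (simp add: br_def is_hom_simps is_hom_relabel)

lemma relabel_ev: "relabel \<rho> (ev L) = ev (map (map_prod \<rho> \<rho>) L)"
  by (induction L) (simp_all add: is_hom_simps is_hom_relabel)

lemma shear_relabel: "shearx u (relabel \<rho> f) = relabel \<rho> (shearx u f)"
  "sheary u (relabel \<rho> f) = relabel \<rho> (sheary u f)"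
proof -
  show "shearx u (relabel \<rho> f) = relabel \<rho> (shearx u f)"
  proof (rule hom_int_eqI[OF is_hom_comp[OF is_hom_relabel is_hom_shear(1)]
        is_hom_comp[OF is_hom_shear(1) is_hom_relabel]])
    show "shearx u (relabel \<rho> (mvar v)) = relabel \<rho> (shearx u (mvar v))" for v
      by (cases v) (simp_all add: is_hom_simps is_hom_relabel shear_mvar)
  qed
  show "sheary u (relabel \<rho> f) = relabel \<rho> (sheary u f)"
  proof (rule hom_int_eqI[OF is_hom_comp[OF is_hom_relabel is_hom_shear(2)]
        is_hom_comp[OF is_hom_shear(2) is_hom_relabel]])
    show "sheary u (relabel \<rho> (mvar v)) = relabel \<rho> (sheary u (mvar v))" for v
      by (cases v) (simp_all add: is_hom_simps is_hom_relabel shear_mvar)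
  qed
qed

lemma shear_inv_relabel: "shear_inv f \<Longrightarrow> shear_inv (relabel \<rho> f)"
  by (simp add: shear_inv_def shear_relabel)

definition mdeg :: "(pvar \<Rightarrow>\<^sub>0 nat) \<Rightarrow> 8 multiset" where
  "mdeg m = (\<Sum>i\<in>UNIV. replicate_mset (Poly_Mapping.lookup m (PX i) + Poly_Mapping.lookup m (PY i)) i)"

lemma count_mdeg: "count (mdeg m) i = Poly_Mapping.lookup m (PX i) + Poly_Mapping.lookup m (PY i)"
  by (simp add: mdeg_def count_sum)

lemma mdeg_add: "mdeg (m + n) = mdeg m + mdeg n"
  by (rule multiset_eqI) (simp add: count_mdeg lookup_add)

lemma mh_mdeg: "mh \<delta> f \<longleftrightarrow> (\<forall>m\<in>Poly_Mapping.keys f. mdeg m = \<delta>)"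
  by (auto simp: mh_def multiset_eq_iff count_mdeg)

lemma single_add_exp: "Poly_Mapping.single (m + n) (1::int) = Poly_Mapping.single m 1 * Poly_Mapping.single n 1"
  by (simp add: mult_single)

lemma mh_relabel_monomial: "mh (image_mset \<rho> (mdeg m)) (relabel \<rho> (Poly_Mapping.single m 1))"
proof (induction m rule: poly_mapping_single_induct)
  case (1 v n)
  have v: "mh (image_mset \<rho> (mdeg (Poly_Mapping.single v 1))) (relabel \<rho> (mvar v))"
  proof (cases v)
    case (PX i)
    have "mdeg (Poly_Mapping.single v 1) = {#i#}"
      by (rule multiset_eqI) (simp add: count_mdeg PX lookup_single when_def)
    then show ?thesis using mh_mvar(1)[of "\<rho> i"] by (simp add: PX)
  next
    case (PY i)
    have "mdeg (Poly_Mapping.single v 1) = {#i#}"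
      by (rule multiset_eqI) (simp add: count_mdeg PY lookup_single when_def)
    then show ?thesis using mh_mvar(2)[of "\<rho> i"] by (simp add: PY)
  qed
  show ?case
  proof (induction n)
    case 0
    have "mdeg 0 = {#}" by (rule multiset_eqI) (simp add: count_mdeg)
    then show ?case by (simp add: is_hom_one is_hom_relabel mh_one)
  next
    case (Suc n)
    have eq: "Poly_Mapping.single v (Suc n) = Poly_Mapping.single v 1 + Poly_Mapping.single v n"
      by (simp flip: single_add)
    have "mh (image_mset \<rho> (mdeg (Poly_Mapping.single v 1)) + image_mset \<rho> (mdeg (Poly_Mapping.single v n)))
       (relabel \<rho> (mvar v) * relabel \<rho> (Poly_Mapping.single (Poly_Mapping.single v n) 1))"
      by (rule mh_mult[OF v Suc])
    then show ?case unfolding eq single_add_exp mdeg_add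
      by (simp add: is_hom_mult is_hom_relabel mvar_def)
  qed
next
  case (2 m n)
  show ?case using mh_mult[OF 2] by (simp add: mdeg_add single_add_exp is_hom_mult is_hom_relabel)
qed

lemma single_eq_of_int_mult: "Poly_Mapping.single (m :: 'v \<Rightarrow>\<^sub>0 nat) (c::int) = of_int c * Poly_Mapping.single m 1"
  by (simp add: mconst_times_single flip: mconst_int)

lemma mh_of_int: "mh \<delta> f \<Longrightarrow> mh \<delta> (of_int c * f)" for f :: "(pvar, int) mpoly"
  unfolding mconst_int[symmetric] by (auto simp: mh_def in_keys_iff lookup_mconst_times)

lemma mh_sum: "(\<And>i. i \<in> A \<Longrightarrow> mh \<delta> (f i)) \<Longrightarrow> mh \<delta> (sum f A)"
  by (induction A rule: infinite_finite_induct) (auto intro: mh_add)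

lemma mh_relabel: "mh \<delta> f \<Longrightarrow> mh (image_mset \<rho> \<delta>) (relabel \<rho> f)"
proof -
  assume f: "mh \<delta> f"
  have "relabel \<rho> f = (\<Sum>m\<in>Poly_Mapping.keys f. relabel \<rho> (Poly_Mapping.single m (Poly_Mapping.lookup f m)))"
    by (subst poly_mapping_sum_singles[of f]) (rule is_hom_sum[OF is_hom_relabel])
  moreover have "mh (image_mset \<rho> \<delta>) (relabel \<rho> (Poly_Mapping.single m (Poly_Mapping.lookup f m)))"
    if "m \<in> Poly_Mapping.keys f" for m
    using that f mh_relabel_monomial[of \<rho> m]
    by (subst single_eq_of_int_mult) (simp add: mh_mdeg[of \<delta>] is_hom_simps is_hom_relabel mh_of_int)
  ultimately show ?thesis by (simp add: mh_sum)
qed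

lemma mvar_dvd_if_subst_zero:
  assumes "msubst of_int (\<lambda>w. if w = v then 0 else mvar w :: ('v, int) mpoly) f = 0"
  shows "mvar v dvd (f :: ('v, int) mpoly)"
proof -
  let ?z = "msubst of_int (\<lambda>w. if w = v then 0 else mvar w) :: ('v, int) mpoly \<Rightarrow> ('v, int) mpoly"
  have z: "is_hom ?z" by (simp add: is_hom_msubst is_hom_of_int_map)
  have "mvar v dvd f - ?z f"
  proof (induction f rule: mpoly_induct)
    case (const c) then show ?case by (simp add: mconst_int is_hom_of_int z)
  next
    case (var w) then show ?case by (simp add: msubst_mvar is_hom_of_int_map)
  next
    case (add f g)
    have "f + g - ?z (f + g) = (f - ?z f) + (g - ?z g)" by (simp add: is_hom_add z)
    then show ?case by (simp only: dvd_add[OF add])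
  next
    case (mult f g)
    have "f * g - ?z (f * g) = (f - ?z f) * g + ?z f * (g - ?z g)"
      by (simp add: is_hom_mult z algebra_simps)
    then show ?case using mult by simp
  qed
  then show ?thesis using assms by simp
qed

lemma br_dvd_cancel_y:
  assumes "i \<noteq> j" "br i j dvd yv i * f"
  shows "br i j dvd f"
proof -
  obtain g where g: "yv i * f = br i j * g" using assms(2) by (auto elim: dvdE)
  let ?z = "msubst of_int (\<lambda>w. if w = PY i then 0 else mvar w) :: (pvar, int) mpoly \<Rightarrow> (pvar, int) mpoly"
  have z: "is_hom ?z" by (simp add: is_hom_msubst is_hom_of_int_map)
  have zv: "?z (mvar w) = (if w = PY i then 0 else mvar w)" for w
    by (simp add: msubst_mvar is_hom_of_int_map)
  have "0 = ?z (br i j) * ?z g" using arg_cong[OF g, of ?z] by (simp add: is_hom_mult z zv)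
  moreover have "?z (br i j) = xv i * yv j"
    using assms(1) by (simp add: br_def is_hom_simps z zv)
  ultimately have "?z g = 0" by simp
  then have "yv i dvd g" by (rule mvar_dvd_if_subst_zero)
  then obtain h where "g = yv i * h" by (auto elim: dvdE)
  then have "yv i * f = yv i * (br i j * h)" using g by (simp add: ac_simps)
  then show ?thesis by simp
qed

definition collapse :: "8 \<Rightarrow> 8 \<Rightarrow> 8 \<Rightarrow> 8" where
  "collapse i j v = (if v = j then i else v)"

lemma br_dvd_mult_cong:
  fixes a b c d \<beta> :: "'a::comm_ring_1"
  shows "\<beta> dvd a - b \<Longrightarrow> \<beta> dvd c - d \<Longrightarrow> \<beta> dvd a * c - b * d"
proof -
  assume "\<beta> dvd a - b" "\<beta> dvd c - d"
  then have "\<beta> dvd (a - b) * c + b * (c - d)" by simp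
  then show ?thesis by (simp add: algebra_simps)
qed

lemma br_dvd_monomial:
  "br i j dvd yv i ^ count (mdeg m) j * Poly_Mapping.single m 1 -
     yv j ^ count (mdeg m) j * relabel (collapse i j) (Poly_Mapping.single m 1)"
proof (induction m rule: poly_mapping_single_induct)
  case (1 v n)
  show ?case
  proof (induction n)
    case 0
    have "mdeg 0 = {#}" by (rule multiset_eqI) (simp add: count_mdeg)
    then show ?case by (simp add: is_hom_one is_hom_relabel)
  next
    case (Suc n)
    have eq: "Poly_Mapping.single v (Suc n) = Poly_Mapping.single v 1 + Poly_Mapping.single v n"
      by (simp flip: single_add)
    have one: "br i j dvd yv i ^ count (mdeg (Poly_Mapping.single v 1)) j * mvar v -
        yv j ^ count (mdeg (Poly_Mapping.single v 1)) j * relabel (collapse i j) (mvar v)"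
    proof (cases v)
      case (PX k)
      have "yv i * xv j - yv j * xv i = br i j * (-1)" by (simp add: br_def algebra_simps)
      then have "br i j dvd yv i * xv j - yv j * xv i" by (metis dvd_triv_left)
      then show ?thesis by (auto simp: PX count_mdeg lookup_single when_def collapse_def)
    next
      case (PY k)
      then show ?thesis by (auto simp: count_mdeg lookup_single when_def collapse_def mult.commute)
    qed
    show ?case
      using br_dvd_mult_cong[OF one Suc] unfolding eq single_add_exp mdeg_add
      by (simp add: is_hom_mult is_hom_relabel mvar_def power_add ac_simps)
  qed
next
  case (2 m n)
  show ?case using br_dvd_mult_cong[OF 2]
    by (simp add: mdeg_add single_add_exp is_hom_mult is_hom_relabel power_add ac_simps)
qed

text \<open>Multiplying by a power of \<open>y\<^sub>i\<close> lets one trade \<open>(x\<^sub>j, y\<^sub>j)\<close> for a multiple of \<open>(x\<^sub>i, y\<^sub>i)\<close>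
  modulo the bracket; the bracket is prime to \<open>y\<^sub>i\<close>, which is then cancelled.\<close>

lemma br_dvd_if_collapse_zero:
  assumes "i \<noteq> j" "mh \<delta> h" "relabel (collapse i j) h = 0"
  shows "br i j dvd h"
proof -
  let ?r = "relabel (collapse i j)" and ?e = "count \<delta> j"
  have "br i j dvd yv i ^ ?e * Poly_Mapping.single m (Poly_Mapping.lookup h m) -
      yv j ^ ?e * ?r (Poly_Mapping.single m (Poly_Mapping.lookup h m))"
    if "m \<in> Poly_Mapping.keys h" for m
  proof -
    have "mdeg m = \<delta>" using that assms(2) by (simp add: mh_mdeg)
    then have "br i j dvd of_int (Poly_Mapping.lookup h m) * (yv i ^ ?e * Poly_Mapping.single m 1 -
      yv j ^ ?e * ?r (Poly_Mapping.single m 1))"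
      using br_dvd_monomial[of i j m] by simp
    then show ?thesis by (subst (1 2) single_eq_of_int_mult) (simp add: is_hom_simps is_hom_relabel algebra_simps)
  qed
  then have "br i j dvd (\<Sum>m\<in>Poly_Mapping.keys h. yv i ^ ?e * Poly_Mapping.single m (Poly_Mapping.lookup h m) -
      yv j ^ ?e * ?r (Poly_Mapping.single m (Poly_Mapping.lookup h m)))"
    by (rule dvd_sum)
  then have "br i j dvd yv i ^ ?e * h - yv j ^ ?e * ?r h"
    by (simp add: sum_subtractf flip: sum_distrib_left is_hom_sum[OF is_hom_relabel] poly_mapping_sum_singles)
  then have "br i j dvd yv i ^ ?e * h" using assms(3) by simp
  then show ?thesis
  proof (induction ?e arbitrary: \<delta>)
    case 0 then show ?case by simp
  next
    case (Suc e)
    have "br i j dvd yv i * (yv i ^ e * h)" using Suc.prems Suc.hyps(2) by (metis mult.assoc power_Suc)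
    then have "br i j dvd yv i ^ e * h" using br_dvd_cancel_y[OF assms(1)] by blast
    then show ?case using Suc.hyps(1)[of "replicate_mset e j"] by simp
  qed
qed

lemma ends_map: "ends (map (map_prod \<rho> \<rho>) L) = image_mset \<rho> (ends L)"
  by (induction L) auto

text \<open>Edges between the collapsed points lift to edges between the original points with prescribed multiplicities; this lifts a bracket product along a collision.\<close>

lemma edges_lift:
  "ends L = image_mset \<rho> \<delta> \<Longrightarrow> \<exists>L'. ends L' = \<delta> \<and> map (map_prod \<rho> \<rho>) L' = L"
proof (induction L arbitrary: \<delta>)
  case Nil then show ?case by (intro exI[of _ "[]"]) auto
next
  case (Cons e L)
  then have "image_mset \<rho> \<delta> = add_mset (fst e) (add_mset (snd e) (ends L))" by simp
  then obtain a \<delta>1 where a: "\<delta> = add_mset a \<delta>1" "\<rho> a = fst e" "image_mset \<rho> \<delta>1 = add_mset (snd e) (ends L)"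
    by (metis msed_map_invR)
  then obtain b \<delta>2 where b: "\<delta>1 = add_mset b \<delta>2" "\<rho> b = snd e" "image_mset \<rho> \<delta>2 = ends L"
    by (metis msed_map_invR)
  obtain L' where "ends L' = \<delta>2" "map (map_prod \<rho> \<rho>) L' = L" using Cons.IH[of \<delta>2] b by metis
  then show ?case using a b by (intro exI[of _ "(a, b) # L'"]) auto
qed

text \<open>On a single point the invariants are constant: the polynomials \<open>f(t, 1)\<close> and \<open>f(1, t)\<close> are
  constant by shear invariance.\<close>

lemma shear_inv_single_point:
  assumes "shear_inv f" "mh \<delta> f" "set_mset \<delta> = {i}"
  shows "f = 0"
proof (rule ccontr)
  assume "f \<noteq> 0"
  then obtain m where m: "m \<in> Poly_Mapping.keys f" by (metis keys_eq_empty ex_in_conv)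
  define e where "e = count \<delta> i"
  have e: "e > 0" using assms(3) by (simp add: e_def)
  have key: "Poly_Mapping.lookup k (PX i) + Poly_Mapping.lookup k (PY i) = e \<and>
      (\<forall>j. j \<noteq> i \<longrightarrow> Poly_Mapping.lookup k (PX j) = 0 \<and> Poly_Mapping.lookup k (PY j) = 0)"
    if "k \<in> Poly_Mapping.keys f" for k
  proof -
    have "mdeg k = \<delta>" using that assms(2) by (simp add: mh_mdeg)
    then have "Poly_Mapping.lookup k (PX j) + Poly_Mapping.lookup k (PY j) = count \<delta> j" for j
      using count_mdeg[of k j] by simp
    moreover have "count \<delta> j = 0" if "j \<noteq> i" for j
      using assms(3) that by (metis count_eq_zero_iff singletonD)
    ultimately show ?thesis unfolding e_def by (metis add_is_0)
  qed
  define V where "V = (\<lambda>p q. msubst of_int (\<lambda>v. case v of PX _ \<Rightarrow> p | PY _ \<Rightarrow> q) f :: int poly)"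
  have Vkeys: "V p q = (\<Sum>k\<in>Poly_Mapping.keys f. of_int (Poly_Mapping.lookup f k) *
      (p ^ Poly_Mapping.lookup k (PX i) * q ^ Poly_Mapping.lookup k (PY i)))" for p q
  proof -
    have "mono_val (\<lambda>v. case v of PX _ \<Rightarrow> p | PY _ \<Rightarrow> q) k = p ^ Poly_Mapping.lookup k (PX i) * q ^ Poly_Mapping.lookup k (PY i)"
      if "k \<in> Poly_Mapping.keys f" for k
    proof -
      have "Poly_Mapping.keys k \<subseteq> {PX i, PY i}"
      proof
        fix w assume "w \<in> Poly_Mapping.keys k"
        then show "w \<in> {PX i, PY i}" using key[OF that] by (cases w) (auto simp: in_keys_iff)
      qed
      then show ?thesis by (subst mono_val_superset[of "{PX i, PY i}"]) auto
    qed
    then show ?thesis unfolding V_def msubst_alt by simp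
  qed
  have inj: "k = m" if "k \<in> Poly_Mapping.keys f" "Poly_Mapping.lookup k (PX i) = Poly_Mapping.lookup m (PX i)" for k
  proof (rule poly_mapping_eqI)
    fix w show "Poly_Mapping.lookup k w = Poly_Mapping.lookup m w"
      using key[OF that(1)] key[OF m] that(2) by (cases w) (metis add_left_cancel)+
  qed
  have Vx: "V (p + of_int u * q) q = V p q" and Vy: "V p (q + of_int u * p) = V p q" for p q u
  proof -
    let ?V = "msubst of_int (\<lambda>v. case v of PX _ \<Rightarrow> p | PY _ \<Rightarrow> q) :: (pvar, int) mpoly \<Rightarrow> int poly"
    have hV: "is_hom ?V" by (simp add: is_hom_msubst is_hom_of_int_map)
    have "V (p + of_int u * q) q = ?V (shearx u f)" unfolding V_def
    proof (rule hom_int_eqI[OF _ is_hom_comp[OF is_hom_shear(1) hV]])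
      show "msubst of_int (case_pvar (\<lambda>_. p + of_int u * q) (\<lambda>_. q)) (mvar v) = ?V (shearx u (mvar v))" for v
        by (cases v) (simp_all add: msubst_mvar is_hom_of_int_map shear_mvar is_hom_simps hV)
    qed (simp add: is_hom_msubst is_hom_of_int_map)
    then show "V (p + of_int u * q) q = V p q" using assms(1) by (simp add: shear_inv_def V_def)
    have "V p (q + of_int u * p) = ?V (sheary u f)" unfolding V_def
    proof (rule hom_int_eqI[OF _ is_hom_comp[OF is_hom_shear(2) hV]])
      show "msubst of_int (case_pvar (\<lambda>_. p) (\<lambda>_. q + of_int u * p)) (mvar v) = ?V (sheary u (mvar v))" for v
        by (cases v) (simp_all add: msubst_mvar is_hom_of_int_map shear_mvar is_hom_simps hV)
    qed (simp add: is_hom_msubst is_hom_of_int_map)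
    then show "V p (q + of_int u * p) = V p q" using assms(1) by (simp add: shear_inv_def V_def)
  qed
  have ev: "poly (V p q) u = poly (V [:poly p u:] [:poly q u:]) u" for p q u
    by (simp add: Vkeys poly_sum)
  have const: "P = [:poly P 0:]" if "\<And>u. poly P u = poly P 0" for P :: "int poly"
  proof -
    have "poly (P - [:poly P 0:]) u = 0" for u using that[of u] by simp
    then have "P - [:poly P 0:] = 0" by (metis poly_all_0_iff_0)
    then show ?thesis by simp
  qed
  have V1: "poly (V [:0, 1:] 1) u = poly (V 0 1) u" for u
    using ev[of "[:0, 1:]" 1 u] Vx[of 0 u 1] by (simp add: of_int_poly one_pCons)
  have V2: "poly (V 1 [:0, 1:]) u = poly (V 1 0) u" for u
    using ev[of 1 "[:0, 1:]" u] Vy[of 1 0 u] by (simp add: of_int_poly one_pCons)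
  have V10: "V [:0, 1:] 1 = V 0 1" "V 1 [:0, 1:] = V 1 0"
    using V1 V2 by (metis poly_eq_poly_eq_iff ext)+
  have monx: "([:0, 1:] :: int poly) ^ n = monom 1 n" for n
    by (simp add: monom_altdef)
  have coeff_of_int: "coeff (of_int c * P) n = c * coeff P n" for c n and P :: "int poly"
    by (simp add: of_int_poly)
  have z: "coeff ((0::int poly) ^ a) n = (if a = 0 \<and> n = 0 then 1 else 0)" for a n
    by (cases a) auto
  have "Poly_Mapping.lookup m (PX i) = 0"
  proof (rule ccontr)
    assume nz: "Poly_Mapping.lookup m (PX i) \<noteq> 0"
    have "coeff (V [:0, 1:] 1) (Poly_Mapping.lookup m (PX i)) =
      (\<Sum>k\<in>Poly_Mapping.keys f. if k = m then Poly_Mapping.lookup f m else 0)"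
      unfolding Vkeys coeff_sum by (rule sum.cong) (auto simp: coeff_of_int monx dest: inj)
    moreover have "coeff (V 0 1) (Poly_Mapping.lookup m (PX i)) = 0"
      unfolding Vkeys coeff_sum by (rule sum.neutral) (auto simp: coeff_of_int z nz)
    ultimately show False using V10 m by (simp add: in_keys_iff)
  qed
  moreover have "Poly_Mapping.lookup m (PY i) = 0"
  proof (rule ccontr)
    assume nz: "Poly_Mapping.lookup m (PY i) \<noteq> 0"
    have inj': "k = m" if "k \<in> Poly_Mapping.keys f" "Poly_Mapping.lookup k (PY i) = Poly_Mapping.lookup m (PY i)" for k
      by (rule inj[OF that(1)]) (use key[OF that(1)] key[OF m] that(2) in linarith)
    have "coeff (V 1 [:0, 1:]) (Poly_Mapping.lookup m (PY i)) =
      (\<Sum>k\<in>Poly_Mapping.keys f. if k = m then Poly_Mapping.lookup f m else 0)"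
      unfolding Vkeys coeff_sum by (rule sum.cong) (auto simp: coeff_of_int monx dest: inj')
    moreover have "coeff (V 1 0) (Poly_Mapping.lookup m (PY i)) = 0"
      unfolding Vkeys coeff_sum by (rule sum.neutral) (auto simp: coeff_of_int z nz)
    ultimately show False using V10 m by (simp add: in_keys_iff)
  qed
  ultimately show False using key[OF m] e by simp
qed

text \<open>The first fundamental theorem over the integers. Let two points collide. By induction the result is a combination of bracket products on fewer points; these lift to bracket products with the given multidegree, and the difference vanishes at the collision, hence is a bracket times an invariant of smaller multidegree.\<close>

theorem shear_inv_spanned_by_brackets:
  assumes "shear_inv f" "mh \<delta> f"
  shows "f \<in> zspan {ev L | L. ends L = \<delta>}"
  using assms
proof (induction "(card (set_mset \<delta>), size \<delta>)" arbitrary: \<delta> f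
    rule: wf_induct_rule[OF wf_lex_prod[OF wf_less_than wf_less_than]])
  case (1 \<delta> f)
  consider "\<delta> = {#}" | i where "set_mset \<delta> = {i}" | i j where "i \<in># \<delta>" "j \<in># \<delta>" "i \<noteq> j"
    by (metis (no_types, opaque_lifting) insertI1 is_singletonI' is_singleton_the_elem set_mset_eq_empty_iff)
  then show ?case
  proof cases
    case 1
    have "Poly_Mapping.keys f \<subseteq> {0}"
    proof
      fix m assume "m \<in> Poly_Mapping.keys f"
      then have "mdeg m = {#}" using "1.prems"(2) 1 by (simp add: mh_mdeg)
      then have "Poly_Mapping.lookup m (PX i) + Poly_Mapping.lookup m (PY i) = 0" for i
        using count_mdeg[of m i] by simp
      then have "Poly_Mapping.lookup m v = 0" for v by (cases v) auto
      then show "m \<in> {0}" by (auto intro: poly_mapping_eqI)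
    qed
    then have "f = mconst (Poly_Mapping.lookup f 0)"
      by (intro poly_mapping_eqI) (auto simp: mconst_def lookup_single when_def in_keys_iff)
    then have "f = of_int (Poly_Mapping.lookup f 0) * ev []" by (simp add: mconst_int)
    moreover have "of_int (Poly_Mapping.lookup f 0) * ev [] \<in> zspan {ev L | L. ends L = \<delta>}"
    proof (intro zspan_of_int_mult zspan_base CollectI exI conjI)
      show "ends ([] :: (8 \<times> 8) list) = \<delta>" using 1 by simp
    qed simp
    ultimately show ?thesis by simp
  next
    case 2
    then have "f = 0" using shear_inv_single_point "1.prems" by blast
    then show ?thesis by (simp add: zspan_zero)
  next
    case 3
    let ?\<rho> = "collapse i j"
    let ?\<delta>' = "image_mset ?\<rho> \<delta>"
    have "set_mset ?\<delta>' \<subseteq> set_mset \<delta> - {j}" using 3 by (auto simp: collapse_def)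
    then have less: "card (set_mset ?\<delta>') < card (set_mset \<delta>)"
      using 3 by (metis card_Diff1_less card_mono finite_Diff finite_set_mset le_less_trans)
    have "relabel ?\<rho> f \<in> zspan {ev L | L. ends L = ?\<delta>'}"
      by (rule "1.hyps") (use less "1.prems" in \<open>auto intro: shear_inv_relabel mh_relabel\<close>)
    then have "\<exists>g\<in>zspan {ev L | L. ends L = \<delta>}. relabel ?\<rho> g = relabel ?\<rho> f"
    proof (rule zspan_lift)
      show "relabel ?\<rho> (x + y) = relabel ?\<rho> x + relabel ?\<rho> y" for x y
        by (simp add: is_hom_add is_hom_relabel)
      show "\<exists>g'\<in>{ev L | L. ends L = \<delta>}. relabel ?\<rho> g' = g" if "g \<in> {ev L | L. ends L = ?\<delta>'}" for g
        using that edges_lift[of _ ?\<rho> \<delta>] by (fastforce simp: relabel_ev)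
    qed
    then obtain g where g: "g \<in> zspan {ev L | L. ends L = \<delta>}" "relabel ?\<rho> g = relabel ?\<rho> f" by blast
    let ?h = "f - g"
    have h: "shear_inv ?h" "mh \<delta> ?h" "relabel ?\<rho> ?h = 0"
      using "1.prems" g by (auto intro: shear_inv_diff shear_inv_zspan mh_diff mh_zspan
        simp: is_hom_diff is_hom_relabel)
    obtain k where k: "?h = br i j * k" using br_dvd_if_collapse_zero[OF 3(3) h(2,3)] by (auto elim: dvdE)
    obtain \<epsilon> where \<epsilon>: "\<delta> = {#i, j#} + \<epsilon>"
    proof -
      have "{#i, j#} \<subseteq># \<delta>" using 3 by (simp add: insert_subset_eq_iff in_diff_count)
      then show ?thesis using that by (metis subset_mset.add_diff_inverse)
    qed
    obtain k' where k': "br i j * k' = ?h" "mh \<epsilon> k'"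
      using mh_cofactor[OF mh_br, of i j \<epsilon> k] h(2) unfolding \<epsilon> k by auto
    have "shear_inv k'"
    proof -
      have "br i j * shearx u k' = br i j * k' \<and> br i j * sheary u k' = br i j * k'" for u
        using h(1) shear_inv_br[of i j] unfolding k'(1)[symmetric] shear_inv_def
        by (simp add: is_hom_mult is_hom_shear)
      then show ?thesis using br_neq_0[OF 3(3)] by (simp add: shear_inv_def)
    qed
    have "card (set_mset \<epsilon>) \<le> card (set_mset \<delta>)" unfolding \<epsilon> by (intro card_mono) auto
    then have "k' \<in> zspan {ev L | L. ends L = \<epsilon>}"
      by (intro "1.hyps") (use \<open>shear_inv k'\<close> k' in \<open>auto simp: \<epsilon>\<close>)
    then have "br i j * k' \<in> zspan {ev L | L. ends L = \<delta>}"
    proof (rule zspan_image)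
      show "br i j * g \<in> zspan {ev L | L. ends L = \<delta>}" if g: "g \<in> {ev L | L. ends L = \<epsilon>}" for g
      proof -
        obtain L where "g = ev L" "ends L = \<epsilon>" using g by blast
        then have "br i j * g = ev ((i, j) # L)" "ends ((i, j) # L) = \<delta>" by (simp_all add: \<epsilon>)
        then show ?thesis by (metis (mono_tags, lifting) mem_Collect_eq zspan_base)
      qed
    qed (simp add: distrib_left)
    then have "br i j * k' + g \<in> zspan {ev L | L. ends L = \<delta>}" using g(1) by (rule zspan_add)
    then show ?thesis by (simp add: k'(1))
  qed
qed

section \<open>The second fundamental theorem\<close>

definition rk :: "8 \<Rightarrow> nat" where
  "rk a = card {..<a}"

lemma rk_less_iff: "rk a < rk b \<longleftrightarrow> a < b"
proof -
  have mono: "a < b \<Longrightarrow> rk a < rk b" for a b :: 8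
    unfolding rk_def by (rule psubset_card_mono) auto
  show ?thesis using mono[of a b] mono[of b a] by (metis less_asym linorder_less_linear)
qed

lemma rk_le_iff: "rk a \<le> rk b \<longleftrightarrow> a \<le> b"
  using rk_less_iff[of b a] by (simp add: not_less[symmetric])

lemma rk_bound: "rk a < 8"
proof -
  have "rk a < card (UNIV :: 8 set)" unfolding rk_def by (rule psubset_card_mono) auto
  then show ?thesis by simp
qed

definition spread :: "(8 \<times> 8) list \<Rightarrow> nat" where
  "spread L = (\<Sum>(a, b)\<leftarrow>L. nat ((int (rk a) - int (rk b))\<^sup>2))"

definition oriented :: "(8 \<times> 8) list \<Rightarrow> bool" where
  "oriented L \<longleftrightarrow> (\<forall>(a, b)\<in>set L. a < b)"

definition std_list :: "(8 \<times> 8) list \<Rightarrow> bool" where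
  "std_list L \<longleftrightarrow> oriented L \<and> sorted (map fst L) \<and> sorted (map snd L)"

definition Std :: "8 multiset \<Rightarrow> (8 \<times> 8) list set" where
  "Std \<delta> = {L. std_list L \<and> ends L = \<delta>}"

lemma size_ends: "size (ends L) = 2 * length L"
  by (induction L) auto

lemma finite_ends: "finite {L :: (8 \<times> 8) list. ends L = \<delta>}"
proof (rule finite_subset)
  show "{L. ends L = \<delta>} \<subseteq> {L :: (8 \<times> 8) list. set L \<subseteq> UNIV \<and> length L \<le> size \<delta>}"
    by (auto simp: size_ends)
qed (rule finite_lists_length_le, simp)

lemma finite_Std: "finite (Std \<delta>)"
  unfolding Std_def by (rule finite_subset[OF _ finite_ends[of \<delta>]]) auto

lemma ends_mset: "mset L = mset L' \<Longrightarrow> ends L = ends L'"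
  unfolding ends_def by (metis mset_map)

lemma ev_mset: "mset L = mset L' \<Longrightarrow> ev L = ev L'"
  unfolding ev_def by (metis mset_map prod_mset_prod_list)

lemma spread_mset: "mset L = mset L' \<Longrightarrow> spread L = spread L'"
  unfolding spread_def by (simp add: sum_mset_sum_list[symmetric])

text \<open>In the lexicographic order with all \<open>x\<close> before all \<open>y\<close> the leading monomial of a product of
  brackets \<open>x\<^sub>a y\<^sub>b - x\<^sub>b y\<^sub>a\<close> with \<open>a < b\<close> is the product of the \<open>x\<^sub>a y\<^sub>b\<close>.\<close>

definition lm :: "(8 \<times> 8) list \<Rightarrow> pvar \<Rightarrow>\<^sub>0 nat" where
  "lm L = (\<Sum>(a, b)\<leftarrow>L. Poly_Mapping.single (PX a) 1 + Poly_Mapping.single (PY b) 1)"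

lemma lm_Cons: "lm (e # L) = (Poly_Mapping.single (PX (fst e)) 1 + Poly_Mapping.single (PY (snd e)) 1) + lm L"
  by (simp add: lm_def case_prod_beta)

lemma lookup_lm:
  "Poly_Mapping.lookup (lm L) (PX a) = count (mset (map fst L)) a"
  "Poly_Mapping.lookup (lm L) (PY a) = count (mset (map snd L)) a"
  by (induction L) (auto simp: lm_def lookup_add lookup_single when_def)

lemma lookup_single_times:
  fixes f :: "('v, 'k::comm_ring_1) mpoly"
  shows "Poly_Mapping.lookup (Poly_Mapping.single e c * f) (e + m) = c * Poly_Mapping.lookup f m"
  by (induction f rule: poly_mapping_single_induct)
     (simp_all add: distrib_left mult_single lookup_add lookup_single when_def)

lemma xy_less:
  assumes "a < b"
  shows "Poly_Mapping.single (PX b) 1 + Poly_Mapping.single (PY a) 1 <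
    Poly_Mapping.single (PX a) (1::nat) + Poly_Mapping.single (PY b) 1"
proof -
  have "less_fun (Poly_Mapping.lookup (Poly_Mapping.single (PX b) 1 + Poly_Mapping.single (PY a) 1))
    (Poly_Mapping.lookup (Poly_Mapping.single (PX a) (1::nat) + Poly_Mapping.single (PY b) 1))"
    unfolding less_fun_def
    by (rule exI[of _ "PX a"])
       (use assms in \<open>auto simp: lookup_add lookup_single when_def less_pvar_def less_eq_pvar_def split: pvar.splits\<close>)
  then show ?thesis by (simp add: less_poly_mapping.rep_eq)
qed

lemma keys_single_times:
  "m \<in> Poly_Mapping.keys (Poly_Mapping.single e c * f) \<Longrightarrow> \<exists>n. m = e + n \<and> n \<in> Poly_Mapping.keys f"
  using keys_mult[of "Poly_Mapping.single e c" f] by (auto split: if_splits)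

lemma ev_leading:
  "oriented L \<Longrightarrow> Poly_Mapping.lookup (ev L) (lm L) = 1 \<and> (\<forall>m\<in>Poly_Mapping.keys (ev L). m \<le> lm L)"
proof (induction L)
  case Nil
  then show ?case by (simp add: lm_def lookup_one)
next
  case (Cons e L)
  obtain a b where e: "e = (a, b)" by force
  have ab: "a < b" and IH: "Poly_Mapping.lookup (ev L) (lm L) = 1" "\<forall>m\<in>Poly_Mapping.keys (ev L). m \<le> lm L"
    using Cons by (auto simp: oriented_def e)
  let ?u = "Poly_Mapping.single (PX a) (1::nat) + Poly_Mapping.single (PY b) 1"
  let ?w = "Poly_Mapping.single (PX b) (1::nat) + Poly_Mapping.single (PY a) 1"
  have ev: "ev (e # L) = Poly_Mapping.single ?u 1 * ev L - Poly_Mapping.single ?w 1 * ev L"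
    by (simp add: e br_def mvar_def mult_single left_diff_distrib)
  have wu: "?w < ?u" by (rule xy_less[OF ab])
  have w: "m < ?u + lm L" if mk: "m \<in> Poly_Mapping.keys (Poly_Mapping.single ?w (1::int) * ev L)" for m
  proof -
    obtain n where n: "m = ?w + n" "n \<in> Poly_Mapping.keys (ev L)"
      using keys_single_times[OF mk] by blast
    have "?w + n \<le> ?w + lm L" using IH n by (intro add_left_mono) auto
    also have "\<dots> < ?u + lm L" using wu by (rule add_strict_right_mono)
    finally show ?thesis using n by simp
  qed
  have u: "m \<le> ?u + lm L" if mk: "m \<in> Poly_Mapping.keys (Poly_Mapping.single ?u (1::int) * ev L)" for m
  proof -
    obtain n where n: "m = ?u + n" "n \<in> Poly_Mapping.keys (ev L)"
      using keys_single_times[OF mk] by blast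
    then show ?thesis using IH by (simp add: add_left_mono)
  qed
  have "Poly_Mapping.lookup (Poly_Mapping.single ?w (1::int) * ev L) (?u + lm L) = 0"
    using w by (meson in_keys_iff less_irrefl)
  moreover have "Poly_Mapping.lookup (Poly_Mapping.single ?u (1::int) * ev L) (?u + lm L) = 1"
    using IH by (simp add: lookup_single_times)
  ultimately have 1: "Poly_Mapping.lookup (ev (e # L)) (lm (e # L)) = 1"
    unfolding ev lm_Cons by (simp add: e lookup_minus)
  have "m \<le> lm (e # L)" if "m \<in> Poly_Mapping.keys (ev (e # L))" for m
  proof -
    have "m \<in> Poly_Mapping.keys (Poly_Mapping.single ?u (1::int) * ev L) \<or>
      m \<in> Poly_Mapping.keys (Poly_Mapping.single ?w (1::int) * ev L)"
      using that unfolding ev by (auto simp: in_keys_iff lookup_minus)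
    then show ?thesis using u w by (auto simp: lm_Cons e intro: less_imp_le)
  qed
  with 1 show ?case by blast
qed

lemma lm_inj_on_Std:
  assumes "s \<in> Std \<delta>" "t \<in> Std \<delta>" "lm s = lm t"
  shows "s = t"
proof -
  have "mset (map fst s) = mset (map fst t)" "mset (map snd s) = mset (map snd t)"
    using lookup_lm assms(3) by (metis multiset_eqI)+
  then have "map fst s = map fst t" "map snd s = map snd t"
    using assms(1,2) unfolding Std_def std_list_def
    by (metis (mono_tags, lifting) mem_Collect_eq properties_for_sort)+
  then show ?thesis by (rule pair_list_eqI)
qed

text \<open>Standard bracket products are linearly independent because their leading monomials are pairwise distinct.\<close>

lemma Std_independent:
  assumes "(\<Sum>s\<in>Std \<delta>. of_int (d s) * ev s) = 0" "s \<in> Std \<delta>"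
  shows "d s = 0"
proof (rule ccontr)
  assume "d s \<noteq> 0"
  let ?T = "{s \<in> Std \<delta>. d s \<noteq> 0}"
  have fin: "finite (lm ` ?T)" and ne: "lm ` ?T \<noteq> {}" using finite_Std \<open>d s \<noteq> 0\<close> assms(2) by auto
  obtain t where t: "t \<in> ?T" "lm t = Max (lm ` ?T)" using Max_in[OF fin ne] by force
  have "Poly_Mapping.lookup (of_int (d u) * ev u) (lm t) = (if u = t then d t else 0)" if u: "u \<in> Std \<delta>" for u
  proof -
    have l: "Poly_Mapping.lookup (of_int (d u) * ev u) (lm t) = d u * Poly_Mapping.lookup (ev u) (lm t)"
      by (simp add: lookup_mconst_times flip: mconst_int)
    have o: "oriented u" using u by (simp add: Std_def std_list_def)
    show ?thesis
    proof (cases "u = t")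
      case True then show ?thesis using l ev_leading[OF o] by simp
    next
      case False
      show ?thesis
      proof (cases "d u = 0")
        case True then show ?thesis using l False by simp
      next
        case du: False
        have "lm u \<le> lm t" unfolding t(2) by (rule Max_ge[OF fin]) (use u du in auto)
        then have "lm u < lm t" using lm_inj_on_Std[OF u, of t] t(1) False by force
        then have "Poly_Mapping.lookup (ev u) (lm t) = 0"
          using ev_leading[OF o] by (meson in_keys_iff not_le)
        then show ?thesis using l False by simp
      qed
    qed
  qed
  then have "Poly_Mapping.lookup (\<Sum>s\<in>Std \<delta>. of_int (d s) * ev s) (lm t) = (\<Sum>u\<in>Std \<delta>. if u = t then d t else 0)"
    unfolding lookup_sum by (rule sum.cong[OF refl])
  also have "\<dots> = d t" using t(1) finite_Std by simp
  finally show False using assms(1) t(1) by simp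
qed

lemma mset_remove1_front: "e \<in> set L \<Longrightarrow> mset L = mset (e # remove1 e L)"
  by simp

text \<open>An assignment \<open>\<omega>\<close> of values to graphs that respects the rules for brackets modulo an additive subgroup \<open>H\<close>: reordering and reversal of edges, loops, and the Pluecker relation.\<close>

locale bracket_relations =
  fixes \<omega> :: "(8 \<times> 8) list \<Rightarrow> 'a::comm_ring_1" and H :: "'a set" and \<delta> :: "8 multiset"
  assumes H0: "0 \<in> H" and H_diff: "x \<in> H \<Longrightarrow> y \<in> H \<Longrightarrow> x - y \<in> H"
    and perm: "mset L = mset L' \<Longrightarrow> ends L = \<delta> \<Longrightarrow> \<omega> L - \<omega> L' \<in> H"
    and loop: "ends ((a, a) # L) = \<delta> \<Longrightarrow> \<omega> ((a, a) # L) \<in> H"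
    and flip: "ends ((a, b) # L) = \<delta> \<Longrightarrow> \<omega> ((a, b) # L) + \<omega> ((b, a) # L) \<in> H"
    and pluecker: "ends ((a, b) # (c, d) # L) = \<delta> \<Longrightarrow>
      \<omega> ((a, b) # (c, d) # L) - \<omega> ((a, c) # (b, d) # L) + \<omega> ((a, d) # (b, c) # L) \<in> H"
begin

lemma H_uminus: "x \<in> H \<Longrightarrow> - x \<in> H"
  using H_diff[OF H0, of x] by simp

lemma H_add: "x \<in> H \<Longrightarrow> y \<in> H \<Longrightarrow> x + y \<in> H"
  using H_diff[of x "-y"] H_uminus[of y] by simp

lemma H_sum: "(\<And>i. i \<in> A \<Longrightarrow> f i \<in> H) \<Longrightarrow> sum f A \<in> H"
  by (induction A rule: infinite_finite_induct) (auto intro: H0 H_add)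

lemma H_of_int: "x \<in> H \<Longrightarrow> of_int n * x \<in> H"
proof -
  assume x: "x \<in> H"
  have nat: "of_nat k * x \<in> H" for k
    by (induction k) (auto simp: distrib_right intro: H0 H_add x)
  show ?thesis using nat H_uminus[OF nat] by (cases n) (auto simp del: of_nat_Suc)
qed

definition straight :: "'a \<Rightarrow> (pvar, int) mpoly \<Rightarrow> bool" where
  "straight x y \<longleftrightarrow> (\<exists>d::(8 \<times> 8) list \<Rightarrow> int. x - (\<Sum>s\<in>Std \<delta>. of_int (d s) * \<omega> s) \<in> H \<and>
     y = (\<Sum>s\<in>Std \<delta>. of_int (d s) * ev s))"

lemma straight_add: "straight x y \<Longrightarrow> straight x' y' \<Longrightarrow> straight (x + x') (y + y')"
proof -
  assume "straight x y" "straight x' y'"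
  then obtain d d' where d: "x - (\<Sum>s\<in>Std \<delta>. of_int (d s) * \<omega> s) \<in> H" "y = (\<Sum>s\<in>Std \<delta>. of_int (d s) * ev s)"
    "x' - (\<Sum>s\<in>Std \<delta>. of_int (d' s) * \<omega> s) \<in> H" "y' = (\<Sum>s\<in>Std \<delta>. of_int (d' s) * ev s)"
    unfolding straight_def by blast
  have "x + x' - (\<Sum>s\<in>Std \<delta>. of_int (d s + d' s) * \<omega> s) \<in> H"
    using H_add[OF d(1,3)] by (simp add: sum.distrib distrib_right algebra_simps)
  moreover have "y + y' = (\<Sum>s\<in>Std \<delta>. of_int (d s + d' s) * ev s)"
    using d by (simp add: sum.distrib distrib_right)
  ultimately show ?thesis unfolding straight_def by (intro exI[of _ "\<lambda>s. d s + d' s"]) blast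
qed

lemma straight_uminus: "straight x y \<Longrightarrow> straight (- x) (- y)"
proof -
  assume "straight x y"
  then obtain d where d: "x - (\<Sum>s\<in>Std \<delta>. of_int (d s) * \<omega> s) \<in> H" "y = (\<Sum>s\<in>Std \<delta>. of_int (d s) * ev s)"
    unfolding straight_def by blast
  have "- x - (\<Sum>s\<in>Std \<delta>. of_int (- d s) * \<omega> s) \<in> H"
    using H_uminus[OF d(1)] by (simp add: sum_negf)
  moreover have "- y = (\<Sum>s\<in>Std \<delta>. of_int (- d s) * ev s)"
    using d by (simp add: sum_negf)
  ultimately show ?thesis unfolding straight_def by (intro exI[of _ "\<lambda>s. - d s"]) blast
qed

lemma straight_cong: "straight x y \<Longrightarrow> x' - x \<in> H \<Longrightarrow> straight x' y"
proof -
  assume "straight x y" and h: "x' - x \<in> H"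
  then obtain d where d: "x - (\<Sum>s\<in>Std \<delta>. of_int (d s) * \<omega> s) \<in> H" "y = (\<Sum>s\<in>Std \<delta>. of_int (d s) * ev s)"
    unfolding straight_def by blast
  have "x' - (\<Sum>s\<in>Std \<delta>. of_int (d s) * \<omega> s) \<in> H" using H_add[OF h d(1)] by simp
  then show ?thesis using d unfolding straight_def by blast
qed

lemma straight_H: "x \<in> H \<Longrightarrow> straight x 0"
  unfolding straight_def by (rule exI[of _ "\<lambda>_. 0"]) simp

lemma straight_Std:
  assumes "s \<in> Std \<delta>" shows "straight (\<omega> s) (ev s)"
  unfolding straight_def
proof (intro exI conjI)
  have "(\<Sum>t\<in>Std \<delta>. of_int (if t = s then 1 else 0) * \<omega> t) = (\<Sum>t\<in>Std \<delta>. if t = s then \<omega> s else 0)"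
    by (rule sum.cong) auto
  then show "\<omega> s - (\<Sum>t\<in>Std \<delta>. of_int (if t = s then 1 else 0) * \<omega> t) \<in> H"
    using assms finite_Std H0 by simp
  have "(\<Sum>t\<in>Std \<delta>. of_int (if t = s then 1 else 0) * ev t) = (\<Sum>t\<in>Std \<delta>. if t = s then ev s else 0)"
    by (rule sum.cong) auto
  then show "ev s = (\<Sum>t\<in>Std \<delta>. of_int (if t = s then 1 else 0) * ev t)"
    using assms finite_Std by simp
qed

text \<open>Straightening: a nested pair \<open>a < c < d < b\<close> of edges \<open>(a, b)\<close>, \<open>(c, d)\<close> is replaced through
  the Pluecker relation by pairs that are not nested, and this lowers the sum of the squared lengths.\<close>

lemma straightening: "ends L = \<delta> \<Longrightarrow> straight (\<omega> L) (ev L)"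
proof (induction "(spread L, length (filter (\<lambda>(a, b). b < a) L))" arbitrary: L
    rule: wf_induct_rule[OF wf_lex_prod[OF wf_less_than wf_less_than]])
  case (1 L)
  have front: "\<exists>M. mset L = mset (e # M)" if "e \<in> set L" for e
    using that by (intro exI[of _ "remove1 e L"]) simp
  have congL: "straight (\<omega> L) (ev L)" if "mset L = mset L'" "straight (\<omega> L') (ev L')" for L'
    using straight_cong[OF that(2) perm[OF that(1) "1.prems"]] ev_mset[OF that(1)] by simp
  consider (is_loop) a where "(a, a) \<in> set L" | (backward) a b where "(b, a) \<in> set L" "a < b"
    | (nest) a b c d where "oriented L" "(a, b) \<in> set L" "(c, d) \<in> set L" "a < c" "d < b"
    | (std) "oriented L" "\<forall>(a, b)\<in>set L. \<forall>(c, d)\<in>set L. a < c \<longrightarrow> b \<le> d"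
  proof (cases "(\<exists>a. (a, a) \<in> set L) \<or> (\<exists>a b. (b, a) \<in> set L \<and> a < b)")
    case True then show ?thesis using that by blast
  next
    case False
    have "a < b" if "(a, b) \<in> set L" for a b
      using False that by (metis linorder_less_linear)
    then have o: "oriented L" by (auto simp: oriented_def)
    show ?thesis
    proof (cases "\<exists>a b c d. (a, b) \<in> set L \<and> (c, d) \<in> set L \<and> a < c \<and> d < b")
      case True then show ?thesis using that(3) o by blast
    next
      case False
      then have "\<not> d < b" if "(a, b) \<in> set L" "(c, d) \<in> set L" "a < c" for a b c d
        using that by blast
      then have "\<forall>(a, b)\<in>set L. \<forall>(c, d)\<in>set L. a < c \<longrightarrow> b \<le> d"
        by (auto simp: not_less[symmetric])
      then show ?thesis using that(4) o by blast
    qed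
  qed
  then show ?case
  proof cases
    case is_loop
    obtain M where M: "mset L = mset ((a, a) # M)" using front[OF is_loop] by blast
    have "ends ((a, a) # M) = \<delta>" using ends_mset[OF M] "1.prems" by metis
    then have "straight (\<omega> ((a, a) # M)) 0" by (intro straight_H loop)
    then show ?thesis using congL[OF M] by simp
  next
    case backward
    obtain M where M: "mset L = mset ((b, a) # M)" using front[OF backward(1)] by blast
    have eM: "ends ((b, a) # M) = \<delta>" using ends_mset[OF M] "1.prems" by metis
    then have eM': "ends ((a, b) # M) = \<delta>" by (simp add: add_mset_commute)
    have "spread L = spread ((a, b) # M)"
      using spread_mset[OF M] by (simp add: spread_def power2_commute)
    moreover have "length (filter (\<lambda>(a, b). b < a) L) = length (filter (\<lambda>(a, b). b < a) ((b, a) # M))"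
      using M by (metis mset_filter size_mset)
    ultimately have "straight (\<omega> ((a, b) # M)) (ev ((a, b) # M))"
      using backward(2) by (intro "1.hyps"[OF _ eM']) auto
    then have "straight (- \<omega> ((a, b) # M)) (ev ((b, a) # M))"
      using straight_uminus by (fastforce simp: br_swap[of a b])
    then have "straight (\<omega> ((b, a) # M)) (ev ((b, a) # M))"
      by (rule straight_cong) (use flip[OF eM] in simp)
    then show ?thesis by (rule congL[OF M])
  next
    case nest
    have cd: "c < d" and ab: "a < b" using nest unfolding oriented_def by auto
    have "(c, d) \<in> set (remove1 (a, b) L)" using nest by (subst in_set_remove1) auto
    then have "mset (remove1 (a, b) L) = mset ((c, d) # remove1 (c, d) (remove1 (a, b) L))"
      by (rule mset_remove1_front)
    then have M: "mset L = mset ((a, b) # (c, d) # remove1 (c, d) (remove1 (a, b) L))"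
      using mset_remove1_front[OF nest(2)] unfolding mset.simps(2) by (simp only:)
    define M where "M = remove1 (c, d) (remove1 (a, b) L)"
    note M = M[folded M_def]
    have e1: "ends ((a, b) # (c, d) # M) = \<delta>" using ends_mset[OF M] "1.prems" by metis
    then have e2: "ends ((a, c) # (b, d) # M) = \<delta>" and e3: "ends ((a, d) # (b, c) # M) = \<delta>"
      by (simp_all add: add_mset_commute)
    have r: "rk a < rk c" "rk c < rk d" "rk d < rk b" using nest cd by (simp_all add: rk_less_iff)
    have s2: "spread ((a, c) # (b, d) # M) < spread L" and s3: "spread ((a, d) # (b, c) # M) < spread L"
    proof -
      obtain p q s where pqs: "rk c = rk a + p" "rk d = rk a + p + q" "rk b = rk a + p + q + s" "p > 0" "q > 0" "s > 0"
        using r by (metis add.assoc less_imp_add_positive)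
      have sL: "spread L = (p + q + s)\<^sup>2 + q\<^sup>2 + spread M"
        unfolding spread_mset[OF M] by (simp add: spread_def pqs power2_eq_square algebra_simps nat_add_distrib nat_mult_distrib)
      have "spread ((a, c) # (b, d) # M) = p\<^sup>2 + s\<^sup>2 + spread M"
        by (simp add: spread_def pqs power2_eq_square algebra_simps nat_add_distrib nat_mult_distrib)
      then show "spread ((a, c) # (b, d) # M) < spread L" using sL pqs
        by (simp add: power2_eq_square algebra_simps)
      have "spread ((a, d) # (b, c) # M) = (p + q)\<^sup>2 + (q + s)\<^sup>2 + spread M"
        by (simp add: spread_def pqs power2_eq_square algebra_simps nat_add_distrib nat_mult_distrib)
      then show "spread ((a, d) # (b, c) # M) < spread L" using sL pqs
        by (simp add: power2_eq_square algebra_simps)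
    qed
    have "straight (\<omega> ((a, c) # (b, d) # M)) (ev ((a, c) # (b, d) # M))"
      by (rule "1.hyps"[OF _ e2]) (use s2 in simp)
    moreover have "straight (\<omega> ((a, d) # (b, c) # M)) (ev ((a, d) # (b, c) # M))"
      by (rule "1.hyps"[OF _ e3]) (use s3 in simp)
    ultimately have "straight (\<omega> ((a, c) # (b, d) # M) + - \<omega> ((a, d) # (b, c) # M))
        (ev ((a, c) # (b, d) # M) + - ev ((a, d) # (b, c) # M))"
      by (intro straight_add straight_uminus)
    moreover have "ev ((a, c) # (b, d) # M) + - ev ((a, d) # (b, c) # M) = ev ((a, b) # (c, d) # M)"
      using br_pluecker[of a b c d] by (simp flip: mult.assoc left_diff_distrib)
    ultimately have "straight (\<omega> ((a, b) # (c, d) # M)) (ev ((a, b) # (c, d) # M))"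
      using straight_cong pluecker[OF e1] by (fastforce simp: algebra_simps)
    then show ?thesis by (rule congL[OF M])
  next
    case std
    define key where "key = (\<lambda>e :: 8 \<times> 8. 8 * rk (fst e) + rk (snd e))"
    define L' where "L' = sort_key key L"
    have m: "mset L = mset L'" and sl: "set L' = set L" by (simp_all add: L'_def)
    have srt: "sorted (map key L')" by (simp add: L'_def)
    have "fst (L' ! i) \<le> fst (L' ! j) \<and> snd (L' ! i) \<le> snd (L' ! j)" if "i \<le> j" "j < length L'" for i j
    proof -
      have k: "key (L' ! i) \<le> key (L' ! j)" using srt that by (simp add: sorted_iff_nth_mono)
      have in_set: "L' ! i \<in> set L" "L' ! j \<in> set L" using that sl by (metis le_less_trans nth_mem)+
      have 1: "rk (fst (L' ! i)) \<le> rk (fst (L' ! j))"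
        using k rk_bound[of "snd (L' ! i)"] rk_bound[of "snd (L' ! j)"] unfolding key_def by linarith
      show ?thesis
      proof (cases "fst (L' ! i) < fst (L' ! j)")
        case True
        then show ?thesis using std(2) in_set by (auto simp: case_prod_beta)
      next
        case False
        then have "fst (L' ! i) = fst (L' ! j)" using 1 by (simp add: rk_le_iff)
        then show ?thesis using k unfolding key_def by (simp add: rk_le_iff)
      qed
    qed
    then have "sorted (map fst L')" "sorted (map snd L')" by (auto simp: sorted_iff_nth_mono)
    moreover have "oriented L'" using std(1) sl by (simp add: oriented_def)
    moreover have "ends L' = \<delta>" using ends_mset[OF m] "1.prems" by simp
    ultimately have "L' \<in> Std \<delta>" by (simp add: Std_def std_list_def)
    then show ?thesis using congL[OF m] straight_Std by blast
  qed
qed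

text \<open>Every linear relation between bracket products carries over to such an assignment: straightening rewrites both sides in the same way into standard graphs, and the standard bracket products are independent.\<close>

theorem relation_transfer:
  assumes "finite K" "\<And>k. k \<in> K \<Longrightarrow> ends (L k) = \<delta>" "(\<Sum>k\<in>K. of_int (c k) * ev (L k)) = 0"
  shows "(\<Sum>k\<in>K. of_int (c k) * \<omega> (L k)) \<in> H"
proof -
  have "\<forall>k\<in>K. \<exists>d::(8 \<times> 8) list \<Rightarrow> int. \<omega> (L k) - (\<Sum>s\<in>Std \<delta>. of_int (d s) * \<omega> s) \<in> H \<and>
     ev (L k) = (\<Sum>s\<in>Std \<delta>. of_int (d s) * ev s)"
    using straightening assms(2) unfolding straight_def by blast
  from bchoice[OF this] obtain d :: "_ \<Rightarrow> (8 \<times> 8) list \<Rightarrow> int" where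
    d1: "\<And>k. k \<in> K \<Longrightarrow> \<omega> (L k) - (\<Sum>s\<in>Std \<delta>. of_int (d k s) * \<omega> s) \<in> H" and
    d2: "\<And>k. k \<in> K \<Longrightarrow> ev (L k) = (\<Sum>s\<in>Std \<delta>. of_int (d k s) * ev s)"
    by blast
  have swap: "(\<Sum>k\<in>K. of_int (c k) * (\<Sum>s\<in>Std \<delta>. of_int (d k s) * g s)) =
     (\<Sum>s\<in>Std \<delta>. of_int (\<Sum>k\<in>K. c k * d k s) * g s)" for g :: "_ \<Rightarrow> 'r::comm_ring_1"
    by (simp add: sum_distrib_left sum_distrib_right mult.assoc) (rule sum.swap)
  have "(\<Sum>s\<in>Std \<delta>. of_int (\<Sum>k\<in>K. c k * d k s) * ev s) = (\<Sum>k\<in>K. of_int (c k) * ev (L k))"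
    by (subst swap[symmetric]) (rule sum.cong, simp_all add: d2)
  then have "(\<Sum>s\<in>Std \<delta>. of_int (\<Sum>k\<in>K. c k * d k s) * ev s) = 0" using assms(3) by simp
  then have z: "(\<Sum>k\<in>K. c k * d k s) = 0" if "s \<in> Std \<delta>" for s by (rule Std_independent[OF _ that])
  have "(\<Sum>k\<in>K. of_int (c k) * (\<omega> (L k) - (\<Sum>s\<in>Std \<delta>. of_int (d k s) * \<omega> s))) \<in> H"
    by (intro H_sum H_of_int d1)
  moreover have "(\<Sum>k\<in>K. of_int (c k) * (\<Sum>s\<in>Std \<delta>. of_int (d k s) * \<omega> s)) = 0"
    unfolding swap by (rule sum.neutral) (simp add: z)
  ultimately show ?thesis by (simp add: right_diff_distrib sum_subtractf)
qed

end

section \<open>Linear extension\<close>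

definition lext :: "('m \<Rightarrow> 'b::comm_ring_1) \<Rightarrow> ('m \<Rightarrow>\<^sub>0 int) \<Rightarrow> 'b" where
  "lext g f = (\<Sum>m\<in>Poly_Mapping.keys f. of_int (Poly_Mapping.lookup f m) * g m)"

lemma lext_superset:
  assumes "finite K" "Poly_Mapping.keys f \<subseteq> K"
  shows "lext g f = (\<Sum>m\<in>K. of_int (Poly_Mapping.lookup f m) * g m)"
  unfolding lext_def
  by (rule sum.mono_neutral_left) (use assms in \<open>auto simp: in_keys_iff\<close>)

lemma lext_add: "lext g (f + f') = lext g f + lext g f'"
proof -
  let ?K = "Poly_Mapping.keys f \<union> Poly_Mapping.keys f'"
  have "Poly_Mapping.keys (f + f') \<subseteq> ?K" by (rule keys_add)
  then show ?thesis
    by (simp add: lext_superset[of ?K] lookup_add distrib_right sum.distrib)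
qed

lemma lext_single: "lext g (Poly_Mapping.single m c) = of_int c * g m"
  by (subst lext_superset[of "{m}"]) auto

lemma lext_zero [simp]: "lext g 0 = 0"
  by (simp add: lext_def)

lemma lext_uminus: "lext g (- f) = - lext g f"
  using lext_add[of g f "-f"] by (simp add: eq_neg_iff_add_eq_0 add.commute)

lemma lext_diff: "lext g (f - f') = lext g f - lext g f'"
  using lext_add[of g f "-f'"] by (simp add: lext_uminus)

lemma lext_sum: "lext g (sum f A) = (\<Sum>i\<in>A. lext g (f i))"
  by (induction A rule: infinite_finite_induct) (auto simp: lext_add)

lemma is_hom_lext:
  assumes "\<And>m n. g (m + n) = g m * g n" "g 0 = 1"
  shows "is_hom (lext g)"
proof -
  have 1: "lext g (Poly_Mapping.single m c * f) = lext g (Poly_Mapping.single m c) * lext g f" for m c f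
    by (induction f rule: poly_mapping_single_induct)
       (simp_all add: mult_single lext_single assms(1) lext_add distrib_left)
  have "lext g (f * f') = lext g f * lext g f'" for f f'
    by (induction f rule: poly_mapping_single_induct) (simp_all add: 1 lext_add distrib_right)
  moreover have "lext g 1 = 1" using lext_single[of g 0 1] by (simp add: assms(2))
  ultimately show ?thesis by (simp add: is_hom_def lext_add)
qed

section \<open>Bipartite graphs and three-by-three minors\<close>

type_synonym graph = "(8 \<times> 8) multiset"

definition Pset :: "8 set" where
  "Pset = {0, 1, 2, 3}"

definition bip :: "graph \<Rightarrow> bool" where
  "bip m \<longleftrightarrow> set_mset m \<subseteq> Pset \<times> (- Pset)"

definition gends :: "graph \<Rightarrow> 8 multiset" where
  "gends m = image_mset fst m + image_mset snd m"

definition gev :: "graph \<Rightarrow> (pvar, int) mpoly" where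
  "gev m = (\<Prod>e\<in>#m. br (fst e) (snd e))"

lemma gends_mset: "gends (mset L) = ends L"
  by (simp add: gends_def ends_def)

lemma gev_mset: "gev (mset L) = ev L"
  by (induction L) (simp_all add: gev_def)

lemma gev_add: "gev (m + n) = gev m * gev n" and gev_empty [simp]: "gev {#} = 1"
  by (simp_all add: gev_def)

lemma gev_add_mset [simp]: "gev (add_mset e m) = br (fst e) (snd e) * gev m"
  by (simp add: gev_def)

lemma gends_add: "gends (m + n) = gends m + gends n"
  by (simp add: gends_def)

lemma gends_empty [simp]: "gends {#} = {#}"
  by (simp add: gends_def)

lemma gends_add_mset [simp]: "gends (add_mset e m) = add_mset (fst e) (add_mset (snd e) (gends m))"
  by (simp add: gends_def)

lemma bip_add: "bip (m + n) \<longleftrightarrow> bip m \<and> bip n" and bip_empty [simp]: "bip {#}"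
  by (auto simp: bip_def)

lemma bip_add_mset [simp]: "bip (add_mset e m) \<longleftrightarrow> fst e \<in> Pset \<and> snd e \<notin> Pset \<and> bip m"
  by (cases e) (auto simp: bip_def)

abbreviation gmono :: "graph \<Rightarrow> graph \<Rightarrow>\<^sub>0 int" where
  "gmono m \<equiv> Poly_Mapping.single m 1"

definition zz :: "8 \<Rightarrow> 8 \<Rightarrow> graph \<Rightarrow>\<^sub>0 int" where
  "zz a b = gmono {#(a, b)#}"

text \<open>The generic three-by-three minor with rows \<open>i, j, k\<close> and columns \<open>u, v, w\<close>.\<close>

definition d3 :: "8 \<Rightarrow> 8 \<Rightarrow> 8 \<Rightarrow> 8 \<Rightarrow> 8 \<Rightarrow> 8 \<Rightarrow> graph \<Rightarrow>\<^sub>0 int" where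
  "d3 i j k u v w = zz i u * zz j v * zz k w - zz i u * zz j w * zz k v - zz i v * zz j u * zz k w
     + zz i v * zz j w * zz k u + zz i w * zz j u * zz k v - zz i w * zz j v * zz k u"

inductive_set I3 :: "(graph \<Rightarrow>\<^sub>0 int) set" where
  I3_zero: "0 \<in> I3"
| I3_step: "x \<in> I3 \<Longrightarrow> x + f * d3 i j k u v w \<in> I3"

lemma I3_gen: "f * d3 i j k u v w \<in> I3"
  using I3_step[OF I3_zero] by simp

lemma I3_add: assumes "x \<in> I3" "y \<in> I3" shows "x + y \<in> I3"
  using assms(2) by induction (use assms(1) in \<open>auto simp: add.assoc[symmetric] intro: I3_step\<close>)

lemma I3_mult: assumes "x \<in> I3" shows "f * x \<in> I3"
  using assms by induction (auto simp: distrib_left mult.assoc[symmetric] intro: I3_zero I3_step)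

lemma I3_uminus: "x \<in> I3 \<Longrightarrow> - x \<in> I3"
  using I3_mult[of x "-1"] by simp

lemma I3_diff: "x \<in> I3 \<Longrightarrow> y \<in> I3 \<Longrightarrow> x - y \<in> I3"
  using I3_add[of x "-y"] I3_uminus[of y] by simp

lemma I3_trans: "x - y \<in> I3 \<Longrightarrow> y - z \<in> I3 \<Longrightarrow> x - z \<in> I3"
  using I3_add[of "x - y" "y - z"] by simp

text \<open>The generic two-by-two minor; its value on brackets is the product of the bracket of the rows and the bracket of the columns.\<close>

definition mn :: "8 \<times> 8 \<Rightarrow> 8 \<times> 8 \<Rightarrow> graph \<Rightarrow>\<^sub>0 int" where
  "mn e f = zz (fst e) (fst f) * zz (snd e) (snd f) - zz (fst e) (snd f) * zz (snd e) (fst f)"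

text \<open>The second exterior power of a matrix of rank two has rank one.\<close>

lemma mn_swap: "mn e f * mn e' f' - mn e' f * mn e f' \<in> I3"
proof -
  obtain a b c d where e: "e = (a, b)" "e' = (c, d)" by force
  obtain p q r s where f: "f = (p, q)" "f' = (r, s)" by force
  have "mn e f * mn e' f' - mn e' f * mn e f' =
     zz d q * d3 a b c r p s - zz d p * d3 a b c r q s + zz c r * d3 a b d p q s - zz c s * d3 a b d r p q"
    unfolding e f mn_def d3_def by (simp add: algebra_simps)
  then show ?thesis by (auto intro!: I3_add I3_diff I3_gen)
qed

lemma mn_pluecker_left: "mn (a, b) f * mn (c, d) f' - mn (a, c) f * mn (b, d) f' + mn (a, d) f * mn (b, c) f' \<in> I3"
proof -
  obtain p q r s where f: "f = (p, q)" "f' = (r, s)" by force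
  have "mn (a, b) f * mn (c, d) f' - mn (a, c) f * mn (b, d) f' + mn (a, d) f * mn (b, c) f' =
     zz d s * d3 a b c p q r - zz c s * d3 a b d p q r + zz b s * d3 a c d p q r - zz a r * d3 b c d p q s"
    unfolding f mn_def d3_def by (simp add: algebra_simps)
  then show ?thesis by (auto intro!: I3_add I3_diff I3_gen)
qed

lemma mn_pluecker_right: "mn f (a, b) * mn f' (c, d) - mn f (a, c) * mn f' (b, d) + mn f (a, d) * mn f' (b, c) \<in> I3"
proof -
  obtain p q r s where f: "f = (p, q)" "f' = (r, s)" by force
  have "mn f (a, b) * mn f' (c, d) - mn f (a, c) * mn f' (b, d) + mn f (a, d) * mn f' (b, c) =
     zz s d * d3 p q r a b c - zz s c * d3 p q r a b d + zz s b * d3 p q r a c d - zz r a * d3 p q s b c d"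
    unfolding f mn_def d3_def by (simp add: algebra_simps)
  then show ?thesis by (auto intro!: I3_add I3_diff I3_gen)
qed

definition pz :: "('x \<Rightarrow> 'y \<Rightarrow> 'a::comm_ring_1) \<Rightarrow> 'x list \<Rightarrow> 'y list \<Rightarrow> 'a" where
  "pz f xs ys = (\<Prod>(x, y)\<leftarrow>zip xs ys. f x y)"

lemma pz_Nil [simp]: "pz f [] ys = 1" "pz f xs [] = 1"
  and pz_Cons [simp]: "pz f (x # xs) (y # ys) = f x y * pz f xs ys"
  by (simp_all add: pz_def)

lemma pz_flip: "pz f xs ys = pz (\<lambda>y x. f x y) ys xs"
proof (induction xs arbitrary: ys)
  case (Cons x xs) then show ?case by (cases ys) auto
qed simp

lemma pz_front:
  assumes "\<And>a x b c. f a b * f x c - f x b * f a c \<in> I3"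
  shows "x \<in> set xs \<Longrightarrow> length xs = length ys \<Longrightarrow> pz f xs ys - pz f (x # remove1 x xs) ys \<in> I3"
proof (induction xs arbitrary: ys)
  case (Cons a as)
  show ?case
  proof (cases "x = a")
    case True then show ?thesis by (simp add: I3_zero)
  next
    case False
    then have xas: "x \<in> set as" using Cons.prems by simp
    then obtain b c cs where ys: "ys = b # c # cs" and l: "length as = length (c # cs)"
      using Cons.prems(2) by (cases ys; cases "tl ys"; cases as) auto
    have "f a b * pz f as (c # cs) - f a b * pz f (x # remove1 x as) (c # cs) \<in> I3"
      using I3_mult[OF Cons.IH[OF xas l], of "f a b"] by (simp add: right_diff_distrib)
    moreover have "f a b * pz f (x # remove1 x as) (c # cs) - pz f (x # a # remove1 x as) ys \<in> I3"
      using I3_mult[OF assms[of a b x c], of "pz f (remove1 x as) cs"]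
      by (simp add: ys algebra_simps)
    ultimately have "f a b * pz f as (c # cs) - pz f (x # a # remove1 x as) ys \<in> I3" by (rule I3_trans)
    then show ?thesis using False by (simp add: ys)
  qed
qed simp

lemma pz_perm:
  assumes "\<And>a x b c. f a b * f x c - f x b * f a c \<in> I3"
  shows "mset xs = mset xs' \<Longrightarrow> length xs = length ys \<Longrightarrow> pz f xs ys - pz f xs' ys \<in> I3"
proof (induction xs' arbitrary: xs ys)
  case Nil then show ?case by (simp add: I3_zero)
next
  case (Cons x t)
  have x: "x \<in> set xs" using Cons.prems(1) by (metis list.set_intros(1) set_mset_mset)
  obtain b bs where ys: "ys = b # bs" using Cons.prems x by (cases ys) auto
  have m: "mset (remove1 x xs) = mset t" using Cons.prems(1) by simp
  have l: "length (remove1 x xs) = length bs" using Cons.prems(2) x by (simp add: length_remove1 ys)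
  have "f x b * pz f (remove1 x xs) bs - f x b * pz f t bs \<in> I3"
    using I3_mult[OF Cons.IH[OF m l], of "f x b"] by (simp add: right_diff_distrib)
  then show ?case using I3_trans[OF pz_front[OF assms x Cons.prems(2)]] by (simp add: ys)
qed

section \<open>Bipartite expansion of a graph\<close>

definition pe :: "(8 \<times> 8) list \<Rightarrow> (8 \<times> 8) list" where
  "pe L = filter (\<lambda>e. fst e \<in> Pset \<and> snd e \<in> Pset) L"

definition ne :: "(8 \<times> 8) list \<Rightarrow> (8 \<times> 8) list" where
  "ne L = filter (\<lambda>e. fst e \<notin> Pset \<and> snd e \<notin> Pset) L"

definition ze :: "(8 \<times> 8) list \<Rightarrow> (8 \<times> 8) list" where
  "ze L = filter (\<lambda>e. (fst e \<in> Pset) \<noteq> (snd e \<in> Pset)) L"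

definition zeta :: "8 \<times> 8 \<Rightarrow> graph \<Rightarrow>\<^sub>0 int" where
  "zeta e = (if fst e \<in> Pset then zz (fst e) (snd e) else - zz (snd e) (fst e))"

text \<open>The edges inside \<open>P\<close> and those inside its complement are matched up, and each pair is replaced by the two-by-two minor with the same value.\<close>

definition bipexp :: "(8 \<times> 8) list \<Rightarrow> graph \<Rightarrow>\<^sub>0 int" where
  "bipexp L = pz mn (pe L) (ne L) * (\<Prod>e\<leftarrow>ze L. zeta e)"

definition balanced :: "8 multiset \<Rightarrow> bool" where
  "balanced \<delta> \<longleftrightarrow> size (filter_mset (\<lambda>v. v \<in> Pset) \<delta>) = size (filter_mset (\<lambda>v. v \<notin> Pset) \<delta>)"

lemma filter_ends:
  "size (filter_mset (\<lambda>v. v \<in> Pset) (ends L)) = 2 * length (pe L) + length (ze L)"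
  "size (filter_mset (\<lambda>v. v \<notin> Pset) (ends L)) = 2 * length (ne L) + length (ze L)"
  by (induction L) (auto simp: pe_def ne_def ze_def)

lemma balanced_length: "balanced (ends L) \<Longrightarrow> length (pe L) = length (ne L)"
  by (simp add: balanced_def filter_ends)

lemma is_hom_gev: "is_hom (lext gev)"
  by (rule is_hom_lext) (simp_all add: gev_add)

lemma gev_zz: "lext gev (zz a b) = br a b"
  by (simp add: zz_def lext_single)

lemma gev_mn: "lext gev (mn e f) = br (fst e) (snd e) * br (fst f) (snd f)"
  by (simp add: mn_def is_hom_simps is_hom_gev gev_zz flip: br_pluecker)

lemma gev_zeta: "lext gev (zeta e) = br (fst e) (snd e)"
  by (simp add: zeta_def is_hom_simps is_hom_gev gev_zz br_swap[of "snd e"])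

lemma gev_pz: "length xs = length ys \<Longrightarrow> lext gev (pz mn xs ys) = ev xs * ev ys"
  by (induction xs ys rule: list_induct2) (simp_all add: is_hom_simps is_hom_gev gev_mn ac_simps)

lemma gev_bipexp: "balanced (ends L) \<Longrightarrow> lext gev (bipexp L) = ev L"
proof -
  assume "balanced (ends L)"
  then have l: "length (pe L) = length (ne L)" by (rule balanced_length)
  have "lext gev (\<Prod>e\<leftarrow>M. zeta e) = ev M" for M
    by (induction M) (simp_all add: is_hom_simps is_hom_gev gev_zeta)
  then have "lext gev (bipexp L) = ev (pe L) * ev (ne L) * ev (ze L)"
    by (simp add: bipexp_def is_hom_mult is_hom_gev gev_pz[OF l])
  also have "\<dots> = ev L" by (induction L) (auto simp: pe_def ne_def ze_def ac_simps)
  finally show ?thesis .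
qed

definition bipspan :: "8 multiset \<Rightarrow> (graph \<Rightarrow>\<^sub>0 int) set" where
  "bipspan \<delta> = zspan {gmono m | m. bip m \<and> gends m = \<delta>}"

lemma bipspan_mult:
  assumes "x \<in> bipspan \<delta>" "y \<in> bipspan \<epsilon>" shows "x * y \<in> bipspan (\<delta> + \<epsilon>)"
proof -
  have "gmono m * y \<in> bipspan (\<delta> + \<epsilon>)" if "bip m" "gends m = \<delta>" for m
    using assms(2) unfolding bipspan_def
  proof (rule zspan_image)
    fix g assume "g \<in> {gmono m |m. bip m \<and> gends m = \<epsilon>}"
    then obtain n where "g = gmono n" "bip n" "gends n = \<epsilon>" by blast
    then have "gmono m * g = gmono (m + n)" "bip (m + n)" "gends (m + n) = \<delta> + \<epsilon>"
      using that by (simp_all add: mult_single bip_add gends_add)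
    then show "gmono m * g \<in> zspan {gmono m |m. bip m \<and> gends m = \<delta> + \<epsilon>}"
      by (intro zspan_base) auto
  qed (simp add: distrib_left)
  then show ?thesis using assms(1) unfolding bipspan_def
    by (intro zspan_image[of x _ "\<lambda>x. x * y"]) (auto simp: distrib_right)
qed

lemma bipspan_gmono: "bip m \<Longrightarrow> gmono m \<in> bipspan (gends m)"
  unfolding bipspan_def by (rule zspan_base) blast

lemma bipspan_one: "1 \<in> bipspan {#}"
  using bipspan_gmono[of "{#}"] by (simp add: zero_multiset_def[symmetric])

lemma bipspan_zz: "a \<in> Pset \<Longrightarrow> b \<notin> Pset \<Longrightarrow> zz a b \<in> bipspan {#a, b#}"
  using bipspan_gmono[of "{#(a, b)#}"] by (simp add: zz_def)

lemma bipspan_mn: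
  assumes "fst e \<in> Pset" "snd e \<in> Pset" "fst f \<notin> Pset" "snd f \<notin> Pset"
  shows "mn e f \<in> bipspan {#fst e, snd e, fst f, snd f#}"
proof -
  have "zz (fst e) (fst f) * zz (snd e) (snd f) \<in> bipspan ({#fst e, fst f#} + {#snd e, snd f#})"
    "zz (fst e) (snd f) * zz (snd e) (fst f) \<in> bipspan ({#fst e, snd f#} + {#snd e, fst f#})"
    by (intro bipspan_mult bipspan_zz assms)+
  then show ?thesis unfolding mn_def bipspan_def
    by (intro zspan_diff) (simp_all add: add_mset_commute)
qed

lemma bipexp_span: "balanced (ends L) \<Longrightarrow> bipexp L \<in> bipspan (ends L)"
proof -
  assume "balanced (ends L)"
  then have l: "length (pe L) = length (ne L)" by (rule balanced_length)
  have 1: "length xs = length ys \<Longrightarrow> (\<forall>e\<in>set xs. fst e \<in> Pset \<and> snd e \<in> Pset) \<Longrightarrow>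
    (\<forall>f\<in>set ys. fst f \<notin> Pset \<and> snd f \<notin> Pset) \<Longrightarrow> pz mn xs ys \<in> bipspan (ends xs + ends ys)" for xs ys
  proof (induction xs ys rule: list_induct2)
    case (Cons x xs y ys)
    have "mn x y * pz mn xs ys \<in> bipspan ({#fst x, snd x, fst y, snd y#} + (ends xs + ends ys))"
      by (intro bipspan_mult bipspan_mn) (use Cons in auto)
    then show ?case by (simp add: add_mset_commute)
  qed (simp add: bipspan_one)
  have 2: "(\<forall>e\<in>set M. (fst e \<in> Pset) \<noteq> (snd e \<in> Pset)) \<Longrightarrow> (\<Prod>e\<leftarrow>M. zeta e) \<in> bipspan (ends M)" for M
  proof (induction M)
    case (Cons e M)
    have "zeta e \<in> bipspan {#fst e, snd e#}"
      using Cons.prems bipspan_zz[of "fst e" "snd e"] bipspan_zz[of "snd e" "fst e"]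
      by (auto simp: zeta_def bipspan_def add_mset_commute intro: zspan_uminus)
    then have "zeta e * (\<Prod>e\<leftarrow>M. zeta e) \<in> bipspan ({#fst e, snd e#} + ends M)"
      by (intro bipspan_mult) (use Cons in auto)
    then show ?case by simp
  qed (simp add: bipspan_one)
  have "bipexp L \<in> bipspan ((ends (pe L) + ends (ne L)) + ends (ze L))"
    unfolding bipexp_def
    by (intro bipspan_mult 1 2 l) (auto simp: pe_def ne_def ze_def)
  moreover have "(ends (pe L) + ends (ne L)) + ends (ze L) = ends L"
    by (induction L) (auto simp: pe_def ne_def ze_def add_mset_commute)
  ultimately show ?thesis by simp
qed

lemma bipexp_bip: "bip (mset L) \<Longrightarrow> bipexp L = gmono (mset L)"
proof -
  assume b: "bip (mset L)"
  then have "pe L = []" "ne L = []" "ze L = L"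
    by (induction L) (auto simp: pe_def ne_def ze_def)
  moreover have "bip (mset M) \<Longrightarrow> (\<Prod>e\<leftarrow>M. zeta e) = gmono (mset M)" for M
    by (induction M) (auto simp: zeta_def zz_def mult_single zero_multiset_def[symmetric])
  ultimately show ?thesis using b by (simp add: bipexp_def)
qed

lemma mn_antisym [simp]: "mn (a, a) f = 0" "mn e (b, b) = 0"
  by (simp_all add: mn_def mult.commute)

lemma mn_flip: "mn (b, a) f = - mn (a, b) f" "mn e (d, c) = - mn e (c, d)"
  by (simp_all add: mn_def mult.commute)

text \<open>The rules for brackets hold for the bipartite expansion modulo the three-by-three minors. The cases of the Pluecker relation are distinguished by the sides on which its four points lie; when all four lie on the same side it is a relation between two-by-two minors of a matrix of rank two.\<close>

lemma bracket_relations_bipexp: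
  assumes "balanced \<delta>" shows "bracket_relations bipexp I3 \<delta>"
proof
  show "0 \<in> I3" by (rule I3_zero)
  show "x - y \<in> I3" if "x \<in> I3" "y \<in> I3" for x y using that by (rule I3_diff)
next
  fix L L' :: "(8 \<times> 8) list" assume m: "mset L = mset L'" and e: "ends L = \<delta>"
  have e': "ends L' = \<delta>" using ends_mset[OF m] e by simp
  have l: "length (pe L) = length (ne L)" "length (pe L') = length (ne L')"
    using balanced_length e e' assms by auto
  have mp: "mset (pe L) = mset (pe L')" and mne: "mset (ne L) = mset (ne L')" and mz: "mset (ze L) = mset (ze L')"
    using m by (simp_all add: pe_def ne_def ze_def)
  have l2: "length (pe L') = length (ne L)" using mset_eq_length[OF mp] l by simp
  have "pz mn (pe L) (ne L) - pz mn (pe L') (ne L) \<in> I3"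
    by (rule pz_perm[OF mn_swap mp l(1)])
  moreover have "pz mn (pe L') (ne L) - pz mn (pe L') (ne L') \<in> I3"
    unfolding pz_flip[of mn] 
  proof (rule pz_perm[OF _ mne])
    show "mn b a * mn c x - mn b x * mn c a \<in> I3" for a x b c
      using mn_swap[of b a c x] by (simp add: mult.commute)
  qed (simp add: l2)
  ultimately have "pz mn (pe L) (ne L) - pz mn (pe L') (ne L') \<in> I3" by (rule I3_trans)
  moreover have "(\<Prod>e\<leftarrow>ze L. zeta e) = (\<Prod>e\<leftarrow>ze L'. zeta e)"
    using mz by (metis mset_map prod_mset_prod_list)
  ultimately have "(\<Prod>e\<leftarrow>ze L'. zeta e) * (pz mn (pe L) (ne L) - pz mn (pe L') (ne L')) \<in> I3"
    and "(\<Prod>e\<leftarrow>ze L. zeta e) = (\<Prod>e\<leftarrow>ze L'. zeta e)" by (auto intro: I3_mult)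
  then show "bipexp L - bipexp L' \<in> I3"
    unfolding bipexp_def by (simp only: right_diff_distrib mult.commute)
next
  fix a L assume "ends ((a, a) # L) = \<delta>"
  then have l: "length (pe ((a, a) # L)) = length (ne ((a, a) # L))"
    using balanced_length[of "(a, a) # L"] assms by simp
  have "bipexp ((a, a) # L) = 0"
  proof (cases "a \<in> Pset")
    case True
    then obtain f ys where "ne L = f # ys" using l by (cases "ne L") (auto simp: pe_def ne_def)
    then show ?thesis using True by (auto simp: bipexp_def pe_def ne_def)
  next
    case False
    then obtain f ys where "pe L = f # ys" using l by (cases "pe L") (auto simp: pe_def ne_def)
    then show ?thesis using False by (auto simp: bipexp_def pe_def ne_def)
  qed
  then show "bipexp ((a, a) # L) \<in> I3" by (simp add: I3_zero)
next
  fix a b L assume "ends ((a, b) # L) = \<delta>"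
  then have l: "length (pe ((a, b) # L)) = length (ne ((a, b) # L))"
    using balanced_length[of "(a, b) # L"] assms by simp
  have "bipexp ((a, b) # L) + bipexp ((b, a) # L) = 0"
  proof (cases "a \<in> Pset \<and> b \<in> Pset \<or> a \<notin> Pset \<and> b \<notin> Pset")
    case True
    then show ?thesis
    proof
      assume ab: "a \<in> Pset \<and> b \<in> Pset"
      then obtain f ys where f: "ne L = f # ys" using l by (cases "ne L") (auto simp: pe_def ne_def)
      have "pe ((a, b) # L) = (a, b) # pe L" "pe ((b, a) # L) = (b, a) # pe L" "ne ((a, b) # L) = ne L"
        "ne ((b, a) # L) = ne L" "ze ((a, b) # L) = ze L" "ze ((b, a) # L) = ze L"
        using ab by (auto simp: pe_def ne_def ze_def)
      then show ?thesis by (simp add: bipexp_def f mn_flip(1)[of b a])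
    next
      assume ab: "a \<notin> Pset \<and> b \<notin> Pset"
      then obtain f ys where f: "pe L = f # ys" using l by (cases "pe L") (auto simp: pe_def ne_def)
      have "ne ((a, b) # L) = (a, b) # ne L" "ne ((b, a) # L) = (b, a) # ne L" "pe ((a, b) # L) = pe L"
        "pe ((b, a) # L) = pe L" "ze ((a, b) # L) = ze L" "ze ((b, a) # L) = ze L"
        using ab by (auto simp: pe_def ne_def ze_def)
      then show ?thesis by (simp add: bipexp_def f mn_flip(2)[of _ b a])
    qed
  next
    case False
    then show ?thesis by (auto simp: bipexp_def pe_def ne_def ze_def zeta_def)
  qed
  then show "bipexp ((a, b) # L) + bipexp ((b, a) # L) \<in> I3" by (simp add: I3_zero)
next
  fix a b c d :: 8 and L assume "ends ((a, b) # (c, d) # L) = \<delta>"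
  then have l: "length (pe ((a, b) # (c, d) # L)) = length (ne ((a, b) # (c, d) # L))"
    using balanced_length[of "(a, b) # (c, d) # L"] assms by simp
  let ?X = "pe L" and ?Y = "ne L" and ?Z = "\<Prod>e\<leftarrow>ze L. zeta e"
  have exp: "bipexp ((p, q) # (r, s) # L) =
    pz mn ((if p \<in> Pset \<and> q \<in> Pset then [(p, q)] else []) @ (if r \<in> Pset \<and> s \<in> Pset then [(r, s)] else []) @ ?X)
      ((if p \<notin> Pset \<and> q \<notin> Pset then [(p, q)] else []) @ (if r \<notin> Pset \<and> s \<notin> Pset then [(r, s)] else []) @ ?Y)
    * ((if (p \<in> Pset) \<noteq> (q \<in> Pset) then zeta (p, q) else 1) * ((if (r \<in> Pset) \<noteq> (s \<in> Pset) then zeta (r, s) else 1) * ?Z))"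
    for p q r s by (simp add: bipexp_def pe_def ne_def ze_def)
  let ?e = "bipexp ((a, b) # (c, d) # L) - bipexp ((a, c) # (b, d) # L) + bipexp ((a, d) # (b, c) # L)"
  have lX: "length (ne L) + (if a \<notin> Pset \<and> b \<notin> Pset then 1 else 0) + (if c \<notin> Pset \<and> d \<notin> Pset then 1 else 0)
    = length (pe L) + (if a \<in> Pset \<and> b \<in> Pset then 1 else 0) + (if c \<in> Pset \<and> d \<in> Pset then 1 else 0)"
    using l by (auto simp: pe_def ne_def)
  have mn1: "mn (p, q) (r, s) = zz p r * zz q s - zz p s * zz q r" for p q r s by (simp add: mn_def)
  consider (pppp) "a \<in> Pset" "b \<in> Pset" "c \<in> Pset" "d \<in> Pset" | (nnnn) "a \<notin> Pset" "b \<notin> Pset" "c \<notin> Pset" "d \<notin> Pset"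
    | (pppn) "a \<in> Pset" "b \<in> Pset" "c \<in> Pset" "d \<notin> Pset" | (ppnp) "a \<in> Pset" "b \<in> Pset" "c \<notin> Pset" "d \<in> Pset"
    | (pnpp) "a \<in> Pset" "b \<notin> Pset" "c \<in> Pset" "d \<in> Pset" | (nppp) "a \<notin> Pset" "b \<in> Pset" "c \<in> Pset" "d \<in> Pset"
    | (nnnp) "a \<notin> Pset" "b \<notin> Pset" "c \<notin> Pset" "d \<in> Pset" | (nnpn) "a \<notin> Pset" "b \<notin> Pset" "c \<in> Pset" "d \<notin> Pset"
    | (npnn) "a \<notin> Pset" "b \<in> Pset" "c \<notin> Pset" "d \<notin> Pset" | (pnnn) "a \<in> Pset" "b \<notin> Pset" "c \<notin> Pset" "d \<notin> Pset"
    | (ppnn) "a \<in> Pset" "b \<in> Pset" "c \<notin> Pset" "d \<notin> Pset" | (pnpn) "a \<in> Pset" "b \<notin> Pset" "c \<in> Pset" "d \<notin> Pset"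
    | (pnnp) "a \<in> Pset" "b \<notin> Pset" "c \<notin> Pset" "d \<in> Pset" | (nppn) "a \<notin> Pset" "b \<in> Pset" "c \<in> Pset" "d \<notin> Pset"
    | (npnp) "a \<notin> Pset" "b \<in> Pset" "c \<notin> Pset" "d \<in> Pset" | (nnpp) "a \<notin> Pset" "b \<notin> Pset" "c \<in> Pset" "d \<in> Pset"
    by (cases "a \<in> Pset"; cases "b \<in> Pset"; cases "c \<in> Pset"; cases "d \<in> Pset"; simp)
  then show "?e \<in> I3"
  proof cases
    case pppp
    then obtain f f' ys where Y: "?Y = f # f' # ys"
      using lX by (cases ?Y; cases "tl ?Y") auto
    have "?e = (pz mn ?X ys * ?Z) * (mn (a, b) f * mn (c, d) f' - mn (a, c) f * mn (b, d) f' + mn (a, d) f * mn (b, c) f')"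
      using pppp by (simp add: exp Y algebra_simps)
    then show ?thesis by (simp only: I3_mult[OF mn_pluecker_left])
  next
    case nnnn
    then obtain f f' xs where X: "?X = f # f' # xs"
      using lX by (cases ?X; cases "tl ?X") auto
    have "?e = (pz mn xs ?Y * ?Z) * (mn f (a, b) * mn f' (c, d) - mn f (a, c) * mn f' (b, d) + mn f (a, d) * mn f' (b, c))"
      using nnnn by (simp add: exp X algebra_simps)
    then show ?thesis by (simp only: I3_mult[OF mn_pluecker_right])
  next
    case pppn
    then obtain p q ys where Y: "?Y = (p, q) # ys" using lX by (cases ?Y) auto
    have "?e = (pz mn ?X ys * ?Z) * (mn (a, b) (p, q) * zz c d - mn (a, c) (p, q) * zz b d + zz a d * mn (b, c) (p, q))"
      using pppn by (simp add: exp Y zeta_def algebra_simps)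
    also have "mn (a, b) (p, q) * zz c d - mn (a, c) (p, q) * zz b d + zz a d * mn (b, c) (p, q) = d3 a b c p q d"
      by (simp add: mn1 d3_def algebra_simps)
    finally have "?e = (pz mn ?X ys * ?Z) * d3 a b c p q d" by simp
    then show ?thesis by (simp only: I3_gen)
  next
    case ppnp
    then obtain p q ys where Y: "?Y = (p, q) # ys" using lX by (cases ?Y) auto
    have "?e = (pz mn ?X ys * ?Z) * (mn (a, b) (p, q) * (- zz d c) - zz a c * mn (b, d) (p, q) + mn (a, d) (p, q) * zz b c)"
      using ppnp by (simp add: exp Y zeta_def algebra_simps)
    also have "mn (a, b) (p, q) * (- zz d c) - zz a c * mn (b, d) (p, q) + mn (a, d) (p, q) * zz b c = - d3 a b d p q c"
      by (simp add: mn1 d3_def algebra_simps)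
    finally have "?e = (- pz mn ?X ys * ?Z) * d3 a b d p q c" by simp
    then show ?thesis by (simp only: I3_gen)
  next
    case pnpp
    then obtain p q ys where Y: "?Y = (p, q) # ys" using lX by (cases ?Y) auto
    have "?e = (pz mn ?X ys * ?Z) * (zz a b * mn (c, d) (p, q) - mn (a, c) (p, q) * (- zz d b) + mn (a, d) (p, q) * (- zz c b))"
      using pnpp by (simp add: exp Y zeta_def algebra_simps)
    also have "zz a b * mn (c, d) (p, q) - mn (a, c) (p, q) * (- zz d b) + mn (a, d) (p, q) * (- zz c b) = d3 a c d p q b"
      by (simp add: mn1 d3_def algebra_simps)
    finally have "?e = (pz mn ?X ys * ?Z) * d3 a c d p q b" by simp
    then show ?thesis by (simp only: I3_gen)
  next
    case nppp
    then obtain p q ys where Y: "?Y = (p, q) # ys" using lX by (cases ?Y) auto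
    have "?e = (pz mn ?X ys * ?Z) * ((- zz b a) * mn (c, d) (p, q) - (- zz c a) * mn (b, d) (p, q) + (- zz d a) * mn (b, c) (p, q))"
      using nppp by (simp add: exp Y zeta_def algebra_simps)
    also have "(- zz b a) * mn (c, d) (p, q) - (- zz c a) * mn (b, d) (p, q) + (- zz d a) * mn (b, c) (p, q) = - d3 b c d p q a"
      by (simp add: mn1 d3_def algebra_simps)
    finally have "?e = (- pz mn ?X ys * ?Z) * d3 b c d p q a" by simp
    then show ?thesis by (simp only: I3_gen)
  next
    case nnnp
    then obtain p q xs where X: "?X = (p, q) # xs" using lX by (cases ?X) auto
    have "?e = (pz mn xs ?Y * ?Z) * (mn (p, q) (a, b) * (- zz d c) - mn (p, q) (a, c) * (- zz d b) + (- zz d a) * mn (p, q) (b, c))"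
      using nnnp by (simp add: exp X zeta_def algebra_simps)
    also have "mn (p, q) (a, b) * (- zz d c) - mn (p, q) (a, c) * (- zz d b) + (- zz d a) * mn (p, q) (b, c) = - d3 p q d a b c"
      by (simp add: mn1 d3_def algebra_simps)
    finally have "?e = (- pz mn xs ?Y * ?Z) * d3 p q d a b c" by simp
    then show ?thesis by (simp only: I3_gen)
  next
    case nnpn
    then obtain p q xs where X: "?X = (p, q) # xs" using lX by (cases ?X) auto
    have "?e = (pz mn xs ?Y * ?Z) * (mn (p, q) (a, b) * zz c d - (- zz c a) * mn (p, q) (b, d) + mn (p, q) (a, d) * (- zz c b))"
      using nnpn by (simp add: exp X zeta_def algebra_simps)
    also have "mn (p, q) (a, b) * zz c d - (- zz c a) * mn (p, q) (b, d) + mn (p, q) (a, d) * (- zz c b) = d3 p q c a b d"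
      by (simp add: mn1 d3_def algebra_simps)
    finally have "?e = (pz mn xs ?Y * ?Z) * d3 p q c a b d" by simp
    then show ?thesis by (simp only: I3_gen)
  next
    case npnn
    then obtain p q xs where X: "?X = (p, q) # xs" using lX by (cases ?X) auto
    have "?e = (pz mn xs ?Y * ?Z) * ((- zz b a) * mn (p, q) (c, d) - mn (p, q) (a, c) * zz b d + mn (p, q) (a, d) * zz b c)"
      using npnn by (simp add: exp X zeta_def algebra_simps)
    also have "(- zz b a) * mn (p, q) (c, d) - mn (p, q) (a, c) * zz b d + mn (p, q) (a, d) * zz b c = - d3 p q b a c d"
      by (simp add: mn1 d3_def algebra_simps)
    finally have "?e = (- pz mn xs ?Y * ?Z) * d3 p q b a c d" by simp
    then show ?thesis by (simp only: I3_gen)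
  next
    case pnnn
    then obtain p q xs where X: "?X = (p, q) # xs" using lX by (cases ?X) auto
    have "?e = (pz mn xs ?Y * ?Z) * (zz a b * mn (p, q) (c, d) - zz a c * mn (p, q) (b, d) + zz a d * mn (p, q) (b, c))"
      using pnnn by (simp add: exp X zeta_def algebra_simps)
    also have "zz a b * mn (p, q) (c, d) - zz a c * mn (p, q) (b, d) + zz a d * mn (p, q) (b, c) = d3 p q a b c d"
      by (simp add: mn1 d3_def algebra_simps)
    finally have "?e = (pz mn xs ?Y * ?Z) * d3 p q a b c d" by simp
    then show ?thesis by (simp only: I3_gen)
  next
    case ppnn
    then have "?e = (pz mn ?X ?Y * ?Z) * (mn (a, b) (c, d) - zz a c * zz b d + zz a d * zz b c)"
      by (simp add: exp zeta_def algebra_simps)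
    also have "mn (a, b) (c, d) - zz a c * zz b d + zz a d * zz b c = 0" by (simp add: mn1 algebra_simps)
    finally have "?e = 0" by simp
    then show ?thesis by (simp add: I3_zero)
  next
    case pnpn
    then have "?e = (pz mn ?X ?Y * ?Z) * (zz a b * zz c d - mn (a, c) (b, d) + zz a d * (- zz c b))"
      by (simp add: exp zeta_def algebra_simps)
    also have "zz a b * zz c d - mn (a, c) (b, d) + zz a d * (- zz c b) = 0" by (simp add: mn1 algebra_simps)
    finally have "?e = 0" by simp
    then show ?thesis by (simp add: I3_zero)
  next
    case pnnp
    then have "?e = (pz mn ?X ?Y * ?Z) * (zz a b * (- zz d c) - zz a c * (- zz d b) + mn (a, d) (b, c))"
      by (simp add: exp zeta_def algebra_simps)
    also have "zz a b * (- zz d c) - zz a c * (- zz d b) + mn (a, d) (b, c) = 0" by (simp add: mn1 algebra_simps)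
    finally have "?e = 0" by simp
    then show ?thesis by (simp add: I3_zero)
  next
    case nppn
    then have "?e = (pz mn ?X ?Y * ?Z) * ((- zz b a) * zz c d - (- zz c a) * zz b d + mn (b, c) (a, d))"
      by (simp add: exp zeta_def algebra_simps)
    also have "(- zz b a) * zz c d - (- zz c a) * zz b d + mn (b, c) (a, d) = 0" by (simp add: mn1 algebra_simps)
    finally have "?e = 0" by simp
    then show ?thesis by (simp add: I3_zero)
  next
    case npnp
    then have "?e = (pz mn ?X ?Y * ?Z) * ((- zz b a) * (- zz d c) - mn (b, d) (a, c) + (- zz d a) * zz b c)"
      by (simp add: exp zeta_def algebra_simps)
    also have "(- zz b a) * (- zz d c) - mn (b, d) (a, c) + (- zz d a) * zz b c = 0" by (simp add: mn1 algebra_simps)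
    finally have "?e = 0" by simp
    then show ?thesis by (simp add: I3_zero)
  next
    case nnpp
    then have "?e = (pz mn ?X ?Y * ?Z) * (mn (c, d) (a, b) - (- zz c a) * (- zz d b) + (- zz d a) * (- zz c b))"
      by (simp add: exp zeta_def algebra_simps)
    also have "mn (c, d) (a, b) - (- zz c a) * (- zz d b) + (- zz d a) * (- zz c b) = 0" by (simp add: mn1 algebra_simps)
    finally have "?e = 0" by simp
    then show ?thesis by (simp add: I3_zero)
  qed
qed

text \<open>The relations between bipartite bracket monomials are generated by the three-by-three minors.\<close>

theorem bip_relations:
  assumes "balanced \<delta>" "f \<in> bipspan \<delta>" "lext gev f = 0"
  shows "f \<in> I3"
proof -
  interpret bracket_relations bipexp I3 \<delta> by (rule bracket_relations_bipexp[OF assms(1)])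
  have keys: "bip m \<and> gends m = \<delta>" if "m \<in> Poly_Mapping.keys f" for m
  proof -
    have "\<forall>m\<in>Poly_Mapping.keys f. bip m \<and> gends m = \<delta>"
      using assms(2) unfolding bipspan_def
    proof induction
      case (zspan_plus x g) then show ?case using keys_add[of x g] by fastforce
    next
      case (zspan_minus x g) then show ?case using keys_diff[of x g] by fastforce
    qed simp
    then show ?thesis using that by blast
  qed
  define lst where "lst m = (SOME L. mset L = m)" for m :: graph
  have lst: "mset (lst m) = m" for m unfolding lst_def by (rule someI_ex) (rule ex_mset)
  have "(\<Sum>m\<in>Poly_Mapping.keys f. of_int (Poly_Mapping.lookup f m) * bipexp (lst m)) \<in> I3"
  proof (rule relation_transfer[OF finite_keys])
    show "ends (lst m) = \<delta>" if "m \<in> Poly_Mapping.keys f" for m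
      using keys[OF that] gends_mset[of "lst m"] by (simp add: lst)
    show "(\<Sum>m\<in>Poly_Mapping.keys f. of_int (Poly_Mapping.lookup f m) * ev (lst m)) = 0"
      using assms(3) unfolding lext_def by (simp add: lst flip: gev_mset)
  qed
  also have "(\<Sum>m\<in>Poly_Mapping.keys f. of_int (Poly_Mapping.lookup f m) * bipexp (lst m)) =
      (\<Sum>m\<in>Poly_Mapping.keys f. Poly_Mapping.single m (Poly_Mapping.lookup f m))"
  proof (rule sum.cong[OF refl])
    fix m assume "m \<in> Poly_Mapping.keys f"
    then have "bipexp (lst m) = gmono m" using bipexp_bip[of "lst m"] keys by (simp add: lst)
    moreover have "(of_int c :: graph \<Rightarrow>\<^sub>0 int) = Poly_Mapping.single 0 c" for c
      using Poly_Mapping.single_of_int[of c, where ?'a = graph and ?'b = int] by simp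
    ultimately show "of_int (Poly_Mapping.lookup f m) * bipexp (lst m) =
        Poly_Mapping.single m (Poly_Mapping.lookup f m)" by (simp add: mult_single)
  qed
  also have "\<dots> = f" by (rule poly_mapping_sum_singles[symmetric])
  finally show ?thesis .
qed

text \<open>Bipartite products span: expand by two-by-two minors.\<close>

theorem ev_bip_span:
  assumes "balanced (ends L)"
  shows "ev L \<in> zspan {gev m | m. bip m \<and> gends m = ends L}"
proof -
  have "lext gev (bipexp L) \<in> zspan {gev m | m. bip m \<and> gends m = ends L}"
    using bipexp_span[OF assms] unfolding bipspan_def
  proof (rule zspan_image)
    fix g assume "g \<in> {gmono m |m. bip m \<and> gends m = ends L}"
    then show "lext gev g \<in> zspan {gev m |m. bip m \<and> gends m = ends L}"
      by (auto simp: lext_single intro!: zspan_base)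
  qed (simp add: lext_add)
  then show ?thesis using gev_bipexp[OF assms] by simp
qed

section \<open>The graded pieces of the ring of invariants\<close>

definition alld :: "nat \<Rightarrow> 8 multiset" where
  "alld d = (\<Sum>i\<in>UNIV. replicate_mset d i)"

lemma count_alld [simp]: "count (alld d) i = d"
  by (simp add: alld_def count_sum)

lemma alld_add: "alld (d + e) = alld d + alld e"
  by (rule multiset_eqI) simp

lemma alld_1_add: "alld (Suc 0) + alld n = alld (Suc n)"
  by (rule multiset_eqI) simp

lemma alld_0 [simp]: "alld 0 = {#}"
  by (rule multiset_eqI) simp

lemma UNIV8: "(UNIV :: 8 set) = {0, 1, 2, 3, 4, 5, 6, 7}"
  by (rule sym, rule card_subset_eq) simp_all

lemma card_Pset: "card Pset = 4"
  by (simp add: Pset_def)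

lemma compl_Pset: "- Pset = {4, 5, 6, 7}"
  unfolding Pset_def by (simp only: Compl_eq_Diff_UNIV UNIV8) auto

lemma card_compl_Pset: "card (- Pset) = 4"
  by (simp add: compl_Pset)

lemma size_filter_count: "size (filter_mset Q M) = (\<Sum>v | Q v. count M v)"
  for M :: "'v::finite multiset"
proof -
  have "size (filter_mset Q M) = sum (count (filter_mset Q M)) (set_mset (filter_mset Q M))"
    by (simp add: size_multiset_overloaded_eq)
  also have "\<dots> = (\<Sum>v | Q v. count M v)"
    by (rule sum.mono_neutral_cong_left) (auto simp: not_in_iff)
  finally show ?thesis .
qed

lemma balanced_alld: "balanced (alld d)"
proof -
  have "{v. v \<in> Pset} = Pset" "{v. v \<notin> Pset} = - Pset" by auto
  then show ?thesis
    by (simp add: balanced_def size_filter_count card_Pset card_compl_Pset)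
qed

lemma R_deg_conv: "f \<in> R_deg d \<longleftrightarrow> sl2_invariant f \<and> mh (alld d) f"
  by (simp add: R_deg_def mh_def)

definition specialise :: "int \<Rightarrow> int \<Rightarrow> int \<Rightarrow> int \<Rightarrow> (gvar, int) mpoly \<Rightarrow> int" where
  "specialise p q r s = msubst of_int (\<lambda>v. case v of A11 \<Rightarrow> p | A12 \<Rightarrow> q | A21 \<Rightarrow> r | A22 \<Rightarrow> s)"

lemma is_hom_specialise: "is_hom (specialise p q r s)"
  unfolding specialise_def by (rule is_hom_msubst[OF is_hom_of_int_map])

lemma specialise_mvar [simp]:
  "specialise p q r s (mvar A11) = p" "specialise p q r s (mvar A12) = q"
  "specialise p q r s (mvar A21) = r" "specialise p q r s (mvar A22) = s"
  by (simp_all add: specialise_def msubst_mvar[OF is_hom_of_int_map] del: of_int_eq_id)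

lemma is_hom_generic_translate: "is_hom generic_translate"
  by (simp add: generic_translate_def is_hom_msubst is_hom_of_int_map)

lemma generic_translate_mvar:
  "generic_translate (mvar (PX i)) = mconst (mvar A11) * mvar (PX i) + mconst (mvar A12) * mvar (PY i)"
  "generic_translate (mvar (PY i)) = mconst (mvar A21) * mvar (PX i) + mconst (mvar A22) * mvar (PY i)"
  by (simp_all add: generic_translate_def msubst_mvar is_hom_of_int_map)

abbreviation map_mconst :: "(pvar, int) mpoly \<Rightarrow> (pvar, (gvar, int) mpoly) mpoly" where
  "map_mconst \<equiv> Poly_Mapping.map mconst"

lemma is_hom_map_mconst: "is_hom map_mconst"
  by (rule is_hom_map[OF is_hom_mconst])

text \<open>Invariance under the generic matrix specialises to invariance under the two families of integral shears.\<close>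

lemma shear_inv_if_sl2_invariant:
  assumes "sl2_invariant f" shows "shear_inv f"
proof -
  let ?det = "mvar A11 * mvar A22 - mvar A12 * mvar A21 - 1 :: (gvar, int) mpoly"
  obtain g where g: "generic_translate f - map_mconst f = mconst ?det * g"
    using assms unfolding sl2_invariant_def by (auto elim: dvdE)
  have spec: "Poly_Mapping.map (specialise p q r s) (generic_translate f) = f"
    if "p * s - q * r = 1" for p q r s
  proof -
    let ?\<Theta> = "Poly_Mapping.map (specialise p q r s) :: (pvar, _) mpoly \<Rightarrow> _"
    have h: "is_hom ?\<Theta>" by (rule is_hom_map[OF is_hom_specialise])
    have "?\<Theta> (map_mconst f) = f"
      by (rule hom_int_eqI[OF is_hom_comp[OF is_hom_map_mconst h] is_hom_id])
         (simp add: map_mvar is_hom_mconst is_hom_specialise)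
    moreover have "?\<Theta> (mconst ?det) = 0"
      using that by (simp add: map_mconst is_hom_specialise is_hom_simps)
    ultimately show ?thesis using arg_cong[OF g, of ?\<Theta>]
      by (simp add: is_hom_diff[OF h] is_hom_mult[OF h])
  qed
  have x: "Poly_Mapping.map (specialise 1 u 0 1) (generic_translate f) = shearx u f" for u
  proof (rule hom_int_eqI[OF is_hom_comp[OF is_hom_generic_translate is_hom_map[OF is_hom_specialise]] is_hom_shear(1)])
    show "Poly_Mapping.map (specialise 1 u 0 1) (generic_translate (mvar v)) = shearx u (mvar v)" for v
      by (cases v) (simp_all add: generic_translate_mvar shear_mvar is_hom_simps is_hom_map[OF is_hom_specialise]
          map_mvar map_mconst is_hom_specialise mconst_int)
  qed
  have y: "Poly_Mapping.map (specialise 1 0 u 1) (generic_translate f) = sheary u f" for u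
  proof (rule hom_int_eqI[OF is_hom_comp[OF is_hom_generic_translate is_hom_map[OF is_hom_specialise]] is_hom_shear(2)])
    show "Poly_Mapping.map (specialise 1 0 u 1) (generic_translate (mvar v)) = sheary u (mvar v)" for v
      by (cases v) (simp_all add: generic_translate_mvar shear_mvar is_hom_simps is_hom_map[OF is_hom_specialise]
          map_mvar map_mconst is_hom_specialise mconst_int)
  qed
  show ?thesis unfolding shear_inv_def using spec[of 1 1] x y by (metis diff_zero mult_1 mult_zero_left mult_zero_right spec)
qed

lemma sl2_invariant_add: "sl2_invariant f \<Longrightarrow> sl2_invariant g \<Longrightarrow> sl2_invariant (f + g)"
  and sl2_invariant_diff: "sl2_invariant f \<Longrightarrow> sl2_invariant g \<Longrightarrow> sl2_invariant (f - g)"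
  and sl2_invariant_0: "sl2_invariant 0"
proof -
  let ?det = "mconst (mvar A11 * mvar A22 - mvar A12 * mvar A21 - 1) :: (pvar, (gvar, int) mpoly) mpoly"
  have e: "generic_translate (f + g) - map_mconst (f + g) = (generic_translate f - map_mconst f) + (generic_translate g - map_mconst g)"
    "generic_translate (f - g) - map_mconst (f - g) = (generic_translate f - map_mconst f) - (generic_translate g - map_mconst g)"
    by (simp_all add: is_hom_simps is_hom_generic_translate is_hom_map_mconst)
  show "sl2_invariant f \<Longrightarrow> sl2_invariant g \<Longrightarrow> sl2_invariant (f + g)"
    unfolding sl2_invariant_def e by (rule dvd_add)
  show "sl2_invariant f \<Longrightarrow> sl2_invariant g \<Longrightarrow> sl2_invariant (f - g)"
    unfolding sl2_invariant_def e by (rule dvd_diff)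
  show "sl2_invariant 0"
    by (simp add: sl2_invariant_def is_hom_simps is_hom_generic_translate is_hom_map_mconst)
qed

lemma sl2_invariant_ev: "sl2_invariant (ev L)"
proof -
  let ?D = "mconst (mvar A11 * mvar A22 - mvar A12 * mvar A21) :: (pvar, (gvar, int) mpoly) mpoly"
  have D: "mconst (mvar A11 * mvar A22 - mvar A12 * mvar A21 - 1) = ?D - 1"
    by (simp add: is_hom_simps is_hom_mconst)
  have br: "generic_translate (br i j) = ?D * map_mconst (br i j)" for i j
    by (simp add: br_def is_hom_simps is_hom_generic_translate is_hom_map_mconst generic_translate_mvar
        map_mvar is_hom_mconst algebra_simps)
  have ev: "generic_translate (ev L) = ?D ^ length L * map_mconst (ev L)"
    by (induction L) (simp_all add: is_hom_simps is_hom_generic_translate is_hom_map_mconst br ac_simps)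
  have "?D - 1 dvd (?D ^ length L - 1) * map_mconst (ev L)"
    by (simp add: power_diff_1_eq)
  then show ?thesis unfolding sl2_invariant_def D ev by (simp add: left_diff_distrib)
qed

text \<open>Invariance under shears already forces a combination of brackets, and brackets are invariant under the generic matrix because they are multiplied by its determinant.\<close>

theorem R_deg_eq_zspan: "R_deg d = zspan {ev L | L. ends L = alld d}"
proof
  show "R_deg d \<subseteq> zspan {ev L | L. ends L = alld d}"
    using shear_inv_spanned_by_brackets shear_inv_if_sl2_invariant by (auto simp: R_deg_conv)
  show "zspan {ev L | L. ends L = alld d} \<subseteq> R_deg d"
  proof
    fix f assume f: "f \<in> zspan {ev L | L. ends L = alld d}"
    then have "sl2_invariant f"
      by induction (auto intro: sl2_invariant_0 sl2_invariant_add sl2_invariant_diff sl2_invariant_ev)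
    then show "f \<in> R_deg d" using mh_zspan[OF f] by (simp add: R_deg_conv)
  qed
qed

lemma R_deg_0: "0 \<in> R_deg d"
  and R_deg_add: "f \<in> R_deg d \<Longrightarrow> g \<in> R_deg d \<Longrightarrow> f + g \<in> R_deg d"
  and R_deg_diff: "f \<in> R_deg d \<Longrightarrow> g \<in> R_deg d \<Longrightarrow> f - g \<in> R_deg d"
  and R_deg_uminus: "f \<in> R_deg d \<Longrightarrow> - f \<in> R_deg d"
  and R_deg_of_int: "f \<in> R_deg d \<Longrightarrow> of_int c * f \<in> R_deg d"
  and R_deg_sum: "(\<And>i. i \<in> A \<Longrightarrow> h i \<in> R_deg d) \<Longrightarrow> sum h A \<in> R_deg d"
  unfolding R_deg_eq_zspan
  by (auto intro: zspan_zero zspan_add zspan_diff zspan_uminus zspan_of_int_mult zspan_sum)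

lemma ev_in_R_deg: "ends L = alld d \<Longrightarrow> ev L \<in> R_deg d"
  unfolding R_deg_eq_zspan by (rule zspan_base) blast

lemma gev_in_R_deg: "gends m = alld d \<Longrightarrow> gev m \<in> R_deg d"
  using ev_in_R_deg[of _ d] gends_mset gev_mset by (metis ex_mset)

lemma R_deg_bip: "f \<in> R_deg d \<Longrightarrow> f \<in> zspan {gev m | m. bip m \<and> gends m = alld d}"
  unfolding R_deg_eq_zspan
proof (erule zspan_mono, clarify)
  fix L :: "(8 \<times> 8) list" assume "ends L = alld d"
  then show "ev L \<in> zspan {gev m | m. bip m \<and> gends m = alld d}"
    using ev_bip_span[of L] balanced_alld[of d] by simp
qed

lemma R_deg_mult: "f \<in> R_deg d \<Longrightarrow> g \<in> R_deg e \<Longrightarrow> f * g \<in> R_deg (d + e)"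
proof -
  assume f: "f \<in> R_deg d" and g: "g \<in> R_deg e"
  have "sl2_invariant (f * g)"
  proof -
    let ?det = "mconst (mvar A11 * mvar A22 - mvar A12 * mvar A21 - 1) :: (pvar, (gvar, int) mpoly) mpoly"
    have "?det dvd generic_translate f * generic_translate g - map_mconst f * map_mconst g"
      by (rule br_dvd_mult_cong) (use f g in \<open>auto simp: R_deg_conv sl2_invariant_def\<close>)
    then show ?thesis
      by (simp add: sl2_invariant_def is_hom_mult is_hom_generic_translate is_hom_map_mconst)
  qed
  then show ?thesis using f g mh_mult by (auto simp: R_deg_conv alld_add)
qed

lemma one_in_R_deg: "1 \<in> R_deg 0"
  using ev_in_R_deg[of "[]" 0] by simp

lemma R_deg_relabel:
  assumes "\<sigma> permutes UNIV" "f \<in> R_deg d" shows "relabel \<sigma> f \<in> R_deg d"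
proof -
  have a: "image_mset \<sigma> (alld d) = alld d"
  proof (rule multiset_eqI)
    fix i
    have "{j. \<sigma> j = i} = {inv_into UNIV \<sigma> i}" using permutes_inverses[OF assms(1)] by auto
    moreover have "set_mset (alld d) = (if d = 0 then {} else UNIV)"
      by (auto simp flip: count_greater_zero_iff)
    ultimately show "count (image_mset \<sigma> (alld d)) i = count (alld d) i"
      by (simp add: count_image_mset vimage_def)
  qed
  have "relabel \<sigma> f \<in> zspan {ev L | L. ends L = alld d}"
    using assms(2) unfolding R_deg_eq_zspan
  proof (rule zspan_image)
    fix g assume "g \<in> {ev L | L. ends L = alld d}"
    then obtain L where "g = ev L" "ends L = alld d" by blast
    then have "relabel \<sigma> g = ev (map (map_prod \<sigma> \<sigma>) L)" "ends (map (map_prod \<sigma> \<sigma>) L) = alld d"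
      by (simp_all add: relabel_ev ends_map a)
    then show "relabel \<sigma> g \<in> zspan {ev L | L. ends L = alld d}" by (auto intro: zspan_base)
  qed (simp add: is_hom_add is_hom_relabel)
  then show ?thesis unfolding R_deg_eq_zspan .
qed

section \<open>Perfect matchings\<close>

text \<open>Hall's marriage theorem, by the induction of Halmos and Vaughan.\<close>

lemma hall:
  fixes A :: "'a \<Rightarrow> 'b set"
  assumes "finite I" "\<And>i. i \<in> I \<Longrightarrow> finite (A i)" "\<And>J. J \<subseteq> I \<Longrightarrow> card J \<le> card (\<Union>(A ` J))"
  shows "\<exists>f. inj_on f I \<and> (\<forall>i\<in>I. f i \<in> A i)"
  using assms
proof (induction "card I" arbitrary: I A rule: less_induct)
  case less
  note fin = less.prems(1) and finA = less.prems(2) and hc = less.prems(3)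
  show ?case
  proof (cases "I = {}")
    case False
    then obtain i where i: "i \<in> I" by blast
    show ?thesis
    proof (cases "\<exists>J. J \<subset> I \<and> J \<noteq> {} \<and> card J = card (\<Union>(A ` J))")
      case True
      then obtain J where J: "J \<subset> I" "J \<noteq> {}" "card J = card (\<Union>(A ` J))" by blast
      have finJ: "finite J" using J(1) fin by (meson finite_subset psubset_imp_subset)
      obtain f where f: "inj_on f J" "\<forall>i\<in>J. f i \<in> A i"
        using less.hyps[of J A] J(1) fin finA hc psubset_card_mono[OF fin J(1)] finJ
        by (metis psubsetE subsetD subset_trans)
      let ?U = "\<Union>(A ` J)" and ?B = "\<lambda>i. A i - \<Union>(A ` J)"
      have finU: "finite ?U" using finJ finA J(1) by blast
      have "\<exists>g. inj_on g (I - J) \<and> (\<forall>i\<in>I - J. g i \<in> ?B i)"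
      proof (rule less.hyps)
        show "card (I - J) < card I" by (rule psubset_card_mono[OF fin]) (use J in blast)
        show "card K \<le> card (\<Union>(?B ` K))" if K: "K \<subseteq> I - J" for K
        proof -
          have finK: "finite K" using K fin by (meson finite_Diff finite_subset)
          have "card (K \<union> J) \<le> card (\<Union>(A ` (K \<union> J)))" by (rule hc) (use K J in auto)
          also have "\<Union>(A ` (K \<union> J)) = \<Union>(?B ` K) \<union> ?U" by auto
          also have "card \<dots> \<le> card (\<Union>(?B ` K)) + card ?U" by (rule card_Un_le)
          finally have "card K + card J \<le> card (\<Union>(?B ` K)) + card ?U"
            using K finK finJ by (subst (asm) card_Un_disjoint) auto
          then show ?thesis using J(3) by simp
        qed
      qed (use fin finA in auto)
      then obtain g where g: "inj_on g (I - J)" "\<forall>i\<in>I - J. g i \<in> ?B i" by blast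
      have "inj_on (\<lambda>i. if i \<in> J then f i else g i) I"
      proof (rule inj_onI)
        fix x y assume xy: "x \<in> I" "y \<in> I" "(if x \<in> J then f x else g x) = (if y \<in> J then f y else g y)"
        consider "x \<in> J" "y \<in> J" | "x \<notin> J" "y \<notin> J" | "x \<in> J" "y \<notin> J" | "x \<notin> J" "y \<in> J" by blast
        then show "x = y"
        proof cases
          case 1 then show ?thesis using xy f(1) by (auto dest: inj_onD)
        next
          case 2 then show ?thesis using xy g(1) by (auto dest: inj_onD)
        next
          case 3
          then have "f x \<in> ?U" "g y \<in> ?B y" using f g xy by auto
          moreover have "g y = f x" using 3 xy(3) by simp
          ultimately show ?thesis by (metis DiffD2)
        next
          case 4
          have "f y \<in> ?U" using f(2) 4(2) by blast
          moreover have "g x \<in> ?B x" using g(2) 4(1) xy(1) by blast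
          moreover have "g x = f y" using 4 xy(3) by simp
          ultimately show ?thesis by (metis DiffD2)
        qed
      qed
      then show ?thesis using f g by (intro exI[of _ "\<lambda>i. if i \<in> J then f i else g i"]) auto
    next
      case no_tight: False
      have "card {i} \<le> card (\<Union>(A ` {i}))" by (rule hc) (use i in auto)
      then obtain a where a: "a \<in> A i" by fastforce
      let ?B = "\<lambda>j. A j - {a}"
      have "\<exists>g. inj_on g (I - {i}) \<and> (\<forall>j\<in>I - {i}. g j \<in> ?B j)"
      proof (rule less.hyps)
        show "card (I - {i}) < card I" using card_Diff1_less[OF fin i] .
        show "card K \<le> card (\<Union>(?B ` K))" if K: "K \<subseteq> I - {i}" for K
        proof (cases "K = {}")
          case False
          have finU: "finite (\<Union>(A ` K))" 
          proof -
            have "K \<subseteq> I" using K by blast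
            moreover from this have "finite K" using fin by (rule finite_subset)
            ultimately show ?thesis using finA by auto
          qed
          have "card K \<noteq> card (\<Union>(A ` K))" using no_tight False K i by blast
          moreover have "card K \<le> card (\<Union>(A ` K))" by (rule hc) (use K in auto)
          ultimately have "card K < card (\<Union>(A ` K))" by simp
          moreover have "\<Union>(?B ` K) = \<Union>(A ` K) - {a}" by auto
          moreover have "card (\<Union>(A ` K)) \<le> Suc (card (\<Union>(A ` K) - {a}))"
            by (cases "a \<in> \<Union>(A ` K)") (simp_all add: card_Suc_Diff1[OF finU] del: Union_iff UN_iff)
          ultimately show ?thesis by simp
        qed simp
      qed (use fin finA in auto)
      then obtain g where g: "inj_on g (I - {i})" "\<forall>j\<in>I - {i}. g j \<in> ?B j" by blast
      have "inj_on (g(i := a)) (insert i (I - {i}))"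
        using g by (auto simp: inj_on_def)
      moreover have "insert i (I - {i}) = I" using i by auto
      ultimately show ?thesis using g a by (intro exI[of _ "g(i := a)"]) auto
    qed
  qed simp
qed

definition PM :: "graph set" where
  "PM = {\<mu>. bip \<mu> \<and> gends \<mu> = alld 1}"

lemma count_gends_P:
  assumes "bip m" "i \<in> Pset"
  shows "count (gends m) i = (\<Sum>j\<in>-Pset. count m (i, j))"
proof -
  have "snd -` {i} \<inter> set_mset m = {}" using assms by (auto simp: bip_def)
  moreover have "(\<Sum>e\<in>fst -` {i} \<inter> set_mset m. count m e) = (\<Sum>e\<in>Pair i ` (- Pset). count m e)"
    by (rule sum.mono_neutral_left) (use assms in \<open>auto simp: bip_def not_in_iff[symmetric]\<close>)
  moreover have "(\<Sum>e\<in>Pair i ` (- Pset). count m e) = (\<Sum>j\<in>-Pset. count m (i, j))"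
    by (subst sum.reindex) (auto simp: inj_on_def)
  ultimately show ?thesis by (simp add: gends_def count_image_mset)
qed

lemma count_gends_N:
  assumes "bip m" "j \<notin> Pset"
  shows "count (gends m) j = (\<Sum>i\<in>Pset. count m (i, j))"
proof -
  have "fst -` {j} \<inter> set_mset m = {}" using assms by (auto simp: bip_def)
  moreover have "(\<Sum>e\<in>snd -` {j} \<inter> set_mset m. count m e) = (\<Sum>e\<in>(\<lambda>i. (i, j)) ` Pset. count m e)"
    by (rule sum.mono_neutral_left) (use assms in \<open>auto simp: bip_def not_in_iff[symmetric] Pset_def\<close>)
  moreover have "(\<Sum>e\<in>(\<lambda>i. (i, j)) ` Pset. count m e) = (\<Sum>i\<in>Pset. count m (i, j))"
    by (subst sum.reindex) (auto simp: inj_on_def)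
  ultimately show ?thesis by (simp add: gends_def count_image_mset)
qed

lemma finite_Pset: "finite Pset" and finite_compl_Pset: "finite (- Pset)"
  by (simp_all add: Pset_def)

text \<open>Hall's condition for a regular bipartite graph: the edges at a set of rows end in at least as many columns, by counting.\<close>

lemma regular_contains_PM:
  assumes "bip m" "gends m = alld (Suc d)"
  shows "\<exists>\<mu>\<in>PM. \<mu> \<subseteq># m"
proof -
  let ?A = "\<lambda>i. {j. (i, j) \<in># m}"
  have row: "(\<Sum>j\<in>-Pset. count m (i, j)) = Suc d" if "i \<in> Pset" for i
    using count_gends_P[OF assms(1) that] assms(2) by simp
  have col: "(\<Sum>i\<in>Pset. count m (i, j)) = Suc d" if "j \<notin> Pset" for j
    using count_gends_N[OF assms(1) that] assms(2) by simp
  have A: "?A i \<subseteq> - Pset" for i using assms(1) by (auto simp: bip_def)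
  have "\<exists>f. inj_on f Pset \<and> (\<forall>i\<in>Pset. f i \<in> ?A i)"
  proof (rule hall)
    fix J assume J: "J \<subseteq> Pset"
    let ?U = "\<Union>(?A ` J)"
    have finJ: "finite J" using J finite_Pset finite_subset by blast
    have U: "?U \<subseteq> - Pset" using A by blast
    have "Suc d * card J = (\<Sum>i\<in>J. \<Sum>j\<in>-Pset. count m (i, j))"
      using row J by (simp add: subset_iff)
    also have "\<dots> = (\<Sum>i\<in>J. \<Sum>j\<in>?U. count m (i, j))"
      by (intro sum.cong refl sum.mono_neutral_right) (use U in \<open>auto simp: not_in_iff[symmetric]\<close>)
    also have "\<dots> = (\<Sum>j\<in>?U. \<Sum>i\<in>J. count m (i, j))" by (rule sum.swap)
    also have "\<dots> \<le> (\<Sum>j\<in>?U. \<Sum>i\<in>Pset. count m (i, j))"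
      by (intro sum_mono sum_mono2) (use J finite_Pset in auto)
    also have "\<dots> = Suc d * card ?U" using col U by (simp add: subset_iff)
    finally show "card J \<le> card ?U" by (simp only: Suc_mult_le_cancel1)
  qed (use finite_Pset in auto)
  then obtain f where f: "inj_on f Pset" "\<forall>i\<in>Pset. (i, f i) \<in># m" by auto
  let ?\<mu> = "mset_set ((\<lambda>i. (i, f i)) ` Pset)"
  have sub: "(\<lambda>i. (i, f i)) ` Pset \<subseteq> set_mset m" using f(2) by auto
  have le: "?\<mu> \<subseteq># m"
  proof (rule mset_subset_eqI)
    show "count ?\<mu> e \<le> count m e" for e
      using subsetD[OF sub, of e] finite_Pset by (auto simp: count_mset_set' Suc_le_eq)
  qed
  have fP: "f ` Pset \<subseteq> - Pset" using f(2) A by auto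
  have "f ` Pset = - Pset"
    by (rule card_subset_eq) (use fP f(1) finite_compl_Pset in \<open>auto simp: card_image card_Pset card_compl_Pset\<close>)
  moreover have "gends ?\<mu> = mset_set Pset + mset_set (f ` Pset)"
  proof -
    have "?\<mu> = image_mset (\<lambda>i. (i, f i)) (mset_set Pset)"
      by (rule image_mset_mset_set[symmetric]) (auto simp: inj_on_def)
    then show ?thesis
      by (simp add: gends_def multiset.map_comp comp_def image_mset_mset_set f(1))
  qed
  ultimately have "gends ?\<mu> = alld 1"
    by (intro multiset_eqI) (auto simp: count_mset_set' finite_Pset finite_compl_Pset)
  moreover have "bip ?\<mu>" using f(2) A finite_Pset by (auto simp: bip_def)
  ultimately show ?thesis using le by (auto simp: PM_def)
qed

text \<open>Koenig's theorem, by removing one matching at a time.\<close>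

lemma regular_factorization:
  "bip m \<Longrightarrow> gends m = alld d \<Longrightarrow> \<exists>F. set_mset F \<subseteq> PM \<and> size F = d \<and> \<Sum>\<^sub># F = m"
proof (induction d arbitrary: m)
  case 0
  then have "size (image_mset fst m) = 0" by (simp add: gends_def)
  then have "m = {#}" by simp
  then show ?case by (intro exI[of _ "{#}"]) simp
next
  case (Suc d)
  obtain \<mu> where \<mu>: "\<mu> \<in> PM" "\<mu> \<subseteq># m" using regular_contains_PM[OF Suc.prems] by blast
  then obtain n where n: "m = \<mu> + n" by (metis subset_mset.add_diff_inverse)
  have "alld (Suc 0) + gends n = alld (Suc 0) + alld d"
    using Suc.prems(2) \<mu>(1) by (simp add: n PM_def gends_add alld_1_add)
  then have "gends n = alld d" by simp
  then obtain F where "set_mset F \<subseteq> PM" "size F = d" "\<Sum>\<^sub># F = n"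
    using Suc.IH[of n] Suc.prems(1) by (auto simp: n bip_add)
  then show ?case using \<mu>(1) by (intro exI[of _ "add_mset \<mu> F"]) (simp add: n)
qed

lemma sum_PM:
  assumes "set_mset F \<subseteq> PM"
  shows "bip (\<Sum>\<^sub># F)" "gends (\<Sum>\<^sub># F) = alld (size F)"
  using assms by (induction F) (auto simp: bip_add gends_add PM_def alld_1_add)

lemma PM_explicit:
  assumes "\<mu> \<in> PM" "distinct [a, b, c, d]" "Pset = {a, b, c, d}"
  shows "\<exists>a' b' c' d'. distinct [a', b', c', d'] \<and> - Pset = {a', b', c', d'} \<and>
    \<mu> = {#(a, a'), (b, b'), (c, c'), (d, d')#}"
proof -
  have b: "bip \<mu>" and g: "gends \<mu> = alld 1" using assms(1) by (auto simp: PM_def)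
  have ex: "\<exists>j. (i, j) \<in># \<mu>" if "i \<in> Pset" for i
  proof (rule ccontr)
    assume "\<nexists>j. (i, j) \<in># \<mu>"
    then have "count (gends \<mu>) i = 0" unfolding count_gends_P[OF b that] by (simp add: not_in_iff)
    then show False using g by simp
  qed
  obtain a' b' c' d' where e: "(a, a') \<in># \<mu>" "(b, b') \<in># \<mu>" "(c, c') \<in># \<mu>" "(d, d') \<in># \<mu>"
    using ex assms(3) by (metis insertCI)
  have inj: "i = k" if ij: "(i, j) \<in># \<mu>" "(k, j) \<in># \<mu>" for i j k
  proof (rule ccontr)
    assume ik: "i \<noteq> k"
    have P: "i \<in> Pset" "k \<in> Pset" "j \<notin> Pset" using ij b by (auto simp: bip_def)
    have "(\<Sum>i\<in>{i, k}. count \<mu> (i, j)) \<le> (\<Sum>i\<in>Pset. count \<mu> (i, j))"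
      by (rule sum_mono2) (use P finite_Pset in auto)
    also have "\<dots> = 1" using count_gends_N[OF b P(3)] g by simp
    finally have "count \<mu> (i, j) + count \<mu> (k, j) \<le> 1" using ik by simp
    moreover have "count \<mu> (i, j) > 0" "count \<mu> (k, j) > 0" using ij by simp_all
    ultimately show False by linarith
  qed
  have d: "distinct [a', b', c', d']" using inj e assms(2) by auto
  have "{#(a, a'), (b, b'), (c, c'), (d, d')#} = mset_set {(a, a'), (b, b'), (c, c'), (d, d')}"
    using assms(2) by simp
  also have "\<dots> \<subseteq># \<mu>"
    using e by (auto simp: subseteq_mset_def count_mset_set' Suc_le_eq)
  finally have sub: "{#(a, a'), (b, b'), (c, c'), (d, d')#} \<subseteq># \<mu>" .
  have "size (gends \<mu>) = 2 * size \<mu>" by (simp add: gends_def)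
  moreover have "size (alld 1) = 8" using size_filter_count[of "\<lambda>_. True" "alld 1"] by simp
  ultimately have size4: "size \<mu> = 4" using g by simp
  have "\<mu> = {#(a, a'), (b, b'), (c, c'), (d, d')#}"
  proof (rule ccontr)
    assume "\<mu> \<noteq> {#(a, a'), (b, b'), (c, c'), (d, d')#}"
    then have "{#(a, a'), (b, b'), (c, c'), (d, d')#} \<subset># \<mu>" using sub by (simp add: subset_mset.less_le)
    then show False using mset_subset_size size4 by fastforce
  qed
  moreover have "{a', b', c', d'} = - Pset"
  proof (rule card_subset_eq)
    show "{a', b', c', d'} \<subseteq> - Pset" using e b by (auto simp: bip_def)
  qed (use d in \<open>auto simp: card_compl_Pset finite_compl_Pset\<close>)
  ultimately show ?thesis using d by metis
qed

section \<open>Homogeneous polynomials\<close>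

declare One_nat_def [simp del]

definition exp_deg :: "('v::finite \<Rightarrow>\<^sub>0 nat) \<Rightarrow> nat" where
  "exp_deg m = (\<Sum>v\<in>UNIV. Poly_Mapping.lookup m v)"

lemma homog_iff: "f \<in> homog d \<longleftrightarrow> (\<forall>m\<in>Poly_Mapping.keys f. exp_deg m = d)"
  for f :: "('v::finite, 'k::comm_ring_1) mpoly"
proof -
  have "(\<Sum>v\<in>Poly_Mapping.keys m. Poly_Mapping.lookup m v) = exp_deg m" for m :: "'v \<Rightarrow>\<^sub>0 nat"
    unfolding exp_deg_def by (rule sum.mono_neutral_left) (auto simp: in_keys_iff)
  then show ?thesis by (simp add: homog_def)
qed

lemma exp_deg_add: "exp_deg (m + n) = exp_deg m + exp_deg n"
  by (simp add: exp_deg_def lookup_add sum.distrib)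

lemma exp_deg_single: "exp_deg (Poly_Mapping.single v n) = n"
  by (simp add: exp_deg_def lookup_single when_def)

lemma exp_deg_zero_iff: "exp_deg m = 0 \<longleftrightarrow> m = 0"
  by (auto simp: exp_deg_def intro: poly_mapping_eqI)

lemma homog_0 [simp]: "0 \<in> homog d"
  by (simp add: homog_def)

context
  fixes f g :: "('v::finite, 'k::comm_ring_1) mpoly"
begin

lemma homog_add: "f \<in> homog d \<Longrightarrow> g \<in> homog d \<Longrightarrow> f + g \<in> homog d"
  unfolding homog_iff using keys_add[of f g] by blast

lemma homog_uminus: "f \<in> homog d \<Longrightarrow> - f \<in> homog d"
  by (simp add: homog_iff keys_uminus')

lemma homog_mult: "f \<in> homog d \<Longrightarrow> g \<in> homog e \<Longrightarrow> f * g \<in> homog (d + e)"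
  unfolding homog_iff using keys_mult[of f g] by (fastforce simp: exp_deg_add)

end

lemma homog_diff: "f \<in> homog d \<Longrightarrow> g \<in> homog d \<Longrightarrow> f - g \<in> homog d"
  for f g :: "('v::finite, 'k::comm_ring_1) mpoly"
  using homog_add[of f d "-g"] homog_uminus[of g d] by simp

lemma homog_sum: "(\<And>i. i \<in> A \<Longrightarrow> h i \<in> homog d) \<Longrightarrow> sum h A \<in> homog d"
  for h :: "'i \<Rightarrow> ('v::finite, 'k::comm_ring_1) mpoly"
  by (induction A rule: infinite_finite_induct) (auto intro: homog_add)

lemma homog_mvar: "(mvar v :: ('v::finite, 'k::comm_ring_1) mpoly) \<in> homog 1"
  by (auto simp: homog_iff mvar_def exp_deg_single split: if_splits)

lemma homog_mconst: "(mconst c :: ('v::finite, 'k::comm_ring_1) mpoly) \<in> homog 0"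
  by (auto simp: homog_iff mconst_def exp_deg_zero_iff)

lemma homog_of_int: "(of_int c :: ('v::finite, 'k::comm_ring_1) mpoly) \<in> homog 0"
  using homog_mconst[of "of_int c"] by simp

lemma homog_mult0: "f \<in> homog 0 \<Longrightarrow> g \<in> homog d \<Longrightarrow> f * g \<in> homog d"
  for f g :: "('v::finite, 'k::comm_ring_1) mpoly"
  using homog_mult[of f 0 g d] by simp

lemma homog_0_mconst: "f \<in> homog 0 \<Longrightarrow> f = mconst (Poly_Mapping.lookup f 0)"
  for f :: "('v::finite, 'k::comm_ring_1) mpoly"
  by (rule poly_mapping_eqI) (auto simp: homog_iff exp_deg_zero_iff mconst_def lookup_single when_def in_keys_iff)

lemma homog_single: "c = 0 \<or> exp_deg m = d \<Longrightarrow> Poly_Mapping.single m c \<in> homog d"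
  by (auto simp: homog_iff)

lemma homog_induct [consumes 1, case_names single add]:
  assumes "f \<in> homog d" "\<And>m c. exp_deg m = d \<Longrightarrow> P (Poly_Mapping.single m c)"
    "\<And>f g. P f \<Longrightarrow> P g \<Longrightarrow> P (f + g)" "P 0"
  shows "P (f :: ('v::finite, 'k::comm_ring_1) mpoly)"
proof -
  have "finite A \<Longrightarrow> A \<subseteq> Poly_Mapping.keys f \<Longrightarrow> P (\<Sum>m\<in>A. Poly_Mapping.single m (Poly_Mapping.lookup f m))" for A
    by (induction A rule: finite_induct) (use assms in \<open>auto simp: homog_iff\<close>)
  from this[OF finite_keys order_refl] show ?thesis
    by (simp flip: poly_mapping_sum_singles)
qed

lemma mpderiv_0 [simp]: "mpderiv v 0 = 0"
  by (simp add: mpderiv_def)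

lemma homog_mpderiv: "f \<in> homog (Suc d) \<Longrightarrow> mpderiv v f \<in> homog d"
  for f :: "('v::finite, 'k::comm_ring_1) mpoly"
proof (induction rule: homog_induct)
  case (single m c)
  show ?case
  proof (cases "Poly_Mapping.lookup m v = 0")
    case False
    have "m = (m - Poly_Mapping.single v 1) + Poly_Mapping.single v 1"
      using exp_minus_add[OF False, of "Poly_Mapping.single v 1"] by simp
    then have "exp_deg m = exp_deg (m - Poly_Mapping.single v 1) + 1"
      by (metis exp_deg_add exp_deg_single)
    then show ?thesis using single by (auto simp: mpderiv_single intro: homog_single)
  qed (simp add: mpderiv_single)
qed (auto simp: mpderiv_add intro: homog_add)

lemma euler: "f \<in> homog d \<Longrightarrow> (\<Sum>v\<in>UNIV. mvar v * mpderiv v f) = of_nat d * f"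
  for f :: "('v::finite, 'k::comm_ring_1) mpoly"
proof (induction rule: homog_induct)
  case (single m c)
  have "mvar v * mpderiv v (Poly_Mapping.single m c) = of_nat (Poly_Mapping.lookup m v) * Poly_Mapping.single m c" for v
  proof (cases "Poly_Mapping.lookup m v = 0")
    case False
    have "m = (m - Poly_Mapping.single v 1) + Poly_Mapping.single v 1"
      using exp_minus_add[OF False, of "Poly_Mapping.single v 1"] by simp
    then have "Poly_Mapping.single v 1 + (m - Poly_Mapping.single v 1) = m" by (simp add: add.commute)
    moreover have "(of_nat n :: ('v, 'k) mpoly) = Poly_Mapping.single 0 (of_nat n)" for n by simp
    ultimately show ?thesis by (simp add: mvar_def mpderiv_single mult_single del: single_of_nat)
  qed (simp add: mpderiv_single)
  then have "(\<Sum>v\<in>UNIV. mvar v * mpderiv v (Poly_Mapping.single m c)) =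
      (\<Sum>v\<in>UNIV. of_nat (Poly_Mapping.lookup m v)) * Poly_Mapping.single m c"
    by (simp add: sum_distrib_right)
  then show ?case using single by (simp add: exp_deg_def flip: of_nat_sum)
qed (auto simp: mpderiv_add distrib_left sum.distrib)

lemma of_nat_mult_eq_0:
  fixes f :: "('v, 'k::{idom, ring_char_0}) mpoly"
  assumes "of_nat (Suc n) * f = 0" shows "f = 0"
proof (rule poly_mapping_eqI)
  fix m
  have "mconst (of_nat (Suc n)) * f = 0"
    using assms is_hom_of_nat[OF is_hom_mconst, of "Suc n"] by metis
  then have "of_nat (Suc n) * Poly_Mapping.lookup f m = 0"
    using lookup_mconst_times[of "of_nat (Suc n)" f m] by simp
  then show "Poly_Mapping.lookup f m = Poly_Mapping.lookup 0 m"
    by (simp del: of_nat_Suc)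
qed

section \<open>The linear forms attached to a basis\<close>

text \<open>The value of an invariant at the configuration in which the points of \<open>S\<close> sit at \<open>(1, 0)\<close> and the others at \<open>(0, 1)\<close>.\<close>

definition coef :: "8 set \<Rightarrow> (pvar, int) mpoly \<Rightarrow> int" where
  "coef S = msubst of_int (\<lambda>v. case v of PX i \<Rightarrow> of_bool (i \<in> S) | PY i \<Rightarrow> of_bool (i \<notin> S))"

lemma is_hom_coef: "is_hom (coef S)"
  unfolding coef_def by (rule is_hom_msubst[OF is_hom_of_int_map])

lemma coef_br: "coef S (br i j) = (if i \<in> S then of_bool (j \<notin> S) else - of_bool (j \<in> S))"
proof -
  have "coef S (xv i) = of_bool (i \<in> S)" "coef S (yv i) = of_bool (i \<notin> S)" for i
    by (simp_all add: coef_def msubst_mvar[OF is_hom_of_int_map] del: of_int_eq_id)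
  then show ?thesis by (auto simp: br_def is_hom_simps is_hom_coef)
qed

lemma coef_relabel: "coef S (relabel \<sigma> w) = coef (\<sigma> -` S) w"
proof (rule hom_int_eqI[OF is_hom_comp[OF is_hom_relabel is_hom_coef] is_hom_coef])
  show "coef S (relabel \<sigma> (mvar v)) = coef (\<sigma> -` S) (mvar v)" for v
    by (cases v) (simp_all add: coef_def msubst_mvar[OF is_hom_of_int_map] del: of_int_eq_id)
qed

lemma relabel_relabel: "relabel \<sigma> (relabel \<tau> w) = relabel (\<sigma> \<circ> \<tau>) w"
proof (rule hom_int_eqI[OF is_hom_comp[OF is_hom_relabel is_hom_relabel] is_hom_relabel])
  show "relabel \<sigma> (relabel \<tau> (mvar v)) = relabel (\<sigma> \<circ> \<tau>) (mvar v)" for v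
    by (cases v) simp_all
qed

locale eight_points =
  fixes b :: "14 \<Rightarrow> (pvar, int) mpoly"
  assumes basis: "Z_basis b (R_deg 1)"
begin

lemma b_in [simp]: "b i \<in> R_deg 1"
  using basis by (simp add: Z_basis_def)

lemma coords_sum: "w \<in> R_deg 1 \<Longrightarrow> (\<Sum>i\<in>UNIV. of_int (coords b w i) * b i) = w"
proof -
  assume w: "w \<in> R_deg 1"
  then have "\<exists>!c::14 \<Rightarrow> int. w = (\<Sum>i\<in>UNIV. of_int (c i) * b i)"
    using basis unfolding Z_basis_def by blast
  from theI'[OF this] show ?thesis unfolding coords_def by (rule sym)
qed

lemma coords_unique:
  assumes "w = (\<Sum>i\<in>UNIV. of_int (c i) * b i)" shows "coords b w = c"
proof -
  have "w \<in> R_deg 1" unfolding assms by (intro R_deg_sum R_deg_of_int b_in)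
  then have "\<exists>!c::14 \<Rightarrow> int. w = (\<Sum>i\<in>UNIV. of_int (c i) * b i)"
    using basis unfolding Z_basis_def by blast
  then obtain c0 :: "14 \<Rightarrow> int" where c0: "\<And>d. w = (\<Sum>i\<in>UNIV. of_int (d i) * b i) \<Longrightarrow> d = c0"
    by (elim ex1E) blast
  show ?thesis
    using c0[OF coords_sum[OF \<open>w \<in> R_deg 1\<close>, symmetric]] c0[OF assms] by simp
qed

definition lin :: "(pvar, int) mpoly \<Rightarrow> (14, 'k::comm_ring_1) mpoly" where
  "lin w = (\<Sum>i\<in>UNIV. of_int (coords b w i) * mvar i)"

lemma lin_add: "w \<in> R_deg 1 \<Longrightarrow> w' \<in> R_deg 1 \<Longrightarrow> lin (w + w') = lin w + lin w'"
proof -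
  assume w: "w \<in> R_deg 1" "w' \<in> R_deg 1"
  have "coords b (w + w') = (\<lambda>i. coords b w i + coords b w' i)"
    by (rule coords_unique) (simp add: distrib_right sum.distrib coords_sum w)
  then show ?thesis by (simp add: lin_def distrib_right sum.distrib)
qed

lemma lin_of_int: "w \<in> R_deg 1 \<Longrightarrow> lin (of_int c * w) = of_int c * lin w"
proof -
  assume w: "w \<in> R_deg 1"
  have "coords b (of_int c * w) = (\<lambda>i. c * coords b w i)"
    by (rule coords_unique) (simp add: mult.assoc coords_sum w flip: sum_distrib_left)
  then show ?thesis by (simp add: lin_def mult.assoc flip: sum_distrib_left)
qed

lemma lin_uminus: "w \<in> R_deg 1 \<Longrightarrow> lin (- w) = - lin w"
  using lin_of_int[of w "-1"] by simp

lemma lin_diff: "w \<in> R_deg 1 \<Longrightarrow> w' \<in> R_deg 1 \<Longrightarrow> lin (w - w') = lin w - lin w'"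
  unfolding diff_conv_add_uminus by (simp only: lin_add lin_uminus R_deg_uminus)

lemma lin_zero [simp]: "lin 0 = 0"
  using lin_of_int[of 0 0] R_deg_0 by simp

lemma lin_b: "lin (b i) = mvar i"
proof -
  have "coords b (b i) = (\<lambda>j. if j = i then 1 else 0)"
    by (rule coords_unique) (simp add: if_distrib[of of_int] if_distrib[of "\<lambda>c. c * _"] cong: if_cong)
  then show ?thesis
    by (simp add: lin_def if_distrib[of of_int] if_distrib[of "\<lambda>c. c * _"] cong: if_cong)
qed

lemma homog_lin: "lin w \<in> homog 1"
  unfolding lin_def by (intro homog_sum homog_mult0 homog_of_int homog_mvar)

abbreviation \<phi> :: "(14, int) mpoly \<Rightarrow> (pvar, int) mpoly" where
  "\<phi> \<equiv> sym_to_R b"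

lemma is_hom_\<phi>: "is_hom \<phi>"
  by (simp add: sym_to_R_def is_hom_msubst is_hom_of_int_map)

lemma \<phi>_mvar: "\<phi> (mvar i) = b i"
  by (simp add: sym_to_R_def msubst_mvar is_hom_of_int_map)

lemma \<phi>_lin: "w \<in> R_deg 1 \<Longrightarrow> \<phi> (lin w) = w"
  by (simp add: lin_def is_hom_simps is_hom_\<phi> \<phi>_mvar coords_sum)

section \<open>Constant vector fields\<close>

text \<open>The derivative in the direction of the vector of \<open>V\<close>'s dual that evaluates at the configuration of \<open>S\<close>.\<close>

definition D :: "8 set \<Rightarrow> (14, 'k::comm_ring_1) mpoly \<Rightarrow> (14, 'k) mpoly" where
  "D S f = (\<Sum>i\<in>UNIV. of_int (coef S (b i)) * mpderiv i f)"

lemma D_add: "D S (f + g) = D S f + D S g"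
  by (simp add: D_def mpderiv_add distrib_left sum.distrib)

lemma D_mult: "D S (f * g) = D S f * g + f * D S g"
  by (simp add: D_def mpderiv_mult distrib_left sum.distrib sum_distrib_left sum_distrib_right ac_simps)

lemma D_mconst [simp]: "D S (mconst c) = 0"
  by (simp add: D_def)

lemma D_of_int [simp]: "D S (of_int c) = 0"
  using D_mconst[of S "of_int c"] by simp

lemma D_zero [simp]: "D S 0 = 0"
  using D_of_int[of S 0] by simp

lemma D_uminus: "D S (- f) = - D S f"
  using D_add[of S f "-f"] by (simp add: eq_neg_iff_add_eq_0 add.commute)

lemma D_diff: "D S (f - g) = D S f - D S g"
  using D_add[of S f "-g"] by (simp add: D_uminus)

lemma D_sum: "D S (sum h A) = (\<Sum>i\<in>A. D S (h i))"
  by (induction A rule: infinite_finite_induct) (auto simp: D_add)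

lemma D_of_int_mult: "D S (of_int c * f) = of_int c * D S f"
  by (simp add: D_mult)

lemma D_mvar: "D S (mvar i) = of_int (coef S (b i))"
  by (simp add: D_def mpderiv_mvar if_distrib[of "\<lambda>c. _ * c"] cong: if_cong)

lemma D_lin: "w \<in> R_deg 1 \<Longrightarrow> D S (lin w) = of_int (coef S w)"
proof -
  assume w: "w \<in> R_deg 1"
  have "D S (lin w) = (\<Sum>i\<in>UNIV. of_int (coords b w i * coef S (b i)))"
    by (simp add: lin_def D_sum D_of_int_mult D_mvar)
  also have "\<dots> = of_int (coef S (\<Sum>i\<in>UNIV. of_int (coords b w i) * b i))"
    by (simp add: is_hom_simps is_hom_coef)
  finally show ?thesis by (simp add: coords_sum w)
qed

lemma homog_D: "f \<in> homog (Suc d) \<Longrightarrow> D S f \<in> homog d"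
  unfolding D_def by (intro homog_sum homog_mult0 homog_of_int homog_mpderiv)

section \<open>The action of permutations\<close>

definition act :: "(8 \<Rightarrow> 8) \<Rightarrow> (14, 'k::comm_ring_1) mpoly \<Rightarrow> (14, 'k) mpoly" where
  "act \<sigma> = msubst mconst (\<lambda>i. lin (relabel \<sigma> (b i)))"

lemma perm_act_sym_eq: "perm_act_sym b \<sigma> = act \<sigma>"
  by (simp add: perm_act_sym_def act_def lin_def relabel_perm_act)

lemma is_hom_act: "is_hom (act \<sigma>)"
  by (simp add: act_def is_hom_msubst is_hom_mconst)

lemma act_mvar: "act \<sigma> (mvar i) = lin (relabel \<sigma> (b i))"
  by (simp add: act_def msubst_mvar is_hom_mconst)

lemma act_mconst: "act \<sigma> (mconst c) = mconst c"
  by (simp add: act_def msubst_mconst is_hom_mconst)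

context
  fixes \<sigma> :: "8 \<Rightarrow> 8" assumes \<sigma>: "\<sigma> permutes UNIV"
begin

lemma lin_sum: "(\<And>i. i \<in> A \<Longrightarrow> h i \<in> R_deg 1) \<Longrightarrow> lin (sum h A) = (\<Sum>i\<in>A. lin (h i))"
  by (induction A rule: infinite_finite_induct) (auto simp: lin_add R_deg_sum)

lemma act_lin: "w \<in> R_deg 1 \<Longrightarrow> act \<sigma> (lin w) = lin (relabel \<sigma> w)"
proof -
  assume w: "w \<in> R_deg 1"
  have "act \<sigma> (lin w) = (\<Sum>i\<in>UNIV. of_int (coords b w i) * lin (relabel \<sigma> (b i)))"
    by (simp add: lin_def[of w] is_hom_simps is_hom_act act_mvar)
  also have "\<dots> = lin (\<Sum>i\<in>UNIV. of_int (coords b w i) * relabel \<sigma> (b i))"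
    by (subst lin_sum) (auto simp: lin_of_int R_deg_relabel[OF \<sigma>] intro!: R_deg_of_int)
  also have "(\<Sum>i\<in>UNIV. of_int (coords b w i) * relabel \<sigma> (b i)) = relabel \<sigma> (\<Sum>i\<in>UNIV. of_int (coords b w i) * b i)"
    by (simp add: is_hom_simps is_hom_relabel)
  finally show ?thesis by (simp add: coords_sum w)
qed

lemma D_act: "D S (act \<sigma> f) = act \<sigma> (D (\<sigma> -` S) f)"
proof (induction f rule: mpoly_induct)
  case (const c) then show ?case by (simp add: act_mconst is_hom_zero is_hom_act)
next
  case (var i)
  then show ?case
    by (simp add: act_mvar D_lin R_deg_relabel[OF \<sigma>] coef_relabel D_mvar is_hom_of_int is_hom_act)
qed (simp_all add: is_hom_simps is_hom_act D_add D_mult)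

lemma homog_act: "f \<in> homog d \<Longrightarrow> act \<sigma> f \<in> homog d"
proof (induction rule: homog_induct)
  case (single m c)
  have "act \<sigma> (Poly_Mapping.single m c) = mconst c * mono_val (\<lambda>i. lin (relabel \<sigma> (b i))) m"
    by (simp add: act_def msubst_single is_hom_mconst)
  moreover have "mono_val (\<lambda>i. lin (relabel \<sigma> (b i))) m \<in> homog (exp_deg m)"
  proof (induction m rule: poly_mapping_single_induct)
    case (1 v n)
    have "lin (relabel \<sigma> (b v)) ^ n \<in> homog n"
    proof (induction n)
      case 0 show ?case using homog_mconst[of 1] by simp
    next
      case (Suc n) show ?case using homog_mult[OF homog_lin Suc] by (simp add: plus_1_eq_Suc)
    qed
    then show ?case by (simp add: mono_val_single exp_deg_single)
  qed (simp add: mono_val_add exp_deg_add homog_mult)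
  ultimately show ?case using single homog_mult0[OF homog_mconst] by metis
qed (auto simp: is_hom_simps is_hom_act intro: homog_add)

end

lemma act_act:
  assumes "\<sigma> permutes UNIV" "\<tau> permutes UNIV"
  shows "act \<sigma> (act \<tau> f) = act (\<sigma> \<circ> \<tau>) f"
proof (rule hom_eqI[OF is_hom_comp[OF is_hom_act is_hom_act] is_hom_act])
  show "act \<sigma> (act \<tau> (mvar i)) = act (\<sigma> \<circ> \<tau>) (mvar i)" for i
    by (simp add: act_mvar act_lin[OF assms(1)] R_deg_relabel[OF assms(2)] relabel_relabel)
qed (simp add: act_mconst)

end

section \<open>Dual bases\<close>

definition X4 :: "8 \<Rightarrow> 8 \<Rightarrow> 8 \<Rightarrow> 8 \<Rightarrow> (pvar, int) mpoly" where
  "X4 p q r s = br 0 p * br 1 q * br 2 r * br 3 s"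

text \<open>The ballot sets for the order \<open>0, 4, 1, 5, 2, 6, 3, 7\<close> of the points, and the basis of \<open>V\<close> dual
  to the corresponding coefficient functionals.\<close>

definition ball_sets :: "8 set list" where
  "ball_sets = [{0, 1, 2, 3}, {0, 1, 2, 4}, {0, 1, 2, 5}, {0, 1, 2, 6}, {0, 1, 3, 4}, {0, 1, 3, 5},
     {0, 1, 4, 5}, {0, 1, 4, 6}, {0, 1, 5, 6}, {0, 2, 3, 4}, {0, 2, 4, 5}, {0, 2, 4, 6},
     {0, 3, 4, 5}, {0, 4, 5, 6}]"

definition dual_basis :: "(pvar, int) mpoly list" where
  "dual_basis = [X4 4 5 6 7,
     X4 5 4 7 6 + X4 4 5 6 7 - X4 4 5 7 6 - X4 5 4 6 7 + X4 4 5 6 7 - X4 5 6 7 4,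
     X4 4 5 6 7 - X4 4 6 7 5,
     X4 4 5 6 7 - X4 4 5 7 6,
     X4 4 5 6 7 - X4 5 6 4 7,
     X4 4 5 6 7 - X4 4 6 5 7,
     X4 6 7 4 5 + X4 4 5 6 7 - X4 4 6 7 5 - X4 5 6 4 7,
     X4 5 7 4 6 + X4 4 5 6 7 - X4 4 5 7 6 - X4 5 6 4 7,
     X4 4 7 6 5 - X4 4 6 7 5,
     X4 4 5 6 7 - X4 5 4 6 7,
     X4 6 4 7 5 + X4 4 5 6 7 - X4 4 6 7 5 - X4 5 4 6 7,
     X4 5 4 7 6 + X4 4 5 6 7 - X4 4 5 7 6 - X4 5 4 6 7,
     X4 6 5 4 7 - X4 5 6 4 7,
     X4 6 7 4 5 - X4 7 6 4 5]"

definition dual_expansion :: "(pvar, int) mpoly \<Rightarrow> (pvar, int) mpoly" where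
  "dual_expansion w = (\<Sum>(S, y)\<leftarrow>zip ball_sets dual_basis. of_int (coef S w) * y)"

lemma coef_X4: "coef S (X4 p q r s) = coef S (br 0 p) * coef S (br 1 q) * coef S (br 2 r) * coef S (br 3 s)"
  by (simp add: X4_def is_hom_mult is_hom_coef)

lemma det3_br: "br i p * br j q * br k r - br i p * br j r * br k q - br i q * br j p * br k r
    + br i q * br j r * br k p + br i r * br j p * br k q - br i r * br j q * br k p = 0"
  unfolding br_def by (simp add: algebra_simps)

text \<open>The three-by-three minors of the matrix of brackets give the linear relations between the products
  \<open>X4\<close>.\<close>

lemma X4_linear:
  "X4 a p q r - X4 a p r q - X4 a q p r + X4 a q r p + X4 a r p q - X4 a r q p = 0"
  "X4 p a q r - X4 p a r q - X4 q a p r + X4 q a r p + X4 r a p q - X4 r a q p = 0"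
  "X4 p q a r - X4 p r a q - X4 q p a r + X4 q r a p + X4 r p a q - X4 r q a p = 0"
  "X4 p q r a - X4 p r q a - X4 q p r a + X4 q r p a + X4 r p q a - X4 r q p a = 0"
  using arg_cong[OF det3_br[of 1 p 2 q 3 r], of "\<lambda>x. br 0 a * x"] arg_cong[OF det3_br[of 0 p 2 q 3 r], of "\<lambda>x. br 1 a * x"]
    arg_cong[OF det3_br[of 0 p 1 q 3 r], of "\<lambda>x. br 2 a * x"] arg_cong[OF det3_br[of 0 p 1 q 2 r], of "\<lambda>x. br 3 a * x"]
  by (simp_all add: X4_def right_diff_distrib distrib_left ac_simps)

lemma X4_reduce:
  "X4 4 7 5 6 = X4 4 5 7 6 + X4 4 6 5 7 + X4 4 7 6 5 - X4 4 5 6 7 - X4 4 6 7 5"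
  "X4 5 7 6 4 = X4 5 4 6 7 + X4 5 6 7 4 + X4 5 7 4 6 - X4 5 4 7 6 - X4 5 6 4 7"
  "X4 7 6 5 4 = X4 4 6 5 7 + X4 5 6 7 4 + X4 7 6 4 5 - X4 4 6 7 5 - X4 5 6 4 7"
  "X4 6 7 5 4 = X4 4 7 5 6 + X4 5 7 6 4 + X4 6 7 4 5 - X4 4 7 6 5 - X4 5 7 4 6"
  "X4 7 5 4 6 = X4 5 7 4 6 + X4 6 5 4 7 + X4 7 6 4 5 - X4 5 6 4 7 - X4 6 7 4 5"
  "X4 6 5 7 4 = X4 4 5 7 6 + X4 5 6 7 4 + X4 6 4 7 5 - X4 4 6 7 5 - X4 5 4 7 6"
  "X4 7 5 6 4 = X4 5 7 6 4 + X4 6 5 7 4 + X4 7 6 5 4 - X4 5 6 7 4 - X4 6 7 5 4"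
  "X4 7 4 6 5 = X4 4 7 6 5 + X4 6 4 7 5 + X4 7 6 4 5 - X4 4 6 7 5 - X4 6 7 4 5"
  "X4 7 4 5 6 = X4 4 7 5 6 + X4 5 4 7 6 + X4 7 5 4 6 - X4 4 5 7 6 - X4 5 7 4 6"
  "X4 6 4 5 7 = X4 4 6 5 7 + X4 5 4 6 7 + X4 6 5 4 7 - X4 4 5 6 7 - X4 5 6 4 7"
proof -
  show "X4 4 7 5 6 = X4 4 5 7 6 + X4 4 6 5 7 + X4 4 7 6 5 - X4 4 5 6 7 - X4 4 6 7 5"
    using X4_linear(1)[where a = 4 and p = 5 and q = 6 and r = 7] by (simp add: algebra_simps)
  show "X4 5 7 6 4 = X4 5 4 6 7 + X4 5 6 7 4 + X4 5 7 4 6 - X4 5 4 7 6 - X4 5 6 4 7"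
    using X4_linear(1)[where a = 5 and p = 4 and q = 6 and r = 7] by (simp add: algebra_simps)
  show "X4 7 6 5 4 = X4 4 6 5 7 + X4 5 6 7 4 + X4 7 6 4 5 - X4 4 6 7 5 - X4 5 6 4 7"
    using X4_linear(2)[where a = 6 and p = 4 and q = 5 and r = 7] by (simp add: algebra_simps)
  show "X4 6 7 5 4 = X4 4 7 5 6 + X4 5 7 6 4 + X4 6 7 4 5 - X4 4 7 6 5 - X4 5 7 4 6"
    using X4_linear(2)[where a = 7 and p = 4 and q = 5 and r = 6] by (simp add: algebra_simps)
  show "X4 7 5 4 6 = X4 5 7 4 6 + X4 6 5 4 7 + X4 7 6 4 5 - X4 5 6 4 7 - X4 6 7 4 5"
    using X4_linear(3)[where a = 4 and p = 5 and q = 6 and r = 7] by (simp add: algebra_simps)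
  show "X4 6 5 7 4 = X4 4 5 7 6 + X4 5 6 7 4 + X4 6 4 7 5 - X4 4 6 7 5 - X4 5 4 7 6"
    using X4_linear(3)[where a = 7 and p = 4 and q = 5 and r = 6] by (simp add: algebra_simps)
  show "X4 7 5 6 4 = X4 5 7 6 4 + X4 6 5 7 4 + X4 7 6 5 4 - X4 5 6 7 4 - X4 6 7 5 4"
    using X4_linear(4)[where a = 4 and p = 5 and q = 6 and r = 7] by (simp add: algebra_simps)
  show "X4 7 4 6 5 = X4 4 7 6 5 + X4 6 4 7 5 + X4 7 6 4 5 - X4 4 6 7 5 - X4 6 7 4 5"
    using X4_linear(4)[where a = 5 and p = 4 and q = 6 and r = 7] by (simp add: algebra_simps)
  show "X4 7 4 5 6 = X4 4 7 5 6 + X4 5 4 7 6 + X4 7 5 4 6 - X4 4 5 7 6 - X4 5 7 4 6"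
    using X4_linear(4)[where a = 6 and p = 4 and q = 5 and r = 7] by (simp add: algebra_simps)
  show "X4 6 4 5 7 = X4 4 6 5 7 + X4 5 4 6 7 + X4 6 5 4 7 - X4 4 5 6 7 - X4 5 6 4 7"
    using X4_linear(4)[where a = 7 and p = 4 and q = 5 and r = 6] by (simp add: algebra_simps)
qed

lemma dual_expansion_X4:
  "dual_expansion (X4 4 5 6 7) = X4 4 5 6 7"
  "dual_expansion (X4 4 5 7 6) = X4 4 5 7 6"
  "dual_expansion (X4 4 6 5 7) = X4 4 6 5 7"
  "dual_expansion (X4 4 6 7 5) = X4 4 6 7 5"
  "dual_expansion (X4 4 7 5 6) = X4 4 7 5 6"
  "dual_expansion (X4 4 7 6 5) = X4 4 7 6 5"
  "dual_expansion (X4 5 4 6 7) = X4 5 4 6 7"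
  "dual_expansion (X4 5 4 7 6) = X4 5 4 7 6"
  "dual_expansion (X4 5 6 4 7) = X4 5 6 4 7"
  "dual_expansion (X4 5 6 7 4) = X4 5 6 7 4"
  "dual_expansion (X4 5 7 4 6) = X4 5 7 4 6"
  "dual_expansion (X4 5 7 6 4) = X4 5 7 6 4"
  "dual_expansion (X4 6 4 5 7) = X4 6 4 5 7"
  "dual_expansion (X4 6 4 7 5) = X4 6 4 7 5"
  "dual_expansion (X4 6 5 4 7) = X4 6 5 4 7"
  "dual_expansion (X4 6 5 7 4) = X4 6 5 7 4"
  "dual_expansion (X4 6 7 4 5) = X4 6 7 4 5"
  "dual_expansion (X4 6 7 5 4) = X4 6 7 5 4"
  "dual_expansion (X4 7 4 5 6) = X4 7 4 5 6"
  "dual_expansion (X4 7 4 6 5) = X4 7 4 6 5"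
  "dual_expansion (X4 7 5 4 6) = X4 7 5 4 6"
  "dual_expansion (X4 7 5 6 4) = X4 7 5 6 4"
  "dual_expansion (X4 7 6 4 5) = X4 7 6 4 5"
  "dual_expansion (X4 7 6 5 4) = X4 7 6 5 4"
  unfolding dual_expansion_def ball_sets_def dual_basis_def
  by (simp_all add: coef_X4 coef_br) (simp_all add: X4_reduce algebra_simps)

context eight_points
begin

section \<open>Expansion in the dual basis\<close>

lemma dual_expansion_gev:
  assumes "\<mu> \<in> PM" shows "dual_expansion (gev \<mu>) = gev \<mu>"
proof -
  have "distinct [0, 1, 2, 3::8]" "Pset = {0, 1, 2, 3}" by (simp_all add: Pset_def)
  from PM_explicit[OF assms this] obtain p q r s where
    d: "distinct [p, q, r, s]" and c: "- Pset = {p, q, r, s}" and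
    \<mu>: "\<mu> = {#(0, p), (1, q), (2, r), (3, s)#}" by blast
  have g: "gev \<mu> = X4 p q r s" by (simp add: \<mu> X4_def mult.assoc)
  have "p \<in> {4, 5, 6, 7}" "q \<in> {4, 5, 6, 7}" "r \<in> {4, 5, 6, 7}" "s \<in> {4, 5, 6, 7}"
    using c compl_Pset by auto
  then show ?thesis unfolding g using d
    by (elim insertE emptyE) (simp_all add: dual_expansion_X4)
qed

lemma dual_expansion_add: "dual_expansion (v + w) = dual_expansion v + dual_expansion w"
proof -
  have "(\<Sum>(S, y)\<leftarrow>Z. of_int (coef S (v + w)) * y) =
      (\<Sum>(S, y)\<leftarrow>Z. of_int (coef S v) * y) + (\<Sum>(S, y)\<leftarrow>Z. of_int (coef S w) * y)"
    for Z :: "(8 set \<times> (pvar, int) mpoly) list"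
    by (induction Z) (auto simp: is_hom_add is_hom_coef algebra_simps)
  then show ?thesis by (simp add: dual_expansion_def)
qed

lemma dual_expansion: "w \<in> R_deg 1 \<Longrightarrow> dual_expansion w = w"
proof -
  assume "w \<in> R_deg 1"
  then have "w \<in> zspan {gev m |m. bip m \<and> gends m = alld 1}" by (rule R_deg_bip)
  then show ?thesis
  proof induction
    case zspan_zero
    then show ?case using dual_expansion_add[of 0 0] by simp
  next
    case (zspan_plus x g)
    then show ?case using dual_expansion_gev by (auto simp: dual_expansion_add PM_def)
  next
    case (zspan_minus x g)
    have "dual_expansion (x - g) = dual_expansion x - dual_expansion g"
      using dual_expansion_add[of "x - g" g] by simp
    then show ?case using zspan_minus dual_expansion_gev by (auto simp: PM_def)
  qed
qed

definition is_match :: "(8 \<times> 8) list \<Rightarrow> bool" where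
  "is_match L \<longleftrightarrow> distinct (map fst L @ map snd L) \<and> length L = 4"

lemma is_match_ends: "is_match L \<Longrightarrow> ends L = alld 1"
proof -
  assume L: "is_match L"
  let ?xs = "map fst L @ map snd L"
  have "card (set ?xs) = 8" using L distinct_card[of ?xs] by (simp add: is_match_def)
  then have "set ?xs = UNIV" by (intro card_subset_eq) auto
  moreover have "mset_set (set ?xs) = mset ?xs" by (rule mset_set_set) (use L in \<open>simp add: is_match_def\<close>)
  moreover have "ends L = mset ?xs" by (simp add: ends_def)
  moreover have "alld 1 = mset_set UNIV" by (rule multiset_eqI) simp
  ultimately show ?thesis by simp
qed

lemma X4_in_R_deg: "is_match [(0, p), (1, q), (2, r), (3, s)] \<Longrightarrow> X4 p q r s \<in> R_deg 1"
  using ev_in_R_deg[OF is_match_ends, of "[(0, p), (1, q), (2, r), (3, s)]"]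
  by (simp add: X4_def mult.assoc)

lemma dual_basis_in_R_deg: "\<forall>y\<in>set dual_basis. y \<in> R_deg 1"
  unfolding dual_basis_def
  by (simp only: list.set ball_simps simp_thms)
    (intro conjI R_deg_add R_deg_diff X4_in_R_deg; simp add: is_match_def)

lemma dual_basis_nth: "a < 14 \<Longrightarrow> dual_basis ! a \<in> R_deg 1"
  using dual_basis_in_R_deg nth_mem[of a dual_basis] by (auto simp: dual_basis_def)

definition u :: "nat \<Rightarrow> (14, 'k::comm_ring_1) mpoly" where
  "u a = lin (dual_basis ! a)"

lemma homog_u: "u a \<in> homog 1"
  unfolding u_def by (rule homog_lin)

lemma sum_list_zip_nth: "length xs = length ys \<Longrightarrow>
    (\<Sum>(x, y)\<leftarrow>zip xs ys. f x y) = (\<Sum>a<length xs. f (xs ! a) (ys ! a))"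
  by (simp add: sum_list_sum_nth atLeast0LessThan)

lemma length_ball_sets: "length ball_sets = 14" and length_dual_basis: "length dual_basis = 14"
  by (simp_all add: ball_sets_def dual_basis_def)

lemma dual_expansion_sum: "w \<in> R_deg 1 \<Longrightarrow> w = (\<Sum>a<14. of_int (coef (ball_sets ! a) w) * dual_basis ! a)"
  using dual_expansion[of w] unfolding dual_expansion_def
  by (subst (asm) sum_list_zip_nth) (simp_all add: length_ball_sets length_dual_basis)

lemma lin_expansion: "w \<in> R_deg 1 \<Longrightarrow> lin w = (\<Sum>a<14. of_int (coef (ball_sets ! a) w) * u a)"
proof -
  assume w: "w \<in> R_deg 1"
  have "lin w = lin (\<Sum>a<14. of_int (coef (ball_sets ! a) w) * dual_basis ! a)"
    using dual_expansion_sum[OF w] by simp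
  also have "\<dots> = (\<Sum>a<14. lin (of_int (coef (ball_sets ! a) w) * dual_basis ! a))"
    by (rule lin_sum[OF permutes_id]) (auto intro!: R_deg_of_int dual_basis_nth)
  also have "\<dots> = (\<Sum>a<14. of_int (coef (ball_sets ! a) w) * u a)"
    by (rule sum.cong) (auto simp: lin_of_int dual_basis_nth u_def)
  finally show ?thesis .
qed

definition Yl :: "(8 \<times> 8) list \<Rightarrow> (14, 'k::comm_ring_1) mpoly" where
  "Yl L = lin (ev L)"

lemma Yl_expansion:
  assumes "is_match L"
  shows "Yl L = (\<Sum>a<14. of_int (coef (ball_sets ! a) (ev L)) * u a)"
  unfolding Yl_def by (rule lin_expansion[OF ev_in_R_deg[OF is_match_ends[OF assms]]])

lemma lessThan14: "{..<14} = {0, 1, 2, 3, 4, 5, 6, 7, 8, 9, 10, 11, 12, 13::nat}"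
  by auto presburger

lemma all_less14: "(\<And>a. a \<in> {0, 1, 2, 3, 4, 5, 6, 7, 8, 9, 10, 11, 12, 13::nat} \<Longrightarrow> Q a) \<Longrightarrow> a < 14 \<Longrightarrow> Q a"
  using lessThan14 by (metis lessThan_iff)

lemma sum14: "(\<Sum>a<14. f a) = f 0 + f 1 + f 2 + f 3 + f 4 + f 5 + f 6 + f 7 + f 8 + f 9 + f 10 + f 11 + f 12 + f 13" for f :: "nat \<Rightarrow> 'a::comm_monoid_add"
  unfolding lessThan14 by (simp add: add.assoc)

lemma ball_sets_nth:
  "ball_sets ! 0 = {0, 1, 2, 3}" "ball_sets ! 1 = {0, 1, 2, 4}" "ball_sets ! 2 = {0, 1, 2, 5}"
  "ball_sets ! 3 = {0, 1, 2, 6}" "ball_sets ! 4 = {0, 1, 3, 4}" "ball_sets ! 5 = {0, 1, 3, 5}"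
  "ball_sets ! 6 = {0, 1, 4, 5}" "ball_sets ! 7 = {0, 1, 4, 6}" "ball_sets ! 8 = {0, 1, 5, 6}"
  "ball_sets ! 9 = {0, 2, 3, 4}" "ball_sets ! 10 = {0, 2, 4, 5}" "ball_sets ! 11 = {0, 2, 4, 6}"
  "ball_sets ! 12 = {0, 3, 4, 5}" "ball_sets ! 13 = {0, 4, 5, 6}"
  by (simp_all add: ball_sets_def)

lemma in_ball_sets:
  "0 \<in> ball_sets ! 0" "1 \<in> ball_sets ! 0" "2 \<in> ball_sets ! 0" "3 \<in> ball_sets ! 0" "4 \<notin> ball_sets ! 0" "5 \<notin> ball_sets ! 0" "6 \<notin> ball_sets ! 0" "7 \<notin> ball_sets ! 0"
  "0 \<in> ball_sets ! 1" "1 \<in> ball_sets ! 1" "2 \<in> ball_sets ! 1" "3 \<notin> ball_sets ! 1" "4 \<in> ball_sets ! 1" "5 \<notin> ball_sets ! 1" "6 \<notin> ball_sets ! 1" "7 \<notin> ball_sets ! 1"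
  "0 \<in> ball_sets ! 2" "1 \<in> ball_sets ! 2" "2 \<in> ball_sets ! 2" "3 \<notin> ball_sets ! 2" "4 \<notin> ball_sets ! 2" "5 \<in> ball_sets ! 2" "6 \<notin> ball_sets ! 2" "7 \<notin> ball_sets ! 2"
  "0 \<in> ball_sets ! 3" "1 \<in> ball_sets ! 3" "2 \<in> ball_sets ! 3" "3 \<notin> ball_sets ! 3" "4 \<notin> ball_sets ! 3" "5 \<notin> ball_sets ! 3" "6 \<in> ball_sets ! 3" "7 \<notin> ball_sets ! 3"
  "0 \<in> ball_sets ! 4" "1 \<in> ball_sets ! 4" "2 \<notin> ball_sets ! 4" "3 \<in> ball_sets ! 4" "4 \<in> ball_sets ! 4" "5 \<notin> ball_sets ! 4" "6 \<notin> ball_sets ! 4" "7 \<notin> ball_sets ! 4"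
  "0 \<in> ball_sets ! 5" "1 \<in> ball_sets ! 5" "2 \<notin> ball_sets ! 5" "3 \<in> ball_sets ! 5" "4 \<notin> ball_sets ! 5" "5 \<in> ball_sets ! 5" "6 \<notin> ball_sets ! 5" "7 \<notin> ball_sets ! 5"
  "0 \<in> ball_sets ! 6" "1 \<in> ball_sets ! 6" "2 \<notin> ball_sets ! 6" "3 \<notin> ball_sets ! 6" "4 \<in> ball_sets ! 6" "5 \<in> ball_sets ! 6" "6 \<notin> ball_sets ! 6" "7 \<notin> ball_sets ! 6"
  "0 \<in> ball_sets ! 7" "1 \<in> ball_sets ! 7" "2 \<notin> ball_sets ! 7" "3 \<notin> ball_sets ! 7" "4 \<in> ball_sets ! 7" "5 \<notin> ball_sets ! 7" "6 \<in> ball_sets ! 7" "7 \<notin> ball_sets ! 7"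
  "0 \<in> ball_sets ! 8" "1 \<in> ball_sets ! 8" "2 \<notin> ball_sets ! 8" "3 \<notin> ball_sets ! 8" "4 \<notin> ball_sets ! 8" "5 \<in> ball_sets ! 8" "6 \<in> ball_sets ! 8" "7 \<notin> ball_sets ! 8"
  "0 \<in> ball_sets ! 9" "1 \<notin> ball_sets ! 9" "2 \<in> ball_sets ! 9" "3 \<in> ball_sets ! 9" "4 \<in> ball_sets ! 9" "5 \<notin> ball_sets ! 9" "6 \<notin> ball_sets ! 9" "7 \<notin> ball_sets ! 9"
  "0 \<in> ball_sets ! 10" "1 \<notin> ball_sets ! 10" "2 \<in> ball_sets ! 10" "3 \<notin> ball_sets ! 10" "4 \<in> ball_sets ! 10" "5 \<in> ball_sets ! 10" "6 \<notin> ball_sets ! 10" "7 \<notin> ball_sets ! 10"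
  "0 \<in> ball_sets ! 11" "1 \<notin> ball_sets ! 11" "2 \<in> ball_sets ! 11" "3 \<notin> ball_sets ! 11" "4 \<in> ball_sets ! 11" "5 \<notin> ball_sets ! 11" "6 \<in> ball_sets ! 11" "7 \<notin> ball_sets ! 11"
  "0 \<in> ball_sets ! 12" "1 \<notin> ball_sets ! 12" "2 \<notin> ball_sets ! 12" "3 \<in> ball_sets ! 12" "4 \<in> ball_sets ! 12" "5 \<in> ball_sets ! 12" "6 \<notin> ball_sets ! 12" "7 \<notin> ball_sets ! 12"
  "0 \<in> ball_sets ! 13" "1 \<notin> ball_sets ! 13" "2 \<notin> ball_sets ! 13" "3 \<notin> ball_sets ! 13" "4 \<in> ball_sets ! 13" "5 \<in> ball_sets ! 13" "6 \<in> ball_sets ! 13" "7 \<notin> ball_sets ! 13"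
  by (simp_all add: ball_sets_def)

lemma coef_dual_basis: "\<forall>a\<in>{..<14}. \<forall>c\<in>{..<14}. coef (ball_sets ! a) (dual_basis ! c) = (if a = c then 1 else 0)"
proof -
  have "\<forall>c\<in>{..<14}. coef S (dual_basis ! c) = (map (coef S) dual_basis) ! c" for S
    by (simp add: length_dual_basis)
  moreover have "map (coef (ball_sets ! a)) dual_basis = map (\<lambda>c. if a = c then 1 else 0) [0..<14]" if "a < 14" for a
    using that
  proof (rule all_less14[rotated])
    fix a :: nat assume a: "a \<in> {0, 1, 2, 3, 4, 5, 6, 7, 8, 9, 10, 11, 12, 13}"
    have u: "[0..<14] = [0, 1, 2, 3, 4, 5, 6, 7, 8, 9, 10, 11, 12, 13::nat]" by (simp add: upt_rec)
    show "map (coef (ball_sets ! a)) dual_basis = map (\<lambda>c. if a = c then 1 else 0) [0..<14]"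
      unfolding u using a
      by (elim insertE emptyE; simp only:)
        (simp_all add: in_ball_sets dual_basis_def is_hom_simps is_hom_coef coef_X4 coef_br)
  qed
  ultimately show ?thesis by simp
qed

lemma D_u: "D S (u a) = of_int (coef S (dual_basis ! a))" if "a < 14"
  unfolding u_def by (rule D_lin[OF dual_basis_nth[OF that]])

lemma D_ball_u: "a < 14 \<Longrightarrow> c < 14 \<Longrightarrow> D (ball_sets ! a) (u c) = (if a = c then 1 else 0)"
  using coef_dual_basis by (simp add: D_u)

lemma mpderiv_sum: "mpderiv i (sum h A) = (\<Sum>j\<in>A. mpderiv i (h j))"
  by (induction A rule: infinite_finite_induct) (auto simp: mpderiv_add)

lemma mpderiv_of_int [simp]: "mpderiv i (of_int c) = 0"
  using mpderiv_mconst[of i "of_int c"] by simp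

lemma mpderiv_of_int_mult: "mpderiv i (of_int c * f) = of_int c * mpderiv i f"
  by (simp add: mpderiv_mult)

lemma mpderiv_lin: "mpderiv i (lin w) = of_int (coords b w i)"
  by (simp add: lin_def mpderiv_sum mpderiv_of_int_mult mpderiv_mvar if_distrib[of "\<lambda>c. _ * c"] cong: if_cong)

lemma mpderiv_expansion:
  fixes f :: "(14, 'k::comm_ring_1) mpoly"
  shows "mpderiv i f = (\<Sum>a<14. of_int (coords b (dual_basis ! a) i) * D (ball_sets ! a) f)"
proof (induction f rule: mpoly_induct)
  case (var j)
  have "(mvar j :: (14, 'k) mpoly) = (\<Sum>a<14. of_int (coef (ball_sets ! a) (b j)) * u a)"
    unfolding lin_b[symmetric] by (rule lin_expansion[OF b_in])
  then have "mpderiv i (mvar j :: (14, 'k) mpoly) =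
      (\<Sum>a<14. of_int (coef (ball_sets ! a) (b j)) * of_int (coords b (dual_basis ! a) i))"
    by (simp add: mpderiv_sum mpderiv_of_int_mult u_def mpderiv_lin)
  then show ?case by (simp add: D_mvar mult.commute)
next
  case (add f g)
  then show ?case by (simp add: D_add mpderiv_add distrib_left sum.distrib)
next
  case (mult f g)
  then show ?case
    by (simp add: D_mult mpderiv_mult distrib_left sum.distrib sum_distrib_left sum_distrib_right ac_simps)
qed simp

text \<open>A form of positive degree that is killed by all constant vector fields vanishes.\<close>

lemma form_eq_0:
  fixes f :: "(14, 'k::{idom, ring_char_0}) mpoly"
  assumes "f \<in> homog (Suc d)" "\<And>a. a < 14 \<Longrightarrow> D (ball_sets ! a) f = 0"
  shows "f = 0"
proof -
  have "mpderiv i f = 0" for i unfolding mpderiv_expansion[of i f] using assms(2) by simp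
  then have "of_nat (Suc d) * f = 0" using euler[OF assms(1)] by simp
  then show ?thesis by (rule of_nat_mult_eq_0)
qed

lemma form_eqI:
  fixes f g :: "(14, 'k::{idom, ring_char_0}) mpoly"
  assumes "f \<in> homog (Suc d)" "g \<in> homog (Suc d)" "\<And>a. a < 14 \<Longrightarrow> D (ball_sets ! a) f = D (ball_sets ! a) g"
  shows "f = g"
  using form_eq_0[OF homog_diff[OF assms(1,2)]] assms(3) by (simp add: D_diff)

section \<open>The quadrics of the four-four splits\<close>

text \<open>For a permutation \<open>\<sigma>\<close> the quadric \<open>quad \<sigma>\<close> says that a product of two matchings does not change when
  the two four-cycles of their union exchange their colours on one side of the split.\<close>

definition quad :: "(8 \<Rightarrow> 8) \<Rightarrow> (14, 'k::comm_ring_1) mpoly" where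
  "quad v = Yl [(v 0, v 1), (v 2, v 3), (v 4, v 5), (v 6, v 7)] * Yl [(v 0, v 2), (v 1, v 3), (v 4, v 6), (v 5, v 7)]
    - Yl [(v 0, v 1), (v 2, v 3), (v 4, v 6), (v 5, v 7)] * Yl [(v 0, v 2), (v 1, v 3), (v 4, v 5), (v 6, v 7)]"

lemma homog_Yl: "Yl L \<in> homog 1"
  unfolding Yl_def by (rule homog_lin)

lemma homog_quad: "quad v \<in> homog 2"
  using homog_mult[OF homog_Yl homog_Yl] unfolding quad_def by (intro homog_diff) simp_all

lemma act_Yl: "\<sigma> permutes UNIV \<Longrightarrow> is_match L \<Longrightarrow> act \<sigma> (Yl L) = Yl (map (map_prod \<sigma> \<sigma>) L)"
  by (simp add: Yl_def act_lin ev_in_R_deg is_match_ends relabel_ev)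

lemma act_quad_id: "\<sigma> permutes UNIV \<Longrightarrow> act \<sigma> (quad id) = quad \<sigma>"
  by (simp add: quad_def is_hom_simps is_hom_act act_Yl is_match_def)

lemma act_quad: "\<sigma> permutes UNIV \<Longrightarrow> \<tau> permutes UNIV \<Longrightarrow> act \<sigma> (quad \<tau>) = quad (\<sigma> \<circ> \<tau>)"
proof -
  assume \<sigma>: "\<sigma> permutes UNIV" and \<tau>: "\<tau> permutes UNIV"
  have "act \<sigma> (quad \<tau>) = act \<sigma> (act \<tau> (quad id))" by (simp only: act_quad_id[OF \<tau>])
  also have "\<dots> = quad (\<sigma> \<circ> \<tau>)" by (simp only: act_act[OF \<sigma> \<tau>] act_quad_id[OF permutes_compose[OF \<tau> \<sigma>]])
  finally show ?thesis .
qed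

lemmas coef_eval = is_hom_mult[OF is_hom_coef] is_hom_one[OF is_hom_coef] coef_br

lemmas Yl_eval = Yl_expansion sum14 in_ball_sets coef_eval is_match_def

lemma quad_id: "quad id = u 6 * u 11 - u 7 * u 10 + u 7 * u 12 + u 8 * u 10 - u 8 * u 11 - u 8 * u 12 - u 11 * u 12"
  by (simp add: quad_def Yl_eval algebra_simps)

lemma quad_transpose:
  assumes "(i, j) \<in> Pset \<times> Pset \<or> (i, j) \<in> (- Pset) \<times> (- Pset)" "i \<noteq> j"
  shows "quad (transpose i j) = - quad id"
proof -
  have t01: "quad (transpose 0 1) = - quad id"
    unfolding quad_id by (simp add: quad_def transpose_def Yl_eval algebra_simps)
  have t02: "quad (transpose 0 2) = - quad id"
    unfolding quad_id by (simp add: quad_def transpose_def Yl_eval algebra_simps)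
  have t03: "quad (transpose 0 3) = - quad id"
    unfolding quad_id by (simp add: quad_def transpose_def Yl_eval algebra_simps)
  have t12: "quad (transpose 1 2) = - quad id"
    unfolding quad_id by (simp add: quad_def transpose_def Yl_eval algebra_simps)
  have t13: "quad (transpose 1 3) = - quad id"
    unfolding quad_id by (simp add: quad_def transpose_def Yl_eval algebra_simps)
  have t23: "quad (transpose 2 3) = - quad id"
    unfolding quad_id by (simp add: quad_def transpose_def Yl_eval algebra_simps)
  have t45: "quad (transpose 4 5) = - quad id"
    unfolding quad_id by (simp add: quad_def transpose_def Yl_eval algebra_simps)
  have t46: "quad (transpose 4 6) = - quad id"
    unfolding quad_id by (simp add: quad_def transpose_def Yl_eval algebra_simps)
  have t47: "quad (transpose 4 7) = - quad id"
    unfolding quad_id by (simp add: quad_def transpose_def Yl_eval algebra_simps)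
  have t56: "quad (transpose 5 6) = - quad id"
    unfolding quad_id by (simp add: quad_def transpose_def Yl_eval algebra_simps)
  have t57: "quad (transpose 5 7) = - quad id"
    unfolding quad_id by (simp add: quad_def transpose_def Yl_eval algebra_simps)
  have t67: "quad (transpose 6 7) = - quad id"
    unfolding quad_id by (simp add: quad_def transpose_def Yl_eval algebra_simps)
  show ?thesis using assms unfolding compl_Pset unfolding Pset_def
    by (auto simp: t01 t02 t03 t12 t13 t23 t45 t46 t47 t56 t57 t67 transpose_commute[of 1 0] transpose_commute[of 2 0] transpose_commute[of 3 0] transpose_commute[of 2 1] transpose_commute[of 3 1] transpose_commute[of 3 2] transpose_commute[of 5 4] transpose_commute[of 6 4] transpose_commute[of 7 4] transpose_commute[of 6 5] transpose_commute[of 7 5] transpose_commute[of 7 6])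
qed

end

section \<open>Signs\<close>

lemma permutes_UNIV_permutation: "\<sigma> permutes (UNIV :: 8 set) \<Longrightarrow> permutation \<sigma>"
  unfolding permutation_permutes by (intro exI[of _ UNIV]) simp

lemma sign_comp: "\<sigma> permutes (UNIV :: 8 set) \<Longrightarrow> \<tau> permutes UNIV \<Longrightarrow> sign (\<sigma> \<circ> \<tau>) = sign \<sigma> * sign \<tau>"
  by (rule sign_compose) (rule permutes_UNIV_permutation, assumption)+

lemma transpose_permutes: "transpose i j permutes (UNIV :: 8 set)"
  by (rule permutes_swap_id) simp_all

lemma sign_sq: "sign \<sigma> * sign \<sigma> = 1"
  by (simp add: sign_def)

lemma inj_permutes8: "inj \<kappa> \<Longrightarrow> \<kappa> permutes (UNIV :: 8 set)"
  by (rule bij_imp_permutes) (auto simp: bij_def finite_UNIV_inj_surj)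

text \<open>Three subsets of the eight points attach three bits to each point; \<open>bits\<close> is the resulting map
  to the points \<open>0, ..., 7\<close>, and \<open>eps\<close> is its sign if the three subsets separate all points.\<close>

definition bits :: "8 set \<Rightarrow> 8 set \<Rightarrow> 8 set \<Rightarrow> 8 \<Rightarrow> 8" where
  "bits S T U i = (if i \<in> S then if i \<in> T then if i \<in> U then 0 else 1 else if i \<in> U then 2 else 3
     else if i \<in> T then if i \<in> U then 4 else 5 else if i \<in> U then 6 else 7)"

definition eps :: "8 set \<Rightarrow> 8 set \<Rightarrow> 8 set \<Rightarrow> int" where
  "eps S T U = (if inj (bits S T U) then sign (bits S T U) else 0)"

lemma bits_in: "bits S T U i \<in> {0, 1, 2, 3} \<longleftrightarrow> i \<in> S" "bits S T U i \<in> {0, 1, 4, 5} \<longleftrightarrow> i \<in> T"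
  "bits S T U i \<in> {0, 2, 4, 6} \<longleftrightarrow> i \<in> U"
  by (simp_all add: bits_def)

lemma bits_vimage: "bits S T U -` {0, 1, 2, 3} = S" "bits S T U -` {0, 1, 4, 5} = T" "bits S T U -` {0, 2, 4, 6} = U"
  using bits_in[of S T U] by (simp_all only: set_eq_iff vimage_eq) simp_all

lemma bits_eqD: "bits S T U i = bits S T U j \<Longrightarrow> (i \<in> S \<longleftrightarrow> j \<in> S) \<and> (i \<in> T \<longleftrightarrow> j \<in> T) \<and> (i \<in> U \<longleftrightarrow> j \<in> U)"
  by (metis bits_in)

lemma inj_comp_left: "inj \<beta> \<Longrightarrow> inj (\<beta> \<circ> \<kappa>) \<longleftrightarrow> inj \<kappa>"
  by (auto simp: inj_def)

lemma eps_swap12: "eps S T U = eps T S U"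
proof -
  let ?\<beta> = "transpose 2 4 \<circ> transpose 3 (5::8)"
  have p: "?\<beta> permutes UNIV" by (intro permutes_compose transpose_permutes)
  have s: "sign ?\<beta> = 1" by (simp add: sign_comp transpose_permutes sign_swap_id)
  have b: "bits T S U = ?\<beta> \<circ> bits S T U"
    by (rule ext) (simp add: bits_def transpose_def)
  have "inj (bits T S U) \<longleftrightarrow> inj (bits S T U)" unfolding b by (rule inj_comp_left[OF permutes_inj[OF p]])
  moreover have "sign (bits T S U) = sign (bits S T U)" if "inj (bits S T U)"
    unfolding b sign_comp[OF p inj_permutes8[OF that]] s by simp
  ultimately show ?thesis by (simp add: eps_def)
qed

lemma eps_swap23: "eps S T U = eps S U T"
proof -
  let ?\<beta> = "transpose 1 2 \<circ> transpose 5 (6::8)"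
  have p: "?\<beta> permutes UNIV" by (intro permutes_compose transpose_permutes)
  have s: "sign ?\<beta> = 1" by (simp add: sign_comp transpose_permutes sign_swap_id)
  have b: "bits S U T = ?\<beta> \<circ> bits S T U"
    by (rule ext) (simp add: bits_def transpose_def)
  have "inj (bits S U T) \<longleftrightarrow> inj (bits S T U)" unfolding b by (rule inj_comp_left[OF permutes_inj[OF p]])
  moreover have "sign (bits S U T) = sign (bits S T U)" if "inj (bits S T U)"
    unfolding b sign_comp[OF p inj_permutes8[OF that]] s by simp
  ultimately show ?thesis by (simp add: eps_def)
qed

lemma eps_vimage:
  assumes \<sigma>: "\<sigma> permutes UNIV"
  shows "eps (\<sigma> -` S) (\<sigma> -` T) (\<sigma> -` U) = sign \<sigma> * eps S T U"
proof -
  have b: "bits (\<sigma> -` S) (\<sigma> -` T) (\<sigma> -` U) = bits S T U \<circ> \<sigma>"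
    by (rule ext) (simp add: bits_def)
  have i: "inj (bits S T U \<circ> \<sigma>) \<longleftrightarrow> inj (bits S T U)"
  proof
    assume "inj (bits S T U \<circ> \<sigma>)"
    then have "inj ((bits S T U \<circ> \<sigma>) \<circ> inv_into UNIV \<sigma>)"
      by (rule inj_compose[OF _ permutes_inj[OF permutes_inv[OF \<sigma>]]])
    then show "inj (bits S T U)" by (simp add: comp_assoc permutes_inv_o[OF \<sigma>])
  qed (use permutes_inj[OF \<sigma>] in \<open>auto intro: inj_compose\<close>)
  show ?thesis unfolding eps_def b i
    by (simp add: sign_comp[OF inj_permutes8 \<sigma>] mult.commute)
qed

context eight_points
begin

section \<open>The quadrics and the sign of a split\<close>

lemma quad_permutes_half:
  assumes "\<tau> permutes A" "A = Pset \<or> A = - Pset"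
  shows "quad \<tau> = (of_int (sign \<tau>) * quad id :: (14, 'k::comm_ring_1) mpoly)"
  using assms(1) finite[of A]
proof (induction rule: permutes_induct)
  case id then show ?case by simp
next
  case (swap i j p)
  have p: "p permutes UNIV" using swap.hyps permutes_subset by blast
  have t: "quad (transpose i j) = (- quad id :: (14, 'k) mpoly)"
    by (rule quad_transpose) (use swap.hyps assms(2) in auto)
  have "quad (transpose i j \<circ> p) = act (transpose i j) (quad p :: (14, 'k) mpoly)"
    by (simp add: act_quad transpose_permutes p)
  also have "\<dots> = - (of_int (sign p) * quad id)"
    unfolding swap.IH by (simp add: is_hom_simps is_hom_act act_quad_id transpose_permutes t)
  also have "\<dots> = of_int (sign (transpose i j \<circ> p)) * quad id"
    using swap.hyps by (simp add: sign_comp[OF transpose_permutes p] sign_swap_id)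
  finally show ?case .
qed

lemma quad_permutes_split:
  assumes \<tau>: "\<tau> permutes UNIV" and P: "\<And>i. \<tau> i \<in> Pset \<longleftrightarrow> i \<in> Pset"
  shows "quad \<tau> = of_int (sign \<tau>) * quad id"
proof -
  let ?p = "\<lambda>i. if i \<in> Pset then \<tau> i else i" and ?n = "\<lambda>i. if i \<in> Pset then i else \<tau> i"
  have inj: "inj_on \<tau> A" for A using permutes_inj[OF \<tau>] by (rule inj_on_subset) simp
  have "\<tau> ` Pset = Pset"
    by (rule card_subset_eq) (use P inj in \<open>auto simp: card_image finite_Pset\<close>)
  then have "bij_betw ?p Pset Pset" using inj[of Pset] by (auto simp: bij_betw_def inj_on_def)
  then have p: "?p permutes Pset" by (rule bij_imp_permutes) simp
  have "\<tau> ` (- Pset) = - Pset"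
    by (rule card_subset_eq) (use P inj in \<open>auto simp: card_image\<close>)
  then have "bij_betw ?n (- Pset) (- Pset)" using inj[of "- Pset"] by (auto simp: bij_betw_def inj_on_def)
  then have n: "?n permutes (- Pset)" by (rule bij_imp_permutes) simp
  have p': "?p permutes UNIV" and n': "?n permutes UNIV" using p n permutes_subset by blast+
  have \<tau>eq: "\<tau> = ?p \<circ> ?n" using P by (auto simp: fun_eq_iff)
  have "quad (?p \<circ> ?n) = act ?p (quad ?n)" by (simp add: act_quad p' n')
  also have "\<dots> = of_int (sign ?n) * quad ?p"
    by (subst quad_permutes_half[OF n]) (simp_all add: is_hom_simps is_hom_act act_quad_id p')
  also have "\<dots> = of_int (sign ?n) * (of_int (sign ?p) * quad id)"
    by (subst quad_permutes_half[OF p]) simp_all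
  also have "\<dots> = of_int (sign (?p \<circ> ?n)) * quad id"
    by (simp add: sign_comp[OF p' n'] ac_simps)
  finally show ?thesis using \<tau>eq by simp
qed

text \<open>The value of the polarised quadric \<open>quad v\<close> on the configurations of \<open>T\<close> and \<open>U\<close>.\<close>

definition qc :: "(8 \<Rightarrow> 8) \<Rightarrow> 8 set \<Rightarrow> 8 set \<Rightarrow> int" where
  "qc v T U =
    (coef T (ev [(v 0, v 1), (v 2, v 3), (v 4, v 5), (v 6, v 7)]) * coef U (ev [(v 0, v 2), (v 1, v 3), (v 4, v 6), (v 5, v 7)])
    + coef U (ev [(v 0, v 1), (v 2, v 3), (v 4, v 5), (v 6, v 7)]) * coef T (ev [(v 0, v 2), (v 1, v 3), (v 4, v 6), (v 5, v 7)]))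
    - (coef T (ev [(v 0, v 1), (v 2, v 3), (v 4, v 6), (v 5, v 7)]) * coef U (ev [(v 0, v 2), (v 1, v 3), (v 4, v 5), (v 6, v 7)])
    + coef U (ev [(v 0, v 1), (v 2, v 3), (v 4, v 6), (v 5, v 7)]) * coef T (ev [(v 0, v 2), (v 1, v 3), (v 4, v 5), (v 6, v 7)]))"

lemma D_Yl: "is_match L \<Longrightarrow> D S (Yl L) = of_int (coef S (ev L))"
  unfolding Yl_def by (rule D_lin[OF ev_in_R_deg[OF is_match_ends]])

lemma is_match_quad:
  assumes "\<sigma> permutes UNIV"
  shows "is_match [(\<sigma> 0, \<sigma> 1), (\<sigma> 2, \<sigma> 3), (\<sigma> 4, \<sigma> 5), (\<sigma> 6, \<sigma> 7)]" "is_match [(\<sigma> 0, \<sigma> 2), (\<sigma> 1, \<sigma> 3), (\<sigma> 4, \<sigma> 6), (\<sigma> 5, \<sigma> 7)]"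
    "is_match [(\<sigma> 0, \<sigma> 1), (\<sigma> 2, \<sigma> 3), (\<sigma> 4, \<sigma> 6), (\<sigma> 5, \<sigma> 7)]" "is_match [(\<sigma> 0, \<sigma> 2), (\<sigma> 1, \<sigma> 3), (\<sigma> 4, \<sigma> 5), (\<sigma> 6, \<sigma> 7)]"
  by (simp_all add: is_match_def inj_eq[OF permutes_inj[OF assms]])

lemma DD_quad: "\<sigma> permutes UNIV \<Longrightarrow> D T (D U (quad \<sigma>)) = of_int (qc \<sigma> T U)"
  by (simp add: quad_def D_diff D_mult D_add D_Yl is_match_quad D_of_int_mult qc_def algebra_simps)

lemma qc_relabel: "qc \<sigma> T U = qc id (\<sigma> -` T) (\<sigma> -` U)"
proof -
  have "coef T (ev [(\<sigma> a, \<sigma> b), (\<sigma> c, \<sigma> d), (\<sigma> e, \<sigma> f), (\<sigma> g, \<sigma> h)]) = coef (\<sigma> -` T) (ev [(a, b), (c, d), (e, f), (g, h)])"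
    for T a b c d e f g h
    by (simp add: coef_eval)
  then show ?thesis by (simp only: qc_def id_apply)
qed

lemma qc_sign:
  assumes "\<tau> permutes UNIV" "\<And>i. \<tau> i \<in> Pset \<longleftrightarrow> i \<in> Pset"
  shows "qc \<tau> T U = sign \<tau> * qc id T U"
proof -
  have "(of_int (qc \<tau> T U) :: (14, int) mpoly) = D T (D U (quad \<tau>))" by (simp add: DD_quad assms(1))
  also have "\<dots> = of_int (sign \<tau>) * D T (D U (quad id))"
    by (subst quad_permutes_split[OF assms]) (simp add: D_of_int_mult)
  also have "\<dots> = of_int (sign \<tau> * qc id T U)" by (simp add: DD_quad permutes_id)
  finally show ?thesis by (simp only: of_int_eq_iff)
qed

text \<open>The quadric changes by the sign under permutations that preserve the split. If the three sets separate the points, such a permutation carries them to a standard triple; otherwise a transposition of two points that are not separated preserves the split and both sets, so the value is its own negative.\<close>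

lemma qc_id: "qc id T U = eps Pset T U"
proof (cases "inj (bits Pset T U)")
  case True
  let ?\<kappa> = "bits Pset T U"
  have p: "?\<kappa> permutes UNIV" by (rule inj_permutes8[OF True])
  have P: "?\<kappa> i \<in> Pset \<longleftrightarrow> i \<in> Pset" for i
    using bits_in(1)[of Pset T U i] by (simp only: Pset_def)
  have "qc ?\<kappa> {0, 1, 4, 5} {0, 2, 4, 6} = qc id T U"
    by (subst qc_relabel) (simp only: bits_vimage)
  moreover have "qc id {0, 1, 4, 5} {0, 2, 4, 6} = 1" by (simp add: qc_def coef_eval)
  ultimately have "qc id T U = sign ?\<kappa>" using qc_sign[OF p P, of "{0, 1, 4, 5}" "{0, 2, 4, 6}"] by simp
  then show ?thesis using True by (simp add: eps_def)
next
  case False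
  then obtain i j where ij: "bits Pset T U i = bits Pset T U j" "i \<noteq> j" by (auto simp: inj_def)
  note same = bits_eqD[OF ij(1)]
  let ?\<tau> = "transpose i j"
  have v: "?\<tau> -` A = A" if "i \<in> A \<longleftrightarrow> j \<in> A" for A
    using that by (auto simp: transpose_def split: if_splits)
  have "qc ?\<tau> T U = qc id T U" by (subst qc_relabel) (use same v in simp)
  moreover have "qc ?\<tau> T U = sign ?\<tau> * qc id T U"
    by (rule qc_sign[OF transpose_permutes]) (use same in \<open>auto simp: transpose_def\<close>)
  ultimately have "qc id T U = 0" using ij(2) by (simp add: sign_swap_id)
  then show ?thesis using False by (simp add: eps_def)
qed

lemma vimage_image_permutes: "\<sigma> permutes UNIV \<Longrightarrow> \<sigma> -` (\<sigma> ` A) = A"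
  by (rule inj_vimage_image_eq) (rule permutes_inj)

lemma qc_eps: "\<sigma> permutes UNIV \<Longrightarrow> qc \<sigma> T U = sign \<sigma> * eps (\<sigma> ` Pset) T U"
  using eps_vimage[of \<sigma> "\<sigma> ` Pset" T U] by (simp add: qc_relabel[of \<sigma>] qc_id vimage_image_permutes)

section \<open>The skew cubic\<close>

definition ball_perms :: "(8 \<Rightarrow> 8) list" where
  "ball_perms = [id, transpose 3 4, transpose 3 5, transpose 3 6, transpose 2 4, transpose 2 5, transpose 2 4 \<circ> transpose 3 5, transpose 2 4 \<circ> transpose 3 6, transpose 2 5 \<circ> transpose 3 6, transpose 1 4, transpose 1 4 \<circ> transpose 3 5, transpose 1 4 \<circ> transpose 3 6, transpose 1 4 \<circ> transpose 2 5, transpose 1 4 \<circ> transpose 2 5 \<circ> transpose 3 6]"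

lemma ball_perms_permutes: "a < 14 \<Longrightarrow> ball_perms ! a permutes UNIV"
proof -
  have "\<forall>\<pi>\<in>set ball_perms. \<pi> permutes UNIV"
    by (auto simp: ball_perms_def intro!: permutes_id permutes_compose transpose_permutes)
  moreover have "length ball_perms = 14" by (simp add: ball_perms_def)
  ultimately show "a < 14 \<Longrightarrow> ball_perms ! a permutes UNIV" by (metis nth_mem)
qed

lemma ball_perms_image: "a < 14 \<Longrightarrow> (ball_perms ! a) ` Pset = ball_sets ! a"
proof (erule all_less14[rotated])
  fix a :: nat assume "a \<in> {0, 1, 2, 3, 4, 5, 6, 7, 8, 9, 10, 11, 12, 13}"
  then show "(ball_perms ! a) ` Pset = ball_sets ! a"
    by (elim insertE emptyE; simp only:) (simp_all add: ball_perms_def ball_sets_def Pset_def transpose_def, auto)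
qed

text \<open>In the basis \<open>u\<close>, the coefficient of a product of three distinct basis elements is the sign \<open>eps\<close> of the corresponding three sets.\<close>

definition s3 :: "(14, 'k::comm_ring_1) mpoly" where
  "s3 = u 0 * u 6 * u 11 - u 0 * u 7 * u 10 + u 0 * u 7 * u 12 + u 0 * u 8 * u 10 - u 0 * u 8 * u 11 - u 0 * u 8 * u 12
    - u 0 * u 11 * u 12 - u 1 * u 5 * u 13 + u 1 * u 8 * u 12 - u 2 * u 4 * u 11 + u 2 * u 4 * u 13 + u 2 * u 7 * u 9
    - u 2 * u 7 * u 12 - u 2 * u 9 * u 13 + u 2 * u 11 * u 12 + u 3 * u 4 * u 10 - u 3 * u 4 * u 13 + u 3 * u 5 * u 9
    - u 3 * u 5 * u 10 + u 3 * u 5 * u 13 - u 3 * u 6 * u 9 + u 3 * u 9 * u 13 - u 4 * u 8 * u 10 + u 4 * u 8 * u 11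
    - u 5 * u 7 * u 9 + u 5 * u 7 * u 10 + u 5 * u 9 * u 13 - u 8 * u 11 * u 12"

lemma homog_s3: "s3 \<in> homog 3"
proof -
  have "u a * u c * u d \<in> homog 3" for a c d
    using homog_mult[OF homog_mult[OF homog_u homog_u] homog_u, of a c d] by simp
  then show ?thesis unfolding s3_def by (intro homog_add homog_diff)
qed

lemma sign_swaps: "sign (transpose i j :: 8 \<Rightarrow> 8) = (if i = j then 1 else - 1)"
  by (rule sign_swap_id)

lemma D_ball_s3_quad: "a < 14 \<Longrightarrow> D (ball_sets ! a) s3 = of_int (sign (ball_perms ! a)) * quad (ball_perms ! a)"
proof (erule all_less14[rotated])
  fix a :: nat assume a: "a \<in> {0, 1, 2, 3, 4, 5, 6, 7, 8, 9, 10, 11, 12, 13}"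
  have "D (ball_sets ! a) s3 - of_int (sign (ball_perms ! a)) * quad (ball_perms ! a) = 0"
    using a
    by (elim insertE emptyE; simp only:)
      (simp_all add: s3_def D_add D_diff D_mult D_ball_u ball_perms_def sign_comp transpose_permutes permutes_compose
        sign_swaps quad_def transpose_def Yl_eval, simp_all add: algebra_simps)
  then show "D (ball_sets ! a) s3 = of_int (sign (ball_perms ! a)) * quad (ball_perms ! a)" by simp
qed

lemma D_commute: "D S (D T f) = D T (D S f)"
  by (induction f rule: mpoly_induct) (simp_all add: D_add D_mult D_mvar algebra_simps)

lemma DDD_ball_s3: "a < 14 \<Longrightarrow> D T (D U (D (ball_sets ! a) s3)) = of_int (eps (ball_sets ! a) T U)"
  using sign_sq[of "ball_perms ! a"]
  by (simp add: D_ball_s3_quad D_of_int_mult DD_quad ball_perms_permutes qc_eps ball_perms_image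
      mult.assoc[symmetric] flip: of_int_mult)

text \<open>Both sides are quadrics, so it suffices to compare second derivatives in the directions of the dual basis. There the formula reduces to the symmetry of \<open>eps\<close>, since the derivatives of \<open>s3\<close> in the basis directions are known.\<close>

lemma D_s3:
  fixes \<sigma> :: "8 \<Rightarrow> 8"
  assumes \<sigma>: "\<sigma> permutes UNIV"
  shows "D (\<sigma> ` Pset) s3 = (of_int (sign \<sigma>) * quad \<sigma> :: (14, 'k::{idom, ring_char_0}) mpoly)"
proof (rule form_eqI[of _ 1])
  show h: "D (\<sigma> ` Pset) s3 \<in> homog (Suc 1)" using homog_D[of s3 2] homog_s3 by (simp add: numeral_eq_Suc One_nat_def)
  show h': "of_int (sign \<sigma>) * quad \<sigma> \<in> homog (Suc 1)"
    using homog_mult0[OF homog_of_int homog_quad, of "sign \<sigma>" \<sigma>] by (simp add: numeral_eq_Suc One_nat_def)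
  fix a :: nat assume a: "a < 14"
  show "D (ball_sets ! a) (D (\<sigma> ` Pset) s3) = D (ball_sets ! a) (of_int (sign \<sigma>) * quad \<sigma> :: (14, 'k) mpoly)"
  proof (rule form_eqI[of _ 0])
    show "D (ball_sets ! a) (D (\<sigma> ` Pset) s3) \<in> homog (Suc 0)"
      "D (ball_sets ! a) (of_int (sign \<sigma>) * quad \<sigma>) \<in> homog (Suc 0)"
      using homog_D[OF h] homog_D[OF h'] by (simp_all add: One_nat_def)
    fix c :: nat assume c: "c < 14"
    let ?T = "ball_sets ! c" and ?U = "ball_sets ! a" and ?S = "\<sigma> ` Pset"
    have "D ?T (D ?U (D ?S s3)) = D ?U (D ?S (D ?T s3 :: (14, 'k) mpoly))"
      by (simp only: D_commute[of ?T] D_commute[of ?U ?T])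
    also have "\<dots> = of_int (eps ?T ?U ?S)" by (rule DDD_ball_s3[OF c])
    also have "eps ?T ?U ?S = eps ?S ?T ?U" using eps_swap12 eps_swap23 by metis
    also have "of_int (eps ?S ?T ?U) = of_int (sign \<sigma> * (sign \<sigma> * eps ?S ?T ?U))"
      using sign_sq[of \<sigma>] by (simp only: mult.assoc[symmetric] mult_1)
    also have "\<dots> = D ?T (D ?U (of_int (sign \<sigma>) * quad \<sigma> :: (14, 'k) mpoly))"
      by (simp add: D_of_int_mult DD_quad[OF \<sigma>] qc_eps[OF \<sigma>])
    finally show "D ?T (D ?U (D ?S s3)) = D ?T (D ?U (of_int (sign \<sigma>) * quad \<sigma> :: (14, 'k) mpoly))" .
  qed
qed

text \<open>Compare first derivatives: a permutation moves the splits and their quadrics compatibly.\<close>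

lemma act_s3:
  fixes \<sigma> :: "8 \<Rightarrow> 8"
  assumes \<sigma>: "\<sigma> permutes UNIV"
  shows "act \<sigma> s3 = (of_int (sign \<sigma>) * s3 :: (14, 'k::{idom, ring_char_0}) mpoly)"
proof (rule form_eqI[of _ 2])
  show "act \<sigma> s3 \<in> homog (Suc 2)" using homog_act[OF \<sigma> homog_s3] by simp
  show "of_int (sign \<sigma>) * s3 \<in> homog (Suc 2)" using homog_mult0[OF homog_of_int homog_s3] by simp
  fix a :: nat assume a: "a < 14"
  let ?\<tau> = "ball_perms ! a" and ?i = "inv_into UNIV \<sigma>"
  have \<tau>: "?\<tau> permutes UNIV" by (rule ball_perms_permutes[OF a])
  have i: "?i permutes UNIV" by (rule permutes_inv[OF \<sigma>])
  have i\<tau>: "?i \<circ> ?\<tau> permutes UNIV" by (rule permutes_compose[OF \<tau> i])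
  have c: "\<sigma> \<circ> (?i \<circ> ?\<tau>) = ?\<tau>" by (simp add: comp_assoc[symmetric] permutes_inv_o[OF \<sigma>])
  have "sign \<sigma> * sign (?i \<circ> ?\<tau>) = sign ?\<tau>" using sign_comp[OF \<sigma> i\<tau>] c by simp
  then have sg: "sign (?i \<circ> ?\<tau>) = sign \<sigma> * sign ?\<tau>" using sign_sq[of \<sigma>] by (metis mult.assoc mult_1)
  have v: "\<sigma> -` (ball_sets ! a) = (?i \<circ> ?\<tau>) ` Pset"
  proof -
    have "(?i \<circ> ?\<tau>) ` Pset = \<sigma> -` (\<sigma> ` ((?i \<circ> ?\<tau>) ` Pset))" by (simp only: vimage_image_permutes[OF \<sigma>])
    also have "\<sigma> ` ((?i \<circ> ?\<tau>) ` Pset) = ball_sets ! a" using c ball_perms_image[OF a] by (metis image_comp)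
    finally show ?thesis by simp
  qed
  have "D (ball_sets ! a) (act \<sigma> s3) = act \<sigma> (D ((?i \<circ> ?\<tau>) ` Pset) (s3 :: (14, 'k) mpoly))"
    by (simp only: D_act[OF \<sigma>] v)
  also have "\<dots> = of_int (sign (?i \<circ> ?\<tau>)) * quad (\<sigma> \<circ> (?i \<circ> ?\<tau>))"
    by (simp only: D_s3[OF i\<tau>] is_hom_mult[OF is_hom_act] is_hom_of_int[OF is_hom_act] act_quad[OF \<sigma> i\<tau>])
  also have "\<dots> = of_int (sign \<sigma>) * (of_int (sign ?\<tau>) * quad ?\<tau>)" by (simp add: c sg mult.assoc)
  also have "\<dots> = D (ball_sets ! a) (of_int (sign \<sigma>) * s3)"
    by (simp add: D_of_int_mult D_ball_s3_quad[OF a])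
  finally show "D (ball_sets ! a) (act \<sigma> s3) = D (ball_sets ! a) (of_int (sign \<sigma>) * s3 :: (14, 'k) mpoly)" .
qed

lemma DDD_s3_standard: "D {0, 1, 2, 3} (D {0, 1, 4, 5} (D {0, 2, 4, 6} s3)) = 1"
proof -
  have "D {0, 1, 2, 3} (D {0, 1, 4, 5} (D {0, 2, 4, 6} s3)) = D {0, 1, 4, 5} (D {0, 2, 4, 6} (D {0, 1, 2, 3} s3))"
    by (simp only: D_commute[of "{0, 1, 2, 3}"])
  also have "\<dots> = of_int (eps {0, 1, 2, 3} {0, 1, 4, 5} {0, 2, 4, 6})"
    using DDD_ball_s3[of 0] by (simp add: ball_sets_nth)
  also have "eps {0, 1, 2, 3} {0, 1, 4, 5} {0, 2, 4, 6} = qc id {0, 1, 4, 5} {0, 2, 4, 6}"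
    by (simp only: qc_id Pset_def)
  also have "\<dots> = 1" by (simp add: qc_def coef_eval)
  finally show ?thesis by simp
qed

lemma s3_nonzero: "s3 \<noteq> 0"
  using DDD_s3_standard by (metis D_zero zero_neq_one)

section \<open>Uniqueness of the skew cubic\<close>

lemma D_mconst_mult: "D S (mconst c * f) = mconst c * D S f"
  by (simp add: D_mult)

text \<open>A third derivative in the directions of three sets that do not separate the points vanishes, by the transposition of two points that are not separated. All triples that separate the points are permuted transitively.\<close>

lemma skew_cubic_eq_0:
  fixes g :: "(14, 'k::{idom, ring_char_0}) mpoly"
  assumes g: "g \<in> homog 3" and skew: "\<And>\<sigma>. \<sigma> permutes UNIV \<Longrightarrow> act \<sigma> g = of_int (sign \<sigma>) * g"
    and z: "D {0, 1, 2, 3} (D {0, 1, 4, 5} (D {0, 2, 4, 6} g)) = 0"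
  shows "g = 0"
proof -
  have h: "D U g \<in> homog 2" "D T (D U g) \<in> homog 1" "D S (D T (D U g)) \<in> homog 0" for S T U
  proof -
    show 2: "D U g \<in> homog 2" for U using homog_D[of g 2 U] g by simp
    show 1: "D T (D U g) \<in> homog 1" for T U using homog_D[of "D U g" 1 T] 2 by (simp add: numeral_2_eq_2 One_nat_def)
    show "D S (D T (D U g)) \<in> homog 0" using homog_D[of "D T (D U g)" 0 S] 1 by (simp add: One_nat_def)
  qed
  have fixed: "act \<sigma> (D S (D T (D U g))) = D S (D T (D U g))" for \<sigma> S T U
    using homog_0_mconst[OF h(3)] act_mconst by metis
  have moved: "act \<sigma> (D (\<sigma> -` S) (D (\<sigma> -` T) (D (\<sigma> -` U) g))) = of_int (sign \<sigma>) * D S (D T (D U g))"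
    if "\<sigma> permutes UNIV" for \<sigma> S T U
    using D_act[OF that] skew[OF that] by (metis D_of_int_mult)
  have "D S (D T (D U g)) = 0" for S T U
  proof (cases "inj (bits S T U)")
    case True
    have "D S (D T (D U g)) = act (bits S T U) (D S (D T (D U g)))" by (simp only: fixed)
    also have "\<dots> = of_int (sign (bits S T U)) * D {0, 1, 2, 3} (D {0, 1, 4, 5} (D {0, 2, 4, 6} g))"
      using moved[OF inj_permutes8[OF True], of "{0, 1, 2, 3}" "{0, 1, 4, 5}" "{0, 2, 4, 6}"] by (simp only: bits_vimage)
    finally show ?thesis using z by simp
  next
    case False
    then obtain i j where ij: "bits S T U i = bits S T U j" "i \<noteq> j" by (auto simp: inj_def)
    note same = bits_eqD[OF ij(1)]
    let ?\<tau> = "transpose i j"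
    have v: "?\<tau> -` A = A" if "i \<in> A \<longleftrightarrow> j \<in> A" for A
      using that by (auto simp: transpose_def split: if_splits)
    have "D S (D T (D U g)) = act ?\<tau> (D S (D T (D U g)))" by (simp only: fixed)
    also have "\<dots> = - D S (D T (D U g))"
      using moved[OF transpose_permutes[of i j], of S T U] same v ij(2) by (simp add: sign_swap_id)
    finally have "of_nat (Suc 1) * D S (D T (D U g)) = 0" by (simp add: algebra_simps)
    then show ?thesis by (rule of_nat_mult_eq_0)
  qed
  then have "D T (D U g) = 0" for T U
    using form_eq_0[of "D T (D U g)" 0] h(2) by (simp add: One_nat_def)
  then have "D U g = 0" for U
    using form_eq_0[of "D U g" 1] h(1) by (simp add: numeral_2_eq_2 One_nat_def)
  then show ?thesis using form_eq_0[of g 2] g by simp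
qed

lemma skew_invariant_cubics_eq: "skew_invariant_cubics b = {mconst c * s3 | c. True}"
proof (intro equalityI subsetI)
  fix f :: "(14, rat) mpoly" assume "f \<in> {mconst c * s3 | c. True}"
  then obtain c where f: "f = mconst c * s3" by blast
  have "f \<in> homog 3" unfolding f by (rule homog_mult0[OF homog_mconst homog_s3])
  moreover have "act \<sigma> f = of_int (sign \<sigma>) * f" if "\<sigma> permutes UNIV" for \<sigma>
    unfolding f is_hom_mult[OF is_hom_act] act_mconst act_s3[OF that] by (simp only: ac_simps)
  ultimately show "f \<in> skew_invariant_cubics b" by (simp add: skew_invariant_cubics_def perm_act_sym_eq)
next
  fix f :: "(14, rat) mpoly" assume "f \<in> skew_invariant_cubics b"
  then have f: "f \<in> homog 3" "\<And>\<sigma>. \<sigma> permutes UNIV \<Longrightarrow> act \<sigma> f = of_int (sign \<sigma>) * f"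
    by (simp_all add: skew_invariant_cubics_def perm_act_sym_eq)
  let ?d = "\<lambda>f. D {0, 1, 2, 3} (D {0, 1, 4, 5} (D {0, 2, 4, 6} f))"
  have "D {0, 2, 4, 6} f \<in> homog 2" using homog_D[of f 2] f(1) by simp
  then have "D {0, 1, 4, 5} (D {0, 2, 4, 6} f) \<in> homog 1" using homog_D[of _ 1] by (simp add: numeral_2_eq_2 One_nat_def)
  then have "?d f \<in> homog 0" using homog_D[of _ 0] by (simp add: One_nat_def)
  then obtain c where c: "?d f = mconst c" using homog_0_mconst by blast
  have "f - mconst c * s3 = 0"
  proof (rule skew_cubic_eq_0)
    show "f - mconst c * s3 \<in> homog 3" by (intro homog_diff f homog_mult0[OF homog_mconst homog_s3])
    show "act \<sigma> (f - mconst c * s3) = of_int (sign \<sigma>) * (f - mconst c * s3)" if "\<sigma> permutes UNIV" for \<sigma>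
      unfolding is_hom_diff[OF is_hom_act] is_hom_mult[OF is_hom_act] act_mconst act_s3[OF that] f(2)[OF that]
      by (simp only: algebra_simps)
    show "?d (f - mconst c * s3) = 0"
      by (simp add: D_diff D_mconst_mult c DDD_s3_standard)
  qed
  then show "f \<in> {mconst c * s3 | c. True}" by auto
qed

end

section \<open>Generated ideals\<close>

text \<open>The ideal generated by \<open>G\<close> with coefficients in \<open>C\<close>, built by adding one multiple of a generator at a time.\<close>

inductive_set idl :: "'a::comm_ring_1 set \<Rightarrow> 'a set \<Rightarrow> 'a set" for C G where
  idl_zero: "0 \<in> idl C G"
| idl_step: "x \<in> idl C G \<Longrightarrow> f \<in> C \<Longrightarrow> g \<in> G \<Longrightarrow> x + f * g \<in> idl C G"

lemma idl_gen: "f \<in> C \<Longrightarrow> g \<in> G \<Longrightarrow> f * g \<in> idl C G"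
  using idl_step[OF idl_zero] by force

lemma idl_add: assumes "x \<in> idl C G" "y \<in> idl C G" shows "x + y \<in> idl C G"
  using assms(2) by induction (use assms(1) in \<open>auto simp: add.assoc[symmetric] intro: idl_step\<close>)

lemma idl_mult:
  assumes "x \<in> idl C G" "h \<in> C" "\<And>f. f \<in> C \<Longrightarrow> h * f \<in> C" shows "h * x \<in> idl C G"
  using assms(1)
  by induction (use assms(3) in \<open>auto simp: distrib_left mult.assoc[symmetric] intro: idl_zero idl_step\<close>)

lemma idl_subset:
  assumes "x \<in> idl C G" "G \<subseteq> idl C H" "\<And>f h. f \<in> C \<Longrightarrow> h \<in> C \<Longrightarrow> f * h \<in> C"
  shows "x \<in> idl C H"
  using assms(1)
proof induction
  case (idl_step x f g)
  have "f * g \<in> idl C H" by (rule idl_mult) (use idl_step assms in auto)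
  then show ?case using idl_step idl_add by blast
qed (rule idl.idl_zero)

lemma idl_UNIV_mult: "x \<in> idl UNIV G \<Longrightarrow> h * x \<in> idl UNIV G"
  by (rule idl_mult) auto

lemma idl_UNIV_uminus: "x \<in> idl UNIV G \<Longrightarrow> - x \<in> idl UNIV G"
  using idl_UNIV_mult[of x G "-1"] by simp

lemma idl_UNIV_diff: "x \<in> idl UNIV G \<Longrightarrow> y \<in> idl UNIV G \<Longrightarrow> x - y \<in> idl UNIV G"
  using idl_add[of x UNIV G "-y"] idl_UNIV_uminus[of y G] by simp

lemma idl_UNIV_base: "g \<in> G \<Longrightarrow> g \<in> idl UNIV G"
  using idl_gen[of 1 UNIV g G] by simp

lemma perm8:
  assumes "distinct [v0, v1, v2, v3, v4, v5, v6, v7 :: 8]"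
  shows "\<exists>\<sigma>. \<sigma> permutes UNIV \<and> \<sigma> 0 = v0 \<and> \<sigma> 1 = v1 \<and> \<sigma> 2 = v2 \<and> \<sigma> 3 = v3 \<and>
    \<sigma> 4 = v4 \<and> \<sigma> 5 = v5 \<and> \<sigma> 6 = v6 \<and> \<sigma> 7 = v7"
proof -
  let ?\<sigma> = "\<lambda>i::8. if i = 0 then v0 else if i = 1 then v1 else if i = 2 then v2 else if i = 3 then v3
    else if i = 4 then v4 else if i = 5 then v5 else if i = 6 then v6 else v7"
  have "inj_on ?\<sigma> {0, 1, 2, 3, 4, 5, 6, 7}"
    using assms by (simp add: inj_on_insert)
  then have "?\<sigma> permutes UNIV" unfolding UNIV8[symmetric] by (rule inj_permutes8)
  then show ?thesis by (intro exI[of _ ?\<sigma>]) simp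
qed

definition M4 :: "8 \<Rightarrow> 8 \<Rightarrow> 8 \<Rightarrow> 8 \<Rightarrow> 8 \<Rightarrow> 8 \<Rightarrow> 8 \<Rightarrow> 8 \<Rightarrow> graph" where
  "M4 a b c d p q r s = {#(a, p), (b, q), (c, r), (d, s)#}"

definition rows :: "8 \<Rightarrow> 8 \<Rightarrow> 8 \<Rightarrow> 8 \<Rightarrow> bool" where
  "rows a b c d \<longleftrightarrow> distinct [a, b, c, d] \<and> {a, b, c, d} = Pset"

definition columns :: "8 \<Rightarrow> 8 \<Rightarrow> 8 \<Rightarrow> 8 \<Rightarrow> bool" where
  "columns p q r s \<longleftrightarrow> distinct [p, q, r, s] \<and> {p, q, r, s} = - Pset"

lemma rows_swap: "rows b a c d = rows a b c d" "rows a c b d = rows a b c d" "rows a b d c = rows a b c d"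
  by (auto simp: rows_def)

lemma columns_swap: "columns b a c d = columns a b c d" "columns a c b d = columns a b c d"
  "columns a b d c = columns a b c d"
  by (auto simp: columns_def)

lemma rows_columns_distinct: "rows a b c d \<Longrightarrow> columns p q r s \<Longrightarrow> distinct [a, b, c, d, p, q, r, s]"
  by (auto simp: rows_def columns_def)

lemma PM_M4:
  assumes "\<mu> \<in> PM" "rows a b c d"
  shows "\<exists>p q r s. columns p q r s \<and> \<mu> = M4 a b c d p q r s"
  using PM_explicit[OF assms(1), of a b c d] assms(2) unfolding rows_def columns_def M4_def by metis

context eight_points
begin

lemma rows_columns_image:
  assumes "rows a b' c d" "columns p q r s"
  shows "is_match [(a, p), (b', q), (c, r), (d, s)]"
  using rows_columns_distinct[OF assms] by (auto simp: is_match_def)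

lemma M4_PM: "rows a b' c d \<Longrightarrow> columns p q r s \<Longrightarrow> M4 a b' c d p q r s \<in> PM"
proof -
  assume a: "rows a b' c d" "columns p q r s"
  have "gends (M4 a b' c d p q r s) = alld 1"
    using is_match_ends[OF rows_columns_image[OF a]] by (simp add: M4_def add_mset_commute)
  moreover have "bip (M4 a b' c d p q r s)" using a by (auto simp: M4_def rows_def columns_def)
  ultimately show ?thesis by (simp add: PM_def)
qed

definition J :: "(14, int) mpoly set" where
  "J = idl UNIV (insert s3 {quad \<sigma> | \<sigma>. \<sigma> permutes UNIV})"

lemma J_zero: "0 \<in> J" and J_add: "x \<in> J \<Longrightarrow> y \<in> J \<Longrightarrow> x + y \<in> J"
  and J_diff: "x \<in> J \<Longrightarrow> y \<in> J \<Longrightarrow> x - y \<in> J" and J_mult: "x \<in> J \<Longrightarrow> h * x \<in> J"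
  and J_uminus: "x \<in> J \<Longrightarrow> - x \<in> J"
  unfolding J_def by (auto intro: idl_zero idl_add idl_UNIV_diff idl_UNIV_mult idl_UNIV_uminus)

lemma J_s3: "s3 \<in> J" and J_quad: "\<sigma> permutes UNIV \<Longrightarrow> quad \<sigma> \<in> J"
  unfolding J_def by (auto intro!: idl_UNIV_base)

lemma J_D_ball_s3: "a < 14 \<Longrightarrow> D (ball_sets ! a) s3 \<in> J"
  by (simp add: D_ball_s3_quad J_mult J_quad ball_perms_permutes)

lemma J_act: "\<sigma> permutes UNIV \<Longrightarrow> x \<in> J \<Longrightarrow> act \<sigma> x \<in> J"
proof -
  assume \<sigma>: "\<sigma> permutes UNIV" and "x \<in> J"
  from this(2) show ?thesis unfolding J_def
  proof induction
    case idl_zero then show ?case by (simp add: is_hom_zero is_hom_act idl.idl_zero)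
  next
    case (idl_step x f g)
    have "act \<sigma> g \<in> J" using idl_step.hyps(3)
      by (auto simp: act_quad[OF \<sigma>] act_s3[OF \<sigma>] intro!: J_quad J_mult J_s3 permutes_compose \<sigma>)
    then show ?case using idl_step by (simp add: is_hom_simps is_hom_act J_add J_mult flip: J_def)
  qed
qed

definition cong :: "(14, int) mpoly \<Rightarrow> (14, int) mpoly \<Rightarrow> bool" where
  "cong f g \<longleftrightarrow> f - g \<in> J"

lemma cong_refl: "cong f f"
  by (simp add: cong_def J_zero)

lemma cong_sym: "cong f g \<Longrightarrow> cong g f"
  unfolding cong_def using J_uminus by fastforce

lemma cong_trans: "cong f g \<Longrightarrow> cong g h \<Longrightarrow> cong f h"
  unfolding cong_def using J_add by fastforce

lemma cong_mult: "cong f g \<Longrightarrow> cong (h * f) (h * g)"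
  unfolding cong_def using J_mult by (simp add: right_diff_distrib[symmetric])

definition Ym :: "graph \<Rightarrow> (14, int) mpoly" where
  "Ym \<mu> = lin (gev \<mu>)"

definition PY :: "graph multiset \<Rightarrow> (14, int) mpoly" where
  "PY F = (\<Prod>\<mu>\<in>#F. Ym \<mu>)"

lemma PY_empty [simp]: "PY {#} = 1" and PY_add_mset: "PY (add_mset \<mu> F) = Ym \<mu> * PY F"
  and PY_union: "PY (F + G) = PY F * PY G"
  by (simp_all add: PY_def)

lemma cong_PY_add: "cong (PY F) (PY G) \<Longrightarrow> cong (PY (F + H)) (PY (G + H))"
  using cong_mult[of "PY F" "PY G" "PY H"] by (simp add: PY_union mult.commute)

lemma Ym_M4: "Ym (M4 a b' c d p q r s) = Yl [(a, p), (b', q), (c, r), (d, s)]"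
  by (simp add: Ym_def Yl_def M4_def)

section \<open>Relations of degree two and three\<close>

text \<open>Two matchings with two common four-cycles: this is one of the quadrics.\<close>

lemma two_move:
  assumes "rows a b' c d" "columns p q r s"
  shows "cong (PY {#M4 a b' c d p q r s, M4 a b' c d q p s r#}) (PY {#M4 a b' c d p q s r, M4 a b' c d q p r s#})"
proof -
  have "distinct [a, p, q, b', c, r, s, d]" using rows_columns_distinct[OF assms] by auto
  from perm8[OF this] obtain \<sigma> where \<sigma>: "\<sigma> permutes UNIV" "\<sigma> 0 = a" "\<sigma> 1 = p" "\<sigma> 2 = q" "\<sigma> 3 = b'"
    "\<sigma> 4 = c" "\<sigma> 5 = r" "\<sigma> 6 = s" "\<sigma> 7 = d" by blast
  have e: "ev [(a, p), (q, b'), (c, r), (s, d)] = ev [(a, p), (b', q), (c, r), (d, s)]"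
    "ev [(a, q), (p, b'), (c, s), (r, d)] = ev [(a, q), (b', p), (c, s), (d, r)]"
    "ev [(a, p), (q, b'), (c, s), (r, d)] = ev [(a, p), (b', q), (c, s), (d, r)]"
    "ev [(a, q), (p, b'), (c, r), (s, d)] = ev [(a, q), (b', p), (c, r), (d, s)]"
    by (simp_all add: br_swap[of b' q] br_swap[of b' p] br_swap[of d s] br_swap[of d r])
  have "quad \<sigma> \<in> J" by (rule J_quad[OF \<sigma>(1)])
  then show ?thesis
    by (simp add: cong_def PY_add_mset Ym_M4 quad_def \<sigma> Yl_def[of "[(a, p), (q, b'), (c, r), (s, d)]"]
        Yl_def[of "[(a, q), (p, b'), (c, s), (r, d)]"] Yl_def[of "[(a, p), (q, b'), (c, s), (r, d)]"]
        Yl_def[of "[(a, q), (p, b'), (c, r), (s, d)]"] e del: ev_Cons flip: Yl_def)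
qed

lemma D_ball_s3:
  "D (ball_sets ! 0) (s3 :: (14, 'k::comm_ring_1) mpoly) = u 6 * u 11 - u 7 * u 10 + u 7 * u 12 + u 8 * u 10 - u 8 * u 11 - u 8 * u 12 - u 11 * u 12"
  "D (ball_sets ! 1) (s3 :: (14, 'k::comm_ring_1) mpoly) = - u 5 * u 13 + u 8 * u 12"
  "D (ball_sets ! 2) (s3 :: (14, 'k::comm_ring_1) mpoly) = - u 4 * u 11 + u 4 * u 13 + u 7 * u 9 - u 7 * u 12 - u 9 * u 13 + u 11 * u 12"
  "D (ball_sets ! 3) (s3 :: (14, 'k::comm_ring_1) mpoly) = u 4 * u 10 - u 4 * u 13 + u 5 * u 9 - u 5 * u 10 + u 5 * u 13 - u 6 * u 9 + u 9 * u 13"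
  "D (ball_sets ! 4) (s3 :: (14, 'k::comm_ring_1) mpoly) = - u 2 * u 11 + u 2 * u 13 + u 3 * u 10 - u 3 * u 13 - u 8 * u 10 + u 8 * u 11"
  "D (ball_sets ! 5) (s3 :: (14, 'k::comm_ring_1) mpoly) = - u 1 * u 13 + u 3 * u 9 - u 3 * u 10 + u 3 * u 13 - u 7 * u 9 + u 7 * u 10 + u 9 * u 13"
  "D (ball_sets ! 6) (s3 :: (14, 'k::comm_ring_1) mpoly) = u 0 * u 11 - u 3 * u 9"
  "D (ball_sets ! 7) (s3 :: (14, 'k::comm_ring_1) mpoly) = - u 0 * u 10 + u 0 * u 12 + u 2 * u 9 - u 2 * u 12 - u 5 * u 9 + u 5 * u 10"
  "D (ball_sets ! 8) (s3 :: (14, 'k::comm_ring_1) mpoly) = u 0 * u 10 - u 0 * u 11 - u 0 * u 12 + u 1 * u 12 - u 4 * u 10 + u 4 * u 11 - u 11 * u 12"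
  "D (ball_sets ! 9) (s3 :: (14, 'k::comm_ring_1) mpoly) = u 2 * u 7 - u 2 * u 13 + u 3 * u 5 - u 3 * u 6 + u 3 * u 13 - u 5 * u 7 + u 5 * u 13"
  "D (ball_sets ! 10) (s3 :: (14, 'k::comm_ring_1) mpoly) = - u 0 * u 7 + u 0 * u 8 + u 3 * u 4 - u 3 * u 5 - u 4 * u 8 + u 5 * u 7"
  "D (ball_sets ! 11) (s3 :: (14, 'k::comm_ring_1) mpoly) = u 0 * u 6 - u 0 * u 8 - u 0 * u 12 - u 2 * u 4 + u 2 * u 12 + u 4 * u 8 - u 8 * u 12"
  "D (ball_sets ! 12) (s3 :: (14, 'k::comm_ring_1) mpoly) = u 0 * u 7 - u 0 * u 8 - u 0 * u 11 + u 1 * u 8 - u 2 * u 7 + u 2 * u 11 - u 8 * u 11"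
  "D (ball_sets ! 13) (s3 :: (14, 'k::comm_ring_1) mpoly) = - u 1 * u 5 + u 2 * u 4 - u 2 * u 9 - u 3 * u 4 + u 3 * u 5 + u 3 * u 9 + u 5 * u 9"
  by (simp_all add: s3_def D_add D_diff D_mult D_ball_u)

text \<open>The two kinds of binomial cubics that are not generated by the binomial quadrics. In the basis \<open>u\<close> each
  of them is \<open>- s3\<close> plus an explicit combination of the derivatives of \<open>s3\<close>.\<close>

lemma three_move_C_standard:
  "Yl [(0, 4), (1, 5), (2, 6), (3, 7)] * Yl [(0, 5), (1, 6), (2, 4), (3, 7)] * Yl [(0, 6), (1, 4), (2, 5), (3, 7)]
    - Yl [(0, 5), (1, 4), (2, 6), (3, 7)] * Yl [(0, 6), (1, 5), (2, 4), (3, 7)] * Yl [(0, 4), (1, 6), (2, 5), (3, 7)] \<in> J"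
  (is "?f \<in> J")
proof -
  define Q where "Q a = D (ball_sets ! a) (s3 :: (14, int) mpoly)" for a
  note Qe = D_ball_s3[where ?'k = int, folded Q_def]
  have "?f = u 0 * (- Q 0 - Q 1 - Q 2 - Q 3) + u 1 * (Q 1) + u 2 * (Q 2) + u 3 * (Q 3) + u 4 * (- Q 1 - Q 4 - Q 6 - Q 7) + u 5 * (- Q 2 - Q 5 - Q 6 - Q 8) + u 6 * (Q 6) + u 7 * (Q 7) + u 8 * (Q 8) + u 9 * (- Q 1 - Q 9 - Q 10 - Q 11) + u 10 * (Q 10) + u 11 * (Q 11) + u 12 * (- Q 6 - Q 10 - Q 12 - Q 13) + u 13 * (Q 13) - s3"
    unfolding Qe s3_def by (simp add: Yl_eval) (simp add: algebra_simps)
  also have "\<dots> \<in> J"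
    by (intro J_add J_diff J_uminus J_mult J_s3) (simp_all add: Q_def J_D_ball_s3)
  finally show ?thesis .
qed

lemma three_move_D_standard:
  "Yl [(0, 4), (1, 5), (2, 7), (3, 6)] * Yl [(0, 4), (1, 7), (2, 6), (3, 5)] * Yl [(0, 5), (1, 6), (2, 4), (3, 7)]
    - Yl [(0, 4), (1, 5), (2, 6), (3, 7)] * Yl [(0, 4), (1, 6), (2, 7), (3, 5)] * Yl [(0, 5), (1, 7), (2, 4), (3, 6)] \<in> J"
  (is "?f \<in> J")
proof -
  define Q where "Q a = D (ball_sets ! a) (s3 :: (14, int) mpoly)" for a
  note Qe = D_ball_s3[where ?'k = int, folded Q_def]
  have "?f = u 0 * (Q 0 + Q 1 + Q 4 + Q 9 + Q 10) + u 2 * (Q 2 + Q 6) + u 3 * (Q 1 + Q 3 + Q 7 + Q 11) + u 5 * (Q 5) + u 8 * (Q 8) - s3"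
    unfolding Qe s3_def by (simp add: Yl_eval) (simp add: algebra_simps)
  also have "\<dots> \<in> J"
    by (intro J_add J_diff J_uminus J_mult J_s3) (simp_all add: Q_def J_D_ball_s3)
  finally show ?thesis .
qed

lemma three_move_C:
  assumes "rows a b' c d" "columns p q r s"
  shows "cong (PY {#M4 a b' c d p q r s, M4 a b' c d q r p s, M4 a b' c d r p q s#})
    (PY {#M4 a b' c d q p r s, M4 a b' c d r q p s, M4 a b' c d p r q s#})"
proof -
  from perm8[OF rows_columns_distinct[OF assms]] obtain \<sigma> where \<sigma>: "\<sigma> permutes UNIV" "\<sigma> 0 = a" "\<sigma> 1 = b'" "\<sigma> 2 = c" "\<sigma> 3 = d"
    "\<sigma> 4 = p" "\<sigma> 5 = q" "\<sigma> 6 = r" "\<sigma> 7 = s" by blast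
  show ?thesis using J_act[OF \<sigma>(1) three_move_C_standard]
    by (simp add: is_hom_simps is_hom_act act_Yl[OF \<sigma>(1)] is_match_def \<sigma>(2-) cong_def PY_add_mset Ym_M4 mult.assoc)
qed

lemma three_move_D:
  assumes "rows a b' c d" "columns p q r s"
  shows "cong (PY {#M4 a b' c d p q s r, M4 a b' c d p s r q, M4 a b' c d q r p s#})
    (PY {#M4 a b' c d p q r s, M4 a b' c d p r s q, M4 a b' c d q s p r#})"
proof -
  from perm8[OF rows_columns_distinct[OF assms]] obtain \<sigma> where \<sigma>: "\<sigma> permutes UNIV" "\<sigma> 0 = a" "\<sigma> 1 = b'" "\<sigma> 2 = c" "\<sigma> 3 = d"
    "\<sigma> 4 = p" "\<sigma> 5 = q" "\<sigma> 6 = r" "\<sigma> 7 = s" by blast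
  show ?thesis using J_act[OF \<sigma>(1) three_move_D_standard]
    by (simp add: is_hom_simps is_hom_act act_Yl[OF \<sigma>(1)] is_match_def \<sigma>(2-) cong_def PY_add_mset Ym_M4 mult.assoc)
qed

lemma Yl_flip: "Yl [(p, a), (q, b'), (r, c), (s, d)] = Ym {#(a, p), (b', q), (c, r), (d, s)#}"
  by (simp add: Yl_def Ym_def br_swap[of p a] br_swap[of q b'] br_swap[of r c] br_swap[of s d])

lemma three_move_D_dual:
  assumes "rows a b' c d" "columns p q r s"
  shows "cong (PY {#M4 a b' c d p q s r, M4 a b' c d p s r q, M4 a b' c d r p q s#})
    (PY {#M4 a b' c d p q r s, M4 a b' c d p s q r, M4 a b' c d r p s q#})"
proof -
  have "distinct [p, q, r, s, a, b', c, d]" using rows_columns_distinct[OF assms] by auto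
  from perm8[OF this] obtain \<sigma> where \<sigma>: "\<sigma> permutes UNIV" "\<sigma> 0 = p" "\<sigma> 1 = q" "\<sigma> 2 = r" "\<sigma> 3 = s"
    "\<sigma> 4 = a" "\<sigma> 5 = b'" "\<sigma> 6 = c" "\<sigma> 7 = d" by blast
  show ?thesis using J_act[OF \<sigma>(1) three_move_D_standard]
    by (simp add: is_hom_simps is_hom_act act_Yl[OF \<sigma>(1)] is_match_def \<sigma>(2-))
      (simp add: cong_def PY_add_mset Yl_flip M4_def add_mset_commute mult.assoc)
qed

text \<open>The decomposition \<open>F\<close> can be changed, within its congruence class, into one that contains \<open>\<tau>\<close>.\<close>

definition reaches :: "graph multiset \<Rightarrow> graph \<Rightarrow> bool" where
  "reaches F \<tau> \<longleftrightarrow> (\<exists>G. set_mset G \<subseteq> PM \<and> \<tau> \<in># G \<and> \<Sum>\<^sub># G = \<Sum>\<^sub># F \<and> cong (PY F) (PY G))"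

lemma reachesI:
  "cong (PY F) (PY G) \<Longrightarrow> set_mset G \<subseteq> PM \<Longrightarrow> \<tau> \<in># G \<Longrightarrow> \<Sum>\<^sub># G = \<Sum>\<^sub># F \<Longrightarrow> reaches F \<tau>"
  unfolding reaches_def by blast

text \<open>Two edges of \<open>\<tau>\<close> lie in the first matching and one each in the others. The sixteen configurations of the remaining edges are settled by one or two exchanges.\<close>

lemma reaches_three:
  assumes R: "rows a b' c d" and C: "columns p q r s"
    and x: "columns x0 x1 r x3" "x3 \<noteq> s" and z: "columns z0 z1 z2 s" "z2 \<noteq> r"
  shows "reaches {#M4 a b' c d p q s r, M4 a b' c d x0 x1 r x3, M4 a b' c d z0 z1 z2 s#} (M4 a b' c d p q r s)"
proof -
  note R = R rows_swap and C = C columns_swap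
  have xs: "(x0, x1, x3) \<in> {(p, s, q), (q, s, p), (s, p, q), (s, q, p)}"
    and zs: "(z0, z1, z2) \<in> {(p, r, q), (q, r, p), (r, p, q), (r, q, p)}"
  proof -
    have e: "{x0, x1, r, x3} = {p, q, r, s}" "{z0, z1, z2, s} = {p, q, r, s}" using C(1) x z by (simp_all add: columns_def)
    have d: "distinct [p, q, r, s]" "distinct [x0, x1, r, x3]" "distinct [z0, z1, z2, s]" using C(1) x z by (simp_all add: columns_def)
    have "x0 \<in> {p, q, s}" "x1 \<in> {p, q, s}" "x3 \<in> {p, q}" "z0 \<in> {p, q, r}" "z1 \<in> {p, q, r}" "z2 \<in> {p, q}"
      using e d x z by auto
    then show "(x0, x1, x3) \<in> {(p, s, q), (q, s, p), (s, p, q), (s, q, p)}"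
      "(z0, z1, z2) \<in> {(p, r, q), (q, r, p), (r, p, q), (r, q, p)}"
      using d by auto
  qed
  have True ..
  moreover have "reaches {#M4 a b' c d p q s r, M4 a b' c d p s r q, M4 a b' c d p r q s#} (M4 a b' c d p q r s)"
  proof -
    have c1: "cong (PY {#M4 a b' c d p q s r, M4 a b' c d p s r q, M4 a b' c d p r q s#}) (PY {#M4 a b' c d p q r s, M4 a b' c d p r s q, M4 a b' c d p s q r#})"
      using cong_sym[OF three_move_C[of b' c d a q r s p]] R C by (simp add: M4_def add_mset_commute)
    show ?thesis by (rule reachesI[OF c1]) (use R C in \<open>auto simp: M4_PM\<close>, simp_all add: M4_def add_mset_commute)
  qed
  moreover have "reaches {#M4 a b' c d p q s r, M4 a b' c d p s r q, M4 a b' c d q r p s#} (M4 a b' c d p q r s)"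
  proof -
    have c1: "cong (PY {#M4 a b' c d p q s r, M4 a b' c d p s r q, M4 a b' c d q r p s#}) (PY {#M4 a b' c d p q r s, M4 a b' c d p r s q, M4 a b' c d q s p r#})"
      using three_move_D[of a d c b' p q s r] R C by (simp add: M4_def add_mset_commute)
    show ?thesis by (rule reachesI[OF c1]) (use R C in \<open>auto simp: M4_PM\<close>, simp_all add: M4_def add_mset_commute)
  qed
  moreover have "reaches {#M4 a b' c d p q s r, M4 a b' c d p s r q, M4 a b' c d r p q s#} (M4 a b' c d p q r s)"
  proof -
    have c1: "cong (PY {#M4 a b' c d p q s r, M4 a b' c d p s r q, M4 a b' c d r p q s#}) (PY {#M4 a b' c d p q r s, M4 a b' c d p s q r, M4 a b' c d r p s q#})"
      using three_move_D_dual[of a b' d c p s r q] R C by (simp add: M4_def add_mset_commute)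
    show ?thesis by (rule reachesI[OF c1]) (use R C in \<open>auto simp: M4_PM\<close>, simp_all add: M4_def add_mset_commute)
  qed
  moreover have "reaches {#M4 a b' c d p q s r, M4 a b' c d p s r q, M4 a b' c d r q p s#} (M4 a b' c d p q r s)"
  proof -
    have c1: "cong (PY {#M4 a b' c d p q s r, M4 a b' c d p s r q, M4 a b' c d r q p s#}) (PY {#M4 a b' c d p q r s, M4 a b' c d r s p q, M4 a b' c d p q s r#})"
      using cong_PY_add[OF two_move[of a c b' d p r s q], of "{#M4 a b' c d p q s r#}"] R C by (simp add: M4_def add_mset_commute)
    show ?thesis by (rule reachesI[OF c1]) (use R C in \<open>auto simp: M4_PM\<close>, simp_all add: M4_def add_mset_commute)
  qed
  moreover have "reaches {#M4 a b' c d p q s r, M4 a b' c d q s r p, M4 a b' c d p r q s#} (M4 a b' c d p q r s)"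
  proof -
    have c1: "cong (PY {#M4 a b' c d p q s r, M4 a b' c d q s r p, M4 a b' c d p r q s#}) (PY {#M4 a b' c d p q r s, M4 a b' c d p s q r, M4 a b' c d q r s p#})"
      using cong_sym[OF three_move_D_dual[of a d c b' p s q r]] R C by (simp add: M4_def add_mset_commute)
    show ?thesis by (rule reachesI[OF c1]) (use R C in \<open>auto simp: M4_PM\<close>, simp_all add: M4_def add_mset_commute)
  qed
  moreover have "reaches {#M4 a b' c d p q s r, M4 a b' c d q s r p, M4 a b' c d q r p s#} (M4 a b' c d p q r s)"
  proof -
    have c1: "cong (PY {#M4 a b' c d p q s r, M4 a b' c d q s r p, M4 a b' c d q r p s#}) (PY {#M4 a b' c d p q r s, M4 a b' c d q r s p, M4 a b' c d q s p r#})"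
      using cong_sym[OF three_move_D_dual[of a b' d c q s p r]] R C by (simp add: M4_def add_mset_commute)
    show ?thesis by (rule reachesI[OF c1]) (use R C in \<open>auto simp: M4_PM\<close>, simp_all add: M4_def add_mset_commute)
  qed
  moreover have "reaches {#M4 a b' c d p q s r, M4 a b' c d q s r p, M4 a b' c d r p q s#} (M4 a b' c d p q r s)"
  proof -
    have c1: "cong (PY {#M4 a b' c d p q s r, M4 a b' c d q s r p, M4 a b' c d r p q s#}) (PY {#M4 a b' c d q p r s, M4 a b' c d r s q p, M4 a b' c d p q s r#})"
      using cong_PY_add[OF two_move[of a c b' d q r s p], of "{#M4 a b' c d p q s r#}"] R C by (simp add: M4_def add_mset_commute)
    have c2: "cong (PY {#M4 a b' c d q p r s, M4 a b' c d r s q p, M4 a b' c d p q s r#}) (PY {#M4 a b' c d p q r s, M4 a b' c d q p s r, M4 a b' c d r s q p#})"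
      using cong_PY_add[OF two_move[of a b' c d p q s r], of "{#M4 a b' c d r s q p#}"] R C by (simp add: M4_def add_mset_commute)
    note c1 = cong_trans[OF c1 c2]
    show ?thesis by (rule reachesI[OF c1]) (use R C in \<open>auto simp: M4_PM\<close>, simp_all add: M4_def add_mset_commute)
  qed
  moreover have "reaches {#M4 a b' c d p q s r, M4 a b' c d q s r p, M4 a b' c d r q p s#} (M4 a b' c d p q r s)"
  proof -
    have c1: "cong (PY {#M4 a b' c d p q s r, M4 a b' c d q s r p, M4 a b' c d r q p s#}) (PY {#M4 a b' c d p q r s, M4 a b' c d q s p r, M4 a b' c d r q s p#})"
      using cong_sym[OF three_move_D[of b' d a c q s r p]] R C by (simp add: M4_def add_mset_commute)
    show ?thesis by (rule reachesI[OF c1]) (use R C in \<open>auto simp: M4_PM\<close>, simp_all add: M4_def add_mset_commute)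
  qed
  moreover have "reaches {#M4 a b' c d p q s r, M4 a b' c d s p r q, M4 a b' c d p r q s#} (M4 a b' c d p q r s)"
  proof -
    have c1: "cong (PY {#M4 a b' c d p q s r, M4 a b' c d s p r q, M4 a b' c d p r q s#}) (PY {#M4 a b' c d p q r s, M4 a b' c d p r s q, M4 a b' c d s p q r#})"
      using cong_sym[OF three_move_D[of a d b' c p s r q]] R C by (simp add: M4_def add_mset_commute)
    show ?thesis by (rule reachesI[OF c1]) (use R C in \<open>auto simp: M4_PM\<close>, simp_all add: M4_def add_mset_commute)
  qed
  moreover have "reaches {#M4 a b' c d p q s r, M4 a b' c d s p r q, M4 a b' c d q r p s#} (M4 a b' c d p q r s)"
  proof -
    have c1: "cong (PY {#M4 a b' c d p q s r, M4 a b' c d s p r q, M4 a b' c d q r p s#}) (PY {#M4 a b' c d q p r s, M4 a b' c d s r p q, M4 a b' c d p q s r#})"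
      using cong_PY_add[OF two_move[of a d b' c q s r p], of "{#M4 a b' c d p q s r#}"] R C by (simp add: M4_def add_mset_commute)
    have c2: "cong (PY {#M4 a b' c d q p r s, M4 a b' c d s r p q, M4 a b' c d p q s r#}) (PY {#M4 a b' c d p q r s, M4 a b' c d q p s r, M4 a b' c d s r p q#})"
      using cong_PY_add[OF two_move[of a b' c d p q s r], of "{#M4 a b' c d s r p q#}"] R C by (simp add: M4_def add_mset_commute)
    note c1 = cong_trans[OF c1 c2]
    show ?thesis by (rule reachesI[OF c1]) (use R C in \<open>auto simp: M4_PM\<close>, simp_all add: M4_def add_mset_commute)
  qed
  moreover have "reaches {#M4 a b' c d p q s r, M4 a b' c d s p r q, M4 a b' c d r p q s#} (M4 a b' c d p q r s)"
  proof -
    have c1: "cong (PY {#M4 a b' c d p q s r, M4 a b' c d s p r q, M4 a b' c d r p q s#}) (PY {#M4 a b' c d p q r s, M4 a b' c d r p s q, M4 a b' c d s p q r#})"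
      using cong_sym[OF three_move_D[of b' d a c p q s r]] R C by (simp add: M4_def add_mset_commute)
    show ?thesis by (rule reachesI[OF c1]) (use R C in \<open>auto simp: M4_PM\<close>, simp_all add: M4_def add_mset_commute)
  qed
  moreover have "reaches {#M4 a b' c d p q s r, M4 a b' c d s p r q, M4 a b' c d r q p s#} (M4 a b' c d p q r s)"
  proof -
    have c1: "cong (PY {#M4 a b' c d p q s r, M4 a b' c d s p r q, M4 a b' c d r q p s#}) (PY {#M4 a b' c d p q r s, M4 a b' c d r p s q, M4 a b' c d s q p r#})"
      using cong_sym[OF three_move_D_dual[of b' d c a q s p r]] R C by (simp add: M4_def add_mset_commute)
    show ?thesis by (rule reachesI[OF c1]) (use R C in \<open>auto simp: M4_PM\<close>, simp_all add: M4_def add_mset_commute)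
  qed
  moreover have "reaches {#M4 a b' c d p q s r, M4 a b' c d s q r p, M4 a b' c d p r q s#} (M4 a b' c d p q r s)"
  proof -
    have c1: "cong (PY {#M4 a b' c d p q s r, M4 a b' c d s q r p, M4 a b' c d p r q s#}) (PY {#M4 a b' c d p q r s, M4 a b' c d s r q p, M4 a b' c d p q s r#})"
      using cong_PY_add[OF two_move[of a d b' c p s r q], of "{#M4 a b' c d p q s r#}"] R C by (simp add: M4_def add_mset_commute)
    show ?thesis by (rule reachesI[OF c1]) (use R C in \<open>auto simp: M4_PM\<close>, simp_all add: M4_def add_mset_commute)
  qed
  moreover have "reaches {#M4 a b' c d p q s r, M4 a b' c d s q r p, M4 a b' c d q r p s#} (M4 a b' c d p q r s)"
  proof -
    have c1: "cong (PY {#M4 a b' c d p q s r, M4 a b' c d s q r p, M4 a b' c d q r p s#}) (PY {#M4 a b' c d p q r s, M4 a b' c d q r s p, M4 a b' c d s q p r#})"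
      using three_move_D_dual[of b' a d c q s r p] R C by (simp add: M4_def add_mset_commute)
    show ?thesis by (rule reachesI[OF c1]) (use R C in \<open>auto simp: M4_PM\<close>, simp_all add: M4_def add_mset_commute)
  qed
  moreover have "reaches {#M4 a b' c d p q s r, M4 a b' c d s q r p, M4 a b' c d r p q s#} (M4 a b' c d p q r s)"
  proof -
    have c1: "cong (PY {#M4 a b' c d p q s r, M4 a b' c d s q r p, M4 a b' c d r p q s#}) (PY {#M4 a b' c d p q r s, M4 a b' c d r q s p, M4 a b' c d s p q r#})"
      using three_move_D[of b' d c a q p s r] R C by (simp add: M4_def add_mset_commute)
    show ?thesis by (rule reachesI[OF c1]) (use R C in \<open>auto simp: M4_PM\<close>, simp_all add: M4_def add_mset_commute)
  qed
  moreover have "reaches {#M4 a b' c d p q s r, M4 a b' c d s q r p, M4 a b' c d r q p s#} (M4 a b' c d p q r s)"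
  proof -
    have c1: "cong (PY {#M4 a b' c d p q s r, M4 a b' c d s q r p, M4 a b' c d r q p s#}) (PY {#M4 a b' c d p q r s, M4 a b' c d r q s p, M4 a b' c d s q p r#})"
      using cong_sym[OF three_move_C[of a c d b' p r s q]] R C by (simp add: M4_def add_mset_commute)
    show ?thesis by (rule reachesI[OF c1]) (use R C in \<open>auto simp: M4_PM\<close>, simp_all add: M4_def add_mset_commute)
  qed

  ultimately show ?thesis using xs zs
    by (elim insertE emptyE Pair_inject; simp only:)
qed

end

section \<open>Perfect matchings with the same union\<close>

lemma rows_standard: "rows 0 1 2 3"
  by (auto simp: rows_def Pset_def)

lemma pair_mset_eq: "{#x, y#} = {#z, w#} \<longleftrightarrow> x = z \<and> y = w \<or> x = w \<and> y = z"
  by (auto simp: add_eq_conv_ex)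

lemma columns_two:
  assumes "columns p q r s" "columns p' q' r s"
  shows "p' = p \<and> q' = q \<or> p' = q \<and> q' = p"
proof -
  have "{p, q} = - Pset - {r, s}" "{p', q'} = - Pset - {r, s}" using assms by (auto simp: columns_def)
  then show ?thesis by (metis doubleton_eq_iff)
qed

lemma columns_two':
  assumes "columns p q r s" "columns p q r' s'"
  shows "r' = r \<and> s' = s \<or> r' = s \<and> s' = r"
proof -
  have "{r, s} = - Pset - {p, q}" "{r', s'} = - Pset - {p, q}" using assms by (auto simp: columns_def)
  then show ?thesis by (metis doubleton_eq_iff)
qed

lemma columns_one:
  "columns p q r s \<Longrightarrow> columns p' q r s \<Longrightarrow> p' = p" "columns p q r s \<Longrightarrow> columns p q' r s \<Longrightarrow> q' = q"
  "columns p q r s \<Longrightarrow> columns p q r' s \<Longrightarrow> r' = r" "columns p q r s \<Longrightarrow> columns p q r s' \<Longrightarrow> s' = s"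
  by (auto simp: columns_def)

lemma M4_swap: "M4 b a c d q p r s = M4 a b c d p q r s" "M4 a c b d p r q s = M4 a b c d p q r s"
  "M4 a b d c p q s r = M4 a b c d p q r s"
  by (simp_all add: M4_def add_mset_commute)

lemma PM_gends: "\<mu> \<in> PM \<Longrightarrow> gends \<mu> = alld 1" and PM_bip: "\<mu> \<in> PM \<Longrightarrow> bip \<mu>"
  by (simp_all add: PM_def)

lemma M4_mem:
  assumes "rows a b c d"
  shows "(a, x) \<in># M4 a b c d p q r s \<longleftrightarrow> x = p" "(b, x) \<in># M4 a b c d p q r s \<longleftrightarrow> x = q"
    "(c, x) \<in># M4 a b c d p q r s \<longleftrightarrow> x = r" "(d, x) \<in># M4 a b c d p q r s \<longleftrightarrow> x = s"
  using assms by (auto simp: M4_def rows_def)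

lemma PM_subset_eq:
  assumes "\<tau> \<in> PM" "\<sigma> \<in> PM" "set_mset \<tau> \<subseteq> set_mset \<sigma>"
  shows "\<tau> = \<sigma>"
proof -
  obtain p q r s where \<tau>: "\<tau> = M4 0 1 2 3 p q r s" using PM_M4[OF assms(1) rows_standard] by blast
  obtain p' q' r' s' where \<sigma>: "\<sigma> = M4 0 1 2 3 p' q' r' s'" using PM_M4[OF assms(2) rows_standard] by blast
  have "{(0, p), (1, q), (2, r), (3, s)} \<subseteq> set_mset \<sigma>" using assms(3) by (simp add: \<tau> M4_def)
  then have "p = p'" "q = q'" "r = r'" "s = s'" using M4_mem[OF rows_standard] by (auto simp: \<sigma>)
  then show ?thesis by (simp add: \<tau> \<sigma>)
qed

lemma PM_mset_subset:
  assumes "\<tau> \<in> PM" "set_mset \<tau> \<subseteq> set_mset m"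
  shows "\<tau> \<subseteq># m"
proof -
  obtain p q r s where \<tau>: "\<tau> = M4 0 1 2 3 p q r s" using PM_M4[OF assms(1) rows_standard] by blast
  have "\<tau> = mset_set (set_mset \<tau>)"
    by (simp add: \<tau> M4_def)
  also have "\<dots> \<subseteq># mset_set (set_mset m)" using assms(2) by (simp add: subset_imp_msubset_mset_set)
  also have "\<dots> \<subseteq># m" by (rule mset_set_set_mset_msubset)
  finally show ?thesis .
qed

lemma complete_rows: "distinct [i, j, k] \<Longrightarrow> {i, j, k} \<subseteq> Pset \<Longrightarrow> \<exists>l. rows i j k l"
proof -
  assume d: "distinct [i, j, k]" and s: "{i, j, k} \<subseteq> Pset"
  have "card (Pset - {i, j, k}) = 1" using d s by (subst card_Diff_subset) (auto simp: card_Pset)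
  then obtain l where "Pset - {i, j, k} = {l}" by (metis card_1_singletonE)
  then have "rows i j k l" using d s by (auto simp: rows_def)
  then show ?thesis ..
qed

lemma three_edges:
  assumes "\<tau> \<in> PM" "e1 \<in># \<tau>" "e2 \<in># \<tau>" "e3 \<in># \<tau>" "e1 \<noteq> e2" "e1 \<noteq> e3" "e2 \<noteq> e3"
  shows "\<exists>a b c d p q r s. rows a b c d \<and> columns p q r s \<and> e1 = (a, p) \<and> e2 = (c, r) \<and> e3 = (d, s) \<and>
    \<tau> = M4 a b c d p q r s"
proof -
  obtain p q r s where \<tau>: "\<tau> = M4 0 1 2 3 p q r s" using PM_M4[OF assms(1) rows_standard] by blast
  have P: "fst e \<in> Pset" if "e \<in># \<tau>" for e using that PM_bip[OF assms(1)] by (auto simp: bip_def)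
  have f: "fst e \<noteq> fst e'" if "e \<in># \<tau>" "e' \<in># \<tau>" "e \<noteq> e'" for e e'
    using that by (auto simp: \<tau> M4_def)
  have "\<exists>b. rows (fst e1) b (fst e2) (fst e3)"
    using complete_rows[of "fst e1" "fst e2" "fst e3"] P assms(2-4) f[OF assms(2,3,5)] f[OF assms(2,4,6)] f[OF assms(3,4,7)]
    by (auto simp: rows_def insert_commute)
  then obtain b where R: "rows (fst e1) b (fst e2) (fst e3)" ..
  from PM_M4[OF assms(1) R] obtain p q r s where c: "columns p q r s"
    "\<tau> = M4 (fst e1) b (fst e2) (fst e3) p q r s" by blast
  have "(fst e1, snd e1) \<in># \<tau>" "(fst e2, snd e2) \<in># \<tau>" "(fst e3, snd e3) \<in># \<tau>" using assms by simp_all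
  then have "snd e1 = p" "snd e2 = r" "snd e3 = s" by (simp_all only: c(2) M4_mem[OF R])
  then show ?thesis using R c by (metis prod.collapse)
qed

context eight_points
begin

lemma fiber2_aux:
  assumes R: "rows a b' c d" and C: "columns p q r s" "columns p' q' r' s'" "columns p' q' r s"
  shows "cong (PY {#M4 a b' c d p q r s, M4 a b' c d p' q' r' s'#}) (PY {#M4 a b' c d p' q' r s, M4 a b' c d p q r' s'#})"
proof -
  have "p' = p \<and> q' = q \<or> p' = q \<and> q' = p" by (rule columns_two[OF C(1,3)])
  moreover have "r' = r \<and> s' = s \<or> r' = s \<and> s' = r" by (rule columns_two'[OF C(3,2)])
  moreover have "cong (PY {#M4 a b' c d p q r s, M4 a b' c d q p s r#}) (PY {#M4 a b' c d q p r s, M4 a b' c d p q s r#})"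
    using two_move[OF R C(1)] by (simp add: add_mset_commute)
  ultimately show ?thesis by (auto simp: add_mset_commute cong_refl)
qed

text \<open>Two matchings with the same union as two others differ from them by exchanging a set of rows; only exchanges of two rows are not forced by the columns.\<close>

lemma fiber2:
  assumes "\<mu> \<in> PM" "\<mu>' \<in> PM" "\<nu> \<in> PM" "\<nu>' \<in> PM" and eq: "\<mu> + \<mu>' = \<nu> + \<nu>'"
  shows "cong (PY {#\<mu>, \<mu>'#}) (PY {#\<nu>, \<nu>'#})"
proof -
  note R = rows_standard
  obtain p q r s where \<mu>: "columns p q r s" "\<mu> = M4 0 1 2 3 p q r s" using PM_M4[OF assms(1) R] by blast
  obtain p' q' r' s' where \<mu>': "columns p' q' r' s'" "\<mu>' = M4 0 1 2 3 p' q' r' s'" using PM_M4[OF assms(2) R] by blast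
  obtain x y z w where \<nu>: "columns x y z w" "\<nu> = M4 0 1 2 3 x y z w" using PM_M4[OF assms(3) R] by blast
  obtain x' y' z' w' where \<nu>': "columns x' y' z' w'" "\<nu>' = M4 0 1 2 3 x' y' z' w'" using PM_M4[OF assms(4) R] by blast
  have e: "image_mset snd (filter_mset (\<lambda>e. fst e = i) (\<mu> + \<mu>')) = image_mset snd (filter_mset (\<lambda>e. fst e = i) (\<nu> + \<nu>'))" for i
    by (simp only: eq)
  have 0: "x = p \<and> x' = p' \<or> x = p' \<and> x' = p"
    using e[of 0] by (simp add: \<mu> \<mu>' \<nu> \<nu>' M4_def pair_mset_eq) auto
  have 1: "y = q \<and> y' = q' \<or> y = q' \<and> y' = q"
    using e[of 1] by (simp add: \<mu> \<mu>' \<nu> \<nu>' M4_def pair_mset_eq) auto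
  have 2: "z = r \<and> z' = r' \<or> z = r' \<and> z' = r"
    using e[of 2] by (simp add: \<mu> \<mu>' \<nu> \<nu>' M4_def pair_mset_eq) auto
  have 3: "w = s \<and> w' = s' \<or> w = s' \<and> w' = s"
    using e[of 3] by (simp add: \<mu> \<mu>' \<nu> \<nu>' M4_def pair_mset_eq) auto
  let ?M = "M4 0 1 2 3"
  \<comment> \<open>Up to exchanging the two matchings on the right, at most two rows are exchanged, among them not the last.\<close>
  have key: "cong (PY {#\<mu>, \<mu>'#}) (PY {#?M x y z s, ?M x' y' z' s'#})"
    if C: "columns x y z s" "columns x' y' z' s'" and 0: "x = p \<and> x' = p' \<or> x = p' \<and> x' = p"
      and 1: "y = q \<and> y' = q' \<or> y = q' \<and> y' = q" and 2: "z = r \<and> z' = r' \<or> z = r' \<and> z' = r" for x y z x' y' z'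
  proof -
    have a1: "cong (PY {#?M p q r s, ?M p' q' r' s'#}) (PY {#?M p' q' r s, ?M p q r' s'#})" if "columns p' q' r s"
      using fiber2_aux[OF R \<mu>(1) \<mu>'(1) that] .
    have a2: "cong (PY {#?M p q r s, ?M p' q' r' s'#}) (PY {#?M p' q r' s, ?M p q' r s'#})" if "columns p' q r' s"
      using fiber2_aux[of 0 2 1 3 p r q s p' r' q' s'] R \<mu>(1) \<mu>'(1) that by (simp add: rows_swap columns_swap M4_swap)
    have a3: "cong (PY {#?M p q r s, ?M p' q' r' s'#}) (PY {#?M p q' r' s, ?M p' q r s'#})" if "columns p q' r' s"
      using fiber2_aux[of 1 2 0 3 q r p s q' r' p' s'] R \<mu>(1) \<mu>'(1) that
      by (simp add: M4_def add_mset_commute rows_def columns_def insert_commute) argo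
    have b0: "p' = p" if "columns p' q r s" using columns_one(1)[OF \<mu>(1) that] .
    have b1: "q' = q" if "columns p q' r s" using columns_one(2)[OF \<mu>(1) that] .
    have b2: "r' = r" if "columns p q r' s" using columns_one(3)[OF \<mu>(1) that] .
    have b3: "s' = s" if "columns p' q' r' s" using columns_one(4)[OF \<mu>'(1) that] by simp
    from 0 1 2 show ?thesis
    proof (elim disjE conjE)
      assume e: "x = p" "x' = p'" "y = q" "y' = q'" "z = r" "z' = r'"
      show ?thesis unfolding \<mu>(2) \<mu>'(2) e by (rule cong_refl)
    next
      assume e: "x = p" "x' = p'" "y = q" "y' = q'" "z = r'" "z' = r"
      have "r' = r" using b2 C(1) unfolding e .
      then show ?thesis unfolding \<mu>(2) \<mu>'(2) e by (simp only: cong_refl)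
    next
      assume e: "x = p" "x' = p'" "y = q'" "y' = q" "z = r" "z' = r'"
      have "q' = q" using b1 C(1) unfolding e .
      then show ?thesis unfolding \<mu>(2) \<mu>'(2) e by (simp only: cong_refl)
    next
      assume e: "x = p" "x' = p'" "y = q'" "y' = q" "z = r'" "z' = r"
      show ?thesis using a3 C(1) unfolding \<mu>(2) \<mu>'(2) e .
    next
      assume e: "x = p'" "x' = p" "y = q" "y' = q'" "z = r" "z' = r'"
      have "p' = p" using b0 C(1) unfolding e .
      then show ?thesis unfolding \<mu>(2) \<mu>'(2) e by (simp only: cong_refl)
    next
      assume e: "x = p'" "x' = p" "y = q" "y' = q'" "z = r'" "z' = r"
      show ?thesis using a2 C(1) unfolding \<mu>(2) \<mu>'(2) e .
    next
      assume e: "x = p'" "x' = p" "y = q'" "y' = q" "z = r" "z' = r'"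
      show ?thesis using a1 C(1) unfolding \<mu>(2) \<mu>'(2) e .
    next
      assume e: "x = p'" "x' = p" "y = q'" "y' = q" "z = r'" "z' = r"
      have "s' = s" using b3 C(1) unfolding e .
      then show ?thesis unfolding \<mu>(2) \<mu>'(2) e by (simp only: add_mset_commute[of "?M p q r s"] cong_refl)
    qed
  qed
  from 3 show ?thesis
  proof (elim disjE conjE)
    assume "w = s" "w' = s'"
    then show ?thesis using key[OF _ _ 0 1 2] \<nu> \<nu>' by simp
  next
    assume "w = s'" "w' = s"
    then show ?thesis using key[of x' y' z' x y z] 0 1 2 \<nu> \<nu>' by (simp add: add_mset_commute) argo
  qed
qed

lemma reaches_self: "set_mset F \<subseteq> PM \<Longrightarrow> \<tau> \<in># F \<Longrightarrow> reaches F \<tau>"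
  by (rule reachesI[OF cong_refl]) auto

lemma reaches_trans:
  "cong (PY F) (PY F') \<Longrightarrow> \<Sum>\<^sub># F' = \<Sum>\<^sub># F \<Longrightarrow> reaches F' \<tau> \<Longrightarrow> reaches F \<tau>"
  unfolding reaches_def by (metis cong_trans)

lemma reaches_sub:
  assumes "reaches C \<tau>" "C \<subseteq># F" "set_mset F \<subseteq> PM"
  shows "reaches F \<tau>"
proof -
  obtain G where G: "set_mset G \<subseteq> PM" "\<tau> \<in># G" "\<Sum>\<^sub># G = \<Sum>\<^sub># C" "cong (PY C) (PY G)"
    using assms(1) unfolding reaches_def by blast
  have F: "F = C + (F - C)" using assms(2) by simp
  have "set_mset (F - C) \<subseteq> PM" using assms(3) in_diffD by fastforce
  moreover have "cong (PY F) (PY (G + (F - C)))" using cong_PY_add[OF G(4), of "F - C"] F by simp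
  moreover have "\<Sum>\<^sub># (G + (F - C)) = \<Sum>\<^sub># F" using G(3) F by (metis sum_mset.union)
  ultimately show ?thesis using G by (intro reachesI[of F "G + (F - C)"]) auto
qed

lemma reaches_two:
  assumes "\<sigma>1 \<in> PM" "\<sigma>2 \<in> PM" "\<tau> \<in> PM" "set_mset \<tau> \<subseteq> set_mset \<sigma>1 \<union> set_mset \<sigma>2"
  shows "reaches {#\<sigma>1, \<sigma>2#} \<tau>"
proof -
  have s: "\<tau> \<subseteq># \<sigma>1 + \<sigma>2" using PM_mset_subset[OF assms(3)] assms(4) by auto
  then obtain \<nu> where \<nu>: "\<sigma>1 + \<sigma>2 = \<tau> + \<nu>" by (metis subset_mset.le_iff_add)
  have "gends \<tau> + gends \<nu> = alld 1 + alld 1"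
    using \<nu> PM_gends assms(1,2) by (metis gends_add)
  then have "gends \<nu> = alld 1" by (simp add: PM_gends assms(3))
  moreover have "bip \<nu>" using \<nu> PM_bip assms(1,2) by (metis bip_add)
  ultimately have "\<nu> \<in> PM" by (simp add: PM_def)
  then show ?thesis
    by (intro reachesI[OF fiber2[OF assms(1,2,3) _ \<nu>]]) (use assms(3) \<nu> in \<open>simp_all add: \<nu>\<close>)
qed

lemma three_cover_labelled:
  assumes R: "rows a b' c d" and C: "columns p q r s" and S: "\<sigma>1 \<in> PM" "\<sigma>2 \<in> PM" "\<sigma>3 \<in> PM"
    and "(a, p) \<in># \<sigma>1" "(b', q) \<in># \<sigma>1" "(c, r) \<in># \<sigma>2" "(d, s) \<in># \<sigma>3"
    and "(c, r) \<notin># \<sigma>1" "(c, r) \<notin># \<sigma>3" "(d, s) \<notin># \<sigma>2"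
  shows "reaches {#\<sigma>1, \<sigma>2, \<sigma>3#} (M4 a b' c d p q r s)"
proof -
  obtain p' q' r' s' where 1: "columns p' q' r' s'" "\<sigma>1 = M4 a b' c d p' q' r' s'" using PM_M4[OF S(1) R] by blast
  obtain x0 x1 x2 x3 where 2: "columns x0 x1 x2 x3" "\<sigma>2 = M4 a b' c d x0 x1 x2 x3" using PM_M4[OF S(2) R] by blast
  obtain z0 z1 z2 z3 where 3: "columns z0 z1 z2 z3" "\<sigma>3 = M4 a b' c d z0 z1 z2 z3" using PM_M4[OF S(3) R] by blast
  have e: "p' = p" "q' = q" "r' \<noteq> r" "x2 = r" "x3 \<noteq> s" "z3 = s" "z2 \<noteq> r"
    using assms(6-) by (auto simp: 1(2) 2(2) 3(2) M4_mem[OF R])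
  then have "r' = s" "s' = r" using columns_two'[OF C, of r' s'] 1(1) by auto
  then show ?thesis using reaches_three[OF R C, of x0 x1 x3 z0 z1 z2] 2 3 1 e by simp
qed

text \<open>If two of the three matchings already contain \<open>\<tau>\<close> between them, its complement in their union is a matching. Otherwise each has an edge of \<open>\<tau>\<close> that the others miss.\<close>

lemma three_cover:
  assumes S: "\<sigma>1 \<in> PM" "\<sigma>2 \<in> PM" "\<sigma>3 \<in> PM" and T: "\<tau> \<in> PM"
    and c: "set_mset \<tau> \<subseteq> set_mset \<sigma>1 \<union> set_mset \<sigma>2 \<union> set_mset \<sigma>3"
  shows "reaches {#\<sigma>1, \<sigma>2, \<sigma>3#} \<tau>"
proof -
  have two: ?thesis if "set_mset \<tau> \<subseteq> set_mset \<sigma> \<union> set_mset \<sigma>'" "{#\<sigma>, \<sigma>'#} \<subseteq># {#\<sigma>1, \<sigma>2, \<sigma>3#}" "\<sigma> \<in> PM" "\<sigma>' \<in> PM" for \<sigma> \<sigma>'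
    by (rule reaches_sub[OF reaches_two[OF that(3,4) T that(1)] that(2)]) (use S in auto)
  show ?thesis
  proof (cases "set_mset \<tau> \<subseteq> set_mset \<sigma>2 \<union> set_mset \<sigma>3 \<or> set_mset \<tau> \<subseteq> set_mset \<sigma>1 \<union> set_mset \<sigma>3 \<or>
      set_mset \<tau> \<subseteq> set_mset \<sigma>1 \<union> set_mset \<sigma>2")
    case True
    then show ?thesis using two[of \<sigma>2 \<sigma>3] two[of \<sigma>1 \<sigma>3] two[of \<sigma>1 \<sigma>2] S
      by (auto simp: add_mset_commute[of \<sigma>1 \<sigma>2] add_mset_commute[of \<sigma>2 \<sigma>3])
  next
    case False
    then obtain e1 e2 e3 where e: "e1 \<in># \<tau>" "e1 \<notin># \<sigma>2" "e1 \<notin># \<sigma>3" "e2 \<in># \<tau>" "e2 \<notin># \<sigma>1" "e2 \<notin># \<sigma>3"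
      "e3 \<in># \<tau>" "e3 \<notin># \<sigma>1" "e3 \<notin># \<sigma>2" by blast
    then have e': "e1 \<in># \<sigma>1" "e2 \<in># \<sigma>2" "e3 \<in># \<sigma>3" using c by blast+
    then obtain a b' c' d p q r s where t: "rows a b' c' d" "columns p q r s" "e1 = (a, p)" "e2 = (c', r)" "e3 = (d, s)"
        "\<tau> = M4 a b' c' d p q r s"
      using three_edges[OF T e(1,4,7)] e by blast
    have R: "rows c' b' a d" "rows d b' c' a" and C: "columns r q p s" "columns s q r p"
      using t(1,2) by (auto simp: rows_def columns_def)
    have "(b', q) \<in># \<tau>" by (simp add: t(6) M4_def)
    then consider "(b', q) \<in># \<sigma>1" | "(b', q) \<in># \<sigma>2" | "(b', q) \<in># \<sigma>3" using c by blast
    then show ?thesis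
    proof cases
      case 1
      then show ?thesis using three_cover_labelled[OF t(1,2) S] e e' t(3-6) by simp
    next
      case 2
      have "reaches {#\<sigma>2, \<sigma>1, \<sigma>3#} (M4 c' b' a d r q p s)"
        using three_cover_labelled[OF R(1) C(1) S(2,1,3)] 2 e e' t(3-5) by simp
      then show ?thesis using t(6) by (simp add: M4_def add_mset_commute)
    next
      case 3
      have "reaches {#\<sigma>3, \<sigma>2, \<sigma>1#} (M4 d b' c' a s q r p)"
        using three_cover_labelled[OF R(2) C(2) S(3,2,1)] 3 e e' t(3-5) by simp
      then show ?thesis using t(6) by (simp add: M4_def add_mset_commute)
    qed
  qed
qed

lemma cover_reaches:
  assumes F: "set_mset F \<subseteq> PM" and T: "\<tau> \<in> PM" and C: "\<sigma>1 \<in># F" "\<sigma>2 \<in># F" "\<sigma>3 \<in># F"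
    and c: "set_mset \<tau> \<subseteq> set_mset \<sigma>1 \<union> set_mset \<sigma>2 \<union> set_mset \<sigma>3"
  shows "reaches F \<tau>"
proof -
  have P: "\<sigma>1 \<in> PM" "\<sigma>2 \<in> PM" "\<sigma>3 \<in> PM" using F C by auto
  have sub: "mset_set {\<sigma>1, \<sigma>2, \<sigma>3} \<subseteq># F"
    using C by (meson empty_subsetI finite_set_mset insert_subset mset_set_set_mset_msubset subset_imp_msubset_mset_set
        subset_mset.order_trans)
  have two: "reaches F \<tau>" if "\<sigma> \<noteq> \<sigma>'" "mset_set {\<sigma>, \<sigma>'} \<subseteq># F" "\<sigma> \<in> PM" "\<sigma>' \<in> PM" "set_mset \<tau> \<subseteq> set_mset \<sigma> \<union> set_mset \<sigma>'" for \<sigma> \<sigma>'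
    by (rule reaches_sub[OF reaches_two[OF that(3,4) T that(5)] _ F]) (use that in simp)
  consider "\<sigma>1 = \<sigma>2" "\<sigma>1 = \<sigma>3" | "\<sigma>1 = \<sigma>2" "\<sigma>1 \<noteq> \<sigma>3" | "\<sigma>1 \<noteq> \<sigma>2" "\<sigma>1 = \<sigma>3 \<or> \<sigma>2 = \<sigma>3" | "distinct [\<sigma>1, \<sigma>2, \<sigma>3]" by auto
  then show ?thesis
  proof cases
    case 1
    then have "\<tau> = \<sigma>1" using PM_subset_eq[OF T P(1)] c by auto
    then show ?thesis using reaches_self[OF F] C by simp
  next
    case 2
    then show ?thesis using two[of \<sigma>1 \<sigma>3] sub P c by simp
  next
    case 3
    moreover have "{\<sigma>1, \<sigma>2, \<sigma>3} = {\<sigma>1, \<sigma>2}" using 3 by auto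
    ultimately show ?thesis using two[of \<sigma>1 \<sigma>2] sub P c by (simp only:) blast
  next
    case 4
    then have "{#\<sigma>1, \<sigma>2, \<sigma>3#} \<subseteq># F" using sub by (simp add: add_mset_commute)
    then show ?thesis using reaches_sub[OF three_cover[OF P T c] _ F] by simp
  qed
qed

text \<open>Three matchings, each with one edge of a matching \<open>\<tau>\<close>, have a matching with two edges of \<open>\<tau>\<close> in their union:
  the columns of the fourth row and the rows of the fourth column each occupy at least two of the three lines of
  the edges, so some line can be exchanged with the fourth.\<close>

lemma exchange:
  assumes R: "rows a b' c d" and C: "columns p q r s" and S: "\<sigma>1 \<in> PM" "\<sigma>2 \<in> PM" "\<sigma>3 \<in> PM"
    and e: "(a, p) \<in># \<sigma>1" "(b', q) \<in># \<sigma>2" "(c, r) \<in># \<sigma>3"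
    and n: "(d, s) \<notin># \<sigma>1" "(d, s) \<notin># \<sigma>2" "(d, s) \<notin># \<sigma>3"
  defines "U \<equiv> set_mset \<sigma>1 \<union> set_mset \<sigma>2 \<union> set_mset \<sigma>3"
  shows "(d, p) \<in> U \<and> (a, s) \<in> U \<or> (d, q) \<in> U \<and> (b', s) \<in> U \<or> (d, r) \<in> U \<and> (c, s) \<in> U"
proof -
  obtain x0 x1 x2 x3 where 1: "columns x0 x1 x2 x3" "\<sigma>1 = M4 a b' c d x0 x1 x2 x3" using PM_M4[OF S(1) R] by blast
  obtain y0 y1 y2 y3 where 2: "columns y0 y1 y2 y3" "\<sigma>2 = M4 a b' c d y0 y1 y2 y3" using PM_M4[OF S(2) R] by blast
  obtain z0 z1 z2 z3 where 3: "columns z0 z1 z2 z3" "\<sigma>3 = M4 a b' c d z0 z1 z2 z3" using PM_M4[OF S(3) R] by blast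
  have x: "x0 = p" "x3 \<noteq> s" "y1 = q" "y3 \<noteq> s" "z2 = r" "z3 \<noteq> s"
    using e n by (simp_all add: 1(2) 2(2) 3(2) M4_mem[OF R])
  have 11: "x3 = q \<or> x3 = r" "x1 = s \<or> x2 = s" using 1(1) C x by (auto simp: columns_def)
  have 22: "y3 = p \<or> y3 = r" "y0 = s \<or> y2 = s" using 2(1) C x by (auto simp: columns_def)
  have 33: "z3 = p \<or> z3 = q" "z0 = s \<or> z1 = s" using 3(1) C x by (auto simp: columns_def)
  have m: "(a, x0) \<in> U" "(b', x1) \<in> U" "(c, x2) \<in> U" "(d, x3) \<in> U" "(a, y0) \<in> U" "(b', y1) \<in> U" "(c, y2) \<in> U" "(d, y3) \<in> U"
    "(a, z0) \<in> U" "(b', z1) \<in> U" "(c, z2) \<in> U" "(d, z3) \<in> U"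
    by (simp_all add: U_def 1(2) 2(2) 3(2) M4_def)
  show ?thesis using 11 22 33 m by metis
qed

text \<open>Choose matchings through the four edges of \<open>\<tau>\<close>. If three suffice, exchange them. Otherwise create a matching with two edges of \<open>\<tau>\<close>, after which three suffice.\<close>

lemma reaches_general:
  assumes F: "set_mset F \<subseteq> PM" and T: "\<tau> \<in> PM" and sub: "\<tau> \<subseteq># \<Sum>\<^sub># F"
  shows "reaches F \<tau>"
proof -
  note R = rows_standard
  obtain p q r s where C: "columns p q r s" and \<tau>: "\<tau> = M4 0 1 2 3 p q r s" using PM_M4[OF T R] by blast
  have mem: "\<exists>\<sigma>. \<sigma> \<in># F \<and> e \<in># \<sigma>" if "e \<in># \<Sum>\<^sub># F" for e using that by (auto simp: in_Union_mset_iff)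
  have \<tau>e: "set_mset \<tau> = {(0, p), (1, q), (2, r), (3, s)}" by (simp add: \<tau> M4_def)
  have in_sum: "e \<in># \<Sum>\<^sub># F" if "e \<in># \<tau>" for e using that sub by (rule mset_subset_eqD[rotated])
  obtain \<sigma>1 where 1: "\<sigma>1 \<in># F" "(0, p) \<in># \<sigma>1" using mem[OF in_sum[of "(0, p)"]] \<tau>e by blast
  obtain \<sigma>2 where 2: "\<sigma>2 \<in># F" "(1, q) \<in># \<sigma>2" using mem[OF in_sum[of "(1, q)"]] \<tau>e by blast
  obtain \<sigma>3 where 3: "\<sigma>3 \<in># F" "(2, r) \<in># \<sigma>3" using mem[OF in_sum[of "(2, r)"]] \<tau>e by blast
  obtain \<sigma>4 where 4: "\<sigma>4 \<in># F" "(3, s) \<in># \<sigma>4" using mem[OF in_sum[of "(3, s)"]] \<tau>e by blast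
  have P: "\<sigma>1 \<in> PM" "\<sigma>2 \<in> PM" "\<sigma>3 \<in> PM" "\<sigma>4 \<in> PM" using F 1 2 3 4 by auto
  let ?U = "set_mset \<sigma>1 \<union> set_mset \<sigma>2 \<union> set_mset \<sigma>3"
  show ?thesis
  proof (cases "distinct [\<sigma>1, \<sigma>2, \<sigma>3] \<and> (3, s) \<notin> ?U")
    case False
    show ?thesis
    proof (cases "(3, s) \<in> ?U")
      case True
      then show ?thesis using cover_reaches[OF F T 1(1) 2(1) 3(1)] 1 2 3 \<tau>e by auto
    next
      case n: False
      with False have "\<sigma>1 = \<sigma>2 \<or> \<sigma>1 = \<sigma>3 \<or> \<sigma>2 = \<sigma>3" by auto
      then show ?thesis
        using cover_reaches[OF F T 1(1) 3(1) 4(1)] cover_reaches[OF F T 1(1) 2(1) 4(1)] 1 2 3 4 \<tau>e by auto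
    qed
  next
    case True
    let ?C = "{#\<sigma>1, \<sigma>2, \<sigma>3#}"
    have "mset_set {\<sigma>1, \<sigma>2, \<sigma>3} \<subseteq># F"
      using 1 2 3 by (meson empty_subsetI finite_set_mset insert_subset mset_set_set_mset_msubset
          subset_imp_msubset_mset_set subset_mset.order_trans)
    then have CF: "?C \<subseteq># F" using True by (simp add: add_mset_commute)
    have "(3, p) \<in> ?U \<and> (0, s) \<in> ?U \<or> (3, q) \<in> ?U \<and> (1, s) \<in> ?U \<or> (3, r) \<in> ?U \<and> (2, s) \<in> ?U"
      using exchange[OF R C P(1-3) 1(2) 2(2) 3(2)] True by auto
    then obtain \<rho> e e' where \<rho>: "\<rho> \<in> PM" "set_mset \<rho> \<subseteq> ?U" and e: "e \<in># \<tau>" "e' \<in># \<tau>" "set_mset \<tau> \<subseteq> set_mset \<rho> \<union> {e, e'}"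
    proof (elim disjE conjE)
      assume "(3, p) \<in> ?U" "(0, s) \<in> ?U"
      moreover have "columns s q r p" using C by (auto simp: columns_def)
      ultimately show ?thesis
        using that[of "M4 0 1 2 3 s q r p" "(0, p)" "(3, s)"] M4_PM[OF R] 1 2 3 \<tau>e by (auto simp: M4_def)
    next
      assume "(3, q) \<in> ?U" "(1, s) \<in> ?U"
      moreover have "columns p s r q" using C by (auto simp: columns_def)
      ultimately show ?thesis
        using that[of "M4 0 1 2 3 p s r q" "(1, q)" "(3, s)"] M4_PM[OF R] 1 2 3 \<tau>e by (auto simp: M4_def)
    next
      assume "(3, r) \<in> ?U" "(2, s) \<in> ?U"
      moreover have "columns p q s r" using C by (auto simp: columns_def)
      ultimately show ?thesis
        using that[of "M4 0 1 2 3 p q s r" "(2, r)" "(3, s)"] M4_PM[OF R] 1 2 3 \<tau>e by (auto simp: M4_def)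
    qed
    have "reaches F \<rho>" by (rule reaches_sub[OF three_cover[OF P(1-3) \<rho>] CF F])
    then obtain G where G: "set_mset G \<subseteq> PM" "\<rho> \<in># G" "\<Sum>\<^sub># G = \<Sum>\<^sub># F" "cong (PY F) (PY G)"
      unfolding reaches_def by blast
    obtain \<sigma> \<sigma>' where "\<sigma> \<in># G" "\<sigma>' \<in># G" "e \<in># \<sigma>" "e' \<in># \<sigma>'"
      using in_sum[OF e(1)] in_sum[OF e(2)] unfolding G(3)[symmetric] by (auto simp: in_Union_mset_iff)
    then have "reaches G \<tau>" using cover_reaches[OF G(1) T G(2), of \<sigma> \<sigma>'] e(3) by auto
    then show ?thesis using reaches_trans G by blast
  qed
qed

text \<open>Split off the matchings of one decomposition from the other, one at a time.\<close>

theorem connected_fibres: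
  assumes "set_mset F \<subseteq> PM" "set_mset F' \<subseteq> PM" "\<Sum>\<^sub># F = \<Sum>\<^sub># F'"
  shows "cong (PY F) (PY F')"
  using assms
proof (induction F' arbitrary: F)
  case empty
  have "\<sigma> \<noteq> {#}" if "\<sigma> \<in># F" for \<sigma>
    using PM_gends[of \<sigma>] that empty(1) count_alld[of 1 0] by (metis count_empty gends_empty subsetD zero_neq_one)
  then have "F = {#}" using empty(3) by (cases F) auto
  then show ?case by (simp add: cong_refl)
next
  case (add \<tau> F')
  have "\<tau> \<subseteq># \<Sum>\<^sub># F" using add.prems(3) by simp
  then have "reaches F \<tau>" using reaches_general[OF add.prems(1), of \<tau>] add.prems(2) by simp
  then obtain G where G: "set_mset G \<subseteq> PM" "\<tau> \<in># G" "\<Sum>\<^sub># G = \<Sum>\<^sub># F" "cong (PY F) (PY G)"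
    unfolding reaches_def by blast
  then obtain G' where G': "G = add_mset \<tau> G'" by (meson mset_add)
  have "cong (PY G') (PY F')"
    by (rule add.IH) (use G G' add.prems in auto)
  then have "cong (PY G) (PY (add_mset \<tau> F'))" unfolding G' PY_add_mset by (rule cong_mult)
  with G(4) show ?case by (rule cong_trans)
qed

end

section \<open>Minors of bipartite graphs\<close>

lemma zspan_mult:
  fixes G :: "'a::comm_ring_1 set"
  assumes "x \<in> zspan G" "y \<in> zspan G" "\<And>g h. g \<in> G \<Longrightarrow> h \<in> G \<Longrightarrow> g * h \<in> G"
  shows "x * y \<in> zspan G"
proof -
  have 1: "g * y \<in> zspan G" if "g \<in> G" for g
    using assms(2) by induction
      (use that assms(3) in \<open>auto simp: distrib_left right_diff_distrib intro: zspan_zero zspan_add zspan_diff zspan_base\<close>)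
  from assms(1) show ?thesis
    by induction (auto simp: distrib_right left_diff_distrib intro: zspan_zero zspan_add zspan_diff 1)
qed

definition regular :: "graph \<Rightarrow> bool" where
  "regular m \<longleftrightarrow> bip m \<and> (\<exists>d. gends m = alld d)"

lemma regular_iff: "regular m \<longleftrightarrow> (\<exists>F. set_mset F \<subseteq> PM \<and> \<Sum>\<^sub># F = m)"
  unfolding regular_def using regular_factorization sum_PM by metis

text \<open>The numbers of edges between the rows and columns of a graph that becomes regular of degree \<open>d\<close> after three
  edges between the first three rows and columns are added, if the last row and column are not joined: \<open>a\<close> is the
  last row and \<open>b\<close> the last column. Some column and some row can be left out so that the other entries of \<open>a\<close> and
  \<open>b\<close> and the entry where they cross are positive. At most one entry of \<open>a\<close> and one of \<open>b\<close> vanish, which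
  dictates the choice, and counting shows that the crossing entry is then positive.\<close>

lemma five_entries:
  fixes a1 a2 a3 b1 b2 b3 n11 n12 n13 n21 n22 n23 n31 n32 n33 d :: nat
  assumes "n11 + n12 + n13 + b1 + 1 = d" "n21 + n22 + n23 + b2 + 1 = d" "n31 + n32 + n33 + b3 + 1 = d"
    "n11 + n21 + n31 + a1 + 1 = d" "n12 + n22 + n32 + a2 + 1 = d" "n13 + n23 + n33 + a3 + 1 = d"
    "a1 + a2 + a3 = d" "b1 + b2 + b3 = d"
  shows "a2 > 0 \<and> a3 > 0 \<and> (b2 > 0 \<and> b3 > 0 \<and> n11 > 0 \<or> b1 > 0 \<and> b3 > 0 \<and> n21 > 0 \<or> b1 > 0 \<and> b2 > 0 \<and> n31 > 0) \<or>
    a1 > 0 \<and> a3 > 0 \<and> (b2 > 0 \<and> b3 > 0 \<and> n12 > 0 \<or> b1 > 0 \<and> b3 > 0 \<and> n22 > 0 \<or> b1 > 0 \<and> b2 > 0 \<and> n32 > 0) \<or>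
    a1 > 0 \<and> a2 > 0 \<and> (b2 > 0 \<and> b3 > 0 \<and> n13 > 0 \<or> b1 > 0 \<and> b3 > 0 \<and> n23 > 0 \<or> b1 > 0 \<and> b2 > 0 \<and> n33 > 0)"
proof -
  have
    "\<not> (a1 = 0 \<and> a2 = 0)" "\<not> (a1 = 0 \<and> a3 = 0)" "\<not> (a2 = 0 \<and> a3 = 0)" "\<not> (b1 = 0 \<and> b2 = 0)"
    "\<not> (b1 = 0 \<and> b3 = 0)" "\<not> (b2 = 0 \<and> b3 = 0)" "\<not> (a1 = 0 \<and> b1 = 0 \<and> n11 = 0)" "\<not> (a1 = 0 \<and> b2 = 0 \<and> n21 = 0)"
    "\<not> (a1 = 0 \<and> b3 = 0 \<and> n31 = 0)" "\<not> (a2 = 0 \<and> b1 = 0 \<and> n12 = 0)" "\<not> (a2 = 0 \<and> b2 = 0 \<and> n22 = 0)" "\<not> (a2 = 0 \<and> b3 = 0 \<and> n32 = 0)"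
    "\<not> (a3 = 0 \<and> b1 = 0 \<and> n13 = 0)" "\<not> (a3 = 0 \<and> b2 = 0 \<and> n23 = 0)" "\<not> (a3 = 0 \<and> b3 = 0 \<and> n33 = 0)" "\<not> (a1 = 0 \<and> n11 = 0 \<and> n21 = 0 \<and> n31 = 0)"
    "\<not> (b1 = 0 \<and> n11 = 0 \<and> n12 = 0 \<and> n13 = 0)" "\<not> (a2 = 0 \<and> n12 = 0 \<and> n22 = 0 \<and> n32 = 0)" "\<not> (b2 = 0 \<and> n21 = 0 \<and> n22 = 0 \<and> n23 = 0)" "\<not> (a3 = 0 \<and> n13 = 0 \<and> n23 = 0 \<and> n33 = 0)"
    "\<not> (b3 = 0 \<and> n31 = 0 \<and> n32 = 0 \<and> n33 = 0)"
    by (rule notI, elim conjE, use assms in linarith)+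
  moreover have "\<not> (n11 = 0 \<and> n12 = 0 \<and> n13 = 0 \<and> n21 = 0 \<and> n22 = 0 \<and> n23 = 0 \<and> n31 = 0 \<and> n32 = 0 \<and> n33 = 0)"
  proof
    assume "n11 = 0 \<and> n12 = 0 \<and> n13 = 0 \<and> n21 = 0 \<and> n22 = 0 \<and> n23 = 0 \<and> n31 = 0 \<and> n32 = 0 \<and> n33 = 0"
    then have "b1 + 1 = d" "b2 + 1 = d" "b3 + 1 = d" using assms(1-3) by simp_all
    then have "2 * b1 = 1" using assms(8) by linarith
    then show False by presburger
  qed
  ultimately show ?thesis unfolding neq0_conv[symmetric] by argo
qed

lemma d3_rows: "d3 j i k u v w = - d3 i j k u v w" "d3 i k j u v w = - d3 i j k u v w"
  "d3 i j k v u w = - d3 i j k u v w" "d3 i j k u w v = - d3 i j k u v w"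
  by (simp_all add: d3_def algebra_simps)

lemma d3_eq_0: "\<not> distinct [i, j, k] \<or> \<not> distinct [u, v, w] \<Longrightarrow> d3 i j k u v w = 0"
  by (auto simp: d3_def algebra_simps)

lemma complete_columns: "distinct [u, v, w] \<Longrightarrow> {u, v, w} \<subseteq> - Pset \<Longrightarrow> \<exists>x. columns u v w x"
proof -
  assume d: "distinct [u, v, w]" and s: "{u, v, w} \<subseteq> - Pset"
  have "card (- Pset - {u, v, w}) = 1" using d s by (subst card_Diff_subset) (auto simp: card_compl_Pset)
  then obtain x where "- Pset - {u, v, w} = {x}" by (metis card_1_singletonE)
  then have "columns u v w x" using d s by (auto simp: columns_def)
  then show ?thesis ..
qed

context eight_points
begin

text \<open>The product of the matchings in some decomposition; by connectedness its class modulo \<open>J\<close> depends on the graph alone. The value is zero on graphs that are not regular.\<close>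

definition psi :: "graph \<Rightarrow> (14, int) mpoly" where
  "psi m = (if regular m then PY (SOME F. set_mset F \<subseteq> PM \<and> \<Sum>\<^sub># F = m) else 0)"

lemma psi_cong: "set_mset F \<subseteq> PM \<Longrightarrow> cong (psi (\<Sum>\<^sub># F)) (PY F)"
proof -
  assume F: "set_mset F \<subseteq> PM"
  then have r: "regular (\<Sum>\<^sub># F)" by (auto simp: regular_iff)
  define F' where "F' = (SOME F'. set_mset F' \<subseteq> PM \<and> \<Sum>\<^sub># F' = \<Sum>\<^sub># F)"
  have "set_mset F' \<subseteq> PM \<and> \<Sum>\<^sub># F' = \<Sum>\<^sub># F" unfolding F'_def by (rule someI_ex) (use F in blast)
  then show ?thesis using connected_fibres[of F' F] F r by (simp add: psi_def F'_def)
qed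

lemma psi_cong_split:
  assumes "set_mset F \<subseteq> PM" "set_mset F' \<subseteq> PM" "m = \<Sum>\<^sub># F + \<Sum>\<^sub># F'"
  shows "psi m - PY F * PY F' \<in> J"
  using psi_cong[of "F + F'"] assms by (simp add: cong_def PY_union)

text \<open>The image under \<open>psi\<close> of a three-by-three minor times the graph \<open>n\<close>.\<close>

definition alt :: "graph \<Rightarrow> 8 \<Rightarrow> 8 \<Rightarrow> 8 \<Rightarrow> 8 \<Rightarrow> 8 \<Rightarrow> 8 \<Rightarrow> (14, int) mpoly" where
  "alt n i j k t v w = psi (n + {#(i, t), (j, v), (k, w)#}) - psi (n + {#(i, t), (j, w), (k, v)#})
     - psi (n + {#(i, v), (j, t), (k, w)#}) + psi (n + {#(i, v), (j, w), (k, t)#})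
     + psi (n + {#(i, w), (j, t), (k, v)#}) - psi (n + {#(i, w), (j, v), (k, t)#})"

lemma lext_psi_d3: "lext psi (Poly_Mapping.single n c * d3 i j k t v w) = of_int c * alt n i j k t v w"
  by (simp add: d3_def zz_def alt_def distrib_left right_diff_distrib mult_single lext_add lext_diff lext_single add_mset_commute)

text \<open>If the complementary edge is present, the alternating sum is linear: it is the image of a three-by-three
  minor of a matrix of rank two.\<close>

lemma alt_edge:
  assumes R: "rows i j k l" and C: "columns t v w x" and F: "set_mset F \<subseteq> PM" "\<Sum>\<^sub># F = n"
  shows "alt (add_mset (l, x) n) i j k t v w \<in> J"
proof -
  have C': "columns t v w x" "columns t w v x" "columns v t w x" "columns v w t x" "columns w t v x" "columns w v t x"
    using C by (auto simp: columns_def)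
  have P: "M4 i j k l p q r s \<in> PM" if "columns p q r s" for p q r s by (rule M4_PM[OF R that])
  have c: "psi (add_mset (l, x) n + {#(i, p), (j, q), (k, r)#}) - Ym (M4 i j k l p q r x) * PY F \<in> J"
    if "columns p q r x" for p q r
    using psi_cong_split[of "{#M4 i j k l p q r x#}" F] P[OF that] F
    by (simp add: M4_def PY_add_mset add_mset_commute)
  let ?Y = "\<lambda>p q r. Ym (M4 i j k l p q r x)"
  have g: "gev (M4 i j k l p q r x) \<in> R_deg 1" if "columns p q r x" for p q r
    using gev_in_R_deg[OF PM_gends[OF P[OF that]]] .
  have "?Y t v w - ?Y t w v - ?Y v t w + ?Y v w t + ?Y w t v - ?Y w v t =
      lin (gev (M4 i j k l t v w x) - gev (M4 i j k l t w v x) - gev (M4 i j k l v t w x) + gev (M4 i j k l v w t x)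
        + gev (M4 i j k l w t v x) - gev (M4 i j k l w v t x))"
    using C' by (simp only: Ym_def lin_add lin_diff R_deg_add R_deg_diff g)
  also have "gev (M4 i j k l t v w x) - gev (M4 i j k l t w v x) - gev (M4 i j k l v t w x) + gev (M4 i j k l v w t x)
        + gev (M4 i j k l w t v x) - gev (M4 i j k l w v t x) = 0"
    by (simp add: M4_def br_def algebra_simps)
  finally have z: "?Y t v w * PY F - ?Y t w v * PY F - ?Y v t w * PY F + ?Y v w t * PY F + ?Y w t v * PY F - ?Y w v t * PY F = 0"
    by (simp flip: distrib_right left_diff_distrib)
  have "alt (add_mset (l, x) n) i j k t v w =
      (psi (add_mset (l, x) n + {#(i, t), (j, v), (k, w)#}) - ?Y t v w * PY F)
    - (psi (add_mset (l, x) n + {#(i, t), (j, w), (k, v)#}) - ?Y t w v * PY F)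
    - (psi (add_mset (l, x) n + {#(i, v), (j, t), (k, w)#}) - ?Y v t w * PY F)
    + (psi (add_mset (l, x) n + {#(i, v), (j, w), (k, t)#}) - ?Y v w t * PY F)
    + (psi (add_mset (l, x) n + {#(i, w), (j, t), (k, v)#}) - ?Y w t v * PY F)
    - (psi (add_mset (l, x) n + {#(i, w), (j, v), (k, t)#}) - ?Y w v t * PY F) + 0"
    unfolding z[symmetric] alt_def by (simp add: algebra_simps)
  also have "\<dots> \<in> J" by (intro J_add J_diff J_zero c C')
  finally show ?thesis .
qed

text \<open>The alternating sum over the two-regular graphs that contain five given edges is a difference of two of
  the quadrics.\<close>

lemma alt_quadric_standard:
  "Yl [(0, 4), (1, 7), (2, 6), (3, 5)] * Yl [(0, 7), (1, 5), (2, 6), (3, 4)]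
    - Yl [(0, 7), (1, 6), (2, 5), (3, 4)] * Yl [(0, 4), (1, 7), (2, 6), (3, 5)]
    - Yl [(0, 5), (1, 7), (2, 6), (3, 4)] * Yl [(0, 7), (1, 4), (2, 6), (3, 5)]
    + Yl [(0, 5), (1, 7), (2, 6), (3, 4)] * Yl [(0, 7), (1, 6), (2, 4), (3, 5)]
    + Yl [(0, 6), (1, 7), (2, 5), (3, 4)] * Yl [(0, 7), (1, 4), (2, 6), (3, 5)]
    - Yl [(0, 6), (1, 7), (2, 4), (3, 5)] * Yl [(0, 7), (1, 5), (2, 6), (3, 4)] \<in> J"
  (is "?f \<in> J")
proof -
  have "?f = quad (transpose 3 7) - quad (transpose 2 6 \<circ> transpose 3 7)"
    unfolding quad_def by (simp add: transpose_def Yl_eval) (simp add: algebra_simps)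
  also have "\<dots> \<in> J" by (intro J_diff J_quad permutes_compose transpose_permutes)
  finally show ?thesis .
qed

lemma alt_quadric:
  assumes "rows a b' c d" "columns p q r s"
  defines "Y \<equiv> \<lambda>p q r s. Ym (M4 a b' c d p q r s)"
  shows "Y p s r q * Y s q r p - Y s r q p * Y p s r q - Y q s r p * Y s p r q + Y q s r p * Y s r p q
    + Y r s q p * Y s p r q - Y r s p q * Y s q r p \<in> J"
proof -
  from perm8[OF rows_columns_distinct[OF assms(1,2)]] obtain \<sigma> where \<sigma>: "\<sigma> permutes UNIV" "\<sigma> 0 = a" "\<sigma> 1 = b'" "\<sigma> 2 = c"
    "\<sigma> 3 = d" "\<sigma> 4 = p" "\<sigma> 5 = q" "\<sigma> 6 = r" "\<sigma> 7 = s" by blast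
  show ?thesis using J_act[OF \<sigma>(1) alt_quadric_standard]
    by (simp add: is_hom_simps is_hom_act act_Yl[OF \<sigma>(1)] is_match_def \<sigma>(2-) Y_def Ym_M4)
qed

lemma alt_five_edges:
  assumes R: "rows i j k l" and C: "columns t v w x" and F: "set_mset F \<subseteq> PM" "\<Sum>\<^sub># F = n"
  shows "alt (n + {#(l, t), (l, v), (i, x), (j, x), (k, w)#}) i j k t v w \<in> J"
proof -
  let ?M = "M4 i j k l" and ?n = "n + {#(l, t), (l, v), (i, x), (j, x), (k, w)#}"
  let ?Y = "\<lambda>p q r s. Ym (?M p q r s)"
  have C': "columns t x w v" "columns x v w t" "columns x w v t" "columns v x w t" "columns x t w v" "columns x w t v"
    "columns w x v t" "columns w x t v"
    using C by (auto simp: columns_def)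
  note P = M4_PM[OF R]
  have c: "psi m - PY {#\<mu>, \<mu>'#} * PY F \<in> J" if "\<mu> \<in> PM" "\<mu>' \<in> PM" "m = \<mu> + \<mu>' + n" for \<mu> \<mu>' m
    using psi_cong_split[of "{#\<mu>, \<mu>'#}" F] that F by (simp add: ac_simps)
  have c1: "psi (?n + {#(i, t), (j, v), (k, w)#}) - ?Y t x w v * ?Y x v w t * PY F \<in> J"
    using c[OF P[OF C'(1)] P[OF C'(2)], of "?n + {#(i, t), (j, v), (k, w)#}"] by (simp add: M4_def PY_add_mset add_mset_commute mult_ac)
  have c2: "psi (?n + {#(i, t), (j, w), (k, v)#}) - ?Y x w v t * ?Y t x w v * PY F \<in> J"
    using c[OF P[OF C'(3)] P[OF C'(1)], of "?n + {#(i, t), (j, w), (k, v)#}"] by (simp add: M4_def PY_add_mset add_mset_commute mult_ac)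
  have c3: "psi (?n + {#(i, v), (j, t), (k, w)#}) - ?Y v x w t * ?Y x t w v * PY F \<in> J"
    using c[OF P[OF C'(4)] P[OF C'(5)], of "?n + {#(i, v), (j, t), (k, w)#}"] by (simp add: M4_def PY_add_mset add_mset_commute mult_ac)
  have c4: "psi (?n + {#(i, v), (j, w), (k, t)#}) - ?Y v x w t * ?Y x w t v * PY F \<in> J"
    using c[OF P[OF C'(4)] P[OF C'(6)], of "?n + {#(i, v), (j, w), (k, t)#}"] by (simp add: M4_def PY_add_mset add_mset_commute mult_ac)
  have c5: "psi (?n + {#(i, w), (j, t), (k, v)#}) - ?Y w x v t * ?Y x t w v * PY F \<in> J"
    using c[OF P[OF C'(7)] P[OF C'(5)], of "?n + {#(i, w), (j, t), (k, v)#}"] by (simp add: M4_def PY_add_mset add_mset_commute mult_ac)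
  have c6: "psi (?n + {#(i, w), (j, v), (k, t)#}) - ?Y w x t v * ?Y x v w t * PY F \<in> J"
    using c[OF P[OF C'(8)] P[OF C'(2)], of "?n + {#(i, w), (j, v), (k, t)#}"] by (simp add: M4_def PY_add_mset add_mset_commute mult_ac)
  let ?q = "?Y t x w v * ?Y x v w t - ?Y x w v t * ?Y t x w v - ?Y v x w t * ?Y x t w v + ?Y v x w t * ?Y x w t v
    + ?Y w x v t * ?Y x t w v - ?Y w x t v * ?Y x v w t"
  have "alt ?n i j k t v w = (psi (?n + {#(i, t), (j, v), (k, w)#}) - ?Y t x w v * ?Y x v w t * PY F)
    - (psi (?n + {#(i, t), (j, w), (k, v)#}) - ?Y x w v t * ?Y t x w v * PY F)
    - (psi (?n + {#(i, v), (j, t), (k, w)#}) - ?Y v x w t * ?Y x t w v * PY F)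
    + (psi (?n + {#(i, v), (j, w), (k, t)#}) - ?Y v x w t * ?Y x w t v * PY F)
    + (psi (?n + {#(i, w), (j, t), (k, v)#}) - ?Y w x v t * ?Y x t w v * PY F)
    - (psi (?n + {#(i, w), (j, v), (k, t)#}) - ?Y w x t v * ?Y x v w t * PY F) + PY F * ?q"
    unfolding alt_def by (simp only: algebra_simps)
  also have "\<dots> \<in> J" by (intro J_add J_diff c1 c2 c3 c4 c5 c6 J_mult alt_quadric[OF R C])
  finally show ?thesis .
qed

lemma alt_eq: "alt n i j k t v w = lext psi (gmono n * d3 i j k t v w)"
  using lext_psi_d3[of n 1 i j k t v w] by simp

lemma alt_swap: "alt n j i k t v w = - alt n i j k t v w" "alt n i k j t v w = - alt n i j k t v w"
  "alt n i j k v t w = - alt n i j k t v w" "alt n i j k t w v = - alt n i j k t v w"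
  unfolding alt_eq d3_rows(1)[of j i k t v w] d3_rows(2)[of i k j t v w] d3_rows(3)[of i j k v t w] d3_rows(4)[of i j k t w v]
    mult_minus_right lext_uminus by (rule refl)+

lemma J_uminus_iff: "- x \<in> J \<longleftrightarrow> x \<in> J"
  using J_uminus[of x] J_uminus[of "- x"] by auto

lemma J_alt_swap: "alt n j i k t v w \<in> J \<longleftrightarrow> alt n i j k t v w \<in> J" "alt n i k j t v w \<in> J \<longleftrightarrow> alt n i j k t v w \<in> J"
  "alt n i j k v t w \<in> J \<longleftrightarrow> alt n i j k t v w \<in> J" "alt n i j k t w v \<in> J \<longleftrightarrow> alt n i j k t v w \<in> J"
  unfolding alt_swap(1)[of n j i k t v w] alt_swap(2)[of n i k j t v w] alt_swap(3)[of n i j k v t w] alt_swap(4)[of n i j k t w v]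
    J_uminus_iff by (rule refl)+

lemma J_alt_cycle: "alt n j k i t v w \<in> J \<longleftrightarrow> alt n i j k t v w \<in> J" "alt n i j k v w t \<in> J \<longleftrightarrow> alt n i j k t v w \<in> J"
  using J_alt_swap(1)[of n i j k t v w] J_alt_swap(2)[of n j i k t v w] J_alt_swap(3)[of n i j k t v w] J_alt_swap(4)[of n i j k v t w]
  by blast+

lemma alt_five_edges':
  assumes R: "rows i j k l" and C: "columns t v w x" and b: "bip n" and g: "gends n + {#i, t, j, v, k, w#} = alld d"
    and e: "(l, t) \<in># n" "(l, v) \<in># n" "(i, x) \<in># n" "(j, x) \<in># n" "(k, w) \<in># n"
  shows "alt n i j k t v w \<in> J"
proof -
  let ?\<kappa> = "{#(l, t), (l, v), (i, x), (j, x), (k, w)#}"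
  have "?\<kappa> = mset_set (set_mset ?\<kappa>)" using R C by (auto simp: rows_def columns_def)
  also have "\<dots> \<subseteq># mset_set (set_mset n)" using e by (intro subset_imp_msubset_mset_set) auto
  also have "\<dots> \<subseteq># n" by (rule mset_set_set_mset_msubset)
  finally obtain n' where n': "n = n' + ?\<kappa>" by (metis add.commute subset_mset.le_iff_add)
  have "gends ?\<kappa> + {#i, t, j, v, k, w#} = {#i, j, k, l, t, v, w, x#} + {#i, j, k, l, t, v, w, x#}"
    by (simp add: add_mset_commute)
  also have "{#i, j, k, l, t, v, w, x#} = gends (M4 i j k l t v w x)" by (simp add: M4_def add_mset_commute)
  also have "\<dots> = alld 1" by (rule PM_gends[OF M4_PM[OF R C]])
  finally have k: "gends ?\<kappa> + {#i, t, j, v, k, w#} = alld 1 + alld 1" .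
  have "gends n' + (gends ?\<kappa> + {#i, t, j, v, k, w#}) = alld d" using g unfolding n' gends_add by (simp only: add.assoc)
  then have "gends n' + (alld 1 + alld 1) = alld d" unfolding k .
  then have g': "gends n' + alld 2 = alld d" by (simp add: alld_add[symmetric])
  then have "count (gends n' + alld 2) i = d" for i by (simp del: count_union)
  then have "count (gends n') i = d - 2" for i by (metis add_diff_cancel_right' count_alld count_union)
  then have "gends n' = alld (d - 2)" by (intro multiset_eqI) simp
  moreover have "bip n'" using b by (simp add: n' bip_add)
  ultimately obtain F where "set_mset F \<subseteq> PM" "\<Sum>\<^sub># F = n'" using regular_factorization by metis
  then show ?thesis unfolding n' by (rule alt_five_edges[OF R C])
qed

text \<open>The graphs in a minor have the same degrees, so they are regular simultaneously. If the complementary edge of the minor is missing from \<open>n\<close>, counting degrees provides five edges of \<open>n\<close> for \<open>alt_five_edges\<close>.\<close>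

lemma alt_in_J: "alt n i j k t v w \<in> J"
proof (cases "distinct [i, j, k] \<and> distinct [t, v, w] \<and> regular (n + {#(i, t), (j, v), (k, w)#})")
  case False
  have same: "regular (n + {#(i, u'), (j, v'), (k, w')#}) = regular (n + {#(i, t), (j, v), (k, w)#})"
    if "(u', v', w') \<in> {(t, w, v), (v, t, w), (v, w, t), (w, t, v), (w, v, t)}" for u' v' w'
    using that unfolding regular_def by (auto simp: bip_add gends_add add_mset_commute)
  have "alt n i j k t v w = 0"
  proof (cases "distinct [i, j, k] \<and> distinct [t, v, w]")
    case True
    then have "\<not> regular (n + {#(i, t), (j, v), (k, w)#})" using False by blast
    then have "psi (n + {#(i, u'), (j, v'), (k, w')#}) = 0"
      if "(u', v', w') \<in> {(t, v, w), (t, w, v), (v, t, w), (v, w, t), (w, t, v), (w, v, t)}" for u' v' w'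
      using same that unfolding psi_def by auto
    then show ?thesis unfolding alt_def by simp
  next
    case False
    then show ?thesis using lext_psi_d3[of n 1 i j k t v w] d3_eq_0 by simp
  qed
  then show ?thesis by (simp add: J_zero)
next
  case True
  then obtain d where b: "bip n" "{i, j, k} \<subseteq> Pset" "{t, v, w} \<subseteq> - Pset" and g: "gends n + {#i, t, j, v, k, w#} = alld d"
    by (auto simp: regular_def bip_add gends_add)
  obtain l where R: "rows i j k l" using complete_rows True b by blast
  obtain x where C: "columns t v w x" using complete_columns True b by blast
  show ?thesis
  proof (cases "(l, x) \<in># n")
    case e: True
    then obtain n' where n': "n = add_mset (l, x) n'" by (meson mset_add)
    have "{#i, j, k, l, t, v, w, x#} = gends (M4 i j k l t v w x)" by (simp add: M4_def add_mset_commute)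
    also have "\<dots> = alld 1" by (rule PM_gends[OF M4_PM[OF R C]])
    finally have e: "{#i, j, k, l, t, v, w, x#} = alld 1" .
    have "gends n' + {#i, j, k, l, t, v, w, x#} = alld d" using g by (simp add: n' add_mset_commute)
    then have "gends n' + alld 1 = alld d" unfolding e .
    then have "count (gends n' + alld 1) i = d" for i by (simp del: count_union)
    then have "count (gends n') i = d - 1" for i by (metis add_diff_cancel_right' count_alld count_union)
    then have "gends n' = alld (d - 1)" by (intro multiset_eqI) simp
    moreover have "bip n'" using b(1) by (simp add: n')
    ultimately obtain F where "set_mset F \<subseteq> PM" "\<Sum>\<^sub># F = n'" using regular_factorization by metis
    then show ?thesis unfolding n' by (rule alt_edge[OF R C])
  next
    case False
    have Pe: "Pset = {i, j, k, l}" "- Pset = {t, v, w, x}" using R C by (simp_all add: rows_def columns_def)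
    have dis: "distinct [i, j, k, l, t, v, w, x]" by (rule rows_columns_distinct[OF R C])
    have deg: "count (gends n) y + count {#i, t, j, v, k, w#} y = d" for y
      using arg_cong[OF g, of "\<lambda>m. count m y"] by (simp only: count_union count_alld)
    have row: "count (gends n) y = count n (y, t) + count n (y, v) + count n (y, w) + count n (y, x)" if "y \<in> Pset" for y
      using count_gends_P[OF b(1) that] dis by (simp add: Pe(2) add.assoc)
    have col: "count (gends n) y = count n (i, y) + count n (j, y) + count n (k, y) + count n (l, y)" if "y \<in> - Pset" for y
      using count_gends_N[OF b(1), of y] that dis by (simp add: Pe(1) add.assoc)
    have lx: "count n (l, x) = 0" using False by (simp add: not_in_iff)
    have cnt: "count {#i, t, j, v, k, w#} i = 1" "count {#i, t, j, v, k, w#} j = 1" "count {#i, t, j, v, k, w#} k = 1"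
      "count {#i, t, j, v, k, w#} l = 0" "count {#i, t, j, v, k, w#} t = 1" "count {#i, t, j, v, k, w#} v = 1"
      "count {#i, t, j, v, k, w#} w = 1" "count {#i, t, j, v, k, w#} x = 0"
      using dis by auto
    have inP: "i \<in> Pset" "j \<in> Pset" "k \<in> Pset" "l \<in> Pset" unfolding Pe(1) by simp_all
    have inN: "t \<in> - Pset" "v \<in> - Pset" "w \<in> - Pset" "x \<in> - Pset" unfolding Pe(2) by simp_all
    have rs: "count n (i, t) + count n (i, v) + count n (i, w) + count n (i, x) + 1 = d"
      "count n (j, t) + count n (j, v) + count n (j, w) + count n (j, x) + 1 = d"
      "count n (k, t) + count n (k, v) + count n (k, w) + count n (k, x) + 1 = d"
      "count n (l, t) + count n (l, v) + count n (l, w) = d"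
      using deg[of i] deg[of j] deg[of k] deg[of l] row[OF inP(1)] row[OF inP(2)] row[OF inP(3)] row[OF inP(4)] cnt(1-4) lx
      by (simp_all only: add_0_right)
    have cs: "count n (i, t) + count n (j, t) + count n (k, t) + count n (l, t) + 1 = d"
      "count n (i, v) + count n (j, v) + count n (k, v) + count n (l, v) + 1 = d"
      "count n (i, w) + count n (j, w) + count n (k, w) + count n (l, w) + 1 = d"
      "count n (i, x) + count n (j, x) + count n (k, x) = d"
      using deg[of t] deg[of v] deg[of w] deg[of x] col[OF inN(1)] col[OF inN(2)] col[OF inN(3)] col[OF inN(4)] cnt(5-8) lx
      by (simp_all only: add_0_right)
    have pick: "alt n i j k t v w \<in> J"
      if ijk: "(i', j', k') \<in> {(i, j, k), (i, k, j), (j, k, i)}" and uvw: "(u', v', w') \<in> {(t, v, w), (t, w, v), (v, w, t)}"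
        and e: "count n (l, u') > 0" "count n (l, v') > 0" "count n (i', x) > 0" "count n (j', x) > 0" "count n (k', w') > 0"
      for i' j' k' u' v' w'
    proof -
      have "rows i' j' k' l" "columns u' v' w' x" using ijk uvw R C by (auto simp: rows_def columns_def)
      moreover have "{#i', u', j', v', k', w'#} = {#i, t, j, v, k, w#}" using ijk uvw by (auto simp: add_mset_commute)
      ultimately have "alt n i' j' k' u' v' w' \<in> J"
        using alt_five_edges'[OF _ _ b(1), of i' j' k' l u' v' w' x d] e g by simp
      then show ?thesis using ijk uvw
        by (elim insertE emptyE Pair_inject) (simp_all only: J_alt_swap(2)[of n i k j] J_alt_swap(4)[of n _ _ _ t w v] J_alt_cycle(1)[of n j k i] J_alt_cycle(2)[of n _ _ _ v w t])
    qed
    from five_entries[OF rs(1-3) cs(1-3) rs(4) cs(4)] show ?thesis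
      using pick[of j k i v w t] pick[of i k j v w t] pick[of i j k v w t]
        pick[of j k i t w v] pick[of i k j t w v] pick[of i j k t w v]
        pick[of j k i t v w] pick[of i k j t v w] pick[of i j k t v w] by simp argo
  qed
qed

lemma lext_psi_I3: "g \<in> I3 \<Longrightarrow> lext psi g \<in> J"
proof (induction rule: I3.induct)
  case (I3_step x f i j k t v w)
  have "lext psi (f * d3 i j k t v w) \<in> J"
  proof (induction f rule: poly_mapping_single_induct)
    case (1 n c)
    show ?case unfolding lext_psi_d3 by (intro J_mult alt_in_J)
  qed (simp_all add: distrib_right lext_add J_add J_zero)
  then show ?case using I3_step by (simp add: lext_add J_add)
qed (simp add: J_zero)

section \<open>The kernel\<close>

lemma \<phi>_Yl: "is_match L \<Longrightarrow> \<phi> (Yl L) = ev L"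
  unfolding Yl_def by (rule \<phi>_lin[OF ev_in_R_deg[OF is_match_ends]])

lemma \<phi>_quad: "\<sigma> permutes UNIV \<Longrightarrow> \<phi> (quad \<sigma>) = 0"
  by (simp add: quad_def is_hom_simps is_hom_\<phi> \<phi>_Yl is_match_quad ac_simps)

lemma mpderiv_s3_J: "mpderiv i (s3 :: (14, int) mpoly) \<in> J"
proof -
  have "finite A \<Longrightarrow> A \<subseteq> {..<14} \<Longrightarrow> (\<Sum>a\<in>A. of_int (coords b (dual_basis ! a) i) * D (ball_sets ! a) (s3 :: (14, int) mpoly)) \<in> J" for A
    by (induction A rule: finite_induct) (auto intro: J_zero J_add J_mult J_D_ball_s3)
  then show ?thesis unfolding mpderiv_expansion[of i s3] by blast
qed

lemma \<phi>_s3: "\<phi> s3 = 0"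
proof -
  have "\<phi> (mpderiv i s3) = 0" for i
    unfolding mpderiv_expansion[of i s3]
    by (simp add: is_hom_simps is_hom_\<phi> D_ball_s3_quad \<phi>_quad ball_perms_permutes)
  then have "\<phi> (\<Sum>i\<in>UNIV. mvar i * mpderiv i s3) = 0" by (simp add: is_hom_simps is_hom_\<phi>)
  then have "of_nat 3 * \<phi> s3 = 0"
    unfolding euler[OF homog_s3] by (simp only: is_hom_mult[OF is_hom_\<phi>] is_hom_of_nat[OF is_hom_\<phi>])
  then show ?thesis using of_nat_mult_eq_0[of 2 "\<phi> s3"] by (simp only: numeral_3_eq_3 numeral_2_eq_2)
qed

lemma \<phi>_J: "f \<in> J \<Longrightarrow> \<phi> f = 0"
  unfolding J_def
  by (induction rule: idl.induct) (auto simp: is_hom_simps is_hom_\<phi> \<phi>_s3 \<phi>_quad)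

lemma \<phi>_PY: "set_mset F \<subseteq> PM \<Longrightarrow> \<phi> (PY F) = gev (\<Sum>\<^sub># F)"
proof (induction F)
  case (add \<mu> F)
  have "\<phi> (Ym \<mu>) = gev \<mu>" unfolding Ym_def using add.prems by (intro \<phi>_lin gev_in_R_deg) (simp add: PM_gends)
  then show ?case using add by (simp add: PY_add_mset is_hom_simps is_hom_\<phi> gev_add)
qed (simp add: is_hom_simps is_hom_\<phi>)

lemma sym_span: "f \<in> zspan {PY F | F. set_mset F \<subseteq> PM}" (is "f \<in> zspan ?G")
proof (induction f rule: mpoly_induct)
  case (const c)
  have "of_int c * PY {#} \<in> zspan ?G" by (intro zspan_of_int_mult zspan_base CollectI exI[of _ "{#}"]) simp
  then show ?case by (simp add: mconst_int)
next
  case (var i)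
  have "w \<in> R_deg 1 \<and> lin w \<in> zspan ?G" if "w \<in> zspan {gev m | m. bip m \<and> gends m = alld 1}" for w
    using that
  proof induction
    case zspan_zero then show ?case using R_deg_0 by (simp add: zspan.zspan_zero)
  next
    case (zspan_plus x g)
    then obtain m where m: "m \<in> PM" "g = gev m" by (auto simp: PM_def)
    have "PY {#m#} \<in> ?G" using m by (intro CollectI exI[of _ "{#m#}"]) simp
    then have "lin g \<in> ?G" using m by (simp add: PY_add_mset Ym_def)
    moreover have "g \<in> R_deg 1" using m PM_gends gev_in_R_deg by simp
    ultimately show ?case using zspan_plus by (simp add: lin_add R_deg_add zspan.zspan_plus)
  next
    case (zspan_minus x g)
    then obtain m where m: "m \<in> PM" "g = gev m" by (auto simp: PM_def)
    have "PY {#m#} \<in> ?G" using m by (intro CollectI exI[of _ "{#m#}"]) simp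
    then have "lin g \<in> ?G" using m by (simp add: PY_add_mset Ym_def)
    moreover have "g \<in> R_deg 1" using m PM_gends gev_in_R_deg by simp
    ultimately show ?case using zspan_minus by (simp add: lin_diff R_deg_diff zspan.zspan_minus)
  qed
  from this[OF R_deg_bip[OF b_in[of i]]] show ?case by (simp add: lin_b)
next
  case (mult f g)
  show ?case
  proof (rule zspan_mult[OF mult])
    fix g h assume "g \<in> ?G" "h \<in> ?G"
    then obtain F F' where "set_mset (F + F') \<subseteq> PM" "g * h = PY (F + F')" by (auto simp: PY_union)
    then show "g * h \<in> ?G" by blast
  qed
qed (rule zspan_add)

text \<open>Modulo \<open>J\<close> every polynomial is the image of a combination of regular graphs, because the matchings generate.\<close>

lemma reduce_to_graphs:
  "\<exists>g. (\<forall>m\<in>Poly_Mapping.keys g. regular m) \<and> f - lext psi g \<in> J \<and> \<phi> f = lext gev g"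
  using sym_span[of f]
proof induction
  case zspan_zero
  show ?case by (rule exI[of _ 0]) (simp add: J_zero is_hom_zero is_hom_\<phi>)
next
  case (zspan_plus x g)
  then obtain h F where h: "\<forall>m\<in>Poly_Mapping.keys h. regular m" "x - lext psi h \<in> J" "\<phi> x = lext gev h"
    and F: "set_mset F \<subseteq> PM" "g = PY F" by blast
  have "PY F - psi (\<Sum>\<^sub># F) \<in> J" using cong_sym[OF psi_cong[OF F(1)]] by (simp add: cong_def)
  from J_add[OF h(2) this] have "x + g - lext psi (h + gmono (\<Sum>\<^sub># F)) \<in> J"
    by (simp add: F lext_add lext_single algebra_simps)
  moreover have "\<phi> (x + g) = lext gev (h + gmono (\<Sum>\<^sub># F))"
    by (simp add: is_hom_add is_hom_\<phi> h F \<phi>_PY lext_add lext_single)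
  moreover have "\<forall>m\<in>Poly_Mapping.keys (h + gmono (\<Sum>\<^sub># F)). regular m"
  proof
    fix m assume "m \<in> Poly_Mapping.keys (h + gmono (\<Sum>\<^sub># F))"
    from subsetD[OF keys_add this] show "regular m"
    proof (rule UnE)
      assume "m \<in> Poly_Mapping.keys h"
      with h(1) show ?thesis by (rule bspec)
    next
      assume "m \<in> Poly_Mapping.keys (gmono (\<Sum>\<^sub># F))"
      then have "m = \<Sum>\<^sub># F" by simp
      then show ?thesis using F(1) unfolding regular_iff by blast
    qed
  qed
  ultimately show ?case by blast
next
  case (zspan_minus x g)
  then obtain h F where h: "\<forall>m\<in>Poly_Mapping.keys h. regular m" "x - lext psi h \<in> J" "\<phi> x = lext gev h"
    and F: "set_mset F \<subseteq> PM" "g = PY F" by blast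
  have "PY F - psi (\<Sum>\<^sub># F) \<in> J" using cong_sym[OF psi_cong[OF F(1)]] by (simp add: cong_def)
  from J_diff[OF h(2) this] have "x - g - lext psi (h - gmono (\<Sum>\<^sub># F)) \<in> J"
    by (simp add: F lext_diff lext_single algebra_simps)
  moreover have "\<phi> (x - g) = lext gev (h - gmono (\<Sum>\<^sub># F))"
    by (simp add: is_hom_diff is_hom_\<phi> h F \<phi>_PY lext_diff lext_single)
  moreover have "\<forall>m\<in>Poly_Mapping.keys (h - gmono (\<Sum>\<^sub># F)). regular m"
  proof
    fix m assume "m \<in> Poly_Mapping.keys (h - gmono (\<Sum>\<^sub># F))"
    from subsetD[OF keys_diff this] show "regular m"
    proof (rule UnE)
      assume "m \<in> Poly_Mapping.keys h"
      with h(1) show ?thesis by (rule bspec)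
    next
      assume "m \<in> Poly_Mapping.keys (gmono (\<Sum>\<^sub># F))"
      then have "m = \<Sum>\<^sub># F" by simp
      then show ?thesis using F(1) unfolding regular_iff by blast
    qed
  qed
  ultimately show ?case by blast
qed

lemma mh_gev: "mh (gends m) (gev m)"
  using mh_ev gends_mset gev_mset by (metis ex_mset)

lemma restr_lext_gev: "restr (\<lambda>m. mdeg m = \<delta>) (lext gev g) = lext gev (restr (\<lambda>m. gends m = \<delta>) g)"
proof (induction g rule: poly_mapping_single_induct)
  case (1 m c)
  have k: "mdeg t = gends m" if "t \<in> Poly_Mapping.keys (of_int c * gev m)" for t
  proof -
    have "Poly_Mapping.lookup (of_int c * gev m) t = c * Poly_Mapping.lookup (gev m) t"
      using lookup_mconst_times[of c "gev m" t] by (simp add: mconst_int)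
    then have "t \<in> Poly_Mapping.keys (gev m)" using that by (auto simp: in_keys_iff)
    then show ?thesis using mh_gev[of m] by (simp add: mh_mdeg)
  qed
  show ?case
  proof (cases "gends m = \<delta>")
    case True
    then show ?thesis using k by (simp add: lext_single restr_single when_def restr_id)
  next
    case False
    have "restr (\<lambda>m. mdeg m = \<delta>) (of_int c * gev m) = 0"
    proof (rule poly_mapping_eqI)
      fix s
      show "Poly_Mapping.lookup (restr (\<lambda>m. mdeg m = \<delta>) (of_int c * gev m)) s = Poly_Mapping.lookup 0 s"
        using k[of s] False by (cases "mdeg s = \<delta>") (auto simp: lookup_restr when_def in_keys_iff)
    qed
    then show ?thesis using False by (simp add: lext_single restr_single when_def)
  qed
qed (simp_all add: lext_add restr_add)

lemma in_bipspan:
  assumes "\<And>m. m \<in> Poly_Mapping.keys g \<Longrightarrow> bip m \<and> gends m = \<delta>"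
  shows "g \<in> bipspan \<delta>"
proof -
  have "(\<Sum>m\<in>Poly_Mapping.keys g. of_int (Poly_Mapping.lookup g m) * gmono m) \<in> bipspan \<delta>"
    unfolding bipspan_def by (intro zspan_sum zspan_of_int_mult zspan_base) (use assms in auto)
  moreover have "of_int c * gmono m = Poly_Mapping.single m c" for m and c :: int
    using Poly_Mapping.single_of_int[of c, where ?'a = graph and ?'b = int] by (metis add_0 mult.right_neutral mult_single of_int_eq_id id_apply)
  ultimately show ?thesis by (simp flip: poly_mapping_sum_singles)
qed

text \<open>A relation between matchings becomes a relation between bipartite graphs, which splits by multidegree and then lies in the ideal of the three-by-three minors.\<close>

theorem kernel_eq_J: "\<phi> f = 0 \<longleftrightarrow> f \<in> J"
proof
  assume 0: "\<phi> f = 0"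
  obtain g where g: "\<forall>m\<in>Poly_Mapping.keys g. regular m" "f - lext psi g \<in> J" "\<phi> f = lext gev g"
    using reduce_to_graphs[of f] by blast
  let ?r = "\<lambda>\<delta>. restr (\<lambda>m. gends m = \<delta>) g" and ?\<Delta> = "gends ` Poly_Mapping.keys g"
  have r: "lext psi (?r \<delta>) \<in> J" if "\<delta> \<in> ?\<Delta>" for \<delta>
  proof (rule lext_psi_I3, rule bip_relations)
    show "balanced \<delta>" using that g(1) by (auto simp: regular_def balanced_alld)
    show "?r \<delta> \<in> bipspan \<delta>"
      by (rule in_bipspan) (use g(1) in \<open>auto simp: in_keys_iff lookup_restr when_def regular_def split: if_splits\<close>)
    show "lext gev (?r \<delta>) = 0" using restr_lext_gev[of \<delta> g] 0 g(3) by (simp add: restr_def)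
  qed
  have "finite A \<Longrightarrow> A \<subseteq> ?\<Delta> \<Longrightarrow> (\<Sum>\<delta>\<in>A. lext psi (?r \<delta>)) \<in> J" for A
    by (induction A rule: finite_induct) (use r in \<open>auto intro: J_zero J_add\<close>)
  then have "lext psi (\<Sum>\<delta>\<in>?\<Delta>. ?r \<delta>) \<in> J" by (simp add: lext_sum)
  also have "(\<Sum>\<delta>\<in>?\<Delta>. ?r \<delta>) = g"
  proof (rule poly_mapping_eqI)
    fix m
    have "Poly_Mapping.lookup (\<Sum>\<delta>\<in>?\<Delta>. ?r \<delta>) m = (\<Sum>\<delta>\<in>?\<Delta>. if gends m = \<delta> then Poly_Mapping.lookup g m else 0)"
      by (simp add: lookup_sum lookup_restr when_def)
    also have "\<dots> = Poly_Mapping.lookup g m" by (auto simp: in_keys_iff)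
    finally show "Poly_Mapping.lookup (\<Sum>\<delta>\<in>?\<Delta>. ?r \<delta>) m = Poly_Mapping.lookup g m" .
  qed
  finally have "lext psi g \<in> J" .
  from J_add[OF g(2) this] show "f \<in> J" by simp
qed (rule \<phi>_J)

end

context eight_points
begin

section \<open>The cubic is not in the ideal of its derivatives\<close>

definition const_term :: "(14, int) mpoly \<Rightarrow> int" where
  "const_term = msubst of_int (\<lambda>_. 0)"

lemma is_hom_const_term: "is_hom const_term"
  unfolding const_term_def by (rule is_hom_msubst[OF is_hom_of_int_map])

lemma const_term_homog: "f \<in> homog (Suc d) \<Longrightarrow> const_term f = 0"
proof -
  assume "f \<in> homog (Suc d)"
  have "const_term (mvar i) = 0" for i
    unfolding const_term_def by (simp only: msubst_mvar[OF is_hom_of_int_map])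
  then have "const_term (\<Sum>i\<in>UNIV. mvar i * mpderiv i f) = 0" by (simp add: is_hom_simps is_hom_const_term)
  then have "of_nat (Suc d) * const_term f = 0"
    unfolding euler[OF \<open>f \<in> homog (Suc d)\<close>] by (simp only: is_hom_mult[OF is_hom_const_term] is_hom_of_nat[OF is_hom_const_term])
  then show ?thesis by (simp del: of_nat_Suc)
qed

lemma D_numeral [simp]: "D S (numeral n) = 0" and D_one [simp]: "D S 1 = 0"
  using D_of_int[of S "numeral n"] D_of_int[of S 1] by (simp_all only: of_int_numeral of_int_1)

lemma const_term_DDD:
  assumes "q \<in> homog 2"
  shows "const_term (D S (D T (D U (g * q)))) = const_term (D S g) * const_term (D T (D U q))
    + const_term (D T g) * const_term (D S (D U q)) + const_term (D U g) * const_term (D S (D T q))"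
proof -
  have 1: "D A q \<in> homog (Suc 0)" for A using homog_D[of q 1 A] assms by (simp add: numeral_2_eq_2 One_nat_def)
  have 2: "D B (D A q) \<in> homog 0" for A B using homog_D[OF 1] .
  have 3: "D C (D B (D A q)) = 0" for A B C using homog_0_mconst[OF 2[of B A]] D_mconst by metis
  have "const_term q = 0" using const_term_homog[of q 1] assms by (simp add: numeral_2_eq_2 One_nat_def)
  moreover have "const_term (D A q) = 0" for A by (rule const_term_homog[OF 1])
  ultimately show ?thesis
    by (simp add: D_add D_mult is_hom_simps is_hom_const_term 3)
qed

lemma D_hyperplane_u:
  "D {0, 2, 4, 6} (u 0) = 0" "D {0, 2, 4, 6} (u 1) = 0" "D {0, 2, 4, 6} (u 2) = 0" "D {0, 2, 4, 6} (u 3) = 0" "D {0, 2, 4, 6} (u 4) = 0" "D {0, 2, 4, 6} (u 5) = 0" "D {0, 2, 4, 6} (u 6) = 0" "D {0, 2, 4, 6} (u 7) = 0" "D {0, 2, 4, 6} (u 8) = 0" "D {0, 2, 4, 6} (u 9) = 0" "D {0, 2, 4, 6} (u 10) = 0" "D {0, 2, 4, 6} (u 11) = 1" "D {0, 2, 4, 6} (u 12) = 0" "D {0, 2, 4, 6} (u 13) = 0"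
  "D {0, 1, 4, 5} (u 0) = 0" "D {0, 1, 4, 5} (u 1) = 0" "D {0, 1, 4, 5} (u 2) = 0" "D {0, 1, 4, 5} (u 3) = 0" "D {0, 1, 4, 5} (u 4) = 0" "D {0, 1, 4, 5} (u 5) = 0" "D {0, 1, 4, 5} (u 6) = 1" "D {0, 1, 4, 5} (u 7) = 0" "D {0, 1, 4, 5} (u 8) = 0" "D {0, 1, 4, 5} (u 9) = 0" "D {0, 1, 4, 5} (u 10) = 0" "D {0, 1, 4, 5} (u 11) = 0" "D {0, 1, 4, 5} (u 12) = 0" "D {0, 1, 4, 5} (u 13) = 0"
  "D {0, 3, 4, 7} (u 0) = 0" "D {0, 3, 4, 7} (u 1) = 1" "D {0, 3, 4, 7} (u 2) = 0" "D {0, 3, 4, 7} (u 3) = 0" "D {0, 3, 4, 7} (u 4) = 0" "D {0, 3, 4, 7} (u 5) = 0" "D {0, 3, 4, 7} (u 6) = 1" "D {0, 3, 4, 7} (u 7) = 1" "D {0, 3, 4, 7} (u 8) = 0" "D {0, 3, 4, 7} (u 9) = 0" "D {0, 3, 4, 7} (u 10) = 1" "D {0, 3, 4, 7} (u 11) = 1" "D {0, 3, 4, 7} (u 12) = 0" "D {0, 3, 4, 7} (u 13) = 1"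
  "D {0, 1, 2, 3} (u 0) = 1" "D {0, 1, 2, 3} (u 1) = 0" "D {0, 1, 2, 3} (u 2) = 0" "D {0, 1, 2, 3} (u 3) = 0" "D {0, 1, 2, 3} (u 4) = 0" "D {0, 1, 2, 3} (u 5) = 0" "D {0, 1, 2, 3} (u 6) = 0" "D {0, 1, 2, 3} (u 7) = 0" "D {0, 1, 2, 3} (u 8) = 0" "D {0, 1, 2, 3} (u 9) = 0" "D {0, 1, 2, 3} (u 10) = 0" "D {0, 1, 2, 3} (u 11) = 0" "D {0, 1, 2, 3} (u 12) = 0" "D {0, 1, 2, 3} (u 13) = 0"
  "D {0, 2, 5, 7} (u 0) = 1" "D {0, 2, 5, 7} (u 1) = 2" "D {0, 2, 5, 7} (u 2) = 1" "D {0, 2, 5, 7} (u 3) = 1" "D {0, 2, 5, 7} (u 4) = 1" "D {0, 2, 5, 7} (u 5) = 1" "D {0, 2, 5, 7} (u 6) = 2" "D {0, 2, 5, 7} (u 7) = 1" "D {0, 2, 5, 7} (u 8) = 1" "D {0, 2, 5, 7} (u 9) = 1" "D {0, 2, 5, 7} (u 10) = 1" "D {0, 2, 5, 7} (u 11) = 1" "D {0, 2, 5, 7} (u 12) = 1" "D {0, 2, 5, 7} (u 13) = 1"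
  "D {0, 1, 6, 7} (u 0) = 1" "D {0, 1, 6, 7} (u 1) = 1" "D {0, 1, 6, 7} (u 2) = 1" "D {0, 1, 6, 7} (u 3) = 0" "D {0, 1, 6, 7} (u 4) = 1" "D {0, 1, 6, 7} (u 5) = 1" "D {0, 1, 6, 7} (u 6) = 1" "D {0, 1, 6, 7} (u 7) = 0" "D {0, 1, 6, 7} (u 8) = 0" "D {0, 1, 6, 7} (u 9) = 0" "D {0, 1, 6, 7} (u 10) = 0" "D {0, 1, 6, 7} (u 11) = 0" "D {0, 1, 6, 7} (u 12) = 0" "D {0, 1, 6, 7} (u 13) = 0"
  "D {0, 3, 5, 6} (u 0) = 1" "D {0, 3, 5, 6} (u 1) = 2" "D {0, 3, 5, 6} (u 2) = 1" "D {0, 3, 5, 6} (u 3) = 1" "D {0, 3, 5, 6} (u 4) = 1" "D {0, 3, 5, 6} (u 5) = 0" "D {0, 3, 5, 6} (u 6) = 1" "D {0, 3, 5, 6} (u 7) = 1" "D {0, 3, 5, 6} (u 8) = 0" "D {0, 3, 5, 6} (u 9) = 1" "D {0, 3, 5, 6} (u 10) = 1" "D {0, 3, 5, 6} (u 11) = 1" "D {0, 3, 5, 6} (u 12) = 0" "D {0, 3, 5, 6} (u 13) = 0"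
  by (simp_all add: D_u dual_basis_def is_hom_simps is_hom_coef coef_X4 coef_br)

text \<open>View the labels as the group with two elements to the third power. Its seven subgroups of order four, which
  are sets of four labels, are the points of a Fano plane, and the sum runs over the \<open>28\<close> triples of points that do
  not lie on a line.\<close>

definition fano :: "(14, int) mpoly \<Rightarrow> int" where
  "fano f = const_term (D {0, 2, 4, 6} (D {0, 1, 4, 5} (D {0, 1, 2, 3} f)))
    + const_term (D {0, 2, 4, 6} (D {0, 1, 4, 5} (D {0, 2, 5, 7} f)))
    + const_term (D {0, 2, 4, 6} (D {0, 1, 4, 5} (D {0, 1, 6, 7} f)))
    + const_term (D {0, 2, 4, 6} (D {0, 1, 4, 5} (D {0, 3, 5, 6} f)))
    + const_term (D {0, 2, 4, 6} (D {0, 3, 4, 7} (D {0, 1, 2, 3} f)))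
    + const_term (D {0, 2, 4, 6} (D {0, 3, 4, 7} (D {0, 2, 5, 7} f)))
    + const_term (D {0, 2, 4, 6} (D {0, 3, 4, 7} (D {0, 1, 6, 7} f)))
    + const_term (D {0, 2, 4, 6} (D {0, 3, 4, 7} (D {0, 3, 5, 6} f)))
    + const_term (D {0, 2, 4, 6} (D {0, 1, 2, 3} (D {0, 1, 6, 7} f)))
    + const_term (D {0, 2, 4, 6} (D {0, 1, 2, 3} (D {0, 3, 5, 6} f)))
    + const_term (D {0, 2, 4, 6} (D {0, 2, 5, 7} (D {0, 1, 6, 7} f)))
    + const_term (D {0, 2, 4, 6} (D {0, 2, 5, 7} (D {0, 3, 5, 6} f)))
    + const_term (D {0, 1, 4, 5} (D {0, 3, 4, 7} (D {0, 1, 2, 3} f)))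
    + const_term (D {0, 1, 4, 5} (D {0, 3, 4, 7} (D {0, 2, 5, 7} f)))
    + const_term (D {0, 1, 4, 5} (D {0, 3, 4, 7} (D {0, 1, 6, 7} f)))
    + const_term (D {0, 1, 4, 5} (D {0, 3, 4, 7} (D {0, 3, 5, 6} f)))
    + const_term (D {0, 1, 4, 5} (D {0, 1, 2, 3} (D {0, 2, 5, 7} f)))
    + const_term (D {0, 1, 4, 5} (D {0, 1, 2, 3} (D {0, 3, 5, 6} f)))
    + const_term (D {0, 1, 4, 5} (D {0, 2, 5, 7} (D {0, 1, 6, 7} f)))
    + const_term (D {0, 1, 4, 5} (D {0, 1, 6, 7} (D {0, 3, 5, 6} f)))
    + const_term (D {0, 3, 4, 7} (D {0, 1, 2, 3} (D {0, 2, 5, 7} f)))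
    + const_term (D {0, 3, 4, 7} (D {0, 1, 2, 3} (D {0, 1, 6, 7} f)))
    + const_term (D {0, 3, 4, 7} (D {0, 2, 5, 7} (D {0, 3, 5, 6} f)))
    + const_term (D {0, 3, 4, 7} (D {0, 1, 6, 7} (D {0, 3, 5, 6} f)))
    + const_term (D {0, 1, 2, 3} (D {0, 2, 5, 7} (D {0, 1, 6, 7} f)))
    + const_term (D {0, 1, 2, 3} (D {0, 2, 5, 7} (D {0, 3, 5, 6} f)))
    + const_term (D {0, 1, 2, 3} (D {0, 1, 6, 7} (D {0, 3, 5, 6} f)))
    + const_term (D {0, 2, 5, 7} (D {0, 1, 6, 7} (D {0, 3, 5, 6} f)))"

lemma fano_add: "fano (f + g) = fano f + fano g"
  by (simp add: fano_def D_add is_hom_add[OF is_hom_const_term])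

lemma fano_zero: "fano 0 = 0"
  by (simp add: fano_def is_hom_zero[OF is_hom_const_term])

lemmas hyperplane_eval = D_add D_diff D_uminus D_mult D_hyperplane_u

lemma fano_s3: "fano s3 = 28"
proof -
  have t0: "D {0, 2, 4, 6} (D {0, 1, 4, 5} (D {0, 1, 2, 3} s3)) = (1 :: (14, int) mpoly)" by (simp add: s3_def hyperplane_eval)
  have t1: "D {0, 2, 4, 6} (D {0, 1, 4, 5} (D {0, 2, 5, 7} s3)) = (1 :: (14, int) mpoly)" by (simp add: s3_def hyperplane_eval)
  have t2: "D {0, 2, 4, 6} (D {0, 1, 4, 5} (D {0, 1, 6, 7} s3)) = (1 :: (14, int) mpoly)" by (simp add: s3_def hyperplane_eval)
  have t3: "D {0, 2, 4, 6} (D {0, 1, 4, 5} (D {0, 3, 5, 6} s3)) = (1 :: (14, int) mpoly)" by (simp add: s3_def hyperplane_eval)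
  have t4: "D {0, 2, 4, 6} (D {0, 3, 4, 7} (D {0, 1, 2, 3} s3)) = (1 :: (14, int) mpoly)" by (simp add: s3_def hyperplane_eval)
  have t5: "D {0, 2, 4, 6} (D {0, 3, 4, 7} (D {0, 2, 5, 7} s3)) = (1 :: (14, int) mpoly)" by (simp add: s3_def hyperplane_eval)
  have t6: "D {0, 2, 4, 6} (D {0, 3, 4, 7} (D {0, 1, 6, 7} s3)) = (1 :: (14, int) mpoly)" by (simp add: s3_def hyperplane_eval)
  have t7: "D {0, 2, 4, 6} (D {0, 3, 4, 7} (D {0, 3, 5, 6} s3)) = (1 :: (14, int) mpoly)" by (simp add: s3_def hyperplane_eval)
  have t8: "D {0, 2, 4, 6} (D {0, 1, 2, 3} (D {0, 1, 6, 7} s3)) = (1 :: (14, int) mpoly)" by (simp add: s3_def hyperplane_eval)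
  have t9: "D {0, 2, 4, 6} (D {0, 1, 2, 3} (D {0, 3, 5, 6} s3)) = (1 :: (14, int) mpoly)" by (simp add: s3_def hyperplane_eval)
  have t10: "D {0, 2, 4, 6} (D {0, 2, 5, 7} (D {0, 1, 6, 7} s3)) = (1 :: (14, int) mpoly)" by (simp add: s3_def hyperplane_eval)
  have t11: "D {0, 2, 4, 6} (D {0, 2, 5, 7} (D {0, 3, 5, 6} s3)) = (1 :: (14, int) mpoly)" by (simp add: s3_def hyperplane_eval)
  have t12: "D {0, 1, 4, 5} (D {0, 3, 4, 7} (D {0, 1, 2, 3} s3)) = (1 :: (14, int) mpoly)" by (simp add: s3_def hyperplane_eval)
  have t13: "D {0, 1, 4, 5} (D {0, 3, 4, 7} (D {0, 2, 5, 7} s3)) = (1 :: (14, int) mpoly)" by (simp add: s3_def hyperplane_eval)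
  have t14: "D {0, 1, 4, 5} (D {0, 3, 4, 7} (D {0, 1, 6, 7} s3)) = (1 :: (14, int) mpoly)" by (simp add: s3_def hyperplane_eval)
  have t15: "D {0, 1, 4, 5} (D {0, 3, 4, 7} (D {0, 3, 5, 6} s3)) = (1 :: (14, int) mpoly)" by (simp add: s3_def hyperplane_eval)
  have t16: "D {0, 1, 4, 5} (D {0, 1, 2, 3} (D {0, 2, 5, 7} s3)) = (1 :: (14, int) mpoly)" by (simp add: s3_def hyperplane_eval)
  have t17: "D {0, 1, 4, 5} (D {0, 1, 2, 3} (D {0, 3, 5, 6} s3)) = (1 :: (14, int) mpoly)" by (simp add: s3_def hyperplane_eval)
  have t18: "D {0, 1, 4, 5} (D {0, 2, 5, 7} (D {0, 1, 6, 7} s3)) = (1 :: (14, int) mpoly)" by (simp add: s3_def hyperplane_eval)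
  have t19: "D {0, 1, 4, 5} (D {0, 1, 6, 7} (D {0, 3, 5, 6} s3)) = (1 :: (14, int) mpoly)" by (simp add: s3_def hyperplane_eval)
  have t20: "D {0, 3, 4, 7} (D {0, 1, 2, 3} (D {0, 2, 5, 7} s3)) = (1 :: (14, int) mpoly)" by (simp add: s3_def hyperplane_eval)
  have t21: "D {0, 3, 4, 7} (D {0, 1, 2, 3} (D {0, 1, 6, 7} s3)) = (1 :: (14, int) mpoly)" by (simp add: s3_def hyperplane_eval)
  have t22: "D {0, 3, 4, 7} (D {0, 2, 5, 7} (D {0, 3, 5, 6} s3)) = (1 :: (14, int) mpoly)" by (simp add: s3_def hyperplane_eval)
  have t23: "D {0, 3, 4, 7} (D {0, 1, 6, 7} (D {0, 3, 5, 6} s3)) = (1 :: (14, int) mpoly)" by (simp add: s3_def hyperplane_eval)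
  have t24: "D {0, 1, 2, 3} (D {0, 2, 5, 7} (D {0, 1, 6, 7} s3)) = (1 :: (14, int) mpoly)" by (simp add: s3_def hyperplane_eval)
  have t25: "D {0, 1, 2, 3} (D {0, 2, 5, 7} (D {0, 3, 5, 6} s3)) = (1 :: (14, int) mpoly)" by (simp add: s3_def hyperplane_eval)
  have t26: "D {0, 1, 2, 3} (D {0, 1, 6, 7} (D {0, 3, 5, 6} s3)) = (1 :: (14, int) mpoly)" by (simp add: s3_def hyperplane_eval)
  have t27: "D {0, 2, 5, 7} (D {0, 1, 6, 7} (D {0, 3, 5, 6} s3)) = (1 :: (14, int) mpoly)" by (simp add: s3_def hyperplane_eval)
  have "fano s3 = const_term 1 * 28"
    unfolding fano_def
    by (simp add: t0 t1 t2 t3 t4 t5 t6 t7 t8 t9 t10 t11 t12 t13 t14 t15 t16 t17 t18 t19 t20 t21 t22 t23 t24 t25 t26 t27)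
  then show ?thesis by (simp add: is_hom_one[OF is_hom_const_term])
qed

lemma three_dvd_fano: "a < 14 \<Longrightarrow> 3 dvd fano (g * D (ball_sets ! a) s3)"
proof -
  define g0 where "g0 = const_term (D {0, 2, 4, 6} g)"
  define g1 where "g1 = const_term (D {0, 1, 4, 5} g)"
  define g2 where "g2 = const_term (D {0, 3, 4, 7} g)"
  define g3 where "g3 = const_term (D {0, 1, 2, 3} g)"
  define g4 where "g4 = const_term (D {0, 2, 5, 7} g)"
  define g5 where "g5 = const_term (D {0, 1, 6, 7} g)"
  define g6 where "g6 = const_term (D {0, 3, 5, 6} g)"
  have h: "D (ball_sets ! a) s3 \<in> homog 2" for a using homog_D[of s3 2] homog_s3 by simp
  have K: "const_term (numeral n) = numeral n" for n using is_hom_numeral[OF is_hom_const_term] .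
  have K': "const_term (- f) = - const_term f" "const_term 1 = 1" "const_term 0 = 0" for f
    by (simp_all add: is_hom_simps is_hom_const_term)
  show "a < 14 \<Longrightarrow> 3 dvd fano (g * D (ball_sets ! a) s3)"
  proof (erule all_less14[rotated])
    fix a :: nat assume "a \<in> {0, 1, 2, 3, 4, 5, 6, 7, 8, 9, 10, 11, 12, 13}"
    then show "3 dvd fano (g * D (ball_sets ! a) s3)"
      unfolding fano_def const_term_DDD[OF h] g0_def[symmetric] g1_def[symmetric] g2_def[symmetric] g3_def[symmetric] g4_def[symmetric] g5_def[symmetric] g6_def[symmetric]
      by (elim insertE emptyE; simp only:)
        ((simp add: D_ball_s3 hyperplane_eval K K'); presburger)+
  qed
qed

theorem s3_not_in_derivatives: "(s3 :: (14, int) mpoly) \<notin> idl UNIV (range (\<lambda>i. mpderiv i s3))"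
proof
  assume "s3 \<in> idl UNIV (range (\<lambda>i. mpderiv i (s3 :: (14, int) mpoly)))"
  then have "3 dvd fano s3"
  proof induction
    case idl_zero then show ?case by (simp add: fano_zero)
  next
    case (idl_step x f g)
    then obtain i where g: "g = mpderiv i s3" by blast
    have "finite A \<Longrightarrow> A \<subseteq> {..<14} \<Longrightarrow>
      3 dvd fano (f * (\<Sum>a\<in>A. of_int (coords b (dual_basis ! a) i) * D (ball_sets ! a) s3))" for A
    proof (induction A rule: finite_induct)
      case (insert a A)
      have "3 dvd fano ((f * of_int (coords b (dual_basis ! a) i)) * D (ball_sets ! a) s3)"
        by (rule three_dvd_fano) (use insert in simp)
      then show ?case using insert by (simp add: distrib_left fano_add mult.assoc)
    qed (simp add: fano_zero)
    from this[of "{..<14}"] have "3 dvd fano (f * g)" unfolding g mpderiv_expansion[of i s3] by simp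
    then show ?case using idl_step.IH by (simp add: fano_add)
  qed
  then show False by (simp add: fano_s3)
qed

end

section \<open>Subrings as rings with carrier\<close>

lemma ring_on_sel [simp]: "carrier (ring_on C) = C" "x \<otimes>\<^bsub>ring_on C\<^esub> y = x * y" "\<one>\<^bsub>ring_on C\<^esub> = 1"
  "\<zero>\<^bsub>ring_on C\<^esub> = 0" "x \<oplus>\<^bsub>ring_on C\<^esub> y = x + y"
  by (simp_all add: ring_on_def ring_of_type_algebra_def)

definition subring_set :: "'a::comm_ring_1 set \<Rightarrow> bool" where
  "subring_set C \<longleftrightarrow> 0 \<in> C \<and> 1 \<in> C \<and> (\<forall>x\<in>C. - x \<in> C) \<and> (\<forall>x\<in>C. \<forall>y\<in>C. x + y \<in> C \<and> x * y \<in> C)"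

context
  fixes C :: "'a::comm_ring_1 set" assumes C: "subring_set C"
begin

lemma cring_ring_on: "cring (ring_on C)"
proof (rule cringI)
  show "abelian_group (ring_on C)"
  proof (rule abelian_groupI)
    fix x assume "x \<in> carrier (ring_on C)"
    then have "- x \<in> C" using C by (simp add: subring_set_def)
    then show "\<exists>y\<in>carrier (ring_on C). y \<oplus>\<^bsub>ring_on C\<^esub> x = \<zero>\<^bsub>ring_on C\<^esub>" by (intro bexI[of _ "- x"]) simp_all
  qed (use C in \<open>auto simp: subring_set_def ac_simps\<close>)
  show "comm_monoid (ring_on C)"
    by (rule comm_monoidI) (use C in \<open>auto simp: subring_set_def ac_simps\<close>)
qed (simp add: distrib_right)

lemma ideal_ring_on_iff:
  "ideal I (ring_on C) \<longleftrightarrow> I \<subseteq> C \<and> 0 \<in> I \<and> (\<forall>x\<in>I. \<forall>y\<in>I. x + y \<in> I) \<and> (\<forall>x\<in>C. \<forall>y\<in>I. x * y \<in> I)" (is "_ \<longleftrightarrow> ?r")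
proof
  assume i: "ideal I (ring_on C)"
  then have a: "additive_subgroup I (ring_on C)" by (rule ideal.axioms)
  show ?r using additive_subgroup.a_subset[OF a] additive_subgroup.zero_closed[OF a]
      additive_subgroup.a_closed[OF a] ideal.I_l_closed[OF i] by simp
next
  assume r: ?r
  interpret R: cring "ring_on C" by (rule cring_ring_on)
  have inv: "\<ominus>\<^bsub>ring_on C\<^esub> x = - x" if "x \<in> C" for x
    using that C by (intro R.minus_equality) (auto simp: subring_set_def)
  have comm: "a * x \<in> I" if "a \<in> I" "x \<in> C" for a x
    using r that by (metis mult.commute)
  show "ideal I (ring_on C)"
  proof (rule idealI)
    show "subgroup I (add_monoid (ring_on C))"
    proof (rule subgroup.intro)
      fix x assume x: "x \<in> I"
      have "-1 * x \<in> I" using r x C unfolding subring_set_def by blast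
      then show "inv\<^bsub>add_monoid (ring_on C)\<^esub> x \<in> I" using inv[of x] x r by (auto simp: a_inv_def)
    qed (use r in auto)
  qed (use r in \<open>auto simp: R.ring_axioms intro: comm\<close>)
qed

text \<open>The inductive description of a generated ideal agrees with the smallest ideal containing the generators.\<close>

lemma genideal_ring_on:
  assumes "G \<subseteq> C" shows "genideal (ring_on C) G = idl C G"
proof -
  have "ideal (idl C G) (ring_on C)"
    unfolding ideal_ring_on_iff
  proof (intro conjI ballI)
    show "idl C G \<subseteq> C"
    proof
      fix x assume "x \<in> idl C G"
      then show "x \<in> C" by induction (use C assms in \<open>auto simp: subring_set_def\<close>)
    qed
  qed (use C in \<open>auto simp: subring_set_def intro: idl_add idl_mult idl_zero\<close>)
  moreover have "G \<subseteq> idl C G" using idl_gen[of 1 C _ G] C by (auto simp: subring_set_def)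
  moreover have "idl C G \<subseteq> I" if "ideal I (ring_on C)" "G \<subseteq> I" for I
  proof
    fix x assume "x \<in> idl C G"
    then show "x \<in> I" by induction (use that in \<open>auto simp: ideal_ring_on_iff\<close>)
  qed
  ultimately show ?thesis unfolding genideal_def by blast
qed

lemma primeideal_ring_on_iff:
  "primeideal q (ring_on C) \<longleftrightarrow> ideal q (ring_on C) \<and> q \<noteq> C \<and> (\<forall>x\<in>C. \<forall>y\<in>C. x * y \<in> q \<longrightarrow> x \<in> q \<or> y \<in> q)" (is "_ \<longleftrightarrow> ?r")
proof
  assume p: "primeideal q (ring_on C)"
  then show ?r using primeideal.axioms(1)[OF p] primeideal.I_notcarr[OF p] primeideal.I_prime[OF p] by auto
next
  assume ?r
  then show "primeideal q (ring_on C)" by (intro primeidealI cring_ring_on) auto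
qed

end

lemma subring_set_UNIV: "subring_set UNIV"
  by (simp add: subring_set_def)

lemma Sym_V_eq: "Sym_V = ring_on UNIV"
  by (rule Sym_V_def)

section \<open>The ring of invariants\<close>

definition invariants :: "(pvar, int) mpoly set" where
  "invariants = zspan (\<Union>d. R_deg d)"

lemma R_ring_eq: "R_ring = ring_on invariants"
proof -
  have "f \<in> invariants \<longleftrightarrow> (\<exists>n g. (\<forall>d. g d \<in> R_deg d) \<and> f = (\<Sum>d\<le>n. g d))" for f
  proof
    assume "\<exists>n g. (\<forall>d. g d \<in> R_deg d) \<and> f = (\<Sum>d\<le>n. g d)"
    then obtain n g where g: "\<forall>d. g d \<in> R_deg d" "f = (\<Sum>d\<le>n. g d)" by blast
    show "f \<in> invariants" unfolding invariants_def g(2) by (rule zspan_sum, rule zspan_base) (use g(1) in blast)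
  next
    have step: "\<exists>n g. (\<forall>d. g d \<in> R_deg d) \<and> x + y = (\<Sum>d\<le>n. g d)"
      if x: "\<exists>n g. (\<forall>d. g d \<in> R_deg d) \<and> x = (\<Sum>d\<le>n. g d)" and y: "y \<in> R_deg e" for x y e
    proof -
      obtain n g where g: "\<And>d. g d \<in> R_deg d" "x = (\<Sum>d\<le>n. g d)" using x by blast
      let ?g = "\<lambda>d. (if d \<le> n then g d else 0) + (if d = e then y else 0)"
      have "(\<Sum>d\<le>max n e. if d \<le> n then g d else 0) = (\<Sum>d\<le>n. g d)"
        by (rule sum.mono_neutral_cong_right) auto
      moreover have "(\<Sum>d\<le>max n e. if d = e then y else 0) = y" by (simp add: sum.delta)
      ultimately have s: "x + y = (\<Sum>d\<le>max n e. ?g d)" by (simp only: sum.distrib g(2))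
      have r: "?g d \<in> R_deg d" for d using g(1) y R_deg_0 by (auto intro: R_deg_add)
      show ?thesis
      proof (intro exI conjI)
        show "\<forall>d. ?g d \<in> R_deg d" by (rule allI) (rule r)
        show "x + y = (\<Sum>d\<le>max n e. ?g d)" by (rule s)
      qed
    qed
    assume "f \<in> invariants"
    then show "\<exists>n g. (\<forall>d. g d \<in> R_deg d) \<and> f = (\<Sum>d\<le>n. g d)" unfolding invariants_def
    proof induction
      case zspan_zero show ?case by (rule exI[of _ 0], rule exI[of _ "\<lambda>_. 0"]) (simp add: R_deg_0)
    next
      case (zspan_plus x g) then show ?case using step by blast
    next
      case (zspan_minus x g)
      then obtain e where "- g \<in> R_deg e" using R_deg_uminus by blast
      then show ?case using step[OF zspan_minus.IH, of "- g"] by simp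
    qed
  qed
  then show ?thesis unfolding R_ring_def by (intro arg_cong[of _ _ ring_on]) blast
qed

lemma subring_set_invariants: "subring_set invariants"
  unfolding subring_set_def invariants_def
  using one_in_R_deg R_deg_mult
  by (auto intro!: zspan_zero zspan_uminus zspan_add zspan_mult zspan_base[of 1]) blast+

context eight_points
begin

lemma \<phi>_R_deg: "f \<in> homog d \<Longrightarrow> \<phi> f \<in> R_deg d"
proof (induction rule: homog_induct)
  case (single m c)
  have pow: "b v ^ n \<in> R_deg n" for v n
  proof (induction n)
    case (Suc n)
    show ?case using R_deg_mult[OF b_in[of v] Suc] by (simp add: plus_1_eq_Suc)
  qed (simp add: one_in_R_deg)
  have "finite A \<Longrightarrow> (\<Prod>v\<in>A. b v ^ Poly_Mapping.lookup m v) \<in> R_deg (\<Sum>v\<in>A. Poly_Mapping.lookup m v)" for A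
    by (induction A rule: finite_induct) (use one_in_R_deg R_deg_mult[OF pow] in auto)
  then have "mono_val b m \<in> R_deg d"
    unfolding mono_val_superset[of UNIV m b, simplified] single(1)[symmetric] exp_deg_def by simp
  then show ?case by (simp add: sym_to_R_def msubst_single is_hom_of_int_map R_deg_of_int del: of_int_eq_id)
qed (simp_all add: is_hom_simps is_hom_\<phi> R_deg_add R_deg_0)

lemma homog_PY: "PY F \<in> homog (size F)"
proof (induction F)
  case empty show ?case using homog_of_int[of 1] by simp
next
  case (add \<mu> F)
  then show ?case using homog_mult[OF homog_lin, of "PY F" "size F" "gev \<mu>"] by (simp add: PY_add_mset Ym_def plus_1_eq_Suc)
qed

lemma R_deg_image: "w \<in> R_deg d \<Longrightarrow> \<exists>f\<in>homog d. \<phi> f = w"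
proof -
  assume "w \<in> R_deg d"
  then have "\<exists>f\<in>zspan (homog d). \<phi> f = w"
  proof (rule zspan_lift[OF R_deg_bip])
    fix g assume "g \<in> {gev m |m. bip m \<and> gends m = alld d}"
    then obtain m where m: "bip m" "gends m = alld d" "g = gev m" by blast
    then obtain F where "set_mset F \<subseteq> PM" "size F = d" "\<Sum>\<^sub># F = m" using regular_factorization by blast
    then show "\<exists>g'\<in>homog d. \<phi> g' = g" using homog_PY[of F] \<phi>_PY[of F] m by auto
  qed (simp add: is_hom_add is_hom_\<phi>)
  moreover have "f \<in> homog d" if "f \<in> zspan (homog d)" for f :: "(14, int) mpoly"
    using that by induction (auto intro: homog_add homog_diff)
  ultimately show ?thesis by blast
qed

lemma range_\<phi>: "range \<phi> = invariants"
proof (intro equalityI subsetI)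
  fix w assume "w \<in> invariants"
  then show "w \<in> range \<phi>" unfolding invariants_def
  proof induction
    case zspan_zero show ?case using is_hom_zero[OF is_hom_\<phi>] by (metis rangeI)
  next
    case (zspan_plus x g)
    then obtain f h where "x = \<phi> f" "g = \<phi> h" using R_deg_image by blast
    then have "x + g = \<phi> (f + h)" by (simp add: is_hom_add is_hom_\<phi>)
    then show ?case by blast
  next
    case (zspan_minus x g)
    then obtain f h where "x = \<phi> f" "g = \<phi> h" using R_deg_image by blast
    then have "x - g = \<phi> (f - h)" by (simp add: is_hom_diff is_hom_\<phi>)
    then show ?case by blast
  qed
next
  fix w assume "w \<in> range \<phi>"
  then obtain f where w: "w = \<phi> f" by blast
  note S = subring_set_invariants[unfolded subring_set_def]
  have "\<phi> f \<in> invariants"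
  proof (induction f rule: mpoly_induct)
    case (const c)
    have "of_int c * 1 \<in> invariants" unfolding invariants_def
      by (rule zspan_of_int_mult) (use one_in_R_deg in \<open>auto intro: zspan_base\<close>)
    then show ?case by (simp add: mconst_int is_hom_of_int is_hom_\<phi>)
  next
    case (var v)
    then show ?case unfolding invariants_def \<phi>_mvar by (intro zspan_base) (use b_in in blast)
  qed (use S in \<open>simp_all add: is_hom_simps is_hom_\<phi>\<close>)
  then show "w \<in> invariants" by (simp add: w)
qed

lemma \<phi>_invariant: "\<phi> f \<in> invariants"
  using range_\<phi> by blast

section \<open>Generators of the ideal of relations\<close>

lemma J_eq_derivatives: "J = idl UNIV (insert s3 (range (\<lambda>i. mpderiv i s3)))" (is "_ = ?I")
proof (intro equalityI subsetI)
  fix x assume "x \<in> ?I"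
  then show "x \<in> J"
    by induction (auto intro: J_zero J_add J_mult J_s3 mpderiv_s3_J)
next
  have q: "quad \<sigma> \<in> ?I" if \<sigma>: "\<sigma> permutes UNIV" for \<sigma>
  proof -
    have "D S s3 \<in> ?I" for S
    proof -
      have "finite A \<Longrightarrow> (\<Sum>i\<in>A. of_int (coef S (b i)) * mpderiv i s3) \<in> ?I" for A
        by (induction A rule: finite_induct) (auto intro: idl_zero idl_add idl_gen)
      then show ?thesis unfolding D_def by simp
    qed
    then have "of_int (sign \<sigma>) * D (\<sigma> ` Pset) s3 \<in> ?I" by (rule idl_UNIV_mult)
    also have "of_int (sign \<sigma>) * D (\<sigma> ` Pset) s3 = (quad \<sigma> :: (14, int) mpoly)"
      using sign_sq[of \<sigma>] by (simp only: D_s3[OF \<sigma>] mult.assoc[symmetric] of_int_mult[symmetric] of_int_1 mult_1)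
    finally show ?thesis .
  qed
  fix x assume "x \<in> J"
  then show "x \<in> ?I" unfolding J_def
    by (rule idl_subset) (use q in \<open>auto intro: idl_UNIV_base\<close>)
qed

lemma rel_ideal_eq: "rel_ideal b = J"
  by (auto simp: rel_ideal_def a_kernel_def' Sym_V_eq R_ring_eq kernel_eq_J)

lemma genideal_Sym_V: "genideal Sym_V G = idl UNIV G"
  unfolding Sym_V_eq by (rule genideal_ring_on[OF subring_set_UNIV]) simp

text \<open>The ideal of relations has homogeneous generators, so it lies in the homogeneous part of every ideal containing it.\<close>

lemma J_homogeneous:
  assumes "f \<in> J" "J \<subseteq> p" shows "f \<in> idl UNIV (p \<inter> (\<Union>d. homog d))"
  using assms(1) unfolding J_def
proof (rule idl_subset)
  show "insert s3 {quad \<sigma> |\<sigma>. \<sigma> permutes UNIV} \<subseteq> idl UNIV (p \<inter> (\<Union>d. homog d))"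
    using assms(2) J_s3 J_quad homog_s3 homog_quad by (blast intro: idl_UNIV_base)
qed simp

section \<open>Points\<close>

text \<open>The preimage of a homogeneous prime is homogeneous: a homogeneous generator of the prime lifts to a homogeneous polynomial, and the ambiguity lies in \<open>J\<close>.\<close>

lemma pullback_point:
  assumes "q \<in> Proj R_ring R_deg"
  shows "{f. \<phi> f \<in> q} \<in> PV" "J \<subseteq> {f. \<phi> f \<in> q}"
proof -
  note I = ideal_ring_on_iff[OF subring_set_invariants] and P = primeideal_ring_on_iff[OF subring_set_invariants]
    and S = subring_set_invariants[unfolded subring_set_def]
  let ?p = "{f. \<phi> f \<in> q}"
  have q: "ideal q (ring_on invariants)" "q \<noteq> invariants" "\<And>x y. x \<in> invariants \<Longrightarrow> y \<in> invariants \<Longrightarrow> x * y \<in> q \<Longrightarrow> x \<in> q \<or> y \<in> q"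
    and qg: "q = genideal (ring_on invariants) (q \<inter> (\<Union>d. R_deg d))" and irr: "\<not> (\<Union>d\<in>{0<..}. R_deg d) \<subseteq> q"
    using assms unfolding Proj_def R_ring_eq P by blast+
  have q': "q \<subseteq> invariants" "0 \<in> q" "\<And>x y. x \<in> q \<Longrightarrow> y \<in> q \<Longrightarrow> x + y \<in> q" "\<And>x y. x \<in> invariants \<Longrightarrow> y \<in> q \<Longrightarrow> x * y \<in> q"
    using q(1) unfolding I by blast+
  show J: "J \<subseteq> ?p" using \<phi>_J q'(2) by auto
  have p: "ideal ?p (ring_on UNIV)"
    unfolding ideal_ring_on_iff[OF subring_set_UNIV] using q' \<phi>_invariant by (auto simp: is_hom_simps is_hom_\<phi>)
  have "1 \<notin> q"
  proof
    assume "1 \<in> q"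
    then have "invariants \<subseteq> q" using q'(4)[of _ 1] by auto
    then show False using q(2) q'(1) by blast
  qed
  then have "?p \<noteq> UNIV" using is_hom_one[OF is_hom_\<phi>] by (metis UNIV_I mem_Collect_eq)
  moreover have "f \<in> ?p \<or> g \<in> ?p" if "f * g \<in> ?p" for f g
    using that q(3)[OF \<phi>_invariant \<phi>_invariant] by (simp add: is_hom_mult is_hom_\<phi>)
  ultimately have prime: "primeideal ?p (ring_on UNIV)"
    unfolding primeideal_ring_on_iff[OF subring_set_UNIV] using p by blast
  have lift: "\<exists>f'\<in>idl UNIV (?p \<inter> (\<Union>d. homog d)). \<phi> f' = w" if "w \<in> q" for w
  proof -
    have "w \<in> idl invariants (q \<inter> (\<Union>d. R_deg d))"
      using that qg genideal_ring_on[OF subring_set_invariants, of "q \<inter> (\<Union>d. R_deg d)"] q'(1) by auto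
    then show ?thesis
    proof induction
      case idl_zero show ?case using idl.idl_zero is_hom_zero[OF is_hom_\<phi>] by blast
    next
      case (idl_step x r g)
      obtain x' where x': "x' \<in> idl UNIV (?p \<inter> (\<Union>d. homog d))" "\<phi> x' = x" using idl_step.IH by blast
      obtain r' where r': "r = \<phi> r'" using idl_step.hyps(2) range_\<phi> by blast
      obtain d g' where g': "g' \<in> homog d" "\<phi> g' = g" using idl_step.hyps(3) R_deg_image by blast
      have "g' \<in> ?p \<inter> (\<Union>d. homog d)" using g' idl_step.hyps(3) by auto
      then have "x' + r' * g' \<in> idl UNIV (?p \<inter> (\<Union>d. homog d))" using x' by (intro idl.idl_step) auto
      then show ?case using x' r' g' by (intro bexI[of _ "x' + r' * g'"]) (simp_all add: is_hom_simps is_hom_\<phi>)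
    qed
  qed
  have "?p = idl UNIV (?p \<inter> (\<Union>d. homog d))"
  proof (intro equalityI subsetI)
    fix f assume "f \<in> ?p"
    then obtain f' where f': "f' \<in> idl UNIV (?p \<inter> (\<Union>d. homog d))" "\<phi> f' = \<phi> f" using lift by blast
    then have "f - f' \<in> J" by (simp add: is_hom_diff is_hom_\<phi> flip: kernel_eq_J)
    then have "f - f' \<in> idl UNIV (?p \<inter> (\<Union>d. homog d))" using J by (rule J_homogeneous)
    from idl_add[OF this f'(1)] show "f \<in> idl UNIV (?p \<inter> (\<Union>d. homog d))" by simp
  next
    fix f assume "f \<in> idl UNIV (?p \<inter> (\<Union>d. homog d))"
    then show "f \<in> ?p"
      by induction (use p in \<open>auto simp: ideal_ring_on_iff[OF subring_set_UNIV]\<close>)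
  qed
  moreover have "\<not> (\<Union>d\<in>{0<..}. homog d) \<subseteq> ?p"
  proof
    assume h: "(\<Union>d\<in>{0<..}. homog d) \<subseteq> ?p"
    have "w \<in> q" if "d > 0" "w \<in> R_deg d" for d w
      using R_deg_image[OF that(2)] h that(1) by blast
    then show False using irr by blast
  qed
  ultimately show "?p \<in> PV"
    unfolding PV_def Proj_def using prime genideal_Sym_V by (simp add: Sym_V_eq)
qed

lemma pushforward_point:
  assumes "p \<in> PV" "J \<subseteq> p"
  shows "\<phi> ` p \<in> Proj R_ring R_deg" "{f. \<phi> f \<in> \<phi> ` p} = p"
proof -
  note I = ideal_ring_on_iff[OF subring_set_invariants] and P = primeideal_ring_on_iff[OF subring_set_invariants]
  have p: "ideal p (ring_on UNIV)" "p \<noteq> UNIV" "\<And>x y. x * y \<in> p \<Longrightarrow> x \<in> p \<or> y \<in> p"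
    and pg: "p = idl UNIV (p \<inter> (\<Union>d. homog d))" and irr: "\<not> (\<Union>d\<in>{0<..}. homog d) \<subseteq> p"
    using assms(1) unfolding PV_def Proj_def genideal_Sym_V unfolding Sym_V_eq primeideal_ring_on_iff[OF subring_set_UNIV] by blast+
  have p': "0 \<in> p" "\<And>x y. x \<in> p \<Longrightarrow> y \<in> p \<Longrightarrow> x + y \<in> p" "\<And>x y. y \<in> p \<Longrightarrow> x * y \<in> p"
    using p(1) unfolding ideal_ring_on_iff[OF subring_set_UNIV] by blast+
  show pre: "{f. \<phi> f \<in> \<phi> ` p} = p"
  proof (intro equalityI subsetI)
    fix f assume "f \<in> {f. \<phi> f \<in> \<phi> ` p}"
    then obtain f' where f': "f' \<in> p" "\<phi> f = \<phi> f'" by blast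
    then have "f - f' \<in> p" using assms(2) by (auto simp: is_hom_diff is_hom_\<phi> simp flip: kernel_eq_J)
    from p'(2)[OF this f'(1)] show "f \<in> p" by simp
  qed blast
  have mem: "\<phi> f \<in> \<phi> ` p \<longleftrightarrow> f \<in> p" for f using pre by blast
  have q: "ideal (\<phi> ` p) (ring_on invariants)" unfolding I
  proof (intro conjI ballI)
    show "\<phi> ` p \<subseteq> invariants" using \<phi>_invariant by blast
    show "0 \<in> \<phi> ` p" using p'(1) is_hom_zero[OF is_hom_\<phi>] by (metis image_eqI)
    show "x + y \<in> \<phi> ` p" if "x \<in> \<phi> ` p" "y \<in> \<phi> ` p" for x y
      using that p'(2) by (auto simp flip: is_hom_add[OF is_hom_\<phi>])
    show "x * y \<in> \<phi> ` p" if "x \<in> invariants" "y \<in> \<phi> ` p" for x y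
    proof -
      obtain f where "x = \<phi> f" using \<open>x \<in> invariants\<close> range_\<phi> by blast
      then show ?thesis using that(2) p'(3) by (auto simp flip: is_hom_mult[OF is_hom_\<phi>])
    qed
  qed
  have "\<phi> ` p \<noteq> invariants" using p(2) mem range_\<phi> by blast
  moreover have "x \<in> \<phi> ` p \<or> y \<in> \<phi> ` p" if xy: "x \<in> invariants" "y \<in> invariants" "x * y \<in> \<phi> ` p" for x y
  proof -
    obtain f g where fg: "x = \<phi> f" "y = \<phi> g" using xy range_\<phi> by blast
    then have "f * g \<in> p" using xy(3) mem[of "f * g"] by (simp add: is_hom_mult is_hom_\<phi>)
    then show ?thesis using p(3) fg by blast
  qed
  ultimately have prime: "primeideal (\<phi> ` p) (ring_on invariants)" unfolding P using q by blast
  have "\<phi> ` p = idl invariants (\<phi> ` p \<inter> (\<Union>d. R_deg d))"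
  proof (intro equalityI subsetI)
    fix w assume "w \<in> \<phi> ` p"
    then obtain f where f: "w = \<phi> f" "f \<in> idl UNIV (p \<inter> (\<Union>d. homog d))" using pg by blast
    from f(2) have "\<phi> f \<in> idl invariants (\<phi> ` p \<inter> (\<Union>d. R_deg d))"
    proof induction
      case idl_zero show ?case by (simp add: is_hom_zero is_hom_\<phi> idl.idl_zero)
    next
      case (idl_step x r g)
      have "\<phi> g \<in> \<phi> ` p \<inter> (\<Union>d. R_deg d)" using idl_step.hyps(3) \<phi>_R_deg by blast
      from idl.idl_step[OF idl_step.IH \<phi>_invariant this, of r] show ?case by (simp add: is_hom_simps is_hom_\<phi>)
    qed
    then show "w \<in> idl invariants (\<phi> ` p \<inter> (\<Union>d. R_deg d))" by (simp add: f)
  next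
    fix w assume "w \<in> idl invariants (\<phi> ` p \<inter> (\<Union>d. R_deg d))"
    then show "w \<in> \<phi> ` p"
    proof induction
      case idl_zero show ?case using q unfolding I by blast
    next
      case (idl_step x f g)
      have "f * g \<in> \<phi> ` p" using q idl_step.hyps(2,3) unfolding I by blast
      then show ?case using q idl_step.IH unfolding I by blast
    qed
  qed
  moreover have "genideal (ring_on invariants) (\<phi> ` p \<inter> (\<Union>d. R_deg d)) = idl invariants (\<phi> ` p \<inter> (\<Union>d. R_deg d))"
    by (rule genideal_ring_on[OF subring_set_invariants]) (use \<phi>_invariant in blast)
  moreover have "\<not> (\<Union>d\<in>{0<..}. R_deg d) \<subseteq> \<phi> ` p"
  proof
    assume "(\<Union>d\<in>{0<..}. R_deg d) \<subseteq> \<phi> ` p"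
    then have "f \<in> p" if "d > 0" "f \<in> homog d" for d f using \<phi>_R_deg[OF that(2)] that(1) mem by blast
    then show False using irr by blast
  qed
  ultimately show "\<phi> ` p \<in> Proj R_ring R_deg" unfolding Proj_def R_ring_eq using prime by simp
qed

lemma M8_eq: "M8 b = closed_subscheme J"
proof -
  have "(\<lambda>q. {f. \<phi> f \<in> q}) ` Proj R_ring R_deg = {p \<in> PV. J \<subseteq> p}"
  proof (intro equalityI subsetI)
    fix p assume "p \<in> {p \<in> PV. J \<subseteq> p}"
    then show "p \<in> (\<lambda>q. {f. \<phi> f \<in> q}) ` Proj R_ring R_deg"
      using pushforward_point[of p] by (intro image_eqI[of _ _ "\<phi> ` p"]) auto
  qed (use pullback_point in auto)
  moreover have "b i ^ m * \<phi> g = 0 \<longleftrightarrow> mvar i ^ m * g \<in> J" for i m g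
  proof -
    have "\<phi> (mvar i ^ m) = b i ^ m"
      by (induction m) (simp_all add: is_hom_simps is_hom_\<phi> \<phi>_mvar)
    then show ?thesis by (simp add: is_hom_mult is_hom_\<phi> flip: kernel_eq_J)
  qed
  ultimately show ?thesis by (simp add: M8_def closed_subscheme_def)
qed

section \<open>Inverting three\<close>

text \<open>Polynomials whose coefficients have powers of three as denominators, described by their monomials in order to see that they form a ring.\<close>

definition third :: "(14, rat) mpoly set" where
  "third = zspan {Poly_Mapping.single m c | m c. \<exists>n. 3 ^ n * c \<in> \<int>}"

lemma Ints_pow_mono: "3 ^ n * c \<in> \<int> \<Longrightarrow> n \<le> k \<Longrightarrow> 3 ^ k * (c :: rat) \<in> \<int>"
proof -
  assume "3 ^ n * c \<in> \<int>" "n \<le> k"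
  have "3 ^ (k - n) * (3 ^ n * c) \<in> \<int>" by (rule Ints_mult[OF Ints_power[OF Ints_numeral] \<open>3 ^ n * c \<in> \<int>\<close>])
  moreover have "3 ^ (k - n) * (3 ^ n * c) = 3 ^ k * c"
    using \<open>n \<le> k\<close> by (simp add: mult.assoc[symmetric] power_add[symmetric])
  ultimately show ?thesis by simp
qed

lemma third_iff: "f \<in> third \<longleftrightarrow> (\<forall>m. \<exists>n. 3 ^ n * Poly_Mapping.lookup f m \<in> \<int>)"
proof
  have add: "\<exists>n. 3 ^ n * (c + c') \<in> \<int>" if "\<exists>n. 3 ^ n * c \<in> \<int>" "\<exists>n. 3 ^ n * c' \<in> \<int>" for c c' :: rat
  proof -
    from that obtain n n' where "3 ^ n * c \<in> \<int>" "3 ^ n' * c' \<in> \<int>" by blast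
    then have "3 ^ (n + n') * c + 3 ^ (n + n') * c' \<in> \<int>" using Ints_pow_mono by (intro Ints_add) simp_all
    then show ?thesis by (metis distrib_left)
  qed
  have single: "\<exists>n. 3 ^ n * Poly_Mapping.lookup (Poly_Mapping.single m c) t \<in> \<int>" if "\<exists>n. 3 ^ n * c \<in> \<int>"
    for m t :: "14 \<Rightarrow>\<^sub>0 nat" and c :: rat
    using that by (cases "m = t") (simp_all add: lookup_single)
  have minus: "\<exists>n. 3 ^ n * (- c) \<in> \<int>" if "\<exists>n. 3 ^ n * c \<in> \<int>" for c :: rat
    using that by auto
  assume "f \<in> third"
  then show "\<forall>m. \<exists>n. 3 ^ n * Poly_Mapping.lookup f m \<in> \<int>" unfolding third_def
  proof induction
    case (zspan_plus x g)
    then obtain m c where g: "g = Poly_Mapping.single m c" "\<exists>n. 3 ^ n * c \<in> \<int>" by blast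
    have "\<exists>n. 3 ^ n * (Poly_Mapping.lookup x t + Poly_Mapping.lookup g t) \<in> \<int>" for t
      by (rule add) (use zspan_plus.IH single[OF g(2)] g(1) in blast)+
    then show ?case by (simp add: lookup_add)
  next
    case (zspan_minus x g)
    then obtain m c where g: "g = Poly_Mapping.single m c" "\<exists>n. 3 ^ n * c \<in> \<int>" by blast
    have "\<exists>n. 3 ^ n * (Poly_Mapping.lookup x t + - Poly_Mapping.lookup g t) \<in> \<int>" for t
      by (rule add) (use zspan_minus.IH single[OF g(2)] g(1) minus in blast)+
    then show ?case by (simp add: lookup_minus)
  qed simp
next
  assume f: "\<forall>m. \<exists>n. 3 ^ n * Poly_Mapping.lookup f m \<in> \<int>"
  have "(\<Sum>m\<in>Poly_Mapping.keys f. Poly_Mapping.single m (Poly_Mapping.lookup f m)) \<in> third"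
    unfolding third_def by (intro zspan_sum zspan_base) (use f in blast)
  then show "f \<in> third" by (simp flip: poly_mapping_sum_singles)
qed

lemma Sym_V_third_eq: "Sym_V_third = ring_on third"
  unfolding Sym_V_third_def by (intro arg_cong[of _ _ ring_on]) (use third_iff in blast)

lemma subring_set_third: "subring_set third"
proof -
  have m: "g * h \<in> {Poly_Mapping.single m c | m c. \<exists>n. 3 ^ n * c \<in> \<int>}"
    if gh: "g \<in> {Poly_Mapping.single m c | m c. \<exists>n. 3 ^ n * c \<in> \<int>}" "h \<in> {Poly_Mapping.single m c | m c. \<exists>n. 3 ^ n * c \<in> \<int>}"
    for g h :: "(14, rat) mpoly"
  proof -
    obtain m m' c c' n n' where e: "g = Poly_Mapping.single m c" "h = Poly_Mapping.single m' c'" "3 ^ n * c \<in> \<int>" "3 ^ n' * c' \<in> \<int>"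
      using gh by blast
    have "(3 ^ n * c) * (3 ^ n' * c') \<in> \<int>" by (rule Ints_mult[OF e(3,4)])
    then have "3 ^ (n + n') * (c * c') \<in> \<int>" by (simp add: power_add ac_simps)
    then show ?thesis using e by (auto simp: mult_single)
  qed
  have mult: "x * y \<in> third" if "x \<in> third" "y \<in> third" for x y
    using that unfolding third_def by (rule zspan_mult) (rule m)
  have "1 \<in> third" unfolding third_iff by (auto simp: lookup_one when_def)
  moreover have "0 \<in> third" "\<And>x. x \<in> third \<Longrightarrow> - x \<in> third" "\<And>x y. x \<in> third \<Longrightarrow> y \<in> third \<Longrightarrow> x + y \<in> third"
    unfolding third_def by (rule zspan_zero zspan_uminus zspan_add; assumption)+
  ultimately show ?thesis using mult unfolding subring_set_def by blast
qed

lemma is_hom_to_rat: "is_hom (to_rat :: ('v, int) mpoly \<Rightarrow> ('v, rat) mpoly)"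
  unfolding to_rat_def by (rule is_hom_map[OF is_hom_of_int_map])

lemma to_rat_third: "to_rat f \<in> third"
proof -
  have "3 ^ 0 * Poly_Mapping.lookup (to_rat f) m \<in> \<int>" for m
    by (simp add: to_rat_def lookup_map_hom[OF is_hom_of_int_map])
  then show ?thesis unfolding third_iff by blast
qed

lemma to_rat_mvar: "to_rat (mvar i) = mvar i"
  unfolding to_rat_def by (rule map_mvar[OF is_hom_of_int_map])

lemma to_rat_u: "to_rat (u a) = u a"
  by (simp add: u_def lin_def is_hom_simps is_hom_to_rat is_hom_of_int to_rat_mvar)

lemma to_rat_s3: "to_rat s3 = s3"
  unfolding s3_def
  by (simp only: is_hom_add[OF is_hom_to_rat] is_hom_mult[OF is_hom_to_rat] is_hom_diff[OF is_hom_to_rat] to_rat_u)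

text \<open>After inverting three, Euler's formula expresses the cubic by its derivatives.\<close>

lemma genideal_third:
  "genideal Sym_V_third (to_rat ` J) = genideal Sym_V_third (to_rat ` range (\<lambda>i. mpderiv i s3))"
proof -
  let ?G = "to_rat ` range (\<lambda>i. mpderiv i (s3 :: (14, int) mpoly))"
  note S = subring_set_third[unfolded subring_set_def]
  have g: "genideal Sym_V_third (to_rat ` A) = idl third (to_rat ` A)" for A :: "(14, int) mpoly set"
    unfolding Sym_V_third_eq by (rule genideal_ring_on[OF subring_set_third]) (use to_rat_third in blast)
  have m: "h * x \<in> idl third ?G" if "h \<in> third" "x \<in> idl third ?G" for h x
    by (rule idl_mult[OF that(2,1)]) (use S that in blast)
  have base: "to_rat (mpderiv i s3) \<in> idl third ?G" for i
    using idl_gen[of 1 third "to_rat (mpderiv i s3)" ?G] S by auto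
  have s: "to_rat s3 \<in> idl third ?G"
  proof -
    have t: "mconst (1/3) * mvar i \<in> third" for i
    proof -
      have "mconst (1/3) * mvar i = Poly_Mapping.single (Poly_Mapping.single i 1) (1/3 :: rat)"
        by (simp add: mvar_def mconst_times_single)
      moreover have "3 ^ 1 * (1/3 :: rat) \<in> \<int>" by simp
      ultimately show ?thesis unfolding third_def by (intro zspan_base) blast
    qed
    have "finite A \<Longrightarrow> (\<Sum>i\<in>A. mconst (1/3) * mvar i * to_rat (mpderiv i s3)) \<in> idl third ?G" for A
      by (induction A rule: finite_induct) (use t in \<open>auto intro!: idl_add m base intro: idl_zero\<close>)
    then have "(\<Sum>i\<in>UNIV. mconst (1/3) * mvar i * to_rat (mpderiv i s3)) \<in> idl third ?G" by simp
    also have "(\<Sum>i\<in>UNIV. mconst (1/3) * mvar i * to_rat (mpderiv i s3)) = mconst (1/3) * to_rat (\<Sum>i\<in>UNIV. mvar i * mpderiv i s3)"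
      by (simp add: is_hom_simps is_hom_to_rat to_rat_mvar sum_distrib_left mult.assoc)
    also have "\<dots> = mconst (1/3) * mconst 3 * to_rat s3"
    proof -
      have 3: "mconst (3 :: rat) = (3 :: (14, rat) mpoly)" by (rule is_hom_numeral[OF is_hom_mconst])
      show ?thesis unfolding euler[OF homog_s3] 3
        by (simp add: is_hom_mult[OF is_hom_to_rat] is_hom_numeral[OF is_hom_to_rat] mult.assoc)
    qed
    also have "mconst (1/3) * mconst 3 = (1 :: (14, rat) mpoly)"
      unfolding is_hom_mult[OF is_hom_mconst, symmetric] by simp
    finally show ?thesis by simp
  qed
  have J: "to_rat x \<in> idl third ?G" if "x \<in> J" for x
    using that unfolding J_eq_derivatives
  proof induction
    case idl_zero then show ?case by (simp add: is_hom_zero is_hom_to_rat idl.idl_zero)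
  next
    case (idl_step x f g)
    have "to_rat f * to_rat g \<in> idl third ?G" by (rule m[OF to_rat_third]) (use idl_step.hyps(3) s base in auto)
    then show ?case using idl_step.IH by (simp add: is_hom_simps is_hom_to_rat idl_add)
  qed
  show ?thesis unfolding g
  proof (intro equalityI subsetI)
    fix x assume "x \<in> idl third (to_rat ` J)"
    then show "x \<in> idl third ?G" by (rule idl_subset) (use J S in auto)
  next
    fix x assume "x \<in> idl third ?G"
    then show "x \<in> idl third (to_rat ` J)"
      by induction (use mpderiv_s3_J in \<open>auto intro: idl_zero idl_step\<close>)
  qed
qed

end

theorem theorem1p2:
  fixes b :: "14 \<Rightarrow> (pvar, int) mpoly"
  assumes basis: "Z_basis b (R_deg 1)"
  shows "\<exists>s' :: (14, int) mpoly.
    s' \<noteq> 0 \<and> s' \<in> homog 3 \<and>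
    (\<exists>s. s \<noteq> 0 \<and> skew_invariant_cubics b = {mconst c * s | c. True} \<and>
         (\<exists>c. to_rat s' = mconst c * s)) \<and>
    M8 b = singular_locus s' \<and>
    rel_ideal b = genideal Sym_V (insert s' (range (\<lambda>i. mpderiv i s'))) \<and>
    genideal Sym_V_third (to_rat ` rel_ideal b) =
      genideal Sym_V_third (to_rat ` range (\<lambda>i. mpderiv i s')) \<and>
    s' \<notin> genideal Sym_V (range (\<lambda>i. mpderiv i s'))"
proof -
  interpret eight_points b by unfold_locales (rule basis)
  have I: "genideal Sym_V (insert s3 (range (\<lambda>i. mpderiv i s3))) = J"
    unfolding genideal_Sym_V by (rule J_eq_derivatives[symmetric])
  have r: "to_rat s3 = mconst 1 * s3" by (simp add: to_rat_s3 is_hom_one[OF is_hom_mconst])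
  show ?thesis
  proof (intro exI[of _ "s3 :: (14, int) mpoly"] conjI)
    show "\<exists>s. s \<noteq> 0 \<and> skew_invariant_cubics b = {mconst c * s | c. True} \<and> (\<exists>c. to_rat s3 = mconst c * s)"
      using s3_nonzero skew_invariant_cubics_eq r by blast
    show "M8 b = singular_locus s3" unfolding singular_locus_def I by (rule M8_eq)
    show "rel_ideal b = genideal Sym_V (insert s3 (range (\<lambda>i. mpderiv i s3)))" unfolding I by (rule rel_ideal_eq)
    show "genideal Sym_V_third (to_rat ` rel_ideal b) = genideal Sym_V_third (to_rat ` range (\<lambda>i. mpderiv i s3))"
      unfolding rel_ideal_eq by (rule genideal_third)
    show "s3 \<notin> genideal Sym_V (range (\<lambda>i. mpderiv i s3))"
      unfolding genideal_Sym_V by (rule s3_not_in_derivatives)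
  qed (rule s3_nonzero, rule homog_s3)
qed

end
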